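(* Let $S$ be a zero-dimensional local $\mathbb{C}$-algebra with embedding dimension $\operatorname{embdim}(S)$, order $\operatorname{ord}(S)$ and first deviation $\varepsilon_1(S)$. If $$\varepsilon_1(S)+1<\operatorname{embdim}(S)+\operatorname{ord}(S),$$ then the Lie algebra $\operatorname{Der}_{\mathbb{C}} S$ is solvable.
   Context: A zero-dimensional local $\mathbb{C}$-algebra $S$ here means a $\mathbb{C}$-algebra of the form $S\cong R/I$, where $R=\mathbb{C}[\![x_1,\dots,x_n]\!]$ is a formal power series ring with maximal ideal $\mathfrak{m}=\langle x_1,\dots,x_n\rangle$, and $I\subseteq R$ is a proper ideal with $R/I$ of Krull dimension zero (equivalently, $I$ is proper and contains a power of $\mathfrak{m}$), presented so that $I\subseteq\mathfrak{m}^2$. With such a presentation: - $\operatorname{embdim}(S)=n$ is the embedding dimension. - The order $\operatorname{ord}(S)$ is the maximal integer $m\ge 2$ such that $I\subseteq\mathfrak{m}^m$. (In the degenerate case $S=\mathbb{C}$, i.e. $n=0$ and $I=0$, no such maximum exists; there the convention is immaterial because $\operatorname{Der}_{\mathbb{C}}S=0$.) - The first deviation is $\varepsilon_1(S)=\dim_{\mathbb{C}}H_1(S)$, where $H_\bullet(S)$ is the Koszul algebra of $S$ (the homology of the Koszul complex on a minimal system of generators of the maximal ideal of $S$); equivalently $\varepsilon_1(S)=\dim_{\mathbb{C}}(I/\mathfrak{m}I)$ is the minimal number of generators of $I$. $\operatorname{Der}_{\mathbb{C}}S$ is the complex Lie algebra of $\mathbb{C}$-linear derivations $S\to S$ with the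 commutator bracket. *)

theory Defs
  imports
    "HOL-Algebra.QuotRing"
    "HOL-Algebra.Ideal_Product"
    "HOL-Library.Extended_Nat"
    "Jordan_Normal_Form.VS_Connect"
begin


section \<open>Formal power series in finitely many variables\<close>

text \<open>
  A monomial in \<open>x\<^sub>0, \<dots>, x\<^sub>n\<^sub>-\<^sub>1\<close> is a multiset over \<open>{..<n}\<close> (the
  representation of the library theory \<open>Indexed_Polynomials\<close>), and a power series is an arbitrary
  family of coefficients. Families are indexed by all multisets over \<^typ>\<open>nat\<close>; those involving
  an index \<open>\<ge> n\<close> get coefficient 0. Multiplication is the convolution over the factorizations
  \<open>m = a + (m - a)\<close>.
\<close>

definition mpower_series :: "nat \<Rightarrow> (complex, nat multiset \<Rightarrow> complex) module" where
  "mpower_series n =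
     \<lparr>carrier = {f. \<forall>m. \<not> set_mset m \<subseteq> {..<n} \<longrightarrow> f m = 0},
      mult = (\<lambda>f g m. \<Sum>a | a \<subseteq># m. f a * g (m - a)),
      one = (\<lambda>m. if m = {#} then 1 else 0),
      zero = (\<lambda>m. 0),
      add = (\<lambda>f g m. f m + g m),
      smult = (\<lambda>c f m. c * f m)\<rparr>"

lemma finite_submultisets: "finite {a. a \<subseteq># (m :: 'b multiset)}"
proof (induction m)
  case (add x m)
  have "{a. a \<subseteq># add_mset x m} \<subseteq> {a. a \<subseteq># m} \<union> add_mset x ` {a. a \<subseteq># m}"
  proof
    fix a assume "a \<in> {a. a \<subseteq># add_mset x m}"
    then have a: "a \<subseteq># add_mset x m" by simp
    show "a \<in> {a. a \<subseteq># m} \<union> add_mset x ` {a. a \<subseteq># m}"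
    proof (cases "x \<in># a")
      case True
      then obtain b where b: "a = add_mset x b" by (metis insert_DiffM)
      then show ?thesis using a by simp
    next
      case False
      have "a - {#x#} \<subseteq># m" using a by (simp add: subset_eq_diff_conv)
      then have "a \<subseteq># m" using False by (simp add: diff_single_trivial)
      then show ?thesis by simp
    qed
  qed
  then show ?case using add by (meson finite_Un finite_imageI finite_subset)
qed simp

lemma mpower_series_mult_assoc:
  fixes f g h :: "nat multiset \<Rightarrow> complex"
  shows "(\<Sum>a | a \<subseteq># m. (\<Sum>b | b \<subseteq># a. f b * g (a - b)) * h (m - a)) =
         (\<Sum>a | a \<subseteq># m. f a * (\<Sum>b | b \<subseteq># m - a. g b * h (m - a - b)))"
proof -
  note fin = finite_submultisets
  have "(\<Sum>a | a \<subseteq># m. (\<Sum>b | b \<subseteq># a. f b * g (a - b)) * h (m - a)) =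
        (\<Sum>(a, b) \<in> (SIGMA a:{a. a \<subseteq># m}. {b. b \<subseteq># a}). f b * g (a - b) * h (m - a))"
    by (simp add: sum_distrib_right sum.Sigma fin)
  also have "\<dots> = (\<Sum>(a, b) \<in> (SIGMA a:{a. a \<subseteq># m}. {b. b \<subseteq># m - a}). f a * (g b * h (m - a - b)))"
  proof (rule sum.reindex_bij_witness[of _ "\<lambda>(a, b). (a + b, a)" "\<lambda>(a, b). (b, a - b)"])
    fix p assume "p \<in> (SIGMA a:{a. a \<subseteq># m}. {b. b \<subseteq># a})"
    then obtain a b where p: "p = (a, b)" and a: "a \<subseteq># m" and b: "b \<subseteq># a" by blast
    have ab: "b + (a - b) = a" by (rule subset_mset.add_diff_inverse[OF b])
    have bm: "b \<subseteq># m" by (rule subset_mset.order_trans[OF b a])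
    have "m - b + b = m" by (rule subset_mset.diff_add[OF bm])
    then have abm: "a - b \<subseteq># m - b" using a by (simp only: subset_eq_diff_conv)
    have "m - b - (a - b) = m - a" by (simp only: diff_diff_add ab)
    then show "(case case p of (a, b) \<Rightarrow> (b, a - b) of
        (a, b) \<Rightarrow> f a * (g b * h (m - a - b))) = (case p of (a, b) \<Rightarrow> f b * g (a - b) * h (m - a))"
      by (simp only: p prod.case mult.assoc)
    show "(case case p of (a, b) \<Rightarrow> (b, a - b) of (a, b) \<Rightarrow> (a + b, a)) = p"
      by (simp only: p prod.case ab)
    show "(case p of (a, b) \<Rightarrow> (b, a - b)) \<in> (SIGMA a:{a. a \<subseteq># m}. {b. b \<subseteq># m - a})"
      unfolding p prod.case using bm abm by blast
  next
    fix p assume "p \<in> (SIGMA a:{a. a \<subseteq># m}. {b. b \<subseteq># m - a})"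
    then obtain a b where p: "p = (a, b)" and a: "a \<subseteq># m" and b: "b \<subseteq># m - a" by blast
    have "a + b \<subseteq># a + (m - a)" using b by (simp only: subset_mset.add_left_mono)
    then have abm: "a + b \<subseteq># m" by (simp only: subset_mset.add_diff_inverse[OF a])
    show "(case case p of (a, b) \<Rightarrow> (a + b, a) of (a, b) \<Rightarrow> (b, a - b)) = p"
      by (simp only: p prod.case add_diff_cancel_left')
    show "(case p of (a, b) \<Rightarrow> (a + b, a)) \<in> (SIGMA a:{a. a \<subseteq># m}. {b. b \<subseteq># a})"
      unfolding p prod.case using abm mset_subset_eq_add_left by blast
  qed
  also have "\<dots> = (\<Sum>a | a \<subseteq># m. f a * (\<Sum>b | b \<subseteq># m - a. g b * h (m - a - b)))"
    by (simp add: sum_distrib_left sum.Sigma fin)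
  finally show ?thesis .
qed

lemma mpower_series_mult_comm:
  fixes f g :: "nat multiset \<Rightarrow> complex"
  shows "(\<Sum>a | a \<subseteq># m. f a * g (m - a)) = (\<Sum>a | a \<subseteq># m. g a * f (m - a))"
  by (rule sum.reindex_bij_witness[of _ "\<lambda>a. m - a" "\<lambda>a. m - a"])
     (auto simp: subset_mset.diff_diff_right mult.commute)

lemma mpower_series_mult_one:
  fixes f :: "nat multiset \<Rightarrow> complex"
  shows "(\<Sum>a | a \<subseteq># m. (if a = {#} then 1 else 0) * f (m - a)) = f m"
proof -
  have "(\<Sum>a | a \<subseteq># m. (if a = {#} then 1 else 0) * f (m - a)) =
        (\<Sum>a \<in> {{#}}. (if a = {#} then 1 else 0) * f (m - a))"
    by (rule sum.mono_neutral_right) (auto simp: finite_submultisets)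
  then show ?thesis by simp
qed

lemma mpower_series_algebra: "algebra class_ring (mpower_series n)"
proof (rule algebraI)
  show "cring (class_ring :: complex ring)" by unfold_locales
  show "cring (mpower_series n)"
  proof (rule cringI)
    show "abelian_group (mpower_series n)"
    proof (rule abelian_groupI)
      fix f assume "f \<in> carrier (mpower_series n)"
      then show "\<exists>g\<in>carrier (mpower_series n). g \<oplus>\<^bsub>mpower_series n\<^esub> f = \<zero>\<^bsub>mpower_series n\<^esub>"
        by (intro bexI[of _ "\<lambda>m. - f m"]) (auto simp: mpower_series_def)
    qed (auto simp: mpower_series_def add_ac)
    show "Group.comm_monoid (mpower_series n)"
    proof (rule comm_monoidI)
      fix f g assume "f \<in> carrier (mpower_series n)" "g \<in> carrier (mpower_series n)"
      then have f: "f m = 0" and g: "g m = 0" if "\<not> set_mset m \<subseteq> {..<n}" for m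
        using that by (auto simp: mpower_series_def)
      have "f a * g (m - a) = 0" if "\<not> set_mset m \<subseteq> {..<n}" "a \<subseteq># m" for m a
      proof (rule ccontr)
        assume "f a * g (m - a) \<noteq> 0"
        then have "set_mset a \<subseteq> {..<n}" "set_mset (m - a) \<subseteq> {..<n}" using f g by auto
        then have "set_mset (a + (m - a)) \<subseteq> {..<n}" by (simp only: set_mset_union) blast
        then show False using that by (simp add: subset_mset.add_diff_inverse)
      qed
      then have "(\<Sum>a | a \<subseteq># m. f a * g (m - a)) = 0" if "\<not> set_mset m \<subseteq> {..<n}" for m
        using that by (intro sum.neutral) blast
      then show "f \<otimes>\<^bsub>mpower_series n\<^esub> g \<in> carrier (mpower_series n)"
        by (simp add: mpower_series_def)
    next
      fix f g assume "f \<in> carrier (mpower_series n)" "g \<in> carrier (mpower_series n)"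
      show "f \<otimes>\<^bsub>mpower_series n\<^esub> g = g \<otimes>\<^bsub>mpower_series n\<^esub> f"
        using mpower_series_mult_comm by (simp add: mpower_series_def)
    qed (simp_all add: mpower_series_def mpower_series_mult_assoc mpower_series_mult_one)
  qed (simp add: mpower_series_def distrib_right sum.distrib)
qed (auto simp: mpower_series_def algebra_simps sum_distrib_left)

definition mvar :: "nat \<Rightarrow> nat multiset \<Rightarrow> complex" where
  "mvar i = (\<lambda>m. if m = {#i#} then 1 else 0)"

definition mmax_ideal :: "nat \<Rightarrow> (nat multiset \<Rightarrow> complex) set" where
  "mmax_ideal n = Idl\<^bsub>mpower_series n\<^esub> (mvar ` {..<n})"

definition ideal_power :: "('a, 'b) ring_scheme \<Rightarrow> 'a set \<Rightarrow> nat \<Rightarrow> 'a set" where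
  "ideal_power R J k = J [^]\<^bsub>ideals_set R\<^esub> k"

section \<open>Zero-dimensional local algebras\<close>

text \<open>The zero ring, which has no prime ideals, gets dimension 0 here.\<close>

definition krull_dim :: "('a, 'b) ring_scheme \<Rightarrow> enat" where
  "krull_dim R = Sup {enat k | k. \<exists>P. (\<forall>i\<le>k. primeideal (P i) R) \<and> (\<forall>i<k. P i \<subset> P (Suc i))}"

text \<open>
  \<open>zero_dim_presentation n I S\<close>: the algebra \<open>S\<close> is isomorphic, as a complex algebra, to \<open>R / I\<close>
  with \<open>R\<close> the power series ring in \<open>n\<close> variables, \<open>I\<close> proper and contained in the square of the
  maximal ideal, and \<open>R / I\<close> of Krull dimension 0. The embedding dimension of \<open>S\<close> is then \<open>n\<close>.
\<close>

definition zero_dim_presentation ::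
    "nat \<Rightarrow> (nat multiset \<Rightarrow> complex) set \<Rightarrow> (complex, 'a) module \<Rightarrow> bool" where
  "zero_dim_presentation n I S \<longleftrightarrow>
     ideal I (mpower_series n) \<and> I \<noteq> carrier (mpower_series n) \<and>
     krull_dim (mpower_series n Quot I) = 0 \<and>
     I \<subseteq> ideal_power (mpower_series n) (mmax_ideal n) 2 \<and>
     (\<exists>h \<in> ring_iso (mpower_series n Quot I) S.
        \<forall>c. \<forall>f \<in> carrier (mpower_series n).
          h (I +>\<^bsub>mpower_series n\<^esub> (c \<odot>\<^bsub>mpower_series n\<^esub> f)) =
          c \<odot>\<^bsub>S\<^esub> h (I +>\<^bsub>mpower_series n\<^esub> f))"

text \<open>
  For \<open>n = 0\<close> (so \<open>I = 0\<close> and \<open>S\<close> is the ground field) there is no greatest such exponent and the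
  value is unspecified.
\<close>

definition presentation_order :: "nat \<Rightarrow> (nat multiset \<Rightarrow> complex) set \<Rightarrow> nat" where
  "presentation_order n I =
     (GREATEST m. 2 \<le> m \<and> I \<subseteq> ideal_power (mpower_series n) (mmax_ideal n) m)"

section \<open>Koszul homology and the first deviation\<close>

text \<open>
  The Koszul complex of a list \<open>ys\<close> of length \<open>k\<close>: a chain of degree \<open>p\<close> is the family of
  its coordinates with respect to the basis \<open>e\<^sub>A = e\<^bsub>i\<^sub>1\<^esub> \<and> \<dots> \<and> e\<^bsub>i\<^sub>p\<^esub>\<close>, where
  \<open>A = {i\<^sub>1 < \<dots> < i\<^sub>p}\<close> ranges over the \<open>p\<close>-subsets of \<open>{..<k}\<close>. The differential
  \<open>e\<^bsub>i\<^sub>1\<^esub> \<and> \<dots> \<and> e\<^bsub>i\<^sub>p\<^esub> \<mapsto> \<Sum>\<^sub>q (-1)\<^sup>q\<^sup>-\<^sup>1 y\<^bsub>i\<^sub>q\<^esub> e\<^bsub>A - {i\<^sub>q}\<^esub>\<close> is written in coordinates: the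
  coefficient at \<open>B\<close> collects the contributions of all \<open>A = B \<union> {i}\<close>.
\<close>

definition koszul_chains ::
    "('k, 'a) module \<Rightarrow> 'a list \<Rightarrow> nat \<Rightarrow> ('k, nat set \<Rightarrow> 'a) module" where
  "koszul_chains S ys p =
     (let X = {A. A \<subseteq> {..<length ys} \<and> card A = p} in
      \<lparr>carrier = X \<rightarrow>\<^sub>E carrier S,
       mult = undefined,
       one = undefined,
       zero = (\<lambda>A\<in>X. \<zero>\<^bsub>S\<^esub>),
       add = (\<lambda>v w. \<lambda>A\<in>X. v A \<oplus>\<^bsub>S\<^esub> w A),
       smult = (\<lambda>c v. \<lambda>A\<in>X. c \<odot>\<^bsub>S\<^esub> v A)\<rparr>)"

text \<open>In degree \<open>p = 0\<close> the target is the zero module of functions on the empty index set.\<close>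

definition koszul_diff ::
    "('k, 'a) module \<Rightarrow> 'a list \<Rightarrow> nat \<Rightarrow> (nat set \<Rightarrow> 'a) \<Rightarrow> (nat set \<Rightarrow> 'a)" where
  "koszul_diff S ys p v =
     (\<lambda>B\<in>{B. B \<subseteq> {..<length ys} \<and> Suc (card B) = p}.
        \<Oplus>\<^bsub>S\<^esub> i \<in> {..<length ys} - B.
          (\<ominus>\<^bsub>S\<^esub> \<one>\<^bsub>S\<^esub>) [^]\<^bsub>S\<^esub> card {j \<in> B. j < i} \<otimes>\<^bsub>S\<^esub> (ys ! i \<otimes>\<^bsub>S\<^esub> v (insert i B)))"

definition koszul_cycles :: "('k, 'a) module \<Rightarrow> 'a list \<Rightarrow> nat \<Rightarrow> (nat set \<Rightarrow> 'a) set" where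
  "koszul_cycles S ys p =
     {v \<in> carrier (koszul_chains S ys p).
        \<forall>B. B \<subseteq> {..<length ys} \<and> Suc (card B) = p \<longrightarrow> koszul_diff S ys p v B = \<zero>\<^bsub>S\<^esub>}"

definition koszul_boundaries :: "('k, 'a) module \<Rightarrow> 'a list \<Rightarrow> nat \<Rightarrow> (nat set \<Rightarrow> 'a) set" where
  "koszul_boundaries S ys p = koszul_diff S ys (Suc p) ` carrier (koszul_chains S ys (Suc p))"

definition quotient_module :: "('k, 'a) module \<Rightarrow> 'a set \<Rightarrow> ('k, 'a set) module" where
  "quotient_module V W =
     \<lparr>carrier = a_rcosets\<^bsub>V\<^esub> W,
      mult = undefined,
      one = undefined,
      zero = W,
      add = set_add V,
      smult = (\<lambda>c X. \<Union>x\<in>X. W +>\<^bsub>V\<^esub> (c \<odot>\<^bsub>V\<^esub> x))\<rparr>"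

definition koszul_homology ::
    "('k, 'a) module \<Rightarrow> 'a list \<Rightarrow> nat \<Rightarrow> ('k, (nat set \<Rightarrow> 'a) set) module" where
  "koszul_homology S ys p =
     quotient_module ((koszul_chains S ys p)\<lparr>carrier := koszul_cycles S ys p\<rparr>)
       (koszul_boundaries S ys p)"

definition minimal_generators :: "('a, 'b) ring_scheme \<Rightarrow> 'a set \<Rightarrow> 'a list \<Rightarrow> bool" where
  "minimal_generators R M ys \<longleftrightarrow>
     distinct ys \<and> set ys \<subseteq> carrier R \<and> Idl\<^bsub>R\<^esub> (set ys) = M \<and>
     (\<forall>Y. Y \<subset> set ys \<longrightarrow> Idl\<^bsub>R\<^esub> Y \<noteq> M)"

text \<open>
  Meant for local \<open>S\<close>. Up to isomorphism the Koszul complex, hence the dimension below, does not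
  depend on the chosen minimal system of generators.
\<close>

definition first_deviation :: "(complex, 'a) module \<Rightarrow> nat" where
  "first_deviation S =
     (let ys = (SOME ys. minimal_generators S (THE M. maximalideal M S) ys)
      in vectorspace.dim class_ring (koszul_homology S ys 1))"

section \<open>Lie algebras and derivations\<close>

record ('k, 'v) lie_alg = "('k, 'v) module" +
  lie_bracket :: "'v \<Rightarrow> 'v \<Rightarrow> 'v"

locale lie_algebra = vectorspace K L
  for K :: "('k, 'm) ring_scheme" and L :: "('k, 'v) lie_alg" +
  assumes bracket_closed:
      "\<lbrakk>x \<in> carrier L; y \<in> carrier L\<rbrakk> \<Longrightarrow> lie_bracket L x y \<in> carrier L"
    and bracket_add_left:
      "\<lbrakk>x \<in> carrier L; y \<in> carrier L; z \<in> carrier L\<rbrakk> \<Longrightarrow>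
       lie_bracket L (x \<oplus>\<^bsub>L\<^esub> y) z = lie_bracket L x z \<oplus>\<^bsub>L\<^esub> lie_bracket L y z"
    and bracket_add_right:
      "\<lbrakk>x \<in> carrier L; y \<in> carrier L; z \<in> carrier L\<rbrakk> \<Longrightarrow>
       lie_bracket L x (y \<oplus>\<^bsub>L\<^esub> z) = lie_bracket L x y \<oplus>\<^bsub>L\<^esub> lie_bracket L x z"
    and bracket_smult_left:
      "\<lbrakk>c \<in> carrier K; x \<in> carrier L; y \<in> carrier L\<rbrakk> \<Longrightarrow>
       lie_bracket L (c \<odot>\<^bsub>L\<^esub> x) y = c \<odot>\<^bsub>L\<^esub> lie_bracket L x y"
    and bracket_smult_right:
      "\<lbrakk>c \<in> carrier K; x \<in> carrier L; y \<in> carrier L\<rbrakk> \<Longrightarrow>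
       lie_bracket L x (c \<odot>\<^bsub>L\<^esub> y) = c \<odot>\<^bsub>L\<^esub> lie_bracket L x y"
    and bracket_self: "x \<in> carrier L \<Longrightarrow> lie_bracket L x x = \<zero>\<^bsub>L\<^esub>"
    and jacobi:
      "\<lbrakk>x \<in> carrier L; y \<in> carrier L; z \<in> carrier L\<rbrakk> \<Longrightarrow>
       lie_bracket L x (lie_bracket L y z) \<oplus>\<^bsub>L\<^esub> lie_bracket L y (lie_bracket L z x)
         \<oplus>\<^bsub>L\<^esub> lie_bracket L z (lie_bracket L x y) = \<zero>\<^bsub>L\<^esub>"

primrec derived_series :: "('k, 'm) ring_scheme \<Rightarrow> ('k, 'v) lie_alg \<Rightarrow> nat \<Rightarrow> 'v set" where
  "derived_series K L 0 = carrier L"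
| "derived_series K L (Suc i) =
     LinearCombinations.module.span K L
       {lie_bracket L x y | x y. x \<in> derived_series K L i \<and> y \<in> derived_series K L i}"

definition solvable_lie :: "('k, 'm) ring_scheme \<Rightarrow> ('k, 'v) lie_alg \<Rightarrow> bool" where
  "solvable_lie K L \<longleftrightarrow> (\<exists>i. derived_series K L i = {\<zero>\<^bsub>L\<^esub>})"

text \<open>Derivations are extensional functions, so that equality is equality on the carrier.\<close>

definition Der :: "(complex, 'a) module \<Rightarrow> (complex, 'a \<Rightarrow> 'a) lie_alg" where
  "Der S =
     \<lparr>carrier = {D \<in> module_hom class_ring S S \<inter> extensional (carrier S).
         \<forall>a \<in> carrier S. \<forall>b \<in> carrier S. D (a \<otimes>\<^bsub>S\<^esub> b) = D a \<otimes>\<^bsub>S\<^esub> b \<oplus>\<^bsub>S\<^esub> a \<otimes>\<^bsub>S\<^esub> D b},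
      mult = undefined,
      one = undefined,
      zero = (\<lambda>a\<in>carrier S. \<zero>\<^bsub>S\<^esub>),
      add = (\<lambda>D E. \<lambda>a\<in>carrier S. D a \<oplus>\<^bsub>S\<^esub> E a),
      smult = (\<lambda>c D. \<lambda>a\<in>carrier S. c \<odot>\<^bsub>S\<^esub> D a),
      lie_bracket = (\<lambda>D E. \<lambda>a\<in>carrier S. D (E a) \<ominus>\<^bsub>S\<^esub> E (D a))\<rparr>"

lemma Der_lie_algebra:
  assumes "algebra class_ring S"
  shows "lie_algebra class_ring (Der S)"
proof -
  interpret A: algebra "class_ring :: complex ring" S by fact
  note hom = module_hom_def Der_def
  have cl: "D a \<in> carrier S" if "D \<in> carrier (Der S)" "a \<in> carrier S" for D a
    using that by (auto simp: hom)
  have add: "D (a \<oplus>\<^bsub>S\<^esub> b) = D a \<oplus>\<^bsub>S\<^esub> D b"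
    if "D \<in> carrier (Der S)" "a \<in> carrier S" "b \<in> carrier S" for D a b
    using that by (auto simp: hom)
  have sm: "D (c \<odot>\<^bsub>S\<^esub> a) = c \<odot>\<^bsub>S\<^esub> D a"
    if "D \<in> carrier (Der S)" "a \<in> carrier S" for D a c
    using that by (auto simp: hom)
  have leib: "D (a \<otimes>\<^bsub>S\<^esub> b) = D a \<otimes>\<^bsub>S\<^esub> b \<oplus>\<^bsub>S\<^esub> a \<otimes>\<^bsub>S\<^esub> D b"
    if "D \<in> carrier (Der S)" "a \<in> carrier S" "b \<in> carrier S" for D a b
    using that by (auto simp: hom)
  have ext: "D \<in> extensional (carrier S)" if "D \<in> carrier (Der S)" for D
    using that by (auto simp: hom)
  have DerI: "(\<lambda>a\<in>carrier S. F a) \<in> carrier (Der S)"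
    if "\<And>a. a \<in> carrier S \<Longrightarrow> F a \<in> carrier S"
      "\<And>a b. \<lbrakk>a \<in> carrier S; b \<in> carrier S\<rbrakk> \<Longrightarrow> F (a \<oplus>\<^bsub>S\<^esub> b) = F a \<oplus>\<^bsub>S\<^esub> F b"
      "\<And>c a. a \<in> carrier S \<Longrightarrow> F (c \<odot>\<^bsub>S\<^esub> a) = c \<odot>\<^bsub>S\<^esub> F a"
      "\<And>a b. \<lbrakk>a \<in> carrier S; b \<in> carrier S\<rbrakk> \<Longrightarrow>
         F (a \<otimes>\<^bsub>S\<^esub> b) = F a \<otimes>\<^bsub>S\<^esub> b \<oplus>\<^bsub>S\<^esub> a \<otimes>\<^bsub>S\<^esub> F b" for F
    using that by (auto simp: hom)
  have smc: "c \<odot>\<^bsub>S\<^esub> a \<in> carrier S" if "a \<in> carrier S" for a and c :: complex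
    using that A.smult_closed[of c a] by simp
  have smadd: "c \<odot>\<^bsub>S\<^esub> (a \<oplus>\<^bsub>S\<^esub> b) = c \<odot>\<^bsub>S\<^esub> a \<oplus>\<^bsub>S\<^esub> c \<odot>\<^bsub>S\<^esub> b"
    if "a \<in> carrier S" "b \<in> carrier S" for a b and c :: complex
    using that A.smult_r_distr[of c a b] by simp
  have smass: "c \<odot>\<^bsub>S\<^esub> (d \<odot>\<^bsub>S\<^esub> a) = (c * d) \<odot>\<^bsub>S\<^esub> a"
    if "a \<in> carrier S" for a and c d :: complex
    using that A.smult_assoc1[of c d a] by simp
  have smladd: "(c + d) \<odot>\<^bsub>S\<^esub> a = c \<odot>\<^bsub>S\<^esub> a \<oplus>\<^bsub>S\<^esub> d \<odot>\<^bsub>S\<^esub> a"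
    if "a \<in> carrier S" for a and c d :: complex
    using that A.smult_l_distr[of c d a] by simp
  have sml: "(c \<odot>\<^bsub>S\<^esub> a) \<otimes>\<^bsub>S\<^esub> b = c \<odot>\<^bsub>S\<^esub> (a \<otimes>\<^bsub>S\<^esub> b)"
    if "a \<in> carrier S" "b \<in> carrier S" for a b and c :: complex
    using that A.smult_assoc2[of c a b] by simp
  have smr: "a \<otimes>\<^bsub>S\<^esub> (c \<odot>\<^bsub>S\<^esub> b) = c \<odot>\<^bsub>S\<^esub> (a \<otimes>\<^bsub>S\<^esub> b)"
    if "a \<in> carrier S" "b \<in> carrier S" for a b and c :: complex
    using that sml[of b a c] by (simp add: A.m_comm smc)
  have smminus: "c \<odot>\<^bsub>S\<^esub> (a \<ominus>\<^bsub>S\<^esub> b) = c \<odot>\<^bsub>S\<^esub> a \<ominus>\<^bsub>S\<^esub> c \<odot>\<^bsub>S\<^esub> b"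
    if "a \<in> carrier S" "b \<in> carrier S" for a b and c :: complex
    using that A.smult_r_minus[of c b] by (simp add: a_minus_def smadd)
  have Dneg: "D (\<ominus>\<^bsub>S\<^esub> a) = \<ominus>\<^bsub>S\<^esub> D a" if "D \<in> carrier (Der S)" "a \<in> carrier S" for D a
    using sm[OF that, of "-1"] that A.smult_l_minus[of 1 a] A.smult_l_minus[of 1 "D a"] A.smult_one
    by (simp add: cl class_ring_simps)
  have Dminus: "D (a \<ominus>\<^bsub>S\<^esub> b) = D a \<ominus>\<^bsub>S\<^esub> D b"
    if "D \<in> carrier (Der S)" "a \<in> carrier S" "b \<in> carrier S" for D a b
    using that by (simp add: a_minus_def add Dneg)
  have rec: "\<zero>\<^bsub>Der S\<^esub> = (\<lambda>a\<in>carrier S. \<zero>\<^bsub>S\<^esub>)"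
      "D \<oplus>\<^bsub>Der S\<^esub> E = (\<lambda>a\<in>carrier S. D a \<oplus>\<^bsub>S\<^esub> E a)"
      "c \<odot>\<^bsub>Der S\<^esub> D = (\<lambda>a\<in>carrier S. c \<odot>\<^bsub>S\<^esub> D a)"
      "lie_bracket (Der S) D E = (\<lambda>a\<in>carrier S. D (E a) \<ominus>\<^bsub>S\<^esub> E (D a))" for D E c
    by (simp_all add: Der_def)
  have eqI: "D = E" if "D \<in> extensional (carrier S)" "E \<in> extensional (carrier S)"
      "\<And>a. a \<in> carrier S \<Longrightarrow> D a = E a" for D E :: "'a \<Rightarrow> 'a"
    using extensionalityI[OF that(1,2)] that(3) by blast
  have zero_cl: "\<zero>\<^bsub>Der S\<^esub> \<in> carrier (Der S)"
    unfolding rec by (rule DerI) (use A.smult_r_null in auto)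
  have add_cl: "D \<oplus>\<^bsub>Der S\<^esub> E \<in> carrier (Der S)"
    if "D \<in> carrier (Der S)" "E \<in> carrier (Der S)" for D E
    unfolding rec
    by (rule DerI) (use that in \<open>simp_all add: cl add sm leib smc smadd A.l_distr A.r_distr A.M.add.m_ac\<close>)
  have sm_cl: "c \<odot>\<^bsub>Der S\<^esub> D \<in> carrier (Der S)" if "D \<in> carrier (Der S)" for D c
    unfolding rec
    by (rule DerI) (use that in \<open>simp_all add: cl add sm leib smc smadd sml smr smass mult.commute\<close>)
  have br_cl: "lie_bracket (Der S) D E \<in> carrier (Der S)"
    if "D \<in> carrier (Der S)" "E \<in> carrier (Der S)" for D E
    unfolding rec
  proof (rule DerI)
    fix a b assume ab: "a \<in> carrier S" "b \<in> carrier S"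
    note c = ab that cl[OF that(1)] cl[OF that(2)]
    show "D (E (a \<oplus>\<^bsub>S\<^esub> b)) \<ominus>\<^bsub>S\<^esub> E (D (a \<oplus>\<^bsub>S\<^esub> b)) =
          D (E a) \<ominus>\<^bsub>S\<^esub> E (D a) \<oplus>\<^bsub>S\<^esub> (D (E b) \<ominus>\<^bsub>S\<^esub> E (D b))"
      using c by (simp add: add) algebra
    show "D (E (a \<otimes>\<^bsub>S\<^esub> b)) \<ominus>\<^bsub>S\<^esub> E (D (a \<otimes>\<^bsub>S\<^esub> b)) =
          (D (E a) \<ominus>\<^bsub>S\<^esub> E (D a)) \<otimes>\<^bsub>S\<^esub> b \<oplus>\<^bsub>S\<^esub> a \<otimes>\<^bsub>S\<^esub> (D (E b) \<ominus>\<^bsub>S\<^esub> E (D b))"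
      using c by (simp add: add leib) algebra
  qed (use that in \<open>simp_all add: cl sm smc smminus\<close>)
  have grp: "abelian_group (Der S)"
  proof (rule abelian_groupI)
    fix D assume D: "D \<in> carrier (Der S)"
    show "\<exists>E\<in>carrier (Der S). E \<oplus>\<^bsub>Der S\<^esub> D = \<zero>\<^bsub>Der S\<^esub>"
    proof (rule bexI[OF _ sm_cl[OF D, of "-1"]])
      have "(-1) \<odot>\<^bsub>S\<^esub> D a \<oplus>\<^bsub>S\<^esub> D a = \<zero>\<^bsub>S\<^esub>" if "a \<in> carrier S" for a
        using smladd[of "D a" "-1" 1] A.smult_one[of "D a"] A.smult_l_null[of "D a"] cl[OF D that] by simp
      then show "(-1) \<odot>\<^bsub>Der S\<^esub> D \<oplus>\<^bsub>Der S\<^esub> D = \<zero>\<^bsub>Der S\<^esub>"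
        unfolding rec by (auto intro!: eqI)
    qed
  qed (auto simp: zero_cl add_cl intro!: eqI ext, auto simp: rec cl A.M.add.m_ac)
  have "module class_ring (Der S)"
  proof (rule moduleI[OF A.R_cring grp])
    fix c d :: complex and D E
    assume D: "D \<in> carrier (Der S)" and E: "E \<in> carrier (Der S)"
    note c = cl[OF D] cl[OF E]
    show "c \<odot>\<^bsub>Der S\<^esub> (D \<oplus>\<^bsub>Der S\<^esub> E) = c \<odot>\<^bsub>Der S\<^esub> D \<oplus>\<^bsub>Der S\<^esub> c \<odot>\<^bsub>Der S\<^esub> E"
      unfolding rec by (intro eqI) (simp_all add: c smadd)
  next
    fix c d :: complex and D
    assume D: "D \<in> carrier (Der S)"
    note c = cl[OF D]
    show "c \<odot>\<^bsub>Der S\<^esub> D \<in> carrier (Der S)" by (rule sm_cl[OF D])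
    show "(c \<oplus>\<^bsub>class_ring\<^esub> d) \<odot>\<^bsub>Der S\<^esub> D = c \<odot>\<^bsub>Der S\<^esub> D \<oplus>\<^bsub>Der S\<^esub> d \<odot>\<^bsub>Der S\<^esub> D"
      unfolding rec by (intro eqI) (simp_all add: c smladd)
    show "(c \<otimes>\<^bsub>class_ring\<^esub> d) \<odot>\<^bsub>Der S\<^esub> D = c \<odot>\<^bsub>Der S\<^esub> (d \<odot>\<^bsub>Der S\<^esub> D)"
      unfolding rec by (intro eqI) (simp_all add: c smass smc)
    show "\<one>\<^bsub>class_ring\<^esub> \<odot>\<^bsub>Der S\<^esub> D = D"
      unfolding rec by (intro eqI) (use A.smult_one c ext[OF D] in simp_all)
  qed
  then have vs: "vectorspace class_ring (Der S)"
    unfolding vectorspace_def using class_field by blast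
  have jac: "x1 \<ominus>\<^bsub>S\<^esub> x2 \<ominus>\<^bsub>S\<^esub> (x3 \<ominus>\<^bsub>S\<^esub> x4) \<oplus>\<^bsub>S\<^esub> (x3 \<ominus>\<^bsub>S\<^esub> x5 \<ominus>\<^bsub>S\<^esub> (x6 \<ominus>\<^bsub>S\<^esub> x2))
      \<oplus>\<^bsub>S\<^esub> (x6 \<ominus>\<^bsub>S\<^esub> x4 \<ominus>\<^bsub>S\<^esub> (x1 \<ominus>\<^bsub>S\<^esub> x5)) = \<zero>\<^bsub>S\<^esub>"
    if "x1 \<in> carrier S" "x2 \<in> carrier S" "x3 \<in> carrier S" "x4 \<in> carrier S"
      "x5 \<in> carrier S" "x6 \<in> carrier S" for x1 x2 x3 x4 x5 x6
    using that by algebra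
  have br_app: "lie_bracket (Der S) D E a = D (E a) \<ominus>\<^bsub>S\<^esub> E (D a)" if "a \<in> carrier S" for D E a
    using that by (simp add: rec)
  have add_app: "(D \<oplus>\<^bsub>Der S\<^esub> E) a = D a \<oplus>\<^bsub>S\<^esub> E a" if "a \<in> carrier S" for D E a
    using that by (simp add: rec)
  have br_ext: "lie_bracket (Der S) D E \<in> extensional (carrier S)"
    and add_ext: "D \<oplus>\<^bsub>Der S\<^esub> E \<in> extensional (carrier S)"
    and zero_ext: "\<zero>\<^bsub>Der S\<^esub> \<in> extensional (carrier S)" for D E
    unfolding rec by (rule restrict_extensional)+
  show ?thesis
  proof (intro lie_algebra.intro vs lie_algebra_axioms.intro)
    fix D E F assume DEF: "D \<in> carrier (Der S)" "E \<in> carrier (Der S)" "F \<in> carrier (Der S)"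
    note c = DEF cl[OF DEF(1)] cl[OF DEF(2)] cl[OF DEF(3)]
    show "lie_bracket (Der S) (D \<oplus>\<^bsub>Der S\<^esub> E) F =
          lie_bracket (Der S) D F \<oplus>\<^bsub>Der S\<^esub> lie_bracket (Der S) E F"
      unfolding rec by (intro eqI) (use c in \<open>simp_all add: add, algebra\<close>)
    show "lie_bracket (Der S) D (E \<oplus>\<^bsub>Der S\<^esub> F) =
          lie_bracket (Der S) D E \<oplus>\<^bsub>Der S\<^esub> lie_bracket (Der S) D F"
      unfolding rec by (intro eqI) (use c in \<open>simp_all add: add, algebra\<close>)
    show "lie_bracket (Der S) D (lie_bracket (Der S) E F)
          \<oplus>\<^bsub>Der S\<^esub> lie_bracket (Der S) E (lie_bracket (Der S) F D)
          \<oplus>\<^bsub>Der S\<^esub> lie_bracket (Der S) F (lie_bracket (Der S) D E) = \<zero>\<^bsub>Der S\<^esub>"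
    proof (rule eqI[OF add_ext zero_ext])
      fix a assume a: "a \<in> carrier S"
      note cc = a c(4-6)[OF a] c(4)[OF c(5)[OF a]] c(4)[OF c(6)[OF a]] c(5)[OF c(4)[OF a]]
        c(5)[OF c(6)[OF a]] c(6)[OF c(4)[OF a]] c(6)[OF c(5)[OF a]]
      show "(lie_bracket (Der S) D (lie_bracket (Der S) E F)
          \<oplus>\<^bsub>Der S\<^esub> lie_bracket (Der S) E (lie_bracket (Der S) F D)
          \<oplus>\<^bsub>Der S\<^esub> lie_bracket (Der S) F (lie_bracket (Der S) D E)) a = \<zero>\<^bsub>Der S\<^esub> a"
        by (simp only: add_app br_app cc Dminus DEF jac c) (simp add: rec a)
    qed
  next
    fix D E and k :: complex assume DE: "D \<in> carrier (Der S)" "E \<in> carrier (Der S)"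
    show "lie_bracket (Der S) (k \<odot>\<^bsub>Der S\<^esub> D) E = k \<odot>\<^bsub>Der S\<^esub> lie_bracket (Der S) D E"
      and "lie_bracket (Der S) D (k \<odot>\<^bsub>Der S\<^esub> E) = k \<odot>\<^bsub>Der S\<^esub> lie_bracket (Der S) D E"
      unfolding rec by (intro eqI; use DE in \<open>simp add: cl sm smminus\<close>)+
  next
    fix D assume "D \<in> carrier (Der S)"
    then show "lie_bracket (Der S) D D = \<zero>\<^bsub>Der S\<^esub>"
      unfolding rec by (intro eqI) (simp_all add: cl A.M.minus_eq A.M.r_neg)
  qed (use br_cl in auto)
qed

end

theory Submission
  imports Defs "HOL-Computational_Algebra.Fundamental_Theorem_Algebra" "HOL-Library.Function_Algebras"
begin

text \<open>
  Let \<open>R\<close> be the ring of power series in \<open>n\<close> variables, \<open>\<mm>\<close> its maximal ideal, \<open>S = R / J\<close> with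
  \<open>J \<subseteq> \<mm>\<^sup>k\<close>. The claim is that \<open>J\<close> needs at least \<open>n + k - 1\<close> generators if the derivations of \<open>S\<close> do not
  form a solvable Lie algebra. The reason is that such an algebra of derivations contains a copy of
  \<open>sl\<^sub>2\<close>, whose weights make it possible to count equations.

  Derivations of \<open>S\<close> lift to derivations of \<open>R\<close> that preserve \<open>\<mm>\<close> and \<open>J\<close>, and \<open>J\<close> contains a power of
  \<open>\<mm>\<close> because \<open>S\<close> has dimension zero. Truncating power series, the lifts form a Lie algebra \<open>g\<close> of
  operators on a finite dimensional space; if \<open>g\<close> is solvable, so is the algebra of derivations of \<open>S\<close>
  (\<open>ex_lift\<close>, \<open>solvable_if_dser_trivial\<close>).

  The copy of \<open>sl\<^sub>2\<close> is found through the trace form. With an operator \<open>x\<close>, \<open>g\<close> contains all replicas of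
  \<open>x\<close>: operators that act on the generalized eigenspaces of \<open>x\<close> by an additive function of the eigenvalue. The
  replica for complex conjugation pairs with \<open>x\<close> to the sum of the squares \<open>|l|\<^sup>2\<close> of the eigenvalues, so that
  the radical \<open>rad\<close> of the trace form consists of nilpotent operators. Choose a diagonalizable element \<open>a\<close>
  of \<open>g\<close> with as many differences of eigenvalues as possible. Its centralizer is abelian modulo \<open>rad\<close>. If all
  other weight vectors of \<open>a\<close> are in \<open>rad\<close>, then \<open>[g, g] \<subseteq> rad\<close> and \<open>g\<close> is solvable by Engel's theorem. A
  weight vector \<open>e\<close> outside \<open>rad\<close> can be completed to a triple \<open>e, f, h\<close> satisfying the relations of \<open>sl\<^sub>2\<close>
  modulo \<open>rad\<close> (\<open>root_triple\<close>, \<open>solvable_or_sl2\<close>). By Engel's theorem again, \<open>rad\<close> can be ignored when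
  determining weights: a weight vector killed by \<open>e\<close> in a subquotient has a natural number as its weight
  (\<open>highest_weight_natural\<close>).

  Let \<open>Y\<close> be a basis of \<open>\<mm> / \<mm>\<^sup>2\<close> and \<open>W\<close> a basis of \<open>J / \<mm> J\<close>, both consisting of weight vectors for \<open>h\<close>. Fix
  \<open>j \<ge> 0\<close> and divide \<open>R\<close> by the variables of weight greater than \<open>- j\<close> and by the images under \<open>e\<close> of those of weight
  at most \<open>- j - 2\<close>. An equation of weight greater than \<open>- k j\<close> then disappears, since each of its monomials has degree at
  least \<open>k\<close> and so contains a variable of weight greater than \<open>- j\<close>. Images under \<open>e\<close> disappear too, since the images of
  all variables do. As \<open>e\<close> is injective on negative weights of \<open>J / \<mm> J\<close>, there remain as many equations as
  \<open>W\<close> has vectors of weight \<open>- k j\<close> or \<open>- k j - 1\<close>. The quotient by these is finite dimensional, so in total at least \<open>n\<close>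
  elements have been divided out, by a growth argument (\<open>generators_ge_dimension\<close>); hence \<open>Y\<close> has at most that
  many vectors of weight \<open>- j\<close> or \<open>- j - 1\<close> (\<open>lower_window\<close>). The same holds for positive weights, with \<open>f\<close>
  instead of \<open>e\<close>. Adding up these inequalities over all \<open>j\<close>, where the numbers for \<open>W\<close> decrease with the absolute value
  of the weight and each vector is counted twice, gives \<open>2 card W \<ge> 2 card Y + 2 (k - 1)\<close>. The last
  term is due to the weights of the variables not all being zero (\<open>weight_count\<close>, \<open>many_equations\<close>).

  Finally, the first deviation is at least the number of generators: a Koszul cycle \<open>(s\<^sub>i)\<close> for
  generators \<open>y\<^sub>i\<close> of the maximal ideal of \<open>S\<close> is sent to the class of \<open>\<Sum> Y\<^sub>i s\<^sub>i\<close> in \<open>J / \<mm> J\<close>, for lifts of all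
  elements to \<open>R\<close>. Boundaries are sent to \<open>0\<close>, and the map is onto because \<open>J \<subseteq> \<mm>\<^sup>2\<close>
  (\<open>generators_from_homology\<close>).
\<close>

section \<open>Complex vector spaces and their endomorphisms\<close>

text \<open>Endomorphisms of a complex vector space, power series and tuples of power series all carry
  this structure, so that the theory of spans, bases and dimensions applies to each of them.\<close>

class cspace = ab_group_add +
  fixes cscale :: "complex \<Rightarrow> 'a \<Rightarrow> 'a" (infixr "*\<^sub>C" 75)
  assumes cscale_add_right: "c *\<^sub>C (x + y) = c *\<^sub>C x + c *\<^sub>C y"
    and cscale_add_left: "(c + d) *\<^sub>C x = c *\<^sub>C x + d *\<^sub>C x"
    and cscale_cscale: "c *\<^sub>C d *\<^sub>C x = (c * d) *\<^sub>C x"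
    and cscale_one: "1 *\<^sub>C x = x"

global_interpretation cs: vector_space "cscale :: complex \<Rightarrow> 'a::cspace \<Rightarrow> 'a"
  by standard (simp_all add: cscale_add_right cscale_add_left cscale_cscale cscale_one)

declare cscale_cscale [simp] cscale_one [simp]

definition lin :: "('v::cspace \<Rightarrow> 'w::cspace) \<Rightarrow> bool" where
  "lin T \<longleftrightarrow> (\<forall>u v. T (u + v) = T u + T v) \<and> (\<forall>c v. T (c *\<^sub>C v) = c *\<^sub>C T v)"

typedef (overloaded) 'v endo = "{T :: 'v::cspace \<Rightarrow> 'v. lin T}"
  morphisms ap Endo
  by (rule exI[of _ id]) (simp add: lin_def)

notation ap (infixr "\<cdot>" 75)

setup_lifting type_definition_endo

instantiation endo :: (cspace) "{ring, monoid_mult, cspace}"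
begin

lift_definition zero_endo :: "'a endo" is "\<lambda>v. 0"
  by (simp add: lin_def)
lift_definition one_endo :: "'a endo" is "\<lambda>v. v"
  by (simp add: lin_def)
lift_definition plus_endo :: "'a endo \<Rightarrow> 'a endo \<Rightarrow> 'a endo" is "\<lambda>S T v. S v + T v"
  by (simp add: lin_def cscale_add_right)
lift_definition minus_endo :: "'a endo \<Rightarrow> 'a endo \<Rightarrow> 'a endo" is "\<lambda>S T v. S v - T v"
  by (simp add: lin_def cs.scale_right_diff_distrib)
lift_definition uminus_endo :: "'a endo \<Rightarrow> 'a endo" is "\<lambda>T v. - T v"
  by (simp add: lin_def)
lift_definition times_endo :: "'a endo \<Rightarrow> 'a endo \<Rightarrow> 'a endo" is "\<lambda>S T v. S (T v)"
  by (simp add: lin_def)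
lift_definition cscale_endo :: "complex \<Rightarrow> 'a endo \<Rightarrow> 'a endo" is "\<lambda>c T v. c *\<^sub>C T v"
  by (simp add: lin_def cscale_add_right mult.commute)

instance
  by standard
    (transfer; simp add: lin_def fun_eq_iff algebra_simps cscale_add_right cscale_add_left)+

end

lemma endo_eqI: "(\<And>v. S \<cdot> v = T \<cdot> v) \<Longrightarrow> S = T"
  by (metis ap_inject ext)

lemma ap_lin: "lin (ap T)"
  using ap[of T] by simp

lemma ap_add_right [simp]: "T \<cdot> (u + v) = T \<cdot> u + T \<cdot> v"
  and ap_cscale_right [simp]: "T \<cdot> (c *\<^sub>C v) = c *\<^sub>C T \<cdot> v"
  using ap_lin[of T] by (simp_all add: lin_def)

lemma ap_zero_right [simp]: "T \<cdot> 0 = 0"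
  by (metis ap_cscale_right cs.scale_zero_left)

lemma ap_minus_right [simp]: "T \<cdot> (- v) = - (T \<cdot> v)"
  by (metis ap_add_right ap_zero_right eq_neg_iff_add_eq_0)

lemma ap_diff_right [simp]: "T \<cdot> (u - v) = T \<cdot> u - T \<cdot> v"
  by (metis ap_add_right ap_minus_right diff_conv_add_uminus)

lemma ap_sum_right: "T \<cdot> (\<Sum>i\<in>A. f i) = (\<Sum>i\<in>A. T \<cdot> f i)"
  by (induction A rule: infinite_finite_induct) auto

lemma ap_zero [simp]: "0 \<cdot> v = 0" by transfer simp
lemma ap_one [simp]: "1 \<cdot> v = v" by transfer simp
lemma ap_add [simp]: "(S + T) \<cdot> v = S \<cdot> v + T \<cdot> v" by transfer simp
lemma ap_diff [simp]: "(S - T) \<cdot> v = S \<cdot> v - T \<cdot> v" by transfer simp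
lemma ap_uminus [simp]: "(- T) \<cdot> v = - (T \<cdot> v)" by transfer simp
lemma ap_mult [simp]: "(S * T) \<cdot> v = S \<cdot> T \<cdot> v" by transfer simp
lemma ap_cscale [simp]: "(c *\<^sub>C T) \<cdot> v = c *\<^sub>C T \<cdot> v" by transfer simp

lemma ap_sum: "(\<Sum>i\<in>A. f i) \<cdot> v = (\<Sum>i\<in>A. f i \<cdot> v)"
  by (induction A rule: infinite_finite_induct) auto

lemma mult_cscale_left [simp]: "(c *\<^sub>C S) * T = c *\<^sub>C (S * T :: 'v::cspace endo)"
  by (rule endo_eqI) simp
lemma mult_cscale_right [simp]: "S * (c *\<^sub>C T) = c *\<^sub>C (S * T :: 'v::cspace endo)"
  by (rule endo_eqI) simp

lemma ap_Endo: "lin f \<Longrightarrow> Endo f \<cdot> v = f v"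
  by (simp add: Endo_inverse)

lemma ap_power_Suc2: "T ^ Suc k \<cdot> v = T ^ k \<cdot> T \<cdot> v"
  by (simp only: power_Suc2 ap_mult)

lemma power_in_invariant:
  assumes "\<And>u. u \<in> U \<Longrightarrow> T \<cdot> u \<in> U" "v \<in> U"
  shows "T ^ k \<cdot> v \<in> U"
  using assms by (induction k) auto

section \<open>Generalized eigenvectors\<close>

definition shift :: "'v::cspace endo \<Rightarrow> complex \<Rightarrow> 'v endo" where
  "shift T l = T - l *\<^sub>C 1"

lemma ap_shift [simp]: "shift T l \<cdot> v = T \<cdot> v - l *\<^sub>C v"
  by (simp add: shift_def)

text \<open>Working with powers of \<^term>\<open>shift T l\<close> instead of a Jordan form makes sense on spaces of any
  dimension; the type of power series is infinite dimensional, only the operators have finite rank.\<close>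

definition genvec :: "'v::cspace endo \<Rightarrow> complex \<Rightarrow> 'v \<Rightarrow> bool" where
  "genvec T l v \<longleftrightarrow> (\<exists>k. shift T l ^ k \<cdot> v = 0)"

lemma shift_commute: "S * T = T * S \<Longrightarrow> shift S l * T = T * shift S l"
  by (simp add: shift_def algebra_simps)

lemma power_commuting:
  fixes S T :: "'a::monoid_mult"
  assumes "S * T = T * S" shows "S ^ k * T = T * S ^ k"
  by (rule power_commuting_commutes) (use assms in simp)

lemma power_mono_zero: "T ^ k \<cdot> v = 0 \<Longrightarrow> k \<le> j \<Longrightarrow> T ^ j \<cdot> v = 0"
  by (metis ap_mult ap_zero_right le_add_diff_inverse2 power_add)

lemma genvec_eigen: "T \<cdot> v = l *\<^sub>C v \<Longrightarrow> genvec T l v"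
  unfolding genvec_def by (rule exI[of _ 1]) simp

lemma genvec_add:
  assumes "genvec T l u" "genvec T l v" shows "genvec T l (u + v)"
proof -
  from assms obtain i j where "shift T l ^ i \<cdot> u = 0" "shift T l ^ j \<cdot> v = 0"
    by (auto simp: genvec_def)
  then have "shift T l ^ max i j \<cdot> u = 0" "shift T l ^ max i j \<cdot> v = 0"
    by (meson max.cobounded1 max.cobounded2 power_mono_zero)+
  then show ?thesis unfolding genvec_def by (intro exI[of _ "max i j"]) simp
qed

lemma genvec_scale: "genvec T l u \<Longrightarrow> genvec T l (c *\<^sub>C u)"
  unfolding genvec_def by auto

lemma genvec_zero [simp]: "genvec T l 0"
  by (simp add: genvec_def)

lemma genvec_sum: "(\<And>i. i \<in> A \<Longrightarrow> genvec T l (f i)) \<Longrightarrow> genvec T l (sum f A)"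
  by (induction A rule: infinite_finite_induct) (auto intro: genvec_add)

lemma genvec_commuting:
  assumes "S * T = T * S" "genvec T l v" shows "genvec T l (S \<cdot> v)"
proof -
  obtain k where "shift T l ^ k \<cdot> v = 0" using assms by (auto simp: genvec_def)
  moreover have "shift T l ^ k * S = S * shift T l ^ k"
    using assms by (intro power_commuting shift_commute) simp
  ultimately show ?thesis unfolding genvec_def by (metis ap_mult ap_zero_right)
qed

text \<open>The last nonzero vector in the sequence \<open>(T - l)\<^sup>j v\<close> is an eigenvector.\<close>

lemma genvec_eigenvector:
  assumes "genvec T l v" "v \<noteq> 0"
  obtains j where "shift T l ^ j \<cdot> v \<noteq> 0" "T \<cdot> shift T l ^ j \<cdot> v = l *\<^sub>C shift T l ^ j \<cdot> v"
proof -
  define k where "k = (LEAST k. shift T l ^ k \<cdot> v = 0)"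
  have k: "shift T l ^ k \<cdot> v = 0"
    using assms(1) unfolding genvec_def k_def by (rule LeastI_ex)
  then have "k \<noteq> 0" using assms(2) by (metis ap_one power_0)
  then obtain j where j: "k = Suc j" using not0_implies_Suc by blast
  have "shift T l ^ j \<cdot> v \<noteq> 0" 
    using not_less_Least[of j "\<lambda>k. shift T l ^ k \<cdot> v = 0"] j unfolding k_def by simp
  then show thesis using k unfolding j by (intro that[of j]) simp_all
qed

text \<open>If \<open>v \<noteq> 0\<close>, an eigenvector \<open>(T - l)\<^sup>j v\<close> for \<open>l\<close> is a generalized eigenvector for \<open>m\<close> as well, but
  \<open>T - m\<close> multiplies it by \<open>l - m \<noteq> 0\<close>.\<close>

lemma genvec_distinct:
  assumes "genvec T l v" "genvec T m v" "l \<noteq> m" shows "v = 0"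
proof (rule ccontr)
  assume "v \<noteq> 0"
  then obtain j where j: "shift T l ^ j \<cdot> v \<noteq> 0" "T \<cdot> shift T l ^ j \<cdot> v = l *\<^sub>C shift T l ^ j \<cdot> v"
    using genvec_eigenvector assms(1) by blast
  define w where "w = shift T l ^ j \<cdot> v"
  have "shift T l ^ j * T = T * shift T l ^ j"
    by (intro power_commuting shift_commute) simp
  then have "genvec T m w" unfolding w_def using assms(2) by (intro genvec_commuting) auto
  then obtain k where k: "shift T m ^ k \<cdot> w = 0" by (auto simp: genvec_def)
  have "shift T m ^ k \<cdot> w = (l - m) ^ k *\<^sub>C w"
  proof (induction k)
    case (Suc k)
    have "T \<cdot> w = l *\<^sub>C w" using j by (simp add: w_def)
    with Suc show ?case by (simp add: cs.scale_right_diff_distrib cs.scale_left_diff_distrib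
          left_diff_distrib mult.commute)
  qed simp
  then have "(l - m) ^ k *\<^sub>C w = 0" using k by simp
  moreover have "(l - m) ^ k \<noteq> 0" using assms(3) by simp
  ultimately have "w = 0" using cs.scale_eq_0_iff by blast
  then show False using j(1) by (simp add: w_def)
qed

text \<open>Applying a power of \<^term>\<open>shift T m\<close> kills one summand and keeps the others generalized
  eigenvectors, so the number of summands goes down.\<close>

lemma genvec_sum_zero:
  assumes "finite F" "\<And>l. l \<in> F \<Longrightarrow> genvec T l (u l)" "(\<Sum>l\<in>F. u l) = 0"
  shows "\<forall>l\<in>F. u l = 0"
  using assms
proof (induction F arbitrary: u rule: finite_induct)
  case (insert m F)
  have "genvec T m (u m)" using insert.prems(1)[of m] by simp
  then obtain k where k: "shift T m ^ k \<cdot> u m = 0" unfolding genvec_def by blast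
  define w where "w l = shift T m ^ k \<cdot> u l" for l
  have "(\<Sum>l\<in>F. w l) = shift T m ^ k \<cdot> (\<Sum>l\<in>insert m F. u l)"
    using insert.hyps k by (simp add: w_def ap_sum_right)
  also have "\<dots> = 0" using insert.prems by simp
  finally have "(\<Sum>l\<in>F. w l) = 0" .
  moreover have "genvec T l (w l)" if "l \<in> F" for l
  proof -
    have "shift T m ^ k * T = T * shift T m ^ k" by (intro power_commuting shift_commute) simp
    then show ?thesis using that insert.prems(1) unfolding w_def by (intro genvec_commuting) auto
  qed
  ultimately have "\<forall>l\<in>F. w l = 0" using insert.IH by blast
  then have *: "u l = 0" if "l \<in> F" for l
  proof -
    have "genvec T m (u l)" using \<open>\<forall>l\<in>F. w l = 0\<close> that unfolding genvec_def w_def by blast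
    moreover have "l \<noteq> m" using that insert.hyps(2) by blast
    ultimately show ?thesis using that insert.prems(1) genvec_distinct[of T l "u l" m] by blast
  qed
  then have "u m = 0" using insert.prems(2) insert.hyps by simp
  then show ?case using * by blast
qed simp

text \<open>An invariant subspace contains the eigencomponents of its elements: applying \<open>T - m\<close> removes the
  component for \<open>m\<close> and only rescales the others.\<close>

lemma eigen_components_in:
  assumes "finite F" "\<And>l. l \<in> F \<Longrightarrow> T \<cdot> u l = l *\<^sub>C u l" "(\<Sum>l\<in>F. u l) \<in> L"
    and L: "cs.subspace L" "\<And>v. v \<in> L \<Longrightarrow> T \<cdot> v \<in> L"
  shows "\<forall>l\<in>F. u l \<in> L"
  using assms(1-3)
proof (induction F arbitrary: u rule: finite_induct)
  case (insert m F)
  have "T \<cdot> (\<Sum>l\<in>insert m F. u l) - m *\<^sub>C (\<Sum>l\<in>insert m F. u l) \<in> L"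
    using insert.prems(2) L by (intro cs.subspace_diff cs.subspace_scale) auto
  also have "T \<cdot> (\<Sum>l\<in>insert m F. u l) - m *\<^sub>C (\<Sum>l\<in>insert m F. u l)
      = (\<Sum>l\<in>F. (l - m) *\<^sub>C u l)"
    using insert by (simp add: ap_sum_right cscale_add_right cs.scale_sum_right sum_subtractf
        cs.scale_left_diff_distrib)
  finally have "(\<Sum>l\<in>F. (l - m) *\<^sub>C u l) \<in> L" .
  moreover have "T \<cdot> (l - m) *\<^sub>C u l = l *\<^sub>C (l - m) *\<^sub>C u l" if "l \<in> F" for l
    using insert.prems(1)[of l] that by (simp add: mult.commute)
  ultimately have "\<forall>l\<in>F. (l - m) *\<^sub>C u l \<in> L"
    using insert.IH[of "\<lambda>l. (l - m) *\<^sub>C u l"] by presburger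
  then have *: "u l \<in> L" if "l \<in> F" for l
  proof -
    have "l - m \<noteq> 0" using that insert.hyps(2) by auto
    moreover have "(1 / (l - m)) *\<^sub>C (l - m) *\<^sub>C u l \<in> L"
      by (rule cs.subspace_scale[OF L(1)])
        (use \<open>\<forall>l\<in>F. (l - m) *\<^sub>C u l \<in> L\<close> that in blast)
    ultimately show ?thesis by simp
  qed
  then have "(\<Sum>l\<in>F. u l) \<in> L" using L by (intro cs.subspace_sum) auto
  then have "u m \<in> L"
    using insert L cs.subspace_diff[of L "\<Sum>l\<in>insert m F. u l" "\<Sum>l\<in>F. u l"] by simp
  then show ?case using * by simp
qed simp

section \<open>Spanning by generalized eigenvectors\<close>

definition peval :: "'v::cspace endo \<Rightarrow> complex poly \<Rightarrow> 'v endo" where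
  "peval T p = fold_coeffs (\<lambda>a S. a *\<^sub>C 1 + T * S) p 0"

lemma peval_0 [simp]: "peval T 0 = 0"
  by (simp add: peval_def)

lemma peval_pCons [simp]: "peval T (pCons a p) = a *\<^sub>C 1 + T * peval T p"
  by (cases "p = 0 \<and> a = 0") (auto simp: peval_def)

lemma peval_add: "peval T (p + q) = peval T p + peval T q"
  by (induction p q rule: poly_induct2) (simp_all add: algebra_simps cscale_add_left)

lemma peval_smult: "peval T (smult c p) = c *\<^sub>C peval T p"
  by (induction p) (simp_all add: cscale_add_right)

lemma peval_mult: "peval T (p * q) = peval T p * peval T q"
  by (induction p) (simp_all add: peval_add peval_smult algebra_simps)

lemma peval_1: "peval T 1 = 1"
  by (simp add: one_pCons)

lemma peval_power: "peval T (p ^ k) = peval T p ^ k"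
  by (induction k) (simp_all add: peval_1 peval_mult)

lemma peval_monom: "peval T (monom c k) = c *\<^sub>C T ^ k"
  by (induction k) (simp_all add: monom_0 monom_Suc)

lemma peval_sum: "peval T (sum f A) = (\<Sum>i\<in>A. peval T (f i))"
  by (induction A rule: infinite_finite_induct) (simp_all add: peval_add)

lemma peval_in_invariant:
  assumes "cs.subspace U" "\<And>u. u \<in> U \<Longrightarrow> T \<cdot> u \<in> U" "v \<in> U"
  shows "peval T p \<cdot> v \<in> U"
  by (induction p) (use assms in \<open>auto intro: cs.subspace_add cs.subspace_scale cs.subspace_0\<close>)

text \<open>Bezout identity for \<open>(X - l)\<^sup>k\<close> and a polynomial not vanishing at \<open>l\<close>; it splits a vector killed by
  the product into parts killed by the factors.\<close>

lemma power_root_coprime: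
  fixes q :: "complex poly"
  assumes "poly q l \<noteq> 0"
  obtains s t where "s * [:- l, 1:] ^ k + t * q = 1"
proof -
  have "poly (q - [:poly q l:]) l = 0" by simp
  then obtain r where r: "q - [:poly q l:] = [:- l, 1:] * r"
    unfolding poly_eq_0_iff_dvd by blast
  define c where "c = inverse (poly q l)"
  have "smult c q - smult c [:- l, 1:] * r = smult c (q - [:- l, 1:] * r)"
    by (simp add: smult_diff_right)
  also have "q - [:- l, 1:] * r = [:poly q l:]" using r by (metis diff_diff_eq2 add_diff_cancel_left')
  also have "smult c [:poly q l:] = 1" using assms by (simp add: c_def one_pCons)
  also have "smult c q - smult c x * r = smult (- c) r * x + [:c:] * q" for x
    by (simp add: mult.commute)
  finally have 1: "smult (- c) r * [:- l, 1:] + [:c:] * q = 1" .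
  have "\<exists>s t. s * [:- l, 1:] ^ k + t * q = 1"
  proof (induction k)
    case 0
    show ?case by (intro exI[of _ 1] exI[of _ 0]) simp
  next
    case (Suc k)
    then obtain s t where st: "s * [:- l, 1:] ^ k + t * q = 1" by blast
    define u where "u = smult (- c) r"
    define x where "x = [:- l, 1:]"
    have "(s * x ^ k + t * q) * (u * x + [:c:] * q) = 1"
      using st 1 by (simp add: u_def x_def)
    then have "(s * u) * x ^ Suc k + (t * (u * x + [:c:] * q) + s * x ^ k * [:c:]) * q = 1"
      by (simp add: algebra_simps)
    then show ?case unfolding x_def by blast
  qed
  then show thesis using that by blast
qed

text \<open>Over the complex numbers the annihilator \<open>p\<close> has a root \<open>l\<close>. Write \<open>p = (X - l)\<^sup>k q\<close> with \<open>q\<close> nonzero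
  at \<open>l\<close>; the Bezout identity splits \<open>v\<close> into a generalized eigenvector and a vector annihilated by \<open>q\<close>.\<close>

lemma annihilated_in_span_genvec:
  assumes U: "cs.subspace U" "\<And>u. u \<in> U \<Longrightarrow> T \<cdot> u \<in> U"
    and "v \<in> U" "p \<noteq> 0" "peval T p \<cdot> v = 0"
  shows "v \<in> cs.span {u \<in> U. \<exists>l. genvec T l u}"
  using assms(3-)
proof (induction "degree p" arbitrary: p v rule: less_induct)
  case less
  show ?case
  proof (cases "degree p = 0")
    case True
    then obtain c where c: "p = [:c:]" by (rule degree_eq_zeroE)
    then have "c \<noteq> 0" using less.prems(2) by simp
    with c have "v = 0" using less.prems by simp
    then show ?thesis by (simp add: cs.span_zero)
  next
    case False
    then have "\<not> constant (poly p)" by (simp add: constant_degree)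
    then obtain l where l: "poly p l = 0" using fundamental_theorem_of_algebra by blast
    define k where "k = order l p"
    have k0: "k \<noteq> 0" using l less.prems by (simp add: k_def order_root)
    obtain q where q: "p = [:- l, 1:] ^ k * q" "\<not> [:- l, 1:] dvd q"
      using order_decomp[OF less.prems(2)] unfolding k_def by blast
    have "q \<noteq> 0" using q by auto
    have "degree p = k + degree q"
      using q(1) \<open>q \<noteq> 0\<close> by (simp add: degree_mult_eq degree_linear_power)
    then have dq: "degree q < degree p" using k0 by simp
    have "poly q l \<noteq> 0" using q(2) by (simp add: poly_eq_0_iff_dvd)
    then obtain s t where st: "s * [:- l, 1:] ^ k + t * q = 1"
      using power_root_coprime by blast
    define a b where "a = peval T (s * [:- l, 1:] ^ k) \<cdot> v" and "b = peval T (t * q) \<cdot> v"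
    have v: "v = a + b"
      unfolding a_def b_def by (metis ap_add ap_one peval_1 peval_add st)
    have "peval T q \<cdot> a = peval T (s * p) \<cdot> v"
      unfolding a_def by (simp add: q(1) flip: ap_mult peval_mult) (simp add: mult_ac)
    then have "peval T q \<cdot> a = 0" using less.prems(3) by (simp add: peval_mult)
    then have "a \<in> cs.span {u \<in> U. \<exists>l. genvec T l u}"
      using less.hyps[OF dq] \<open>q \<noteq> 0\<close> peval_in_invariant[OF U \<open>v \<in> U\<close>] by (simp add: a_def)
    moreover have "genvec T l b"
    proof -
      have "shift T l = peval T [:- l, 1:]"
        by (rule endo_eqI) simp
      then have "shift T l ^ k \<cdot> b = peval T ([:- l, 1:] ^ k * (t * q)) \<cdot> v"
        by (simp only: b_def peval_mult peval_power ap_mult)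
      also have "[:- l, 1:] ^ k * (t * q) = t * p" by (simp add: q(1) mult_ac)
      finally have "shift T l ^ k \<cdot> b = peval T (t * p) \<cdot> v" .
      then have "shift T l ^ k \<cdot> b = 0" using less.prems(3) by (simp add: peval_mult)
      then show ?thesis by (auto simp: genvec_def)
    qed
    then have "b \<in> cs.span {u \<in> U. \<exists>l. genvec T l u}"
      using peval_in_invariant[OF U \<open>v \<in> U\<close>] by (intro cs.span_base) (auto simp: b_def)
    ultimately show ?thesis unfolding v by (rule cs.span_add)
  qed
qed

text \<open>The vectors \<open>v, T v, T\<^sup>2 v, \<dots>\<close> all lie in a finite dimensional space, so they satisfy a linear relation.\<close>

lemma annihilating_poly:
  fixes T :: "'v::cspace endo"
  assumes U: "\<And>u. u \<in> U \<Longrightarrow> T \<cdot> u \<in> U" "v \<in> U" and fin: "finite B" "U \<subseteq> cs.span B"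
  obtains p where "p \<noteq> 0" "peval T p \<cdot> v = 0"
proof -
  define f where "f i = T ^ i \<cdot> v" for i
  have fU: "f i \<in> cs.span B" for i
    unfolding f_def using power_in_invariant[of U T v i] U fin by blast
  show thesis
  proof (cases "inj_on f {..card B}")
    case False
    then obtain i j where ij: "i \<noteq> j" "f i = f j" by (auto simp: inj_on_def)
    have "monom 1 i - monom 1 j \<noteq> (0::complex poly)"
      using ij by (metis degree_monom_eq eq_iff_diff_eq_0 one_neq_zero)
    moreover have "peval T (monom 1 i + smult (- 1) (monom 1 j)) \<cdot> v = 0"
      unfolding peval_add peval_smult peval_monom using ij by (simp add: f_def)
    ultimately show thesis by (intro that[of "monom 1 i + smult (- 1) (monom 1 j)"]) auto
  next
    case True
    have "cs.dependent (f ` {..card B})"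
    proof (rule ccontr)
      assume "cs.independent (f ` {..card B})"
      then have "card (f ` {..card B}) \<le> card B"
        using cs.independent_span_bound[OF fin(1)] fU by blast
      then show False using True by (simp add: card_image)
    qed
    then obtain c where c: "(\<exists>w\<in>f ` {..card B}. c w \<noteq> 0)" "(\<Sum>w\<in>f ` {..card B}. c w *\<^sub>C w) = 0"
      using cs.dependent_finite[of "f ` {..card B}"] by auto
    define p where "p = (\<Sum>i\<le>card B. monom (c (f i)) i)"
    have "coeff p i = (if i \<le> card B then c (f i) else 0)" for i
      unfolding p_def coeff_sum by (simp add: if_distrib cong: if_cong)
    then have "p \<noteq> 0" using c(1) by (metis (no_types, lifting) coeff_0 imageE atMost_iff)
    moreover have "peval T p \<cdot> v = (\<Sum>i\<le>card B. c (f i) *\<^sub>C f i)"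
      by (simp add: p_def peval_sum peval_monom ap_sum f_def)
    then have "peval T p \<cdot> v = 0" using c(2) True by (simp add: sum.reindex)
    ultimately show thesis by (rule that)
  qed
qed

lemma in_span_genvec:
  assumes "cs.subspace U" "\<And>u. u \<in> U \<Longrightarrow> T \<cdot> u \<in> U" "finite B" "U \<subseteq> cs.span B" "v \<in> U"
  shows "v \<in> cs.span {u \<in> U. \<exists>l. genvec T l u}"
proof -
  obtain p where "p \<noteq> 0" "peval T p \<cdot> v = 0"
    using annihilating_poly[of U T v B] assms(2-5) by blast
  then show ?thesis using annihilated_in_span_genvec[of U T v p] assms(1,2,5) by blast
qed

section \<open>Traces of finite rank operators\<close>

text \<open>A finite dimensional space is given as the image \<open>M\<close> of a projection \<open>E\<close> in a fixed ambient space, and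
  its operators as the endomorphisms \<open>T\<close> of the ambient space with \<open>E T = T = T E\<close>. The truncations of power
  series at varying degrees are of this form, and products of such operators need no conversion.\<close>

locale fin_proj =
  fixes E :: "'v::cspace endo"
  assumes idem: "E * E = E"
    and fin_rank: "\<exists>B. finite B \<and> range (ap E) \<subseteq> cs.span B"
begin

definition M :: "'v set" where "M = {v. E \<cdot> v = v}"

definition ops :: "'v endo set" where "ops = {T. E * T = T \<and> T * E = T}"

definition basis :: "'v set \<Rightarrow> bool" where
  "basis B \<longleftrightarrow> finite B \<and> cs.independent B \<and> cs.span B = M"

lemma subspace_M: "cs.subspace M"
  unfolding cs.subspace_def M_def by simp

lemma E_in_M [simp]: "E \<cdot> v \<in> M"
  by (simp add: M_def idem flip: ap_mult)

lemma M_fix: "v \<in> M \<Longrightarrow> E \<cdot> v = v"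
  by (simp add: M_def)

lemma ops_in_M: "T \<in> ops \<Longrightarrow> T \<cdot> v \<in> M"
  unfolding ops_def M_def by (metis (mono_tags, lifting) ap_mult mem_Collect_eq)

lemma ops_E: "T \<in> ops \<Longrightarrow> T \<cdot> E \<cdot> v = T \<cdot> v"
  unfolding ops_def by (metis (mono_tags, lifting) ap_mult mem_Collect_eq)

lemma ops_intro: "(\<And>v. T \<cdot> v \<in> M) \<Longrightarrow> (\<And>v. T \<cdot> E \<cdot> v = T \<cdot> v) \<Longrightarrow> T \<in> ops"
  unfolding ops_def by (auto intro!: endo_eqI simp: M_fix)

lemma E_ops: "E \<in> ops"
  by (simp add: ops_def idem)

lemma subspace_ops: "cs.subspace ops"
  unfolding cs.subspace_def ops_def by (auto simp: algebra_simps)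

lemma ops_mult: "S \<in> ops \<Longrightarrow> T \<in> ops \<Longrightarrow> S * T \<in> ops"
  unfolding ops_def by (auto simp: mult.assoc) (simp flip: mult.assoc)

lemmas ops_add = cs.subspace_add[OF subspace_ops]
  and ops_diff = cs.subspace_diff[OF subspace_ops]
  and ops_scale = cs.subspace_scale[OF subspace_ops]
  and ops_sum = cs.subspace_sum[OF subspace_ops]

lemma ops_power: "T \<in> ops \<Longrightarrow> T ^ Suc k \<in> ops"
  by (induction k) (auto intro: ops_mult)

lemma M_finite_span: obtains B where "finite B" "M \<subseteq> cs.span B"
  using fin_rank M_fix by (metis rangeI subsetD subsetI)

lemma basis_from_spanning:
  assumes "G \<subseteq> M" "M \<subseteq> cs.span G"
  obtains B where "B \<subseteq> G" "basis B"
proof -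
  obtain B where B: "B \<subseteq> G" "cs.independent B" "G \<subseteq> cs.span B"
    using cs.maximal_independent_subset by blast
  obtain F where F: "finite F" "M \<subseteq> cs.span F" by (rule M_finite_span)
  have "finite B" using cs.independent_span_bound[OF F(1) B(2)] B(1) assms(1) F(2) by blast
  moreover have "cs.span B = M"
  proof
    show "cs.span B \<subseteq> M" using B(1) assms(1) subspace_M by (intro cs.span_minimal) auto
    show "M \<subseteq> cs.span B" using assms(2) B(3) by (metis cs.span_mono cs.span_span subset_trans)
  qed
  ultimately show thesis using that B unfolding basis_def by blast
qed

lemma basis_in_M: "basis B \<Longrightarrow> b \<in> B \<Longrightarrow> b \<in> M"
  unfolding basis_def using cs.span_base by blast

definition crd :: "'v set \<Rightarrow> 'v \<Rightarrow> 'v \<Rightarrow> complex" where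
  "crd B b v = cs.representation B (E \<cdot> v) b"

lemma
  assumes "basis B"
  shows crd_add: "crd B b (u + v) = crd B b u + crd B b v"
    and crd_scale: "crd B b (c *\<^sub>C v) = c * crd B b v"
    and crd_expand: "(\<Sum>b\<in>B. crd B b v *\<^sub>C b) = E \<cdot> v"
    and crd_basis: "b' \<in> B \<Longrightarrow> crd B b b' = (if b = b' then 1 else 0)"
  using assms cs.representation_add[of B] cs.representation_scale[of B] cs.representation_basis[of B]
    cs.sum_representation_eq[of B _ B] basis_in_M[OF assms]
  by (auto simp: basis_def crd_def M_fix)

lemma crd_E: "crd B b (E \<cdot> v) = crd B b v"
  by (simp add: crd_def M_fix)

lemma crd_zero: "basis B \<Longrightarrow> crd B b 0 = 0"
  by (metis crd_scale cs.scale_zero_left mult_zero_left)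

lemma crd_sum: "basis B \<Longrightarrow> crd B b (\<Sum>i\<in>A. f i) = (\<Sum>i\<in>A. crd B b (f i))"
  by (induction A rule: infinite_finite_induct) (auto simp: crd_zero crd_add)

lemma crd_expand_M: "basis B \<Longrightarrow> v \<in> M \<Longrightarrow> (\<Sum>b\<in>B. crd B b v *\<^sub>C b) = v"
  by (simp add: crd_expand M_fix)

definition bas :: "'v set" where "bas = (SOME B. basis B)"

lemma basis_bas: "basis bas"
proof -
  have "M \<subseteq> cs.span M" by (rule cs.span_superset)
  then obtain B where "basis B" using basis_from_spanning[of M] by blast
  then show ?thesis unfolding bas_def by (rule someI)
qed

definition tr :: "'v endo \<Rightarrow> complex" where
  "tr T = (\<Sum>b\<in>bas. crd bas b (T \<cdot> b))"

lemma tr_add: "tr (S + T) = tr S + tr T"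
  by (simp add: tr_def crd_add[OF basis_bas] sum.distrib)

lemma tr_scale: "tr (c *\<^sub>C T) = c * tr T"
  by (simp add: tr_def crd_scale[OF basis_bas] sum_distrib_left)

lemma tr_zero [simp]: "tr 0 = 0"
  by (simp add: tr_def crd_zero[OF basis_bas])

lemma tr_diff: "tr (S - T) = tr S - tr T"
  using tr_add[of "S - T" T] by simp

lemma tr_sum: "tr (sum f A) = (\<Sum>i\<in>A. tr (f i))"
  by (induction A rule: infinite_finite_induct) (auto simp: tr_add)

lemma tr_commute:
  assumes "S \<in> ops" "T \<in> ops" shows "tr (S * T) = tr (T * S)"
proof -
  have *: "tr (S * T) = (\<Sum>b\<in>bas. \<Sum>c\<in>bas. crd bas c (T \<cdot> b) * crd bas b (S \<cdot> c))"
    if "T \<in> ops" for S T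
  proof -
    have "S \<cdot> T \<cdot> b = (\<Sum>c\<in>bas. crd bas c (T \<cdot> b) *\<^sub>C S \<cdot> c)" for b
      using crd_expand_M[OF basis_bas ops_in_M[OF that], of b]
      by (metis (no_types, lifting) ap_cscale_right ap_sum_right sum.cong)
    then show ?thesis
      by (simp add: tr_def crd_sum[OF basis_bas] crd_scale[OF basis_bas])
  qed
  show ?thesis
    unfolding *[OF assms(1)] *[OF assms(2)] by (subst sum.swap) (simp add: mult.commute)
qed

lemma ops_eqI:
  assumes "S \<in> ops" "T \<in> ops" "basis B" "\<And>b. b \<in> B \<Longrightarrow> S \<cdot> b = T \<cdot> b"
  shows "S = T"
proof (rule endo_eqI)
  fix v
  have "S \<cdot> E \<cdot> v = T \<cdot> E \<cdot> v"
    unfolding crd_expand[OF assms(3), symmetric] by (simp add: ap_sum_right assms(4))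
  then show "S \<cdot> v = T \<cdot> v" using assms by (simp add: ops_E)
qed

text \<open>Any linear right inverse of \<open>T\<close> on its image, cut down by \<open>E\<close> on both sides, will do.\<close>

lemma generalized_inverse:
  assumes "T \<in> ops" obtains A where "A \<in> ops" "T * A * T = T"
proof -
  interpret p: vector_space_pair "cscale :: complex \<Rightarrow> 'v \<Rightarrow> 'v" "cscale :: complex \<Rightarrow> 'v \<Rightarrow> 'v" ..
  have "Vector_Spaces.linear cscale cscale (ap T)"
    by (simp add: Vector_Spaces.linear_iff cs.vector_space_axioms)
  then obtain g where g: "Vector_Spaces.linear cscale cscale g" "\<forall>v\<in>ap T ` UNIV. T \<cdot> g v = v"
    using p.linear_exists_right_inverse_on[of "ap T" UNIV] by auto
  then have "lin g" by (simp add: Vector_Spaces.linear_iff lin_def)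
  define A where "A = E * Endo g * E"
  have "A \<in> ops" unfolding A_def ops_def using idem by (simp add: mult.assoc) (simp flip: mult.assoc)
  moreover have "T * A * T = T"
  proof (rule endo_eqI)
    fix v
    have "(T * A * T) \<cdot> v = T \<cdot> g (T \<cdot> v)"
      using assms ap_Endo[OF \<open>lin g\<close>] by (simp add: A_def ops_E M_fix ops_in_M)
    then show "(T * A * T) \<cdot> v = T \<cdot> v" using g(2) by simp
  qed
  ultimately show thesis by (rule that)
qed

text \<open>With a generalized inverse \<open>A\<close> of \<open>T\<close>, the operator \<open>A T T\<close> has the trace of
  \<open>T A T = T\<close> but a smaller index of nilpotency, since \<open>(A T T)\<^sup>k = A T\<^sup>k\<^sup>+\<^sup>1\<close>.\<close>

lemma tr_nilpotent:
  assumes "T \<in> ops" "T ^ p = 0" shows "tr T = 0"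
  using assms
proof (induction p arbitrary: T)
  case 0
  have "T = T * T ^ 0" by simp
  also have "\<dots> = 0" unfolding 0 by simp
  finally show ?case by simp
next
  case (Suc p)
  obtain A where A: "A \<in> ops" "T * A * T = T" by (rule generalized_inverse[OF Suc.prems(1)])
  show ?case
  proof (cases "p = 0")
    case True
    then show ?thesis using Suc.prems(2) by simp
  next
    case False
    have pow: "(A * T * T) ^ Suc k = A * T ^ Suc (Suc k)" for k
    proof (induction k)
      case (Suc k)
      have "(A * T * T) ^ Suc (Suc k) = A * T * (T * A * T) * T ^ Suc k"
        unfolding power_Suc[of _ "Suc k"] Suc by (simp add: mult.assoc)
      then show ?case unfolding A(2) by (simp add: mult.assoc)
    qed (simp add: mult.assoc)
    obtain q where q: "p = Suc q" using False not0_implies_Suc by blast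
    have "(A * T * T) ^ p = 0" using pow[of q] Suc.prems(2) q by simp
    then have "tr (A * T * T) = 0"
      using Suc.IH A(1) Suc.prems(1) by (intro Suc.IH ops_mult) auto
    moreover have "tr (A * T * T) = tr (T * (A * T))"
      using A(1) Suc.prems(1) by (intro tr_commute ops_mult) auto
    ultimately show ?thesis using A(2) by (simp add: mult.assoc)
  qed
qed

definition diag :: "'v set \<Rightarrow> ('v \<Rightarrow> complex) \<Rightarrow> 'v endo" where
  "diag B u = Endo (\<lambda>v. \<Sum>b\<in>B. (u b * crd B b v) *\<^sub>C b)"

lemma ap_diag: "basis B \<Longrightarrow> diag B u \<cdot> v = (\<Sum>b\<in>B. (u b * crd B b v) *\<^sub>C b)"
  unfolding diag_def
  by (subst ap_Endo)
    (auto simp: lin_def crd_add crd_scale algebra_simps cscale_add_left sum.distrib cs.scale_sum_right)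

lemma diag_basis: "basis B \<Longrightarrow> b \<in> B \<Longrightarrow> diag B u \<cdot> b = u b *\<^sub>C b"
proof -
  assume B: "basis B" "b \<in> B"
  then have "diag B u \<cdot> b = (\<Sum>c\<in>B. if c = b then u b *\<^sub>C b else 0)"
    unfolding ap_diag[OF B(1)] by (intro sum.cong) (auto simp: crd_basis)
  also have "\<dots> = u b *\<^sub>C b" using B by (simp add: basis_def)
  finally show ?thesis .
qed

lemma diag_ops: "basis B \<Longrightarrow> diag B u \<in> ops"
proof (rule ops_intro)
  assume B: "basis B"
  show "diag B u \<cdot> v \<in> M" for v
    unfolding ap_diag[OF B] using basis_in_M[OF B]
    by (intro cs.subspace_sum[OF subspace_M] cs.subspace_scale[OF subspace_M])
  show "diag B u \<cdot> E \<cdot> v = diag B u \<cdot> v" for v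
    by (simp add: ap_diag[OF B] crd_E)
qed

lemma tr_diag:
  assumes B: "basis B" shows "tr (diag B u) = (\<Sum>b\<in>B. u b)"
proof -
  have "tr (diag B u) = (\<Sum>c\<in>bas. \<Sum>b\<in>B. u b * (crd B b c * crd bas c b))"
    unfolding tr_def ap_diag[OF B] crd_sum[OF basis_bas] crd_scale[OF basis_bas]
    by (simp add: mult.assoc)
  also have "\<dots> = (\<Sum>b\<in>B. u b * (\<Sum>c\<in>bas. crd bas c b * crd B b c))"
    by (subst sum.swap) (simp add: sum_distrib_left mult_ac)
  also have "\<dots> = (\<Sum>b\<in>B. u b)"
  proof (intro sum.cong refl)
    fix b assume b: "b \<in> B"
    have "(\<Sum>c\<in>bas. crd bas c b * crd B b c) = crd B b (\<Sum>c\<in>bas. crd bas c b *\<^sub>C c)"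
      by (simp add: crd_sum[OF B] crd_scale[OF B])
    also have "\<dots> = 1"
      using b B by (simp add: crd_expand[OF basis_bas] crd_E crd_basis)
    finally show "u b * (\<Sum>c\<in>bas. crd bas c b * crd B b c) = u b" by simp
  qed
  finally show ?thesis .
qed

lemma diag_mult: "basis B \<Longrightarrow> diag B u * diag B w = diag B (\<lambda>b. u b * w b)"
  by (rule ops_eqI[of _ _ B]) (auto intro: ops_mult diag_ops simp: diag_basis mult.commute)

section \<open>Bases of generalized eigenvectors\<close>

definition gbasis :: "'v endo \<Rightarrow> 'v set \<Rightarrow> ('v \<Rightarrow> complex) \<Rightarrow> bool" where
  "gbasis x B l \<longleftrightarrow> basis B \<and> (\<forall>b\<in>B. genvec x (l b) b)"

text \<open>Semisimple over the complex numbers means diagonalizable.\<close>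

definition semisimple :: "'v endo \<Rightarrow> bool" where
  "semisimple a \<longleftrightarrow> M \<subseteq> cs.span {v \<in> M. \<exists>l. a \<cdot> v = l *\<^sub>C v}"

text \<open>The operator \<open>z\<close> preserves each eigenspace of \<open>a\<close>, and each of these is spanned by generalized
  eigenvectors of \<open>z\<close>.\<close>

lemma joint_gbasis:
  assumes a: "a \<in> ops" "semisimple a" and z: "z \<in> ops" "a * z = z * a"
  obtains B be ga where "gbasis z B ga" "\<And>b. b \<in> B \<Longrightarrow> a \<cdot> b = be b *\<^sub>C b"
proof -
  define G where "G = {v \<in> M. (\<exists>l. a \<cdot> v = l *\<^sub>C v) \<and> (\<exists>m. genvec z m v)}"
  obtain F where F: "finite F" "M \<subseteq> cs.span F" by (rule M_finite_span)
  have "v \<in> cs.span G" if v: "v \<in> M" "a \<cdot> v = l *\<^sub>C v" for v l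
  proof -
    define U where "U = {v \<in> M. a \<cdot> v = l *\<^sub>C v}"
    have "cs.subspace U" unfolding U_def cs.subspace_def
      using subspace_M by (auto simp: cs.subspace_def cscale_add_right mult.commute)
    moreover have "z \<cdot> u \<in> U" if "u \<in> U" for u
    proof -
      have "a \<cdot> z \<cdot> u = z \<cdot> a \<cdot> u" using z(2) by (metis ap_mult)
      then show ?thesis using that ops_in_M[OF z(1)] by (simp add: U_def)
    qed
    moreover have "U \<subseteq> cs.span F" using F by (auto simp: U_def)
    moreover have "v \<in> U" using v by (simp add: U_def)
    ultimately have "v \<in> cs.span {u \<in> U. \<exists>m. genvec z m u}" using in_span_genvec F(1) by blast
    moreover have "{u \<in> U. \<exists>m. genvec z m u} \<subseteq> G" by (auto simp: U_def G_def)
    ultimately show ?thesis using cs.span_mono by blast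
  qed
  then have "{v \<in> M. \<exists>l. a \<cdot> v = l *\<^sub>C v} \<subseteq> cs.span G" by blast
  then have "cs.span {v \<in> M. \<exists>l. a \<cdot> v = l *\<^sub>C v} \<subseteq> cs.span G"
    by (intro cs.span_minimal cs.subspace_span)
  then have "M \<subseteq> cs.span G" using a(2) unfolding semisimple_def by (rule subset_trans[rotated])
  moreover have "G \<subseteq> M" by (auto simp: G_def)
  ultimately obtain B where B: "B \<subseteq> G" "basis B" using basis_from_spanning by blast
  have "\<forall>b\<in>B. \<exists>l. a \<cdot> b = l *\<^sub>C b" "\<forall>b\<in>B. \<exists>l. genvec z l b" using B(1) by (auto simp: G_def)
  then obtain be ga where "\<forall>b\<in>B. a \<cdot> b = be b *\<^sub>C b" "\<forall>b\<in>B. genvec z (ga b) b"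
    using bchoice[of B "\<lambda>b l. a \<cdot> b = l *\<^sub>C b"] bchoice[of B "\<lambda>b l. genvec z l b"] by blast
  then show thesis using B(2) by (intro that) (auto simp: gbasis_def)
qed

text \<open>The identity of \<open>M\<close> commutes with everything, so statements about commuting pairs specialize to a
  single operator.\<close>

lemma semisimple_E: "semisimple E"
proof -
  have "M \<subseteq> {v \<in> M. \<exists>l. E \<cdot> v = l *\<^sub>C v}" using M_fix by (auto intro: exI[of _ 1])
  then show ?thesis unfolding semisimple_def using cs.span_superset by blast
qed

lemma ex_gbasis:
  assumes "z \<in> ops" obtains B ga where "gbasis z B ga"
proof -
  have "E * z = z * E" using assms by (simp add: ops_def)
  then show thesis using joint_gbasis[OF E_ops semisimple_E assms] that by blast
qed

text \<open>The operator that acts by \<open>ps (l b)\<close> on the basis vector \<open>b\<close> depends only on \<open>x\<close> and \<open>ps\<close>: on the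
  whole generalized eigenspace for \<open>m\<close> it is multiplication by \<open>ps m\<close>.\<close>

lemma gbasis_eigen:
  assumes "gbasis x B l" "v \<in> M" "genvec x m v"
  shows "diag B (\<lambda>b. ps (l b)) \<cdot> v = ps m *\<^sub>C v"
proof -
  have B: "basis B" and gb: "\<And>b. b \<in> B \<Longrightarrow> genvec x (l b) b"
    using assms(1) by (auto simp: gbasis_def)
  have fB: "finite B" using B by (simp add: basis_def)
  define K where "K = insert m (l ` B)"
  define w where "w k = (\<Sum>b\<in>{b\<in>B. l b = k}. crd B b v *\<^sub>C b)" for k
  define u where "u k = w k - (if k = m then v else 0)" for k
  have "genvec x k (w k)" for k unfolding w_def
    using gb by (intro genvec_sum genvec_scale) auto
  moreover have "genvec x m (- v)" using genvec_scale[OF assms(3), of "-1"] by simp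
  ultimately have 1: "genvec x k (u k)" for k unfolding u_def
    using genvec_add[of x m "w m" "- v"] by (cases "k = m") auto
  have "(\<Sum>k\<in>K. w k) = (\<Sum>b\<in>B. crd B b v *\<^sub>C b)"
    unfolding w_def K_def using fB by (intro sum.group) auto
  also have "\<dots> = v" using crd_expand_M[OF B assms(2)] .
  finally have "(\<Sum>k\<in>K. u k) = 0"
    unfolding u_def using fB by (simp add: sum_subtractf K_def)
  then have 0: "\<forall>k\<in>K. u k = 0"
    using 1 fB by (intro genvec_sum_zero[of K x]) (auto simp: K_def)
  have "diag B (\<lambda>b. ps (l b)) \<cdot> v = (\<Sum>k\<in>K. \<Sum>b\<in>{b\<in>B. l b = k}. (ps (l b) * crd B b v) *\<^sub>C b)"
    unfolding ap_diag[OF B] K_def using fB by (intro sum.group[symmetric]) auto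
  also have "\<dots> = (\<Sum>k\<in>K. ps k *\<^sub>C w k)"
    unfolding w_def cs.scale_sum_right by (intro sum.cong) auto
  also have "\<dots> = (\<Sum>k\<in>K. if k = m then ps m *\<^sub>C v else 0)"
    using 0 by (intro sum.cong) (auto simp: u_def)
  also have "\<dots> = ps m *\<^sub>C v" using fB by (simp add: K_def)
  finally show ?thesis .
qed

text \<open>An operator commuting with \<open>x\<close> preserves the generalized eigenspaces, on which the diagonal
  operator is a scalar.\<close>

lemma gbasis_commute:
  assumes "gbasis x B l" "x \<in> ops" "S \<in> ops" "S * x = x * S"
  shows "S * diag B (\<lambda>b. ps (l b)) = diag B (\<lambda>b. ps (l b)) * S"
proof (rule ops_eqI)
  have B: "basis B" using assms(1) by (simp add: gbasis_def)
  show "basis B" by (fact B)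
  show "S * diag B (\<lambda>b. ps (l b)) \<in> ops" "diag B (\<lambda>b. ps (l b)) * S \<in> ops"
    by (intro ops_mult assms diag_ops B)+
  fix b assume b: "b \<in> B"
  then have "genvec x (l b) (S \<cdot> b)" using assms(1,4) by (intro genvec_commuting) (auto simp: gbasis_def)
  then show "(S * diag B (\<lambda>b. ps (l b))) \<cdot> b = (diag B (\<lambda>b. ps (l b)) * S) \<cdot> b"
    using gbasis_eigen[OF assms(1) ops_in_M[OF assms(3)]] b B by (simp add: diag_basis)
qed

lemma nilpotent_of_genvec:
  assumes "T \<in> ops" "basis B" "\<And>b. b \<in> B \<Longrightarrow> genvec T 0 b"
  shows "\<exists>p. T ^ p = 0"
proof -
  have "\<forall>b\<in>B. \<exists>k. T ^ k \<cdot> b = 0" using assms(3) by (simp add: genvec_def shift_def)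
  then obtain k where k: "\<forall>b\<in>B. T ^ k b \<cdot> b = 0" by (rule bchoice[THEN exE])
  define p where "p = Suc (\<Sum>b\<in>B. k b)"
  have "T ^ p \<cdot> b = 0" if "b \<in> B" for b
  proof (rule power_mono_zero)
    show "T ^ k b \<cdot> b = 0" using k that by blast
    have "k b \<le> (\<Sum>b\<in>B. k b)" using assms(2) that by (intro member_le_sum) (auto simp: basis_def)
    then show "k b \<le> p" by (simp add: p_def)
  qed
  moreover have "0 \<in> ops" using subspace_ops cs.subspace_0 by blast
  ultimately have "T ^ p = 0"
    using assms by (intro ops_eqI[of _ _ B]) (auto simp: p_def simp del: power_Suc intro: ops_power)
  then show ?thesis by blast
qed

text \<open>This is the additive Jordan decomposition: \<^term>\<open>diag B l\<close> is the semisimple part of \<open>x\<close>.\<close>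

lemma gbasis_nilpotent_part:
  assumes "gbasis x B l" "x \<in> ops"
  shows "\<exists>p. (x - diag B l) ^ p = 0"
proof (rule nilpotent_of_genvec)
  have B: "basis B" using assms(1) by (simp add: gbasis_def)
  then show "basis B" .
  show "x - diag B l \<in> ops" using assms B by (intro ops_diff diag_ops)
  fix b assume b: "b \<in> B"
  have gb: "genvec x (l b) b" using assms(1) b by (auto simp: gbasis_def)
  have "(x - diag B l) ^ k \<cdot> b = shift x (l b) ^ k \<cdot> b \<and> shift x (l b) ^ k \<cdot> b \<in> M" for k
  proof (induction k)
    case 0
    then show ?case using basis_in_M[OF B b] by simp
  next
    case (Suc k)
    have "shift x (l b) ^ k * x = x * shift x (l b) ^ k"
      by (intro power_commuting shift_commute) simp
    then have "genvec x (l b) (shift x (l b) ^ k \<cdot> b)" using gb by (intro genvec_commuting) auto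
    then have "diag B l \<cdot> shift x (l b) ^ k \<cdot> b = l b *\<^sub>C shift x (l b) ^ k \<cdot> b"
      using gbasis_eigen[OF assms(1), of _ "l b" "\<lambda>c. c"] Suc by blast
    then show ?case using Suc ops_in_M[OF assms(2)] subspace_M
      by (auto intro: cs.subspace_diff cs.subspace_scale)
  qed
  then show "genvec (x - diag B l) 0 b" using gb by (simp add: genvec_def shift_def)
qed

lemma nilpotent_mult_commute:
  fixes S T :: "'v endo"
  assumes "S ^ p = 0" "S * T = T * S" shows "(S * T) ^ p = 0"
proof -
  have "(S * T) ^ k = S ^ k * T ^ k" for k
  proof (induction k)
    case (Suc k)
    have "S ^ k * T = T * S ^ k" by (rule power_commuting[OF assms(2)])
    then have "S * (T * S ^ k) = S * S ^ k * T" by (simp add: mult.assoc)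
    then show ?case using Suc by (simp add: mult.assoc) (metis mult.assoc)
  qed simp
  then show ?thesis using assms(1) by simp
qed

text \<open>A nilpotent operator times an operator commuting with it is nilpotent, so only the
  semisimple part of \<open>x\<close> contributes to the trace.\<close>

lemma tr_gbasis:
  assumes "gbasis x B l" "x \<in> ops" "x * diag B u = diag B u * x"
  shows "tr (x * diag B u) = (\<Sum>b\<in>B. l b * u b)"
proof -
  have B: "basis B" using assms(1) by (simp add: gbasis_def)
  define N where "N = x - diag B l"
  obtain p where p: "N ^ p = 0" using gbasis_nilpotent_part[OF assms(1,2)] by (auto simp: N_def)
  have N: "N \<in> ops" unfolding N_def using assms B by (intro ops_diff diag_ops)
  have "N * diag B u = diag B u * N"
    using assms(3) B by (simp add: N_def algebra_simps diag_mult mult.commute)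
  then have "(N * diag B u) ^ p = 0" by (rule nilpotent_mult_commute[OF p])
  then have "tr (N * diag B u) = 0" using N B by (intro tr_nilpotent ops_mult diag_ops)
  moreover have "x * diag B u = N * diag B u + diag B (\<lambda>b. l b * u b)"
    using B by (simp add: N_def algebra_simps diag_mult)
  ultimately show ?thesis using B by (simp add: tr_add tr_diag)
qed

lemma gbasis_self_commute:
  assumes "gbasis x B l" "x \<in> ops"
  shows "x * diag B (\<lambda>b. ps (l b)) = diag B (\<lambda>b. ps (l b)) * x"
  using gbasis_commute[OF assms assms(2)] by simp

lemma basis_nonzero: "basis B \<Longrightarrow> b \<in> B \<Longrightarrow> b \<noteq> 0"
  unfolding basis_def using cs.dependent_zero by blast

end

section \<open>Engel's theorem\<close>

definition br :: "'v::cspace endo \<Rightarrow> 'v endo \<Rightarrow> 'v endo" where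
  "br x y = x * y - y * x"

lemma ap_br: "br x y \<cdot> v = x \<cdot> y \<cdot> v - y \<cdot> x \<cdot> v"
  by (simp add: br_def)

lemma independent_extend_chain:
  assumes "cs.subspace V" "S \<subseteq> V" "cs.independent S" "x \<notin> V"
  shows "cs.independent (insert x S)" "x \<notin> S"
proof -
  have "cs.span S \<subseteq> V" using assms by (intro cs.span_minimal)
  then have "x \<notin> cs.span S" using assms(4) by blast
  then show "cs.independent (insert x S)" using assms(3) by (rule cs.independent_insertI)
  show "x \<notin> S" using assms(2,4) by blast
qed

definition lie_sub :: "'v::cspace endo set \<Rightarrow> bool" where
  "lie_sub k \<longleftrightarrow> cs.subspace k \<and> (\<forall>x\<in>k. \<forall>y\<in>k. br x y \<in> k)"

definition stable :: "'v::cspace endo set \<Rightarrow> 'v set \<Rightarrow> bool" where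
  "stable k A \<longleftrightarrow> cs.subspace A \<and> (\<forall>x\<in>k. \<forall>v\<in>A. x \<cdot> v \<in> A)"

lemma stable_mono: "stable k A \<Longrightarrow> m \<subseteq> k \<Longrightarrow> stable m A"
  by (auto simp: stable_def)

context fin_proj
begin

text \<open>The conclusion of Engel's theorem for all invariant subquotients at once: \<open>k\<close> annihilates a nonzero
  vector of \<open>A / B\<close>.\<close>

definition engel :: "'v endo set \<Rightarrow> bool" where
  "engel k \<longleftrightarrow> (\<forall>A B. stable k A \<longrightarrow> stable k B \<longrightarrow> B \<subset> A \<longrightarrow> A \<subseteq> M \<longrightarrow>
     (\<exists>v\<in>A - B. \<forall>x\<in>k. x \<cdot> v \<in> B))"

text \<open>The \<open>i\<close>-th term consists of the vectors killed by every product of \<open>i\<close> elements of \<open>k\<close>.\<close>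

primrec flag :: "'v endo set \<Rightarrow> nat \<Rightarrow> 'v set" where
  "flag k 0 = {0}"
| "flag k (Suc i) = {v \<in> M. \<forall>x\<in>k. x \<cdot> v \<in> flag k i}"

lemma flag_props:
  "cs.subspace (flag k i) \<and> flag k i \<subseteq> M \<and> flag k i \<subseteq> flag k (Suc i)"
proof (induction i)
  case 0
  then show ?case using cs.subspace_0[OF subspace_M] by (auto simp: cs.subspace_def)
next
  case (Suc i)
  have "cs.subspace (flag k (Suc i))"
    using Suc subspace_M unfolding cs.subspace_def by auto
  then show ?case using Suc by auto
qed

lemma flag_mono: "i \<le> j \<Longrightarrow> flag k i \<subseteq> flag k j"
  using flag_props lift_Suc_mono_le[of "flag k"] by blast

lemma flag_lower: "x \<in> k \<Longrightarrow> v \<in> flag k i \<Longrightarrow> x \<cdot> v \<in> flag k (i - 1)"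
  by (cases i) auto

text \<open>As long as the flag has not reached \<open>M\<close>, the defining property of \<^const>\<open>engel\<close> makes it
  grow, which can happen only as often as the dimension permits.\<close>

lemma flag_exhausts:
  assumes "engel k" "k \<subseteq> ops"
  obtains p where "flag k p = M"
proof (rule ccontr)
  assume "\<not> thesis"
  then have ne: "flag k i \<noteq> M" for i using that by blast
  have st: "stable k (flag k i)" for i
    unfolding stable_def
  proof (intro conjI ballI)
    show "cs.subspace (flag k i)" using flag_props by blast
    fix x v assume "x \<in> k" "v \<in> flag k i"
    then have "x \<cdot> v \<in> flag k (i - 1)" by (rule flag_lower)
    then show "x \<cdot> v \<in> flag k i" using flag_mono[of "i - 1" i k] by auto
  qed
  have stM: "stable k M" using subspace_M assms(2) ops_in_M by (auto simp: stable_def)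
  have strict: "\<exists>v. v \<in> flag k (Suc i) \<and> v \<notin> flag k i" for i
  proof -
    have "flag k i \<subset> M" using ne flag_props by blast
    then obtain v where "v \<in> M - flag k i" "\<forall>x\<in>k. x \<cdot> v \<in> flag k i"
      using assms(1) stM st[of i] unfolding engel_def by blast
    then show ?thesis by auto
  qed
  have "\<exists>S. S \<subseteq> flag k i \<and> cs.independent S \<and> card S = i \<and> finite S" for i
  proof (induction i)
    case 0
    show ?case by (intro exI[of _ "{}"]) (auto simp: cs.independent_empty)
  next
    case (Suc i)
    then obtain S where S: "S \<subseteq> flag k i" "cs.independent S" "card S = i" "finite S" by blast
    obtain v where v: "v \<in> flag k (Suc i)" "v \<notin> flag k i" using strict by blast
    have sub: "cs.subspace (flag k i)" using flag_props by blast
    have "S \<subseteq> flag k (Suc i)" using S(1) flag_props[of k i] by blast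
    then show ?case using v S independent_extend_chain[OF sub S(1,2) v(2)]
      by (intro exI[of _ "insert v S"]) auto
  qed note ind = this
  obtain F where F: "finite F" "M \<subseteq> cs.span F" by (rule M_finite_span)
  obtain S where S: "S \<subseteq> flag k (Suc (card F))" "cs.independent S" "card S = Suc (card F)"
    using ind by blast
  have "S \<subseteq> cs.span F" using S(1) flag_props F(2) by blast
  then show False using cs.independent_span_bound[OF F(1) S(2)] S(3) by simp
qed

lemma ops_finite_span: obtains F where "finite F" "ops \<subseteq> cs.span F"
proof -
  have B: "basis bas" by (rule basis_bas)
  define e where "e = (\<lambda>(b, c). Endo (\<lambda>v. crd bas c v *\<^sub>C b))"
  have e: "e (b, c) \<cdot> v = crd bas c v *\<^sub>C b" for b c v
    unfolding e_def prod.case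
    by (subst ap_Endo) (auto simp: lin_def crd_add[OF B] crd_scale[OF B] cscale_add_left)
  have "T \<in> cs.span (e ` (bas \<times> bas))" if T: "T \<in> ops" for T
  proof -
    have "T = (\<Sum>c\<in>bas. \<Sum>b\<in>bas. crd bas b (T \<cdot> c) *\<^sub>C e (b, c))"
    proof (rule endo_eqI)
      fix v
      have "(\<Sum>c\<in>bas. \<Sum>b\<in>bas. crd bas b (T \<cdot> c) *\<^sub>C e (b, c)) \<cdot> v
          = (\<Sum>c\<in>bas. crd bas c v *\<^sub>C (\<Sum>b\<in>bas. crd bas b (T \<cdot> c) *\<^sub>C b))"
        by (simp add: ap_sum e cs.scale_sum_right mult.commute)
      also have "\<dots> = T \<cdot> (\<Sum>c\<in>bas. crd bas c v *\<^sub>C c)"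
        by (simp add: crd_expand_M[OF B ops_in_M[OF T]] ap_sum_right)
      finally show "T \<cdot> v = (\<Sum>c\<in>bas. \<Sum>b\<in>bas. crd bas b (T \<cdot> c) *\<^sub>C e (b, c)) \<cdot> v"
        by (simp add: crd_expand[OF B] ops_E[OF T])
    qed
    also have "\<dots> \<in> cs.span (e ` (bas \<times> bas))"
      by (intro cs.span_sum cs.span_scale cs.span_base) auto
    finally show ?thesis .
  qed
  then show thesis using B by (intro that[of "e ` (bas \<times> bas)"]) (auto simp: basis_def)
qed

text \<open>The operators are filtered by how far they move the flag of \<open>m\<close> up; bracketing with an
  element of \<open>m\<close> lowers this degree. An element of \<open>k - m\<close> of least degree therefore normalizes \<open>m\<close>.\<close>

lemma engel_normalizer:
  assumes m: "engel m" "m \<subseteq> k" "m \<noteq> k" "0 \<in> m" and k: "lie_sub k" "k \<subseteq> ops"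
  obtains x where "x \<in> k" "x \<notin> m" "\<And>y. y \<in> m \<Longrightarrow> br y x \<in> m"
proof -
  obtain p where p: "flag m p = M" using flag_exhausts m(1,2) k(2) by blast
  define O' where "O' s = {T \<in> ops. \<forall>i. \<forall>v\<in>flag m i. T \<cdot> v \<in> flag m (i + s - p)}" for s
  have "T \<in> O' (2 * p)" if "T \<in> ops" for T
  proof -
    have "T \<cdot> v \<in> flag m (i + 2 * p - p)" for i v
      using ops_in_M[OF that] p flag_mono[of p "i + 2 * p - p" m] by auto
    then show ?thesis using that by (simp add: O'_def)
  qed
  then have ex: "\<exists>s. \<not> k \<inter> O' s \<subseteq> m" using m(2,3) k(2) by blast
  define s where "s = (LEAST s. \<not> k \<inter> O' s \<subseteq> m)"
  have s: "\<not> k \<inter> O' s \<subseteq> m" unfolding s_def using ex by (rule LeastI_ex)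
  have "T = 0" if "T \<in> O' 0" for T
  proof (rule endo_eqI)
    fix v
    have "E \<cdot> v \<in> flag m p" using p by simp
    then have "T \<cdot> E \<cdot> v \<in> flag m (p + 0 - p)" using that unfolding O'_def by blast
    then show "T \<cdot> v = 0 \<cdot> v" using that by (simp add: O'_def ops_E)
  qed
  then have "s \<noteq> 0" using s m(4) by (metis IntE subsetI)
  then obtain s' where s': "s = Suc s'" using not0_implies_Suc by blast
  have less: "k \<inter> O' s' \<subseteq> m" using not_less_Least[of s' "\<lambda>s. \<not> k \<inter> O' s \<subseteq> m"] s' unfolding s_def by auto
  obtain x where x: "x \<in> k" "x \<in> O' s" "x \<notin> m" using s by blast
  have "br y x \<in> m" if y: "y \<in> m" for y
  proof -
    have "br y x \<in> ops" using y m(2) x(1) k by (auto simp: lie_sub_def)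
    moreover have "br y x \<cdot> v \<in> flag m (i + s' - p)" if v: "v \<in> flag m i" for i v
    proof -
      have "x \<cdot> v \<in> flag m (i + s - p)" using x(2) v by (simp add: O'_def)
      then have "y \<cdot> x \<cdot> v \<in> flag m (i + s - p - 1)" using y flag_lower by blast
      moreover have "i + s - p - 1 = i + s' - p" by (simp add: s')
      moreover have "x \<cdot> y \<cdot> v \<in> flag m (i + s' - p)"
      proof (cases i)
        case 0
        then have "v = 0" using v by simp
        then show ?thesis using cs.subspace_0 flag_props by fastforce
      next
        case (Suc j)
        then have "y \<cdot> v \<in> flag m j" using v y by simp
        then have "x \<cdot> y \<cdot> v \<in> flag m (j + s - p)" using x(2) by (simp add: O'_def)
        then show ?thesis using Suc s' by simp
      qed
      ultimately show ?thesis unfolding ap_br using flag_props cs.subspace_diff by metis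
    qed
    ultimately have "br y x \<in> O' s'" by (simp add: O'_def)
    moreover have "br y x \<in> k" using y m(2) x(1) k(1) by (auto simp: lie_sub_def)
    ultimately show ?thesis using less by blast
  qed
  then show thesis using that x by blast
qed

text \<open>The vectors of \<open>A\<close> killed by \<open>m\<close> modulo \<open>B\<close> are preserved by \<open>x\<close>, because \<open>x\<close> normalizes \<open>m\<close>. The last
  of the vectors \<open>v, x v, x\<^sup>2 v, \<dots>\<close> outside \<open>B\<close> is killed by \<open>m\<close> and \<open>x\<close>.\<close>

lemma engel_step:
  assumes m: "engel m" "lie_sub m" and x: "\<exists>p. x ^ p = 0" "\<And>y. y \<in> m \<Longrightarrow> br y x \<in> m"
  defines "m' \<equiv> {y + c *\<^sub>C x |y c. y \<in> m}"
  shows "engel m'" "lie_sub m'" "m \<subseteq> m'" "x \<in> m'"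
proof -
  have m0: "0 \<in> m" using m(2) cs.subspace_0 by (auto simp: lie_sub_def)
  show sub: "m \<subseteq> m'"
  proof
    fix y assume "y \<in> m"
    then show "y \<in> m'" unfolding m'_def by (intro CollectI exI[of _ y] exI[of _ 0]) auto
  qed
  show xm: "x \<in> m'" unfolding m'_def using m0 by (intro CollectI exI[of _ 0] exI[of _ 1]) auto
  have "cs.subspace m'"
  proof (rule cs.subspaceI)
    show "0 \<in> m'" using m0 sub by blast
    fix u v c assume "u \<in> m'" "v \<in> m'"
    then obtain y y' d d' where u: "u = y + d *\<^sub>C x" and v: "v = y' + d' *\<^sub>C x"
      and y: "y \<in> m" "y' \<in> m" unfolding m'_def by blast
    have "y + y' \<in> m" "c *\<^sub>C y \<in> m"
      using m(2) y cs.subspace_add cs.subspace_scale by (auto simp: lie_sub_def)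
    moreover have "u + v = (y + y') + (d + d') *\<^sub>C x" "c *\<^sub>C u = c *\<^sub>C y + (c * d) *\<^sub>C x"
      by (simp_all add: u v cscale_add_left cscale_add_right)
    ultimately show "u + v \<in> m'" "c *\<^sub>C u \<in> m'" unfolding m'_def by blast+
  qed
  moreover have "br u v \<in> m'" if uv: "u \<in> m'" "v \<in> m'" for u v
  proof -
    obtain y y' d d' where u: "u = y + d *\<^sub>C x" and v: "v = y' + d' *\<^sub>C x" and "y \<in> m" "y' \<in> m"
      using uv unfolding m'_def by blast
    then have "br y y' \<in> m" "br y x \<in> m" "br y' x \<in> m" using m(2) x(2) by (auto simp: lie_sub_def)
    moreover have "br u v = br y y' + d' *\<^sub>C br y x - d *\<^sub>C br y' x"
      unfolding u v br_def
      by (simp add: algebra_simps cscale_add_right cs.scale_right_diff_distrib mult.commute)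
    ultimately have "br u v \<in> m" using m(2)
      by (simp add: lie_sub_def cs.subspace_add cs.subspace_diff cs.subspace_scale)
    then show ?thesis using sub by blast
  qed
  ultimately show "lie_sub m'" by (simp add: lie_sub_def)
  show "engel m'"
    unfolding engel_def
  proof (intro allI impI)
    fix A B assume A: "stable m' A" and B: "stable m' B" and BA: "B \<subset> A" "A \<subseteq> M"
    obtain v where v: "v \<in> A" "v \<notin> B" "\<forall>y\<in>m. y \<cdot> v \<in> B"
      using m(1) stable_mono[OF A sub] stable_mono[OF B sub] BA unfolding engel_def by blast
    define C where "C = {v \<in> A. \<forall>y\<in>m. y \<cdot> v \<in> B}"
    have xC: "x \<cdot> w \<in> C" if w: "w \<in> C" for w
    proof -
      have "y \<cdot> x \<cdot> w \<in> B" if y: "y \<in> m" for y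
      proof -
        have "y \<cdot> x \<cdot> w = x \<cdot> y \<cdot> w + br y x \<cdot> w" by (simp add: ap_br)
        moreover have "x \<cdot> y \<cdot> w \<in> B" using w y B xm by (auto simp: C_def stable_def)
        moreover have "br y x \<cdot> w \<in> B" using w x(2)[OF y] by (auto simp: C_def)
        ultimately show ?thesis using B by (simp add: stable_def cs.subspace_add)
      qed
      then show ?thesis using w A xm by (auto simp: C_def stable_def)
    qed
    obtain p where p: "x ^ p = 0" using x(1) by blast
    define j where "j = (LEAST j. x ^ j \<cdot> v \<in> B)"
    have "0 \<in> B" using B by (simp add: stable_def cs.subspace_0)
    then have "x ^ p \<cdot> v \<in> B" using p by simp
    then have j: "x ^ j \<cdot> v \<in> B" unfolding j_def by (rule LeastI)
    have "j \<noteq> 0" using j v(2) by (intro notI) simp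
    then obtain i where i: "j = Suc i" using not0_implies_Suc by blast
    define w where "w = x ^ i \<cdot> v"
    have wB: "w \<notin> B" using not_less_Least[of i "\<lambda>j. x ^ j \<cdot> v \<in> B"] i unfolding j_def w_def by auto
    have "v \<in> C" using v by (simp add: C_def)
    then have "w \<in> C" unfolding w_def by (rule power_in_invariant[of C x, rotated]) (rule xC)
    have xw: "x \<cdot> w \<in> B" using j i by (simp add: w_def)
    show "\<exists>v\<in>A - B. \<forall>u\<in>m'. u \<cdot> v \<in> B"
    proof (intro bexI[of _ w] ballI)
      show "w \<in> A - B" using wB \<open>w \<in> C\<close> by (simp add: C_def)
      fix u assume "u \<in> m'"
      then obtain y c where u: "u = y + c *\<^sub>C x" "y \<in> m" unfolding m'_def by blast
      then have "u \<cdot> w = y \<cdot> w + c *\<^sub>C x \<cdot> w" by simp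
      moreover have "y \<cdot> w \<in> B" using u(2) \<open>w \<in> C\<close> by (simp add: C_def)
      ultimately show "u \<cdot> w \<in> B" using xw B by (simp add: stable_def cs.subspace_add cs.subspace_scale)
    qed
  qed
qed

text \<open>Subalgebras with the Engel property can be enlarged one dimension at a time within \<open>k\<close>, by
  normalizing elements, until they are all of \<open>k\<close>.\<close>

theorem engel_nilpotent:
  assumes k: "lie_sub k" "k \<subseteq> ops" and nil: "\<And>x. x \<in> k \<Longrightarrow> \<exists>p. x ^ p = 0"
  shows "engel k"
proof (rule ccontr)
  assume neg: "\<not> engel k"
  have "\<exists>m S. m \<subseteq> k \<and> engel m \<and> lie_sub m \<and> S \<subseteq> m \<and> cs.independent S \<and> card S = n \<and> finite S" for n
  proof (induction n)
    case 0
    have "0 \<in> k" using k(1) cs.subspace_0 by (auto simp: lie_sub_def)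
    moreover have "lie_sub {0}" by (auto simp: lie_sub_def cs.subspace_def br_def)
    moreover have "engel {0}"
    proof -
      have "0 \<in> B" if "stable k B" for k B using that by (simp add: stable_def cs.subspace_0)
      then show ?thesis unfolding engel_def by fastforce
    qed
    ultimately show ?case
      by (intro exI[of _ "{0}"] exI[of _ "{}"]) (auto simp: cs.independent_empty)
  next
    case (Suc n)
    then obtain m S where m: "m \<subseteq> k" "engel m" "lie_sub m"
      and S: "S \<subseteq> m" "cs.independent S" "card S = n" "finite S" by blast
    have "m \<noteq> k" using m(2) neg by blast
    moreover have "0 \<in> m" using m(3) cs.subspace_0 by (auto simp: lie_sub_def)
    ultimately obtain x where x: "x \<in> k" "x \<notin> m" "\<And>y. y \<in> m \<Longrightarrow> br y x \<in> m"
      using engel_normalizer[OF m(2,1) _ _ k] by blast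
    define m' where "m' = {y + c *\<^sub>C x |y c. y \<in> m}"
    note st = engel_step[OF m(2,3) nil[OF x(1)] x(3), folded m'_def]
    have "m' \<subseteq> k" unfolding m'_def using m(1) x(1) k(1)
      by (auto simp: lie_sub_def intro!: cs.subspace_add cs.subspace_scale)
    moreover have "cs.subspace m" using m(3) by (simp add: lie_sub_def)
    note independent_extend_chain[OF this S(1,2) x(2)]
    ultimately show ?case using st S by (intro exI[of _ m'] exI[of _ "insert x S"]) auto
  qed note ind = this
  obtain F where F: "finite F" "ops \<subseteq> cs.span F" by (rule ops_finite_span)
  obtain m S where S: "m \<subseteq> k" "S \<subseteq> m" "cs.independent S" "card S = Suc (card F)"
    using ind[of "Suc (card F)"] by metis
  have "S \<subseteq> cs.span F" using S(1,2) F(2) k(2) by blast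
  then show False using cs.independent_span_bound[OF F(1) S(3)] S(4) by simp
qed

end

section \<open>Generic semisimple elements\<close>

context fin_proj
begin

definition spec :: "'v endo \<Rightarrow> complex set" where
  "spec a = {l. \<exists>v\<in>M. v \<noteq> 0 \<and> a \<cdot> v = l *\<^sub>C v}"

text \<open>For diagonalizable \<open>a\<close> these are the eigenvalues of the commutator with \<open>a\<close>.\<close>

definition diffs :: "'v endo \<Rightarrow> complex set" where
  "diffs a = {l - m |l m. l \<in> spec a \<and> m \<in> spec a}"

lemma spec_genvec_finite:
  assumes "x \<in> ops" shows "finite (spec x)"
proof -
  obtain B l where gb: "gbasis x B l" by (rule ex_gbasis[OF assms])
  then have B: "basis B" by (simp add: gbasis_def)
  have "spec x \<subseteq> l ` B"
  proof
    fix m assume "m \<in> spec x"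
    then obtain v where v: "v \<in> M" "v \<noteq> 0" "x \<cdot> v = m *\<^sub>C v" by (auto simp: spec_def)
    define ps where "ps k = (if k = m then 1 else 0 :: complex)" for k
    have "diag B (\<lambda>b. ps (l b)) \<cdot> v = v"
      using gbasis_eigen[OF gb v(1) genvec_eigen[OF v(3)], of ps] by (simp add: ps_def)
    moreover have "diag B (\<lambda>b. ps (l b)) \<cdot> v = 0" if "m \<notin> l ` B"
    proof -
      have "ps (l b) = 0" if "b \<in> B" for b using \<open>m \<notin> l ` B\<close> that by (auto simp: ps_def)
      then show ?thesis unfolding ap_diag[OF B] by simp
    qed
    ultimately show "m \<in> l ` B" using v(2) by auto
  qed
  then show ?thesis using B finite_subset by (auto simp: basis_def)
qed

lemma eigenbasis:
  assumes "a \<in> ops" "basis B" "\<forall>b\<in>B. a \<cdot> b = be b *\<^sub>C b"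
  shows "a = diag B be" "semisimple a" "spec a = be ` B"
proof -
  show a: "a = diag B be"
    using assms by (intro ops_eqI[of _ _ B]) (auto simp: diag_basis diag_ops)
  have "B \<subseteq> {v \<in> M. \<exists>l. a \<cdot> v = l *\<^sub>C v}" using assms basis_in_M by auto
  then have "cs.span B \<subseteq> cs.span {v \<in> M. \<exists>l. a \<cdot> v = l *\<^sub>C v}" by (rule cs.span_mono)
  then show "semisimple a" using assms(2) by (simp add: semisimple_def basis_def)
  show "spec a = be ` B"
  proof
    show "be ` B \<subseteq> spec a" using assms basis_in_M basis_nonzero by (fastforce simp: spec_def)
    show "spec a \<subseteq> be ` B"
    proof
      fix m assume "m \<in> spec a"
      then obtain v where v: "v \<in> M" "v \<noteq> 0" "a \<cdot> v = m *\<^sub>C v" by (auto simp: spec_def)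
      have "0 = a \<cdot> v - m *\<^sub>C v" using v by simp
      also have "\<dots> = (\<Sum>b\<in>B. (be b * crd B b v) *\<^sub>C b) - m *\<^sub>C (\<Sum>b\<in>B. crd B b v *\<^sub>C b)"
        unfolding crd_expand_M[OF assms(2) v(1)] by (simp add: a ap_diag[OF assms(2)])
      also have "\<dots> = (\<Sum>b\<in>B. ((be b - m) * crd B b v) *\<^sub>C b)"
        by (simp add: cs.scale_sum_right sum_subtractf left_diff_distrib cs.scale_left_diff_distrib)
      finally have "(\<Sum>b\<in>B. ((be b - m) * crd B b v) *\<^sub>C b) = 0" by simp
      then have 0: "\<forall>b\<in>B. (be b - m) * crd B b v = 0"
        using assms(2) cs.independentD[of B B "\<lambda>b. (be b - m) * crd B b v"] by (auto simp: basis_def)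
      have "\<exists>b\<in>B. crd B b v \<noteq> 0"
      proof (rule ccontr)
        assume "\<not> ?thesis"
        then have "(\<Sum>b\<in>B. crd B b v *\<^sub>C b) = 0" by simp
        then show False using crd_expand_M[OF assms(2) v(1)] v(2) by simp
      qed
      then show "m \<in> be ` B" using 0 by auto
    qed
  qed
qed

lemma card_basis: "basis B \<Longrightarrow> card B \<le> card bas"
  using cs.independent_span_bound[of bas B] basis_bas basis_in_M[of B] by (auto simp: basis_def)

lemma diffs_eigenbasis:
  assumes "spec a = be ` B"
  shows "diffs a = (\<lambda>(b, b'). be b - be b') ` (B \<times> B)"
  unfolding diffs_def assms by auto

lemma semisimple_eigenbasis:
  assumes "a \<in> ops" "semisimple a"
  obtains B be where "basis B" "\<forall>b\<in>B. a \<cdot> b = be b *\<^sub>C b"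
  using joint_gbasis[OF assms assms(1)] unfolding gbasis_def by metis

lemma card_diffs:
  assumes "a \<in> ops" "semisimple a" shows "card (diffs a) \<le> card bas * card bas"
proof -
  obtain B be where B: "basis B" "\<forall>b\<in>B. a \<cdot> b = be b *\<^sub>C b"
    by (rule semisimple_eigenbasis[OF assms])
  have "finite B" using B by (simp add: basis_def)
  have "card (diffs a) \<le> card (B \<times> B)"
    unfolding diffs_eigenbasis[OF eigenbasis(3)[OF assms(1) B]]
    by (rule card_image_le) (use \<open>finite B\<close> in simp)
  also have "\<dots> \<le> card bas * card bas"
    using card_basis[OF B(1)] by (simp add: card_cartesian_product mult_mono)
  finally show ?thesis .
qed

text \<open>The commutator with a diagonal operator multiplies the matrix entry at \<open>(b, b')\<close> by the
  difference of the two eigenvalues.\<close>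

lemma diag_bracket_coord:
  assumes B: "basis B" "b \<in> B" "b' \<in> B" and T: "T \<in> ops"
  shows "crd B b (br (diag B u) T \<cdot> b') = (u b - u b') * crd B b (T \<cdot> b')"
proof -
  have "crd B b (diag B u \<cdot> w) = u b * crd B b w" for w
  proof -
    have "crd B b (diag B u \<cdot> w) = (\<Sum>c\<in>B. if c = b then u b * crd B b w else 0)"
      unfolding ap_diag[OF B(1)] crd_sum[OF B(1)] crd_scale[OF B(1)]
      using B by (intro sum.cong) (auto simp: crd_basis)
    then show ?thesis using B by (simp add: basis_def)
  qed
  moreover have "crd B b (v - w) = crd B b v - crd B b w" for v w
    using crd_add[OF B(1), of b "v - w" w] by simp
  ultimately show ?thesis
    unfolding ap_br using B by (simp add: diag_basis crd_scale[OF B(1)] left_diff_distrib)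
qed

lemma br_ops: "S \<in> ops \<Longrightarrow> T \<in> ops \<Longrightarrow> br S T \<in> ops"
  unfolding br_def by (intro ops_diff ops_mult)

lemma ops_eqI_crd:
  assumes "S \<in> ops" "T \<in> ops" "basis B"
    and "\<And>b b'. b \<in> B \<Longrightarrow> b' \<in> B \<Longrightarrow> crd B b (S \<cdot> b') = crd B b (T \<cdot> b')"
  shows "S = T"
proof (rule ops_eqI[OF assms(1-3)])
  fix b' assume "b' \<in> B"
  then have "(\<Sum>b\<in>B. crd B b (S \<cdot> b') *\<^sub>C b) = (\<Sum>b\<in>B. crd B b (T \<cdot> b') *\<^sub>C b)"
    using assms(4) by (intro sum.cong) auto
  then show "S \<cdot> b' = T \<cdot> b'" using assms(1-3) by (simp add: crd_expand_M ops_in_M)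
qed

text \<open>A matrix that is an eigenvector for the commutator with \<^term>\<open>diag B be\<close> is supported on entries
  with one fixed difference of eigenvalues.\<close>

lemma diag_bracket_transfer:
  assumes B: "basis B" and T: "T \<in> ops" "br (diag B be) T = al *\<^sub>C T"
    and c: "\<And>b b'. b \<in> B \<Longrightarrow> b' \<in> B \<Longrightarrow> be b - be b' = al \<Longrightarrow> ga b - ga b' = c"
  shows "br (diag B ga) T = c *\<^sub>C T"
proof (rule ops_eqI_crd[OF _ _ B])
  show "br (diag B ga) T \<in> ops" "c *\<^sub>C T \<in> ops"
    using B T by (auto intro: br_ops diag_ops ops_scale)
  fix b b' assume b: "b \<in> B" "b' \<in> B"
  have "(be b - be b') * crd B b (T \<cdot> b') = al * crd B b (T \<cdot> b')"
    using diag_bracket_coord[OF B b T(1), of be, symmetric] unfolding T(2)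
    by (simp only: ap_cscale crd_scale[OF B])
  then have "crd B b (T \<cdot> b') = 0 \<or> be b - be b' = al" by simp
  then have "(ga b - ga b') * crd B b (T \<cdot> b') = c * crd B b (T \<cdot> b')" using c[OF b] by auto
  then show "crd B b (br (diag B ga) T \<cdot> b') = crd B b ((c *\<^sub>C T) \<cdot> b')"
    unfolding diag_bracket_coord[OF B b T(1)] by (simp add: crd_scale[OF B])
qed

lemma tr_br_cycle:
  assumes "x \<in> ops" "y \<in> ops" "z \<in> ops"
  shows "tr (br x y * z) = tr (x * br y z)"
proof -
  have "tr (y * x * z) = tr (x * z * y)"
    using tr_commute[of y "x * z"] assms by (simp add: ops_mult mult.assoc)
  then show ?thesis by (simp add: br_def algebra_simps tr_diff mult.assoc)
qed

text \<open>Weight spaces of \<open>a\<close> are orthogonal for the trace form unless their weights are opposite.\<close>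

lemma eigen_br_trace_zero:
  assumes "a \<in> ops" "x \<in> ops" "y \<in> ops" "br a x = al *\<^sub>C x" "br a y = be *\<^sub>C y" "al + be \<noteq> 0"
  shows "tr (x * y) = 0"
proof -
  have "br a (x * y) = br a x * y + x * br a y" by (simp add: br_def algebra_simps)
  also have "\<dots> = (al + be) *\<^sub>C (x * y)" by (simp add: assms cscale_add_left)
  finally have "tr (br a (x * y)) = (al + be) * tr (x * y)" by (simp add: tr_scale)
  moreover have "tr (br a (x * y)) = 0"
    using tr_commute[of a "x * y"] assms by (simp add: br_def tr_diff ops_mult)
  ultimately show ?thesis using assms(6) by simp
qed

end

lift_definition ad :: "'v::cspace endo \<Rightarrow> 'v endo endo" is "\<lambda>a T. br a T"
  by (simp add: lin_def br_def algebra_simps cs.scale_right_diff_distrib)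

lemma ap_ad [simp]: "ad a \<cdot> T = br a T" by transfer simp

section \<open>Lie algebras of operators closed under replicas\<close>

text \<open>A replica of \<open>x\<close> acts on each generalized eigenspace of \<open>x\<close> by an additive function of the
  eigenvalue. The semisimple part of \<open>x\<close> is the replica for the identity. The replica for complex
  conjugation serves to make trace forms positive: \<open>tr (x y) = \<Sum> |l|\<^sup>2\<close>.\<close>

locale lie_ops = fin_proj +
  fixes g :: "'a endo set"
  assumes g_ops: "g \<subseteq> ops" and g_lie: "lie_sub g"
    and g_replica: "\<And>x y ps. \<lbrakk>x \<in> g; y \<in> ops; \<And>c d. ps (c + d) = ps c + ps d;
        \<And>m v. v \<in> M \<Longrightarrow> genvec x m v \<Longrightarrow> y \<cdot> v = ps m *\<^sub>C v\<rbrakk> \<Longrightarrow> y \<in> g"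
begin

lemma g_sub: "cs.subspace g"
  using g_lie by (simp add: lie_sub_def)

lemma g_br: "x \<in> g \<Longrightarrow> y \<in> g \<Longrightarrow> br x y \<in> g"
  using g_lie by (simp add: lie_sub_def)

lemma in_ops [simp]: "x \<in> g \<Longrightarrow> x \<in> ops"
  using g_ops by blast

lemmas g_add = cs.subspace_add[OF g_sub]
  and g_diff = cs.subspace_diff[OF g_sub]
  and g_scale = cs.subspace_scale[OF g_sub]

lemma replica_in_g:
  assumes "x \<in> g" "gbasis x B l" "\<And>c d. ps (c + d) = ps c + ps d"
  shows "diag B (\<lambda>b. ps (l b)) \<in> g"
proof (rule g_replica[OF assms(1) _ assms(3)])
  show "diag B (\<lambda>b. ps (l b)) \<in> ops" using assms(2) by (auto simp: gbasis_def intro: diag_ops)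
  show "diag B (\<lambda>b. ps (l b)) \<cdot> v = ps m *\<^sub>C v" if "v \<in> M" "genvec x m v" for m v
    using gbasis_eigen[OF assms(2) that] .
qed

lemma semisimple_part_in_g: "x \<in> g \<Longrightarrow> gbasis x B l \<Longrightarrow> diag B l \<in> g"
  using replica_in_g[of x B l "\<lambda>c. c"] by simp

lemma tr_conjugate_replica:
  assumes "x \<in> g" "gbasis x B l"
  shows "tr (x * diag B (\<lambda>b. cnj (l b))) = (\<Sum>b\<in>B. complex_of_real ((cmod (l b))\<^sup>2))"
proof -
  have "x * diag B (\<lambda>b. cnj (l b)) = diag B (\<lambda>b. cnj (l b)) * x"
    using gbasis_self_commute[OF assms(2), of cnj] assms(1) by simp
  then show ?thesis using tr_gbasis[OF assms(2)] assms(1)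
    by (simp add: complex_norm_square del: of_real_power)
qed

text \<open>A sum of squares \<open>|l|\<^sup>2\<close> vanishes only if all eigenvalues do. This is how vanishing traces lead to
  nilpotency throughout.\<close>

lemma nilpotent_of_conjugate_trace:
  assumes "x \<in> g" "gbasis x B l" "tr (x * diag B (\<lambda>b. cnj (l b))) = 0"
  shows "\<exists>p. x ^ p = 0"
proof -
  have B: "basis B" using assms(2) by (simp add: gbasis_def)
  have "complex_of_real (\<Sum>b\<in>B. (cmod (l b))\<^sup>2) = 0"
    using assms(3) tr_conjugate_replica[OF assms(1,2)] by simp
  then have "(\<Sum>b\<in>B. (cmod (l b))\<^sup>2) = 0" by (simp only: of_real_eq_0_iff)
  then have "\<forall>b\<in>B. (cmod (l b))\<^sup>2 = 0" using B by (subst (asm) sum_nonneg_eq_0_iff) (auto simp: basis_def)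
  then have "genvec x 0 b" if "b \<in> B" for b using that assms(2) by (auto simp: gbasis_def)
  then show ?thesis using B assms(1) by (intro nilpotent_of_genvec) auto
qed

text \<open>The radical of the trace form of \<open>g\<close>. It is an ideal of nilpotent operators, and takes the place of the
  solvable radical.\<close>

definition rad :: "'a endo set" where
  "rad = {x \<in> g. \<forall>y\<in>g. tr (x * y) = 0}"

lemma subspace_rad: "cs.subspace rad"
  using g_sub unfolding cs.subspace_def rad_def
  by (auto simp: algebra_simps tr_add tr_scale)

lemma rad_in_g: "rad \<subseteq> g" by (auto simp: rad_def)

lemma rad_ideal:
  assumes "x \<in> rad" "y \<in> g" shows "br x y \<in> rad" "br y x \<in> rad"
proof -
  have x: "x \<in> g" using assms(1) by (simp add: rad_def)
  have "tr (br x y * z) = 0" if "z \<in> g" for z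
    using tr_br_cycle[of x y z] assms x that g_br[OF assms(2) that] by (simp add: rad_def)
  then show 1: "br x y \<in> rad" using g_br[OF x assms(2)] by (simp add: rad_def)
  have "br y x = (-1) *\<^sub>C br x y" by (simp add: br_def)
  then show "br y x \<in> rad" using cs.subspace_scale[OF subspace_rad 1] by metis
qed

lemma lie_sub_rad: "lie_sub rad"
  unfolding lie_sub_def using subspace_rad rad_ideal rad_in_g by blast

lemma rad_nilpotent:
  assumes "x \<in> rad" shows "\<exists>p. x ^ p = 0"
proof -
  have x: "x \<in> g" using assms rad_in_g by blast
  obtain B l where gb: "gbasis x B l" using ex_gbasis[of x] x by auto
  have "diag B (\<lambda>b. cnj (l b)) \<in> g" using replica_in_g[OF x gb, of cnj] by simp
  then show ?thesis using nilpotent_of_conjugate_trace[OF x gb] assms by (simp add: rad_def)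
qed

lemma engel_rad: "engel rad"
  using engel_nilpotent[OF lie_sub_rad _ rad_nilpotent] rad_in_g g_ops by blast

text \<open>The number of differences of eigenvalues is bounded by the square of the dimension, so a
  semisimple element of \<open>g\<close> for which it is largest exists.\<close>

lemma ex_generic:
  obtains a where "a \<in> g" "semisimple a"
    "\<And>a'. a' \<in> g \<Longrightarrow> semisimple a' \<Longrightarrow> card (diffs a') \<le> card (diffs a)"
proof -
  have "M \<subseteq> {v \<in> M. \<exists>l. 0 \<cdot> v = l *\<^sub>C v}" by (auto intro: exI[of _ 0])
  then have "semisimple 0" unfolding semisimple_def using cs.span_superset by blast
  moreover have "0 \<in> g" using g_sub cs.subspace_0 by blast
  moreover have "\<forall>a. a \<in> g \<and> semisimple a \<longrightarrow> card (diffs a) \<le> card bas * card bas"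
    using card_diffs by simp
  ultimately have "\<exists>a. (a \<in> g \<and> semisimple a) \<and> (\<forall>a'. a' \<in> g \<and> semisimple a' \<longrightarrow> card (diffs a') \<le> card (diffs a))"
    by (intro Lattices_Big.ex_has_greatest_nat[of _ 0 _ "Suc (card bas * card bas)"]) (auto simp: less_Suc_eq_le)
  then show thesis using that by blast
qed

end

locale lie_generic = lie_ops +
  fixes a :: "'a endo"
  assumes a_g: "a \<in> g" and a_ss: "semisimple a"
    and a_max: "\<And>a'. a' \<in> g \<Longrightarrow> semisimple a' \<Longrightarrow> card (diffs a') \<le> card (diffs a)"
begin

lemma joint:
  assumes "z \<in> g" "a * z = z * a"
  obtains B be ga where "gbasis z B ga" "basis B" "a = diag B be" "spec a = be ` B"
proof -
  have ops: "a \<in> ops" "z \<in> ops" using a_g assms(1) by simp_all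
  obtain B be ga where B: "gbasis z B ga" "\<forall>b\<in>B. a \<cdot> b = be b *\<^sub>C b"
    using joint_gbasis[OF ops(1) a_ss ops(2) assms(2)] by metis
  then have bB: "basis B" by (simp add: gbasis_def)
  note eb = eigenbasis[OF ops(1) bB B(2)]
  show thesis by (rule that[OF B(1) bB eb(1,3)])
qed

text \<open>If an element commuting with \<open>a\<close> separated two pairs with the same difference of
  \<open>a\<close>-eigenvalues, adding a generic multiple of its semisimple part to \<open>a\<close> would produce an
  element with more differences.\<close>

lemma differences_determined:
  assumes z: "z \<in> g" "gbasis z B ga" and B: "basis B" "a = diag B be" "spec a = be ` B"
    and b: "b \<in> B" "b' \<in> B" "c \<in> B" "c' \<in> B" "be b - be b' = be c - be c'"
  shows "ga b - ga b' = ga c - ga c'"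
proof -
  define P where "P = B \<times> B"
  define p where "p = (\<lambda>(b, b'). be b - be b')"
  define q where "q = (\<lambda>(b, b'). ga b - ga b')"
  have finP: "finite P" using B(1) by (simp add: P_def basis_def)
  define bad where "bad = (\<lambda>(u, v). - (p u - p v) / (q u - q v)) ` (P \<times> P)"
  \<comment> \<open>For \<open>t\<close> outside this finite set, two pairs with the same difference for \<open>a + t z\<^sub>s\<close> have the
    same differences for both \<open>a\<close> and the semisimple part \<open>z\<^sub>s\<close> of \<open>z\<close>.\<close>
  obtain t where t: "t \<notin> bad"
    using ex_new_if_finite[OF infinite_UNIV_char_0, of bad] finP unfolding bad_def by blast
  define a' where "a' = a + t *\<^sub>C diag B ga"
  have "diag B ga \<in> g" by (rule semisimple_part_in_g[OF z])
  then have a'g: "a' \<in> g" unfolding a'_def using a_g by (intro g_add g_scale)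
  have a'b: "\<forall>b\<in>B. a' \<cdot> b = (be b + t * ga b) *\<^sub>C b"
    using B by (simp add: a'_def diag_basis cscale_add_left)
  note eb = eigenbasis[OF in_ops[OF a'g] B(1) a'b]
  define p' where "p' u = p u + t * q u" for u
  have "diffs a' = p' ` P"
    unfolding diffs_eigenbasis[OF eb(3)] P_def
    by (intro image_cong) (auto simp: p'_def p_def q_def algebra_simps)
  moreover have "diffs a = p ` P" unfolding diffs_eigenbasis[OF B(3)] P_def p_def by simp
  ultimately have card: "card (p' ` P) \<le> card (p ` P)" using a_max[OF a'g eb(2)] by simp
  have sep: "p u = p v \<and> q u = q v" if "u \<in> P" "v \<in> P" "p' u = p' v" for u v
  proof -
    have eq: "(p u - p v) + t * (q u - q v) = 0" using that(3) by (simp add: p'_def algebra_simps)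
    have "q u - q v = 0"
    proof (rule ccontr)
      assume "q u - q v \<noteq> 0"
      then have "t = - (p u - p v) / (q u - q v)" using eq by (simp add: field_simps eq_neg_iff_add_eq_0)
      moreover have "- (p u - p v) / (q u - q v) \<in> bad" unfolding bad_def using that by force
      ultimately show False using t by simp
    qed
    then show ?thesis using eq by simp
  qed
  \<comment> \<open>Differences for the new element determine those for \<open>a\<close>; by maximality of \<open>a\<close> this map \<open>h\<close> is injective,
    so the differences for \<open>a\<close> determine those for the new element as well.\<close>
  define h where "h w = p (SOME u. u \<in> P \<and> p' u = w)" for w
  have h: "h (p' u) = p u" if "u \<in> P" for u
  proof -
    have "(SOME v. v \<in> P \<and> p' v = p' u) \<in> P \<and> p' (SOME v. v \<in> P \<and> p' v = p' u) = p' u"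
      by (rule someI[of _ u]) (use that in simp)
    then show ?thesis unfolding h_def using sep that by blast
  qed
  then have "h ` (p' ` P) = p ` P" by (force simp: image_iff)
  moreover have "card (h ` (p' ` P)) \<le> card (p' ` P)" using finP by (intro card_image_le) simp
  ultimately have "inj_on h (p' ` P)" using card finP by (intro eq_card_imp_inj_on) auto
  moreover have "(b, b') \<in> P" "(c, c') \<in> P" using b by (auto simp: P_def)
  moreover have "h (p' (b, b')) = h (p' (c, c'))" using b(5) h calculation(2,3) by (simp add: p_def)
  ultimately have "p' (b, b') = p' (c, c')" by (auto dest: inj_onD)
  then have "q (b, b') = q (c, c')" using sep \<open>(b, b') \<in> P\<close> \<open>(c, c') \<in> P\<close> by blast
  then show ?thesis by (simp add: q_def)
qed

text \<open>On each weight space of \<open>a\<close> the semisimple part of \<open>z\<close> acts by a scalar, and by opposite scalars on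
  opposite weight spaces.\<close>

lemma replica_bracket:
  assumes z: "z \<in> g" "gbasis z B ga" and B: "basis B" "a = diag B be" "spec a = be ` B"
  obtains c where "\<And>T. T \<in> ops \<Longrightarrow> br a T = al *\<^sub>C T \<Longrightarrow> br (diag B ga) T = c *\<^sub>C T"
    "\<And>T. T \<in> ops \<Longrightarrow> br a T = (- al) *\<^sub>C T \<Longrightarrow> br (diag B ga) T = (- c) *\<^sub>C T"
    "\<And>b b'. b \<in> B \<Longrightarrow> b' \<in> B \<Longrightarrow> be b - be b' = al \<Longrightarrow> ga b - ga b' = c"
proof -
  have "\<exists>c. \<forall>b\<in>B. \<forall>b'\<in>B. be b - be b' = al \<longrightarrow> ga b - ga b' = c"
  proof (cases "\<exists>b\<in>B. \<exists>b'\<in>B. be b - be b' = al")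
    case True
    then obtain d d' where "d \<in> B" "d' \<in> B" "be d - be d' = al" by blast
    then have "ga b - ga b' = ga d - ga d'" if "b \<in> B" "b' \<in> B" "be b - be b' = al" for b b'
      using that by (intro differences_determined[OF assms]) simp_all
    then show ?thesis by blast
  qed blast
  then obtain c where c: "\<And>b b'. b \<in> B \<Longrightarrow> b' \<in> B \<Longrightarrow> be b - be b' = al \<Longrightarrow> ga b - ga b' = c"
    by blast
  show thesis
  proof (rule that[of c])
    show "br (diag B ga) T = c *\<^sub>C T" if "T \<in> ops" "br a T = al *\<^sub>C T" for T
      using diag_bracket_transfer[OF B(1) that(1), of be al ga c] that(2) c B(2) by blast
    show "br (diag B ga) T = (- c) *\<^sub>C T" if "T \<in> ops" "br a T = (- al) *\<^sub>C T" for T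
    proof (rule diag_bracket_transfer[OF B(1) that(1), of be "- al"])
      show "br (diag B be) T = (- al) *\<^sub>C T" using that(2) B(2) by simp
      fix b b' assume "b \<in> B" "b' \<in> B" "be b - be b' = - al"
      then have "ga b' - ga b = c" using c[of b' b] by (simp add: algebra_simps)
      then show "ga b - ga b' = - c" by (simp add: algebra_simps)
    qed
  qed (use c in blast)
qed

text \<open>Conjugation preserves the vanishing of differences of eigenvalues.\<close>

lemma conjugate_replica_bracket:
  assumes B: "basis B" "a = diag B be" and T: "T \<in> ops" "br a T = al *\<^sub>C T"
    and c: "\<And>b b'. b \<in> B \<Longrightarrow> b' \<in> B \<Longrightarrow> be b - be b' = al \<Longrightarrow> ga b - ga b' = 0"
  shows "diag B (\<lambda>b. cnj (ga b)) * T = T * diag B (\<lambda>b. cnj (ga b))"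
proof -
  have "br (diag B (\<lambda>b. cnj (ga b))) T = 0 *\<^sub>C T"
  proof (rule diag_bracket_transfer[OF B(1) T(1)])
    show "br (diag B be) T = al *\<^sub>C T" using T(2) B(2) by simp
    fix b b' assume "b \<in> B" "b' \<in> B" "be b - be b' = al"
    then have "ga b = ga b'" using c[of b b'] by simp
    then show "cnj (ga b) - cnj (ga b') = 0" by simp
  qed
  then show ?thesis by (simp add: br_def)
qed

text \<open>The weight \<open>0\<close> case: on the centralizer of \<open>a\<close> the differences of eigenvalues all vanish.\<close>

lemma centralizer_commutes:
  assumes z: "z \<in> g" "gbasis z B ga" and B: "basis B" "a = diag B be" "spec a = be ` B"
    and T: "T \<in> ops" "a * T = T * a"
  shows "diag B ga * T = T * diag B ga" "diag B (\<lambda>b. cnj (ga b)) * T = T * diag B (\<lambda>b. cnj (ga b))"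
proof -
  have aT: "br a T = 0 *\<^sub>C T" using T(2) by (simp add: br_def)
  have 0: "ga b - ga b' = 0" if "b \<in> B" "b' \<in> B" "be b - be b' = 0" for b b'
    using differences_determined[OF z B, of b b' b b] that by simp
  have "br (diag B ga) T = 0 *\<^sub>C T"
    using diag_bracket_transfer[OF B(1) T(1), of be 0 ga 0] aT 0 B(2) by blast
  then show "diag B ga * T = T * diag B ga" by (simp add: br_def)
  show "diag B (\<lambda>b. cnj (ga b)) * T = T * diag B (\<lambda>b. cnj (ga b))"
    using conjugate_replica_bracket[OF B(1,2) T(1) aT 0] .
qed

lemma tr_nilpotent_commuting:
  assumes "x \<in> ops" "x ^ p = 0" "y \<in> ops" "x * y = y * x" shows "tr (x * y) = 0"
  using tr_nilpotent[OF ops_mult[OF assms(1,3)] nilpotent_mult_commute[OF assms(2,4)]] .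

text \<open>The conjugate replica \<open>d\<close> of \<open>x + y\<close> commutes with \<open>x\<close> and \<open>y\<close>, so \<open>tr ((x + y) d)\<close> is a sum of traces of
  nilpotent operators.\<close>

lemma centralizer_nilpotent_add:
  assumes x: "x \<in> g" "a * x = x * a" "x ^ p = 0" and y: "y \<in> g" "a * y = y * a" "y ^ q = 0"
  shows "\<exists>r. (x + y) ^ r = 0"
proof -
  have s: "x + y \<in> g" "a * (x + y) = (x + y) * a" using x y g_add by (auto simp: algebra_simps)
  obtain B be ga where B: "gbasis (x + y) B ga" "basis B" "a = diag B be" "spec a = be ` B"
    by (rule joint[OF s])
  have "diag B (\<lambda>b. cnj (ga b)) \<in> ops" using B(2) by (rule diag_ops)
  then have "tr (x * diag B (\<lambda>b. cnj (ga b))) = 0" "tr (y * diag B (\<lambda>b. cnj (ga b))) = 0"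
    using x y centralizer_commutes(2)[OF s(1) B] tr_nilpotent_commuting
    by (metis in_ops)+
  then show ?thesis using nilpotent_of_conjugate_trace[OF s(1) B(1)] by (simp add: algebra_simps tr_add)
qed

text \<open>For commuting \<open>x + y\<close>, \<open>x\<close>, \<open>y\<close> all nilpotent, \<open>tr (x y)\<close> vanishes because
  \<open>2 tr (x y) = tr ((x + y)\<^sup>2) - tr (x\<^sup>2) - tr (y\<^sup>2)\<close>.\<close>

lemma centralizer_nilpotent_tr:
  assumes x: "x \<in> g" "a * x = x * a" "x ^ p = 0" and y: "y \<in> g" "a * y = y * a" "y ^ q = 0"
  shows "tr (x * y) = 0"
proof -
  have sq: "tr (z * z) = 0" if "z \<in> g" "z ^ r = 0" for z r
    using tr_nilpotent_commuting[of z r z] that by simp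
  obtain r where "(x + y) ^ r = 0" using centralizer_nilpotent_add[OF assms] by blast
  then have "tr ((x + y) * (x + y)) = 0" using sq x(1) y(1) g_add by blast
  moreover have "tr ((x + y) * (x + y)) = tr (x * x) + 2 * tr (x * y) + tr (y * y)"
    using tr_commute[of y x] x(1) y(1) by (simp add: algebra_simps tr_add)
  ultimately show ?thesis using sq[OF x(1,3)] sq[OF y(1,3)] by simp
qed

text \<open>The matrix blocks of \<open>y\<close> between eigenspaces of \<open>a\<close>, collected by difference of eigenvalues, are
  weight vectors; they belong to \<open>g\<close> since \<open>g\<close> is invariant under the commutator with \<open>a\<close>.\<close>

lemma weight_decomposition:
  assumes "y \<in> g"
  obtains F u where "finite F" "y = (\<Sum>al\<in>F. u al)" "\<And>al. al \<in> F \<Longrightarrow> u al \<in> g"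
    "\<And>al. al \<in> F \<Longrightarrow> br a (u al) = al *\<^sub>C u al"
proof -
  have ya: "y \<in> ops" "a \<in> ops" using assms a_g by auto
  obtain B be where B: "basis B" "\<forall>b\<in>B. a \<cdot> b = be b *\<^sub>C b"
    by (rule semisimple_eigenbasis[OF ya(2) a_ss])
  note a = eigenbasis(1)[OF ya(2) B]
  have fin: "finite B" using B(1) by (simp add: basis_def)
  define P where "P b = diag B (\<lambda>c. if c = b then 1 else 0)" for b
  have P: "P b \<in> ops" for b unfolding P_def by (rule diag_ops[OF B(1)])
  have sumP: "(\<Sum>b\<in>B. P b) = E"
  proof (rule ops_eqI[OF ops_sum[OF P] E_ops B(1)])
    fix c assume c: "c \<in> B"
    have "(\<Sum>b\<in>B. P b) \<cdot> c = (\<Sum>b\<in>B. if b = c then c else 0)"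
      unfolding ap_sum using c by (intro sum.cong) (auto simp: P_def diag_basis[OF B(1)])
    then show "(\<Sum>b\<in>B. P b) \<cdot> c = E \<cdot> c" using c fin basis_in_M[OF B(1) c] by (simp add: M_fix)
  qed
  have aP: "a * P b = be b *\<^sub>C P b" "P b * a = be b *\<^sub>C P b" if "b \<in> B" for b
  proof -
    have "diag B (\<lambda>c. be c * (if c = b then 1 else 0)) = be b *\<^sub>C P b"
      using B(1) that by (intro ops_eqI[OF diag_ops ops_scale[OF P]]) (auto simp: diag_basis P_def)
    moreover have "a * P b = diag B (\<lambda>c. be c * (if c = b then 1 else 0))"
      "P b * a = diag B (\<lambda>c. be c * (if c = b then 1 else 0))"
      by (simp_all add: a P_def diag_mult[OF B(1)] mult.commute)
    ultimately show "a * P b = be b *\<^sub>C P b" "P b * a = be b *\<^sub>C P b" by simp_all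
  qed
  define p where "p = (\<lambda>(b, b'). be b - be b')"
  define F where "F = p ` (B \<times> B)"
  define u where "u al = (\<Sum>(b, b')\<in>{w \<in> B \<times> B. p w = al}. P b * y * P b')" for al
  have "y = E * y * E" using ya(1) by (simp add: ops_def)
  also have "\<dots> = (\<Sum>(b, b')\<in>B \<times> B. P b * y * P b')"
    unfolding sumP[symmetric] sum_distrib_right sum_distrib_left
    by (subst sum.swap) (simp add: sum.cartesian_product)
  also have "\<dots> = (\<Sum>al\<in>F. u al)"
    unfolding F_def u_def using fin by (intro sum.group[symmetric]) auto
  finally have y: "y = (\<Sum>al\<in>F. u al)" .
  have finF: "finite F" using fin by (simp add: F_def)
  have ad_u: "ad a \<cdot> u al = al *\<^sub>C u al" for al
    unfolding u_def ap_sum_right cs.scale_sum_right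
  proof (intro sum.cong refl)
    fix w assume w: "w \<in> {w \<in> B \<times> B. p w = al}"
    then obtain b b' where wb: "w = (b, b')" "b \<in> B" "b' \<in> B" "be b - be b' = al" by (auto simp: p_def)
    have "br a (P b * y * P b') = (a * P b) * y * P b' - P b * y * (P b' * a)"
      by (simp add: br_def mult.assoc)
    also have "\<dots> = al *\<^sub>C (P b * y * P b')"
      using wb by (simp add: aP cs.scale_left_diff_distrib flip: wb(4))
    finally show "ad a \<cdot> (case w of (b, b') \<Rightarrow> P b * y * P b') = al *\<^sub>C (case w of (b, b') \<Rightarrow> P b * y * P b')"
      by (simp add: wb)
  qed
  have "ad a \<cdot> x \<in> g" if "x \<in> g" for x using that a_g g_br by simp
  then have "\<forall>al\<in>F. u al \<in> g"
    using eigen_components_in[OF finF ad_u _ g_sub] assms y by simp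
  then show thesis using that finF y ad_u by simp
qed

text \<open>Against nonzero weight spaces the trace form vanishes for reasons of weight. Against an element
  \<open>y\<close> of the centralizer, split \<open>y\<close> into its nilpotent part, treated by \<open>centralizer_nilpotent_tr\<close>, and its
  semisimple part, which commutes with \<open>z\<close>.\<close>

lemma centralizer_nilpotent_in_rad:
  assumes z: "z \<in> g" "a * z = z * a" "z ^ p = 0"
  shows "z \<in> rad"
proof -
  have central: "tr (z * y) = 0" if y: "y \<in> g" "a * y = y * a" for y
  proof -
    obtain B be ga where B: "gbasis y B ga" "basis B" "a = diag B be" "spec a = be ` B"
      by (rule joint[OF y])
    define s where "s = diag B ga"
    have s: "s \<in> g" unfolding s_def by (rule semisimple_part_in_g[OF y(1) B(1)])
    obtain q where q: "(y - s) ^ q = 0" using gbasis_nilpotent_part[OF B(1)] y by (auto simp: s_def)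
    have "a * s = s * a" using B by (simp add: s_def diag_mult mult.commute)
    then have "a * (y - s) = (y - s) * a" using y(2) by (simp add: algebra_simps)
    then have "tr (z * (y - s)) = 0" using centralizer_nilpotent_tr[OF z g_diff[OF y(1) s] _ q] by blast
    moreover have "s * z = z * s" unfolding s_def using centralizer_commutes(1)[OF y(1) B] z by simp
    then have "tr (z * s) = 0" using tr_nilpotent_commuting[of z p s] z s by simp
    ultimately show ?thesis by (simp add: algebra_simps tr_diff)
  qed
  have "tr (z * y) = 0" if yg: "y \<in> g" for y
  proof -
    obtain F u where u: "finite F" "y = (\<Sum>al\<in>F. u al)" "\<And>al. al \<in> F \<Longrightarrow> u al \<in> g"
      "\<And>al. al \<in> F \<Longrightarrow> br a (u al) = al *\<^sub>C u al" using weight_decomposition[OF yg] by blast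
    have "tr (z * u al) = 0" if al: "al \<in> F" for al
    proof (cases "al = 0")
      case True
      then show ?thesis using central u(3,4)[OF al] by (simp add: br_def)
    next
      case False
      have "br a z = 0 *\<^sub>C z" using z by (simp add: br_def)
      then show ?thesis
        using eigen_br_trace_zero[of a z "u al" 0 al] u(3,4)[OF al] z a_g False by simp
    qed
    then show ?thesis by (simp add: u(2) sum_distrib_left tr_sum)
  qed
  then show ?thesis using z(1) by (simp add: rad_def)
qed

text \<open>With \<open>w = [x, y]\<close> and \<open>d\<close> the conjugate replica of \<open>w\<close>, invariance of the trace form gives
  \<open>tr (w d) = tr (x [y, d]) = 0\<close>, because \<open>d\<close> commutes with \<open>y\<close>. Hence \<open>w\<close> is nilpotent.\<close>

lemma centralizer_br_in_rad:
  assumes x: "x \<in> g" "a * x = x * a" and y: "y \<in> g" "a * y = y * a"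
  shows "br x y \<in> rad"
proof -
  have w: "br x y \<in> g" by (rule g_br[OF x(1) y(1)])
  have "a * (x * y) = x * y * a" "a * (y * x) = y * x * a"
    using x(2) y(2) by (metis mult.assoc)+
  then have aw: "a * br x y = br x y * a" by (simp add: br_def algebra_simps)
  obtain B be ga where B: "gbasis (br x y) B ga" "basis B" "a = diag B be" "spec a = be ` B"
    by (rule joint[OF w aw])
  define d where "d = diag B (\<lambda>b. cnj (ga b))"
  have d: "d \<in> ops" unfolding d_def using B(2) by (rule diag_ops)
  have "d * y = y * d" unfolding d_def using centralizer_commutes(2)[OF w B] y by simp
  then have "br y d = 0" by (simp add: br_def)
  then have "tr (br x y * d) = 0" using tr_br_cycle[of x y d] x y d by simp
  then obtain p where "br x y ^ p = 0" using nilpotent_of_conjugate_trace[OF w B(1)] by (auto simp: d_def)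
  then show ?thesis by (rule centralizer_nilpotent_in_rad[OF w aw])
qed

text \<open>If all root vectors of \<open>a\<close> lie in the radical, then \<open>g\<close> is the sum of the radical and of the
  centralizer of \<open>a\<close>, which is abelian modulo the radical.\<close>

lemma derived_in_rad:
  assumes roots: "\<And>al x. al \<noteq> 0 \<Longrightarrow> x \<in> g \<Longrightarrow> br a x = al *\<^sub>C x \<Longrightarrow> x \<in> rad"
    and "x \<in> g" "y \<in> g"
  shows "br x y \<in> rad"
proof -
  have dec: "\<exists>x0. x0 \<in> g \<and> a * x0 = x0 * a \<and> x - x0 \<in> rad" if x: "x \<in> g" for x
  proof -
    obtain F u where u: "finite F" "x = (\<Sum>al\<in>F. u al)" "\<And>al. al \<in> F \<Longrightarrow> u al \<in> g"
      "\<And>al. al \<in> F \<Longrightarrow> br a (u al) = al *\<^sub>C u al" using weight_decomposition[OF x] by blast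
    define x0 where "x0 = (if 0 \<in> F then u 0 else 0)"
    have "x - x0 = (\<Sum>al\<in>F - {0}. u al)" using u(1) by (simp add: u(2) x0_def sum_diff1)
    also have "\<dots> \<in> rad" using u roots by (intro cs.subspace_sum[OF subspace_rad]) auto
    finally have "x - x0 \<in> rad" .
    moreover have "x0 \<in> g" using u(3) cs.subspace_0[OF g_sub] by (simp add: x0_def)
    moreover have "a * x0 = x0 * a" using u(4)[of 0] by (simp add: x0_def br_def)
    ultimately show ?thesis by blast
  qed
  obtain x0 where x0: "x0 \<in> g" "a * x0 = x0 * a" "x - x0 \<in> rad" using dec assms(2) by blast
  obtain y0 where y0: "y0 \<in> g" "a * y0 = y0 * a" "y - y0 \<in> rad" using dec assms(3) by blast
  have "br x y = br (x - x0) y + br x0 (y - y0) + br x0 y0" by (simp add: br_def algebra_simps)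
  moreover have "br (x - x0) y \<in> rad" "br x0 (y - y0) \<in> rad" "br x0 y0 \<in> rad"
    using rad_ideal x0 y0 assms(3) centralizer_br_in_rad by auto
  ultimately show ?thesis using subspace_rad by (simp add: cs.subspace_add)
qed

text \<open>Since \<open>e\<close> is outside the radical, some \<open>f\<close> of opposite weight has \<open>tr (e f) \<noteq> 0\<close>. Up to scaling, \<open>h\<close> is
  the semisimple part of \<open>t = [e, f]\<close>. The scalar \<open>c\<close> by which it acts on \<open>e\<close> cannot vanish: otherwise
  the conjugate replica \<open>d\<close> of \<open>t\<close> would commute with \<open>f\<close>, so \<open>tr (t d) = tr (e [f, d]) = 0\<close> and \<open>t\<close> would be
  nilpotent, although \<open>tr (t a) = al tr (e f) \<noteq> 0\<close>.\<close>

lemma root_triple: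
  assumes e: "al \<noteq> 0" "e \<in> g" "br a e = al *\<^sub>C e" "e \<notin> rad"
  obtains f h where "f \<in> g" "h \<in> g" "semisimple h" "h \<noteq> 0"
    "br h e = 2 *\<^sub>C e" "br h f = (- 2) *\<^sub>C f" "br e f - h \<in> rad"
proof -
  obtain f' where f': "f' \<in> g" "tr (e * f') \<noteq> 0" using e(2,4) by (auto simp: rad_def)
  obtain F u where u: "finite F" "f' = (\<Sum>al\<in>F. u al)" "\<And>al. al \<in> F \<Longrightarrow> u al \<in> g"
      "\<And>al. al \<in> F \<Longrightarrow> br a (u al) = al *\<^sub>C u al" using weight_decomposition[OF f'(1)] by blast
  have "\<exists>be\<in>F. tr (e * u be) \<noteq> 0"
    using f'(2) by (auto simp: u(2) sum_distrib_left tr_sum intro: sum.neutral)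
  then obtain be where be: "be \<in> F" "tr (e * u be) \<noteq> 0" by blast
  have "al + be = 0"
    using eigen_br_trace_zero[of a e "u be" al be] e u(3,4)[OF be(1)] a_g be(2) by auto
  then have be_al: "be = - al" by (simp add: add_eq_0_iff)
  define f where "f = u be"
  have f: "f \<in> g" "br a f = (- al) *\<^sub>C f" "tr (e * f) \<noteq> 0"
    using u(3,4)[OF be(1)] be be_al by (auto simp: f_def)
  define t where "t = br e f"
  have t: "t \<in> g" unfolding t_def by (rule g_br[OF e(2) f(1)])
  have "br a t = br (br a e) f + br e (br a f)" by (simp add: t_def br_def algebra_simps)
  also have "\<dots> = 0" unfolding e(3) f(2) by (simp add: br_def)
  finally have at: "a * t = t * a" by (simp add: br_def)
  have "tr (t * a) = tr (e * br f a)" unfolding t_def using e f a_g by (intro tr_br_cycle) auto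
  also have "br f a = al *\<^sub>C f" using f(2) by (simp add: br_def algebra_simps)
  also have "tr (e * al *\<^sub>C f) = al * tr (e * f)" by (simp add: tr_scale)
  finally have "tr (t * a) \<noteq> 0" using e(1) f(3) by simp
  then have "t \<notin> rad" using a_g by (auto simp: rad_def)
  then have notnil: "\<nexists>p. t ^ p = 0" using centralizer_nilpotent_in_rad[OF t at] by blast
  obtain B bt ga where B: "gbasis t B ga" "basis B" "a = diag B bt" "spec a = bt ` B"
    by (rule joint[OF t at])
  define s where "s = diag B ga"
  have s: "s \<in> g" unfolding s_def by (rule semisimple_part_in_g[OF t B(1)])
  obtain c where c: "br s e = c *\<^sub>C e" "br s f = (- c) *\<^sub>C f"
      "\<And>b b'. b \<in> B \<Longrightarrow> b' \<in> B \<Longrightarrow> bt b - bt b' = al \<Longrightarrow> ga b - ga b' = c"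
    using replica_bracket[OF t B, of al] e f unfolding s_def by (metis in_ops)
  have "c \<noteq> 0"
  proof
    assume c0: "c = 0"
    define d where "d = diag B (\<lambda>b. cnj (ga b))"
    have d: "d \<in> ops" unfolding d_def using B(2) by (rule diag_ops)
    have "ga b - ga b' = 0" if "b \<in> B" "b' \<in> B" "bt b - bt b' = - al" for b b'
    proof -
      have "bt b' - bt b = al" using that(3) by (simp add: algebra_simps)
      then show ?thesis using c(3)[of b' b] that c0 by simp
    qed
    then have "d * f = f * d"
      unfolding d_def using f by (intro conjugate_replica_bracket[OF B(2,3)]) auto
    then have "tr (t * d) = 0" unfolding t_def using tr_br_cycle[of e f d] e f d by (simp add: br_def)
    then show False using nilpotent_of_conjugate_trace[OF t B(1)] notnil by (simp add: d_def)
  qed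
  define h where "h = (2 / c) *\<^sub>C s"
  have "a * s = s * a" using B by (simp add: s_def diag_mult mult.commute)
  then have "a * (t - s) = (t - s) * a" using at by (simp add: algebra_simps)
  moreover obtain q where "(t - s) ^ q = 0" using gbasis_nilpotent_part[OF B(1)] t by (auto simp: s_def)
  ultimately have ts: "t - s \<in> rad" using centralizer_nilpotent_in_rad[OF g_diff[OF t s]] by blast
  show thesis
  proof (rule that[of "(2 / c) *\<^sub>C f" h])
    show "(2 / c) *\<^sub>C f \<in> g" "h \<in> g" unfolding h_def using f(1) s by (auto intro: g_scale)
    have "\<forall>b\<in>B. h \<cdot> b = (2 / c * ga b) *\<^sub>C b"
      using B(2) by (simp add: h_def s_def diag_basis)
    then show "semisimple h" by (rule eigenbasis(2)[OF in_ops[OF \<open>h \<in> g\<close>] B(2)])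
    have "br h e = (2 / c) *\<^sub>C br s e" by (simp add: h_def br_def cs.scale_right_diff_distrib)
    then show he: "br h e = 2 *\<^sub>C e" using \<open>c \<noteq> 0\<close> by (simp add: c)
    have "e \<noteq> 0" using e(4) cs.subspace_0[OF subspace_rad] by auto
    then show "h \<noteq> 0" using he by (auto simp: br_def)
    have "br h ((2 / c) *\<^sub>C f) = (2 / c * (2 / c)) *\<^sub>C br s f"
      by (simp add: h_def br_def cs.scale_right_diff_distrib)
    then show "br h ((2 / c) *\<^sub>C f) = (- 2) *\<^sub>C (2 / c) *\<^sub>C f" using \<open>c \<noteq> 0\<close> by (simp add: c)
    have "br e ((2 / c) *\<^sub>C f) - h = (2 / c) *\<^sub>C (t - s)"
      by (simp add: t_def h_def br_def cs.scale_right_diff_distrib)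
    then show "br e ((2 / c) *\<^sub>C f) - h \<in> rad" using cs.subspace_scale[OF subspace_rad ts] by metis
  qed
qed

end

section \<open>Weight vectors modulo the nilpotent radical\<close>

text \<open>The derived series for operators, without reference to an abstract Lie algebra.\<close>

primrec dser :: "'v::cspace endo set \<Rightarrow> nat \<Rightarrow> 'v endo set" where
  "dser g 0 = g"
| "dser g (Suc i) = cs.span {br x y |x y. x \<in> dser g i \<and> y \<in> dser g i}"

context lie_ops
begin

text \<open>By Engel's theorem the radical lowers a flag of \<open>M\<close>. Bracketing two operators that lower the flag by
  \<open>i + 1\<close> steps gives one that lowers it by at least \<open>i + 2\<close> steps.\<close>

lemma solvable_if_derived_in_rad:
  assumes "\<And>x y. x \<in> g \<Longrightarrow> y \<in> g \<Longrightarrow> br x y \<in> rad"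
  shows "\<exists>i. dser g i \<subseteq> {0}"
proof -
  have radops: "rad \<subseteq> ops" using rad_in_g g_ops by blast
  obtain p where p: "flag rad p = M" by (rule flag_exhausts[OF engel_rad radops])
  define L where "L i = {x \<in> ops. \<forall>j. \<forall>v\<in>flag rad (j + Suc i). x \<cdot> v \<in> flag rad j}" for i
  have subL: "cs.subspace (L i)" for i
  proof -
    have "cs.subspace (flag rad j)" for j using flag_props by blast
    then show ?thesis using subspace_ops unfolding L_def cs.subspace_def by simp
  qed
  have "dser g (Suc i) \<subseteq> L i" for i
  proof (induction i)
    case 0
    have "rad \<subseteq> L 0" using radops by (auto simp: L_def)
    then have "{br x y |x y. x \<in> dser g 0 \<and> y \<in> dser g 0} \<subseteq> L 0" using assms by auto
    then show ?case unfolding dser.simps(2) by (intro cs.span_minimal subL)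
  next
    case (Suc i)
    have prod: "x \<cdot> y \<cdot> v \<in> flag rad j" if "x \<in> L i" "y \<in> L i" "v \<in> flag rad (j + Suc (Suc i))" for x y v j
    proof -
      have "flag rad (j + Suc (Suc i)) \<subseteq> flag rad ((j + Suc i) + Suc i)" by (rule flag_mono) simp
      then have "v \<in> flag rad ((j + Suc i) + Suc i)" using that(3) by blast
      then have "y \<cdot> v \<in> flag rad (j + Suc i)" using that(2) unfolding L_def by blast
      then show ?thesis using that(1) unfolding L_def by blast
    qed
    have "br x y \<in> L (Suc i)" if "x \<in> L i" "y \<in> L i" for x y
    proof -
      have "br x y \<cdot> v \<in> flag rad j" if "v \<in> flag rad (j + Suc (Suc i))" for v j
        unfolding ap_br using prod \<open>x \<in> L i\<close> \<open>y \<in> L i\<close> that flag_props cs.subspace_diff by metis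
      moreover have "br x y \<in> ops" using that by (auto simp: L_def intro: br_ops)
      ultimately show ?thesis by (simp add: L_def)
    qed
    then have "{br x y |x y. x \<in> dser g (Suc i) \<and> y \<in> dser g (Suc i)} \<subseteq> L (Suc i)"
      using Suc by blast
    then show ?case unfolding dser.simps(2)[of g "Suc i"] by (intro cs.span_minimal subL)
  qed
  moreover have "L p \<subseteq> {0}"
  proof
    fix x assume x: "x \<in> L p"
    have "M \<subseteq> flag rad (0 + Suc p)" using flag_mono[of p "Suc p" rad] p by simp
    then have "x \<cdot> E \<cdot> v = 0" for v using x E_in_M[of v] unfolding L_def by fastforce
    then have "x \<cdot> v = 0 \<cdot> v" for v using x ops_E[of x v] by (simp add: L_def)
    then show "x \<in> {0}" using endo_eqI[of x 0] by simp
  qed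
  ultimately show ?thesis by blast
qed

text \<open>Among the \<open>g\<close>-stable subspaces containing \<open>B\<close> but not \<open>v\<close>, a maximal one has the property that
  \<open>v\<close> is annihilated by the radical modulo it, by Engel's theorem. Modulo this subspace the triple satisfies the exact
  \<open>sl\<^sub>2\<close> relations, and the usual computation with \<open>f\<^sup>k v\<close> applies.\<close>

lemma highest_weight_natural:
  assumes efh: "e \<in> g" "f \<in> g" "h \<in> g" "br h f = (- 2) *\<^sub>C f" "br e f - h \<in> rad"
    and AB: "stable g A" "stable g B" "A \<subseteq> M" "B \<subseteq> A"
    and v: "v \<in> A" "v \<notin> B" "h \<cdot> v = l *\<^sub>C v" "e \<cdot> v \<in> B"
  shows "l \<in> \<nat>"
proof (rule ccontr)
  assume l: "l \<notin> \<nat>"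
  define C where "C = {U. stable g U \<and> B \<subseteq> U \<and> U \<subseteq> A \<and> v \<notin> U}"
  have "\<exists>U\<in>C. \<forall>X\<in>C. U \<subseteq> X \<longrightarrow> X = U"
  proof (rule subset_Zorn_nonempty)
    show "C \<noteq> {}" using AB v by (auto simp: C_def)
    fix K assume K: "K \<noteq> {}" "subset.chain C K"
    have ch: "X \<subseteq> Y \<or> Y \<subseteq> X" if "X \<in> K" "Y \<in> K" for X Y
      using K(2) that by (auto simp: subset.chain_def)
    have KC: "X \<in> C" if "X \<in> K" for X using K(2) that by (auto simp: subset.chain_def)
    have "cs.subspace (\<Union>K)"
    proof (rule cs.subspaceI)
      obtain X where "X \<in> K" using K(1) by blast
      then show "0 \<in> \<Union>K" using KC[of X] cs.subspace_0 by (auto simp: C_def stable_def)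
      fix x y c assume "x \<in> \<Union>K" "y \<in> \<Union>K"
      then obtain X Y where XY: "X \<in> K" "Y \<in> K" "x \<in> X" "y \<in> Y" by blast
      then obtain Z where Z: "Z \<in> K" "x \<in> Z" "y \<in> Z" using ch[of X Y] by blast
      then have "cs.subspace Z" using KC[of Z] by (auto simp: C_def stable_def)
      then show "x + y \<in> \<Union>K" using Z cs.subspace_add by blast
      show "c *\<^sub>C x \<in> \<Union>K" using Z \<open>cs.subspace Z\<close> cs.subspace_scale by blast
    qed
    moreover have "\<forall>x\<in>g. \<forall>w\<in>\<Union>K. x \<cdot> w \<in> \<Union>K" using KC by (fastforce simp: C_def stable_def)
    moreover have "B \<subseteq> \<Union>K" "\<Union>K \<subseteq> A" "v \<notin> \<Union>K" using KC K(1) by (auto simp: C_def)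
    ultimately show "\<Union>K \<in> C" by (simp add: C_def stable_def)
  qed
  then obtain U where U: "stable g U" "B \<subseteq> U" "U \<subseteq> A" "v \<notin> U"
    and max: "\<And>X. X \<in> C \<Longrightarrow> U \<subseteq> X \<Longrightarrow> X = U" by (auto simp: C_def)
  have subU: "cs.subspace U" and subA: "cs.subspace A" using U(1) AB(1) by (auto simp: stable_def)
  have gU: "x \<cdot> w \<in> U" if "x \<in> g" "w \<in> U" for x w using U(1) that by (auto simp: stable_def)
  have gA: "x \<cdot> w \<in> A" if "x \<in> g" "w \<in> A" for x w using AB(1) that by (auto simp: stable_def)
  \<comment> \<open>The vectors killed by the radical modulo \<open>U\<close>: a stable subspace, strictly larger than \<open>U\<close>, hence containing \<open>v\<close>.\<close>
  define W where "W = {w \<in> A. \<forall>x\<in>rad. x \<cdot> w \<in> U}"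
  have gW: "y \<cdot> w \<in> W" if "y \<in> g" "w \<in> W" for y w
  proof -
    have "x \<cdot> y \<cdot> w \<in> U" if x: "x \<in> rad" for x
    proof -
      have "x \<cdot> y \<cdot> w = y \<cdot> x \<cdot> w + br x y \<cdot> w" by (simp add: ap_br)
      moreover have "br x y \<cdot> w \<in> U" using rad_ideal(1)[OF x \<open>y \<in> g\<close>] \<open>w \<in> W\<close> by (simp add: W_def)
      moreover have "y \<cdot> x \<cdot> w \<in> U" using x \<open>y \<in> g\<close> \<open>w \<in> W\<close> gU by (simp add: W_def)
      ultimately show ?thesis using cs.subspace_add[OF subU] by simp
    qed
    then show ?thesis using gA that by (simp add: W_def)
  qed
  have UW: "U \<subseteq> W" using U(3) gU rad_in_g by (auto simp: W_def)
  have "cs.subspace W" using subA subU unfolding W_def cs.subspace_def by simp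
  then have stW: "stable g W" using gW by (simp add: stable_def)
  have "U \<subset> A" using U v(1) by blast
  then obtain w where "w \<in> A - U" "\<forall>x\<in>rad. x \<cdot> w \<in> U"
    using engel_rad stable_mono[OF AB(1) rad_in_g] stable_mono[OF U(1) rad_in_g] AB(3)
    unfolding engel_def by blast
  then have "W \<noteq> U" by (auto simp: W_def)
  then have "W \<notin> C" using max UW by blast
  then have "v \<in> W" using stW UW U(2) by (auto simp: C_def W_def)
  define w where "w k = f ^ k \<cdot> v" for k
  have wW: "w k \<in> W" for k
    unfolding w_def using power_in_invariant[of W f v k] gW efh(2) \<open>v \<in> W\<close> by blast
  have hw: "h \<cdot> w k = (l - 2 * of_nat k) *\<^sub>C w k" for k
  proof (induction k)
    case (Suc k)
    have "h \<cdot> f \<cdot> w k = f \<cdot> h \<cdot> w k + br h f \<cdot> w k" by (simp add: ap_br)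
    also have "\<dots> = ((l - 2 * of_nat k) + (- 2)) *\<^sub>C f \<cdot> w k"
      unfolding Suc efh(4) by (simp only: ap_cscale_right ap_cscale cscale_add_left)
    finally show ?case by (simp add: w_def algebra_simps)
  qed (simp add: w_def v)
  have ew: "e \<cdot> w (Suc k) - (of_nat (Suc k) * (l - of_nat k)) *\<^sub>C w k \<in> U" for k
  proof (induction k)
    case 0
    have "e \<cdot> w 1 - l *\<^sub>C w 0 = f \<cdot> e \<cdot> v + (br e f - h) \<cdot> v"
      using v(3) by (simp add: w_def ap_br)
    moreover have "f \<cdot> e \<cdot> v \<in> U" using v(4) U(2) gU efh(2) by blast
    moreover have "(br e f - h) \<cdot> v \<in> U" using \<open>v \<in> W\<close> efh(5) by (auto simp: W_def)
    ultimately show ?case using cs.subspace_add[OF subU] by simp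
  next
    case (Suc k)
    define c where "c = of_nat (Suc k) * (l - of_nat k)"
    define u where "u = e \<cdot> w (Suc k) - c *\<^sub>C w k"
    have "e \<cdot> w (Suc (Suc k)) = f \<cdot> e \<cdot> w (Suc k) + h \<cdot> w (Suc k) + (br e f - h) \<cdot> w (Suc k)"
      by (simp add: w_def ap_br)
    also have "f \<cdot> e \<cdot> w (Suc k) = f \<cdot> u + c *\<^sub>C w (Suc k)" by (simp add: u_def w_def)
    also have "h \<cdot> w (Suc k) = (l - 2 * of_nat (Suc k)) *\<^sub>C w (Suc k)" by (rule hw)
    finally have "e \<cdot> w (Suc (Suc k)) = f \<cdot> u + (br e f - h) \<cdot> w (Suc k)
        + (c + (l - 2 * of_nat (Suc k))) *\<^sub>C w (Suc k)" by (simp add: cscale_add_left)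
    moreover have "c + (l - 2 * of_nat (Suc k)) = of_nat (Suc (Suc k)) * (l - of_nat (Suc k))"
      by (simp add: c_def algebra_simps)
    ultimately have "e \<cdot> w (Suc (Suc k)) - (of_nat (Suc (Suc k)) * (l - of_nat (Suc k))) *\<^sub>C w (Suc k)
        = f \<cdot> u + (br e f - h) \<cdot> w (Suc k)" by (metis add_diff_cancel_right')
    moreover have "u \<in> U" using Suc unfolding u_def c_def .
    then have "f \<cdot> u \<in> U" by (rule gU[OF efh(2)])
    moreover have "(br e f - h) \<cdot> w (Suc k) \<in> U" using wW[of "Suc k"] efh(5) unfolding W_def by blast
    ultimately show ?case using cs.subspace_add[OF subU] by metis
  qed
  have wU: "w k \<notin> U" for k
  proof (induction k)
    case (Suc k)
    show ?case
    proof
      assume "w (Suc k) \<in> U"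
      define c where "c = of_nat (Suc k) * (l - of_nat k)"
      have "e \<cdot> w (Suc k) \<in> U" using \<open>w (Suc k) \<in> U\<close> gU efh(1) by blast
      then have "c *\<^sub>C w k \<in> U" using ew[of k] cs.subspace_diff[OF subU, of "e \<cdot> w (Suc k)"]
        unfolding c_def by fastforce
      moreover have "l \<noteq> of_nat k" using l by auto
      then have "c \<noteq> 0" by (simp only: c_def mult_eq_0_iff of_nat_eq_0_iff) simp
      ultimately have "(1 / c) *\<^sub>C c *\<^sub>C w k \<in> U" using cs.subspace_scale[OF subU] by blast
      then show False using Suc \<open>c \<noteq> 0\<close> by simp
    qed
  qed (use U(4) in \<open>simp add: w_def\<close>)
  \<comment> \<open>As \<open>l\<close> is not a natural number, no factor \<open>(k + 1) (l - k)\<close> vanishes, and \<open>h\<close> gets infinitely many eigenvalues.\<close>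
  have "l - 2 * of_nat k \<in> spec h" for k
  proof -
    have "w k \<noteq> 0" using wU cs.subspace_0[OF subU] by metis
    moreover have "w k \<in> M" using wW AB(3) by (auto simp: W_def)
    ultimately show ?thesis using hw by (auto simp: spec_def)
  qed
  then have "range (\<lambda>k::nat. l - 2 * of_nat k) \<subseteq> spec h" by blast
  moreover have "inj (\<lambda>k::nat. l - 2 * of_nat k)" by (rule injI) simp
  moreover have "finite (spec h)" using spec_genvec_finite efh(3) by simp
  ultimately show False using finite_subset range_inj_infinite by blast
qed

theorem solvable_or_sl2:
  assumes "\<And>i. \<not> dser g i \<subseteq> {0}"
  obtains e f h where "e \<in> g" "f \<in> g" "h \<in> g" "semisimple h" "h \<noteq> 0"
    "br h e = 2 *\<^sub>C e" "br h f = (- 2) *\<^sub>C f" "br e f - h \<in> rad"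
proof -
  obtain a where a: "a \<in> g" "semisimple a"
    "\<And>a'. a' \<in> g \<Longrightarrow> semisimple a' \<Longrightarrow> card (diffs a') \<le> card (diffs a)" by (rule ex_generic) blast
  interpret lie_generic E g a by unfold_locales (use a in auto)
  have "\<exists>al e. al \<noteq> 0 \<and> e \<in> g \<and> br a e = al *\<^sub>C e \<and> e \<notin> rad"
    using derived_in_rad solvable_if_derived_in_rad assms by blast
  then obtain al e where e: "al \<noteq> 0" "e \<in> g" "br a e = al *\<^sub>C e" "e \<notin> rad" by blast
  show thesis by (rule root_triple[OF e]) (use that e(2) in blast)
qed

end

section \<open>The ring of power series in countably many variables\<close>

text \<open>All variables \<open>x\<^sub>0, x\<^sub>1, \<dots>\<close> are present, which makes the ring independent of the number \<open>n\<close> of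
  variables; the ideal \<open>Zn n\<close> below consists of what has to be divided out for a given \<open>n\<close>.\<close>

typedef mps = "UNIV :: (nat multiset \<Rightarrow> complex) set"
  morphisms coef Mps ..

lemma coef_Mps [simp]: "coef (Mps f) = f"
  by (simp add: Mps_inverse)

lemma mps_eqI: "(\<And>m. coef f m = coef g m) \<Longrightarrow> f = g"
  by (metis coef_inject ext)

instantiation mps :: "{comm_ring_1, cspace}"
begin

definition zero_mps :: mps where "0 = Mps (\<lambda>m. 0)"
definition one_mps :: mps where "1 = Mps (\<lambda>m. if m = {#} then 1 else 0)"
definition plus_mps :: "mps \<Rightarrow> mps \<Rightarrow> mps" where "f + g = Mps (\<lambda>m. coef f m + coef g m)"
definition minus_mps :: "mps \<Rightarrow> mps \<Rightarrow> mps" where "f - g = Mps (\<lambda>m. coef f m - coef g m)"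
definition uminus_mps :: "mps \<Rightarrow> mps" where "- f = Mps (\<lambda>m. - coef f m)"
definition times_mps :: "mps \<Rightarrow> mps \<Rightarrow> mps" where
  "f * g = Mps (\<lambda>m. \<Sum>a | a \<subseteq># m. coef f a * coef g (m - a))"
definition cscale_mps :: "complex \<Rightarrow> mps \<Rightarrow> mps" where "c *\<^sub>C f = Mps (\<lambda>m. c * coef f m)"

instance
proof
  fix f g h :: mps and c d :: complex
  show "f * g * h = f * (g * h)"
    by (rule mps_eqI) (simp add: times_mps_def mpower_series_mult_assoc)
  show "f * g = g * f"
    unfolding times_mps_def using mpower_series_mult_comm[where f = "coef f" and g = "coef g"] by simp
  show "1 * f = f"
    by (rule mps_eqI) (simp only: times_mps_def one_mps_def coef_Mps mpower_series_mult_one)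
  show "(f + g) * h = f * h + g * h"
    by (rule mps_eqI) (simp add: times_mps_def plus_mps_def distrib_right sum.distrib)
  have "coef 0 {#} \<noteq> coef 1 {#}" by (simp add: zero_mps_def one_mps_def)
  then show "(0 :: mps) \<noteq> 1" by metis
qed (auto intro!: mps_eqI simp: plus_mps_def zero_mps_def uminus_mps_def minus_mps_def cscale_mps_def
      algebra_simps)

end

lemma coef_zero [simp]: "coef 0 m = 0"
  and coef_one: "coef 1 m = (if m = {#} then 1 else 0)"
  and coef_add [simp]: "coef (f + g) m = coef f m + coef g m"
  and coef_diff [simp]: "coef (f - g) m = coef f m - coef g m"
  and coef_uminus [simp]: "coef (- f) m = - coef f m"
  and coef_mult: "coef (f * g) m = (\<Sum>a | a \<subseteq># m. coef f a * coef g (m - a))"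
  and coef_scale [simp]: "coef (c *\<^sub>C f) m = c * coef f m"
  by (simp_all add: zero_mps_def one_mps_def plus_mps_def minus_mps_def uminus_mps_def
      times_mps_def cscale_mps_def)

lemma coef_sum: "coef (\<Sum>i\<in>A. f i) m = (\<Sum>i\<in>A. coef (f i) m)"
  by (induction A rule: infinite_finite_induct) auto

lemma scale_mult_left [simp]: "(c *\<^sub>C f) * g = c *\<^sub>C (f * g :: mps)"
  by (rule mps_eqI) (simp add: coef_mult sum_distrib_left mult.assoc)

lemma scale_mult_right [simp]: "f * (c *\<^sub>C g) = c *\<^sub>C (f * g :: mps)"
  by (metis mult.commute scale_mult_left)

text \<open>The ring as a module over itself: its subspaces are the ideals.\<close>

global_interpretation mi: Modules.module "(*) :: mps \<Rightarrow> mps \<Rightarrow> mps"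
  by standard (simp_all add: algebra_simps)

lemma ideal_scale: "mi.subspace J \<Longrightarrow> f \<in> J \<Longrightarrow> c *\<^sub>C f \<in> J"
  using mi.subspace_scale[of J f "c *\<^sub>C 1"] by simp

lemma ideal_mult_left: "mi.subspace J \<Longrightarrow> f \<in> J \<Longrightarrow> g * f \<in> J"
  by (rule mi.subspace_scale)

lemma ideal_mult_right: "mi.subspace J \<Longrightarrow> f \<in> J \<Longrightarrow> f * g \<in> J"
  by (metis mi.subspace_scale mult.commute)

lemma ideal_cs: "mi.subspace J \<Longrightarrow> cs.subspace J"
  unfolding cs.subspace_def by (simp add: mi.subspace_0 mi.subspace_add ideal_scale)

definition mon :: "nat multiset \<Rightarrow> mps" where
  "mon p = Mps (\<lambda>m. if m = p then 1 else 0)"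

lemma coef_mon: "coef (mon p) m = (if m = p then 1 else 0)"
  by (simp add: mon_def)

lemma mon_empty: "mon {#} = 1"
  by (rule mps_eqI) (simp add: coef_mon coef_one)

lemma coef_mon_mult: "coef (mon p * f) m = (if p \<subseteq># m then coef f (m - p) else 0)"
proof -
  have "coef (mon p * f) m = (\<Sum>a\<in>{a. a \<subseteq># m}. if a = p then coef f (m - p) else 0)"
    unfolding coef_mult by (intro sum.cong) (auto simp: coef_mon)
  also have "\<dots> = (if p \<subseteq># m then coef f (m - p) else 0)"
    using sum.delta[OF finite_submultisets[of m], of p "\<lambda>a. coef f (m - p)"] by simp
  finally show ?thesis .
qed

lemma mon_mult: "mon p * mon q = mon (p + q)"
  by (rule mps_eqI)
    (auto simp: coef_mon_mult coef_mon subset_mset.add_diff_inverse subset_mset.diff_add_assoc)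

section \<open>Powers of the maximal ideal\<close>

definition monoms :: "nat \<Rightarrow> nat \<Rightarrow> nat multiset set" where
  "monoms n k = {m. set_mset m \<subseteq> {..<n} \<and> size m < k}"

text \<open>The power series whose part in the variables below \<open>n\<close> lies in the \<open>k\<close>-th power of the maximal
  ideal; the other variables are thus treated as zero.\<close>

definition K :: "nat \<Rightarrow> nat \<Rightarrow> mps set" where
  "K n k = {f. \<forall>m\<in>monoms n k. coef f m = 0}"

definition Zn :: "nat \<Rightarrow> mps set" where
  "Zn n = {f. \<forall>m. set_mset m \<subseteq> {..<n} \<longrightarrow> coef f m = 0}"

lemma finite_monoms: "finite (monoms n k)"
proof -
  have "monoms n k \<subseteq> mset ` {xs. set xs \<subseteq> {..<n} \<and> length xs \<le> k}"
  proof
    fix m assume m: "m \<in> monoms n k"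
    obtain xs where "mset xs = m" using ex_mset by blast
    then show "m \<in> mset ` {xs. set xs \<subseteq> {..<n} \<and> length xs \<le> k}"
      using m by (intro image_eqI[of _ _ xs]) (auto simp: monoms_def)
  qed
  then show ?thesis using finite_lists_length_le[of "{..<n}" k] finite_surj by blast
qed

lemma K_0 [simp]: "K n 0 = UNIV"
  by (simp add: K_def monoms_def)

lemma K_antimono: "j \<le> k \<Longrightarrow> K n k \<subseteq> K n j"
  by (auto simp: K_def monoms_def)

lemma Zn_subset_K: "Zn n \<subseteq> K n k"
  by (auto simp: Zn_def K_def monoms_def)

lemma K_mult:
  assumes "f \<in> K n i" "g \<in> K n j" shows "f * g \<in> K n (i + j)"
proof -
  have "coef (f * g) m = 0" if m: "m \<in> monoms n (i + j)" for m
  proof -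
    have "coef f a * coef g (m - a) = 0" if a: "a \<subseteq># m" for a
    proof -
      have "size m = size a + size (m - a)" using a by (simp add: size_Diff_submset size_mset_mono)
      then have "size a < i \<or> size (m - a) < j" using m by (auto simp: monoms_def)
      moreover have "set_mset a \<subseteq> {..<n}" "set_mset (m - a) \<subseteq> {..<n}"
        using m set_mset_mono[OF a] set_mset_mono[OF diff_subset_eq_self[of m a]] by (auto simp: monoms_def)
      ultimately show ?thesis using assms by (auto simp: K_def monoms_def)
    qed
    then show ?thesis unfolding coef_mult by (intro sum.neutral) auto
  qed
  then show ?thesis by (simp add: K_def)
qed

lemma ideal_K: "mi.subspace (K n k)"
proof (rule mi.subspaceI)
  show "0 \<in> K n k" by (simp add: K_def)
  show "f + g \<in> K n k" if "f \<in> K n k" "g \<in> K n k" for f g using that by (simp add: K_def)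
  show "c * f \<in> K n k" if "f \<in> K n k" for c f using K_mult[of c n 0 f k] that by simp
qed

lemma subspace_K: "cs.subspace (K n k)"
  by (rule ideal_cs[OF ideal_K])

lemma mon_in_K: "k \<le> size m \<Longrightarrow> mon m \<in> K n k"
  by (auto simp: K_def coef_mon monoms_def)

text \<open>Each monomial of degree at least \<open>k\<close> is divisible by one of degree \<open>k\<close>; assigning such a divisor to
  every monomial sorts the terms of \<open>f\<close> into finitely many multiples of monomials of degree \<open>k\<close>.\<close>

lemma K_split:
  assumes "f \<in> K n k"
  obtains u where "u \<in> mi.span (mon ` {m. set_mset m \<subseteq> {..<n} \<and> size m = k})" "f - u \<in> Zn n"
proof -
  define D where "D = {m. set_mset m \<subseteq> {..<n} \<and> size m = k}"
  have finD: "finite D"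
    by (rule finite_subset[OF _ finite_monoms[of n "Suc k"]]) (auto simp: D_def monoms_def)
  define P where "P = {m. set_mset m \<subseteq> {..<n} \<and> k \<le> size m}"
  have "\<exists>d. d \<in> D \<and> d \<subseteq># m" if m: "m \<in> P" for m
  proof -
    obtain xs where xs: "mset xs = m" using ex_mset by blast
    have "m = mset (take k xs) + mset (drop k xs)" using xs by (metis append_take_drop_id mset_append)
    then have "mset (take k xs) \<subseteq># m" by simp
    moreover have "size (mset (take k xs)) = k" using m xs by (auto simp: P_def)
    moreover have "set_mset (mset (take k xs)) \<subseteq> {..<n}"
      using m xs set_take_subset[of k xs] unfolding P_def by fastforce
    ultimately show ?thesis unfolding D_def by blast
  qed
  then obtain ch where ch: "\<And>m. m \<in> P \<Longrightarrow> ch m \<in> D \<and> ch m \<subseteq># m" by metis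
  define fd where "fd d = Mps (\<lambda>q. if q + d \<in> P \<and> ch (q + d) = d then coef f (q + d) else 0)" for d
  define u where "u = (\<Sum>d\<in>D. fd d * mon d)"
  have "u \<in> mi.span (mon ` D)" unfolding u_def
    by (intro mi.span_sum mi.span_scale mi.span_base) auto
  moreover have "coef u m = coef f m" if m: "set_mset m \<subseteq> {..<n}" for m
  proof -
    have "coef u m = (\<Sum>d\<in>D. if d \<subseteq># m then coef (fd d) (m - d) else 0)"
      by (simp add: u_def coef_sum mult.commute[of _ "mon _"] coef_mon_mult)
    also have "\<dots> = (\<Sum>d\<in>D. if m \<in> P \<and> d = ch m then coef f m else 0)"
    proof (intro sum.cong refl)
      fix d assume "d \<in> D"
      show "(if d \<subseteq># m then coef (fd d) (m - d) else 0) = (if m \<in> P \<and> d = ch m then coef f m else 0)"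
        using ch[of m] by (auto simp: fd_def)
    qed
    also have "\<dots> = coef f m"
    proof (cases "m \<in> P")
      case True
      then show ?thesis using ch[OF True] finD by simp
    next
      case False
      then have "m \<in> monoms n k" using m by (auto simp: P_def monoms_def)
      then show ?thesis using False assms by (simp add: K_def)
    qed
    finally show ?thesis .
  qed
  then have "f - u \<in> Zn n" by (simp add: Zn_def)
  ultimately show thesis using that by (simp add: D_def)
qed

section \<open>Units and derivations\<close>

lemma power_in_K: "u \<in> K n 1 \<Longrightarrow> u ^ k \<in> K n k"
proof (induction k)
  case (Suc k)
  then show ?case using K_mult[of u n 1 "u ^ k" k] by simp
qed simp

text \<open>With \<open>f = c (1 - u)\<close> the inverse is the geometric series of \<open>u\<close> divided by \<open>c\<close>; as \<open>u\<close> has no constant term,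
  only the powers \<open>u\<^sup>k\<close> with \<open>k \<le> size m\<close> contribute to the coefficient at \<open>m\<close>.\<close>

lemma unit_if_constant_nonzero:
  assumes "coef f {#} \<noteq> 0" obtains g where "f * g = 1"
proof -
  define c where "c = coef f {#}"
  define u where "u = 1 - (1 / c) *\<^sub>C f"
  have ord: "coef (u ^ k) m = 0" if "size m < k" for k m
  proof -
    define n where "n = Suc (Max (insert 0 (set_mset m)))"
    have mn: "m \<in> monoms n k" using that by (auto simp: monoms_def n_def le_imp_less_Suc)
    have "u \<in> K n 1" using assms by (auto simp: K_def monoms_def u_def coef_one c_def)
    then show ?thesis using power_in_K[of u n k] mn by (simp add: K_def)
  qed
  define g where "g = Mps (\<lambda>m. coef (\<Sum>k\<le>size m. u ^ k) m)"
  have g: "coef g a = coef (\<Sum>k\<le>s. u ^ k) a" if "size a \<le> s" for a s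
  proof -
    have "(\<Sum>k\<le>s. coef (u ^ k) a) = (\<Sum>k\<le>size a. coef (u ^ k) a)"
      using that ord by (intro sum.mono_neutral_right) auto
    then show ?thesis by (simp add: g_def coef_sum)
  qed
  have "(1 - u) * g = 1"
  proof (rule mps_eqI)
    fix m
    have "coef ((1 - u) * g) m = coef ((1 - u) * (\<Sum>k\<le>size m. u ^ k)) m"
      unfolding coef_mult by (intro sum.cong) (auto simp: g size_mset_mono)
    also have "(1 - u) * (\<Sum>k\<le>size m. u ^ k) = 1 - u ^ Suc (size m)"
      by (simp add: sum_gp_basic)
    finally show "coef ((1 - u) * g) m = coef 1 m"
      using ord[of m "Suc (size m)"] by (simp only: coef_diff) simp
  qed
  then have "f * ((1 / c) *\<^sub>C g) = 1" by (simp add: u_def algebra_simps)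
  then show thesis by (rule that)
qed

text \<open>Partial derivative by the variable \<open>x\<^sub>i\<close>.\<close>

definition pd :: "nat \<Rightarrow> mps \<Rightarrow> mps" where
  "pd i f = Mps (\<lambda>m. of_nat (Suc (count m i)) * coef f (add_mset i m))"

lemma coef_pd: "coef (pd i f) m = of_nat (Suc (count m i)) * coef f (add_mset i m)"
  by (simp add: pd_def)

lemma pd_add: "pd i (f + g) = pd i f + pd i g"
  by (rule mps_eqI) (simp add: coef_pd algebra_simps)

lemma pd_scale: "pd i (c *\<^sub>C f) = c *\<^sub>C pd i f"
  by (rule mps_eqI) (simp add: coef_pd algebra_simps)

text \<open>Leibniz rule, one half: \<open>x\<^sub>i\<close> times the derivative multiplies a monomial by its exponent of \<open>x\<^sub>i\<close>, and
  exponents add up in products.\<close>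

lemma pd_weight_sum:
  fixes f g :: mps
  shows "(\<Sum>a | a \<subseteq># add_mset i m. of_nat (count a i) * (coef f a * coef g (add_mset i m - a)))
    = coef (pd i f * g) m"
proof -
  have "(\<Sum>a | a \<subseteq># add_mset i m. of_nat (count a i) * (coef f a * coef g (add_mset i m - a)))
      = (\<Sum>a | a \<subseteq># add_mset i m \<and> i \<in># a. of_nat (count a i) * (coef f a * coef g (add_mset i m - a)))"
    by (rule sum.mono_neutral_right) (auto simp: finite_submultisets not_in_iff)
  also have "\<dots> = (\<Sum>a | a \<subseteq># m. coef (pd i f) a * coef g (m - a))"
  proof (rule sum.reindex_bij_witness[of _ "add_mset i" "\<lambda>a. a - {#i#}"])
    fix a assume a: "a \<in> {a. a \<subseteq># add_mset i m \<and> i \<in># a}"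
    then obtain b where b: "a = add_mset i b" by (metis mem_Collect_eq mset_add)
    show "add_mset i (a - {#i#}) = a" "a - {#i#} \<in> {a. a \<subseteq># m}" using a b by auto
    show "coef (pd i f) (a - {#i#}) * coef g (m - (a - {#i#}))
        = of_nat (count a i) * (coef f a * coef g (add_mset i m - a))"
      by (simp add: b coef_pd)
  qed auto
  finally show ?thesis by (simp add: coef_mult)
qed

lemma pd_mult: "pd i (f * g) = pd i f * g + f * pd i g"
proof (rule mps_eqI)
  fix m
  let ?S = "{a. a \<subseteq># add_mset i m}"
  have "coef (pd i (f * g)) m = (\<Sum>a\<in>?S. of_nat (Suc (count m i)) * (coef f a * coef g (add_mset i m - a)))"
    by (simp only: coef_pd coef_mult sum_distrib_left)
  also have "\<dots> = (\<Sum>a\<in>?S. of_nat (count a i) * (coef f a * coef g (add_mset i m - a))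
      + of_nat (count (add_mset i m - a) i) * (coef g (add_mset i m - a) * coef f a))"
  proof (intro sum.cong refl)
    fix a assume "a \<in> ?S"
    then have "count a i \<le> Suc (count m i)" using mset_subset_eq_count[of a "add_mset i m" i] by simp
    then have "Suc (count m i) = count a i + count (add_mset i m - a) i" by simp
    then have "of_nat (Suc (count m i)) = (of_nat (count a i) + of_nat (count (add_mset i m - a) i) :: complex)"
      by (metis of_nat_add)
    then show "of_nat (Suc (count m i)) * (coef f a * coef g (add_mset i m - a)) =
       of_nat (count a i) * (coef f a * coef g (add_mset i m - a))
      + of_nat (count (add_mset i m - a) i) * (coef g (add_mset i m - a) * coef f a)"
      by (simp only: distrib_right mult.commute[of "coef g _"])
  qed
  also have "\<dots> = coef (pd i f * g) m
      + (\<Sum>a\<in>?S. of_nat (count (add_mset i m - a) i) * (coef g (add_mset i m - a) * coef f a))"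
    by (simp only: sum.distrib pd_weight_sum)
  also have "(\<Sum>a\<in>?S. of_nat (count (add_mset i m - a) i) * (coef g (add_mset i m - a) * coef f a))
      = (\<Sum>a\<in>?S. of_nat (count a i) * (coef g a * coef f (add_mset i m - a)))"
    by (rule sum.reindex_bij_witness[of _ "\<lambda>a. add_mset i m - a" "\<lambda>a. add_mset i m - a"])
      (auto simp: subset_mset.diff_diff_right)
  finally show "coef (pd i (f * g)) m = coef (pd i f * g + f * pd i g) m"
    by (simp only: pd_weight_sum coef_add mult.commute[of f])
qed

lemma pd_in_K: "i < n \<Longrightarrow> f \<in> K n (Suc k) \<Longrightarrow> pd i f \<in> K n k"
  by (auto simp: K_def monoms_def coef_pd)

lemma pd_var: "pd i (mon {#j#}) = (if i = j then 1 else 0)"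
  by (rule mps_eqI) (auto simp: coef_pd coef_mon coef_one)

section \<open>Independence modulo a subspace\<close>

text \<open>Linear independence of the classes of the vectors in the quotient by \<open>B\<close>, and of the vectors among
  each other.\<close>

definition indep_mod :: "'v::cspace set \<Rightarrow> 'v set \<Rightarrow> bool" where
  "indep_mod B Y \<longleftrightarrow> finite Y \<and> (\<forall>c. (\<Sum>y\<in>Y. c y *\<^sub>C y) \<in> B \<longrightarrow> (\<forall>y\<in>Y. c y = 0))"

text \<open>Adding a basis of \<open>B\<close> reduces independence modulo \<open>B\<close> to ordinary independence, and with it the
  exchange and dimension arguments below.\<close>

lemma indep_mod_iff_independent:
  assumes B0: "finite B0" "cs.independent B0" "cs.span B0 = B" and Y: "finite Y"
  shows "indep_mod B Y \<longleftrightarrow> cs.independent (Y \<union> B0) \<and> Y \<inter> B0 = {}"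
proof
  assume ind: "indep_mod B Y"
  have disj: "Y \<inter> B0 = {}"
  proof (rule ccontr)
    assume "Y \<inter> B0 \<noteq> {}"
    then obtain y where y: "y \<in> Y" "y \<in> B0" by blast
    have "(\<Sum>x\<in>Y. (if x = y then 1 else 0) *\<^sub>C x) = (\<Sum>x\<in>Y. if x = y then y else 0)"
      by (intro sum.cong) auto
    also have "\<dots> = y" using y Y by simp
    finally have "(\<Sum>x\<in>Y. (if x = y then 1 else 0) *\<^sub>C x) \<in> B" using y B0 cs.span_base by auto
    then have "\<forall>x\<in>Y. (if x = y then 1 else 0 :: complex) = 0"
      using ind[unfolded indep_mod_def, THEN conjunct2, rule_format, of "\<lambda>x. if x = y then 1 else 0"] by simp
    then show False using y by auto
  qed
  have "\<not> cs.dependent (Y \<union> B0)"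
  proof
    assume "cs.dependent (Y \<union> B0)"
    then obtain u where u: "\<exists>v\<in>Y \<union> B0. u v \<noteq> 0" "(\<Sum>v\<in>Y \<union> B0. u v *\<^sub>C v) = 0"
      using cs.dependent_finite[of "Y \<union> B0"] Y B0(1) by auto
    have s: "(\<Sum>v\<in>Y. u v *\<^sub>C v) + (\<Sum>v\<in>B0. u v *\<^sub>C v) = 0"
      using u(2) sum.union_disjoint[OF Y B0(1) disj, of "\<lambda>v. u v *\<^sub>C v"] by simp
    have "(\<Sum>v\<in>B0. (- u v) *\<^sub>C v) \<in> B"
      unfolding B0(3)[symmetric] by (intro cs.span_sum cs.span_scale cs.span_base)
    moreover have "(\<Sum>v\<in>Y. u v *\<^sub>C v) = (\<Sum>v\<in>B0. (- u v) *\<^sub>C v)"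
      using s by (simp add: sum_negf eq_neg_iff_add_eq_0)
    ultimately have "(\<Sum>v\<in>Y. u v *\<^sub>C v) \<in> B" by simp
    then have 0: "\<forall>y\<in>Y. u y = 0" using ind unfolding indep_mod_def by blast
    then have "(\<Sum>v\<in>B0. u v *\<^sub>C v) = 0" using s by simp
    then have "\<forall>v\<in>B0. u v = 0" using B0(1,2) cs.independentD[of B0 B0 u] by auto
    then show False using u(1) 0 by blast
  qed
  then show "cs.independent (Y \<union> B0) \<and> Y \<inter> B0 = {}" using disj by blast
next
  assume ind: "cs.independent (Y \<union> B0) \<and> Y \<inter> B0 = {}"
  have "\<forall>y\<in>Y. c y = 0" if c: "(\<Sum>y\<in>Y. c y *\<^sub>C y) \<in> B" for c
  proof -
    obtain r where r: "(\<Sum>y\<in>Y. c y *\<^sub>C y) = (\<Sum>b\<in>B0. r b *\<^sub>C b)"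
      using c unfolding B0(3)[symmetric] cs.span_finite[OF B0(1)] by blast
    define u where "u v = (if v \<in> Y then c v else - r v)" for v
    have "(\<Sum>v\<in>Y \<union> B0. u v *\<^sub>C v) = (\<Sum>v\<in>Y. u v *\<^sub>C v) + (\<Sum>v\<in>B0. u v *\<^sub>C v)"
      using ind Y B0(1) by (intro sum.union_disjoint) auto
    also have "(\<Sum>v\<in>Y. u v *\<^sub>C v) = (\<Sum>b\<in>B0. r b *\<^sub>C b)" unfolding r[symmetric] by (simp add: u_def)
    also have "(\<Sum>v\<in>B0. u v *\<^sub>C v) = (\<Sum>b\<in>B0. - (r b *\<^sub>C b))"
      using ind by (intro sum.cong) (auto simp: u_def)
    finally have "(\<Sum>v\<in>Y \<union> B0. u v *\<^sub>C v) = 0" by (simp add: sum_negf)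
    then have "\<forall>v\<in>Y \<union> B0. u v = 0"
      using ind Y B0(1) cs.independentD[of "Y \<union> B0" "Y \<union> B0" u] by auto
    then show ?thesis by (metis UnI1 u_def)
  qed
  then show "indep_mod B Y" using Y by (auto simp: indep_mod_def)
qed

lemma finite_basis_of_subspace:
  assumes "cs.subspace B" "finite F" "B \<subseteq> cs.span F"
  obtains B0 where "finite B0" "cs.independent B0" "cs.span B0 = B"
proof -
  obtain B0 where B0: "B0 \<subseteq> B" "cs.independent B0" "B \<subseteq> cs.span B0"
    using cs.maximal_independent_subset by blast
  have "finite B0" using cs.independent_span_bound[OF assms(2) B0(2)] B0(1) assms(3) by blast
  moreover have "cs.span B0 = B" using B0 assms(1) by (simp add: cs.span_minimal subset_antisym)
  ultimately show thesis using that B0 by blast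
qed

lemma span_Un_span: "cs.span (A \<union> cs.span B) = cs.span (A \<union> B)"
proof
  have "A \<union> cs.span B \<subseteq> cs.span (A \<union> B)"
    using cs.span_superset[of "A \<union> B"] cs.span_mono[of B "A \<union> B"] by auto
  then show "cs.span (A \<union> cs.span B) \<subseteq> cs.span (A \<union> B)" by (intro cs.span_minimal cs.subspace_span)
  show "cs.span (A \<union> B) \<subseteq> cs.span (A \<union> cs.span B)"
    using cs.span_superset[of B] by (intro cs.span_mono) auto
qed

lemma indep_mod_card:
  assumes B: "cs.subspace B" "finite F" "B \<subseteq> cs.span F"
    and Y: "indep_mod B Y" "Y \<subseteq> cs.span (G \<union> B)" "finite G"
  shows "card Y \<le> card G"
proof -
  obtain B0 where B0: "finite B0" "cs.independent B0" "cs.span B0 = B"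
    by (rule finite_basis_of_subspace[OF B])
  have fY: "finite Y" using Y(1) by (simp add: indep_mod_def)
  have ind: "cs.independent (Y \<union> B0)" "Y \<inter> B0 = {}"
    using indep_mod_iff_independent[OF B0 fY] Y(1) by auto
  have "Y \<subseteq> cs.span (G \<union> B0)" using Y(2) span_Un_span[of G B0] B0(3) by simp
  moreover have "B0 \<subseteq> cs.span (G \<union> B0)" using cs.span_superset[of "G \<union> B0"] by blast
  ultimately have "card (Y \<union> B0) \<le> card (G \<union> B0)"
    using cs.independent_span_bound[of "G \<union> B0" "Y \<union> B0"] ind Y(3) B0(1) by auto
  also have "\<dots> \<le> card G + card B0" by (rule card_Un_le)
  finally show ?thesis using ind fY B0(1) by (simp add: card_Un_disjoint)
qed

text \<open>Exchange lemma in a quotient: the vectors of \<open>Y1\<close> replace as many vectors of \<open>Y2\<close>.\<close>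

lemma steinitz_mod:
  assumes B: "cs.subspace B" "finite F" "B \<subseteq> cs.span F"
    and Y1: "indep_mod B Y1" "Y1 \<subseteq> cs.span (Y2 \<union> B)" and Y2: "indep_mod B Y2"
  obtains C where "C \<subseteq> Y2" "card C + card Y1 = card Y2" "Y2 \<subseteq> cs.span (C \<union> Y1 \<union> B)"
proof -
  obtain B0 where B0: "finite B0" "cs.independent B0" "cs.span B0 = B"
    by (rule finite_basis_of_subspace[OF B])
  have fin: "finite Y1" "finite Y2" using Y1 Y2 by (auto simp: indep_mod_def)
  have i1: "cs.independent (Y1 \<union> B0)" "Y1 \<inter> B0 = {}"
    using indep_mod_iff_independent[OF B0 fin(1)] Y1(1) by auto
  have i2: "cs.independent (Y2 \<union> B0)" "Y2 \<inter> B0 = {}"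
    using indep_mod_iff_independent[OF B0 fin(2)] Y2 by auto
  obtain B' where B': "Y1 \<union> B0 \<subseteq> B'" "B' \<subseteq> Y1 \<union> B0 \<union> Y2" "cs.independent B'"
    "Y1 \<union> B0 \<union> Y2 \<subseteq> cs.span B'"
    using cs.maximal_independent_subset_extend[of "Y1 \<union> B0" "Y1 \<union> B0 \<union> Y2"] i1 by blast
  have finB': "finite B'" using B'(2) fin B0(1) finite_subset by blast
  define C where "C = B' - (Y1 \<union> B0)"
  have C: "C \<subseteq> Y2" "B' = C \<union> (Y1 \<union> B0)" using B' by (auto simp: C_def)
  have "Y1 \<subseteq> cs.span (Y2 \<union> B0)" using Y1(2) span_Un_span[of Y2 B0] B0(3) by simp
  then have "B' \<subseteq> cs.span (Y2 \<union> B0)"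
    using B'(2) cs.span_superset[of "Y2 \<union> B0"] by blast
  then have "card B' \<le> card (Y2 \<union> B0)"
    using cs.independent_span_bound[of "Y2 \<union> B0" B'] B'(3) fin B0 by auto
  moreover have "card (Y2 \<union> B0) \<le> card B'"
    using cs.independent_span_bound[OF finB' i2(1)] B'(4) by blast
  ultimately have "card B' = card (Y2 \<union> B0)" by simp
  moreover have "card B' = card C + (card Y1 + card B0)"
    unfolding C(2) using fin B0(1) finB' i1(2)
    by (subst card_Un_disjoint) (auto simp: C_def card_Un_disjoint)
  moreover have "card (Y2 \<union> B0) = card Y2 + card B0"
    using fin B0(1) i2(2) by (simp add: card_Un_disjoint)
  ultimately have "card C + card Y1 = card Y2" by simp
  moreover have "Y2 \<subseteq> cs.span (C \<union> Y1 \<union> B)"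
    using B'(4) span_Un_span[of "C \<union> Y1" B0] unfolding C(2) B0(3) by (simp add: Un_assoc)
  ultimately show thesis using that C(1) by blast
qed

lemma ex_indep_mod:
  assumes B: "cs.subspace B" "finite F" "B \<subseteq> cs.span F" and G: "G \<subseteq> cs.span F"
  obtains Y where "Y \<subseteq> G" "indep_mod B Y" "G \<subseteq> cs.span (Y \<union> B)"
proof -
  obtain B0 where B0: "finite B0" "cs.independent B0" "cs.span B0 = B"
    by (rule finite_basis_of_subspace[OF B])
  obtain B' where B': "B0 \<subseteq> B'" "B' \<subseteq> B0 \<union> G" "cs.independent B'" "B0 \<union> G \<subseteq> cs.span B'"
    using cs.maximal_independent_subset_extend[of B0 "B0 \<union> G"] B0(2) by blast
  have "B0 \<subseteq> cs.span F" using B0(3) B(3) cs.span_superset[of B0] by blast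
  then have "finite B'" using cs.independent_span_bound[OF assms(2) B'(3)] B'(2) G by blast
  define Y where "Y = B' - B0"
  have Y: "Y \<union> B0 = B'" "Y \<inter> B0 = {}" "finite Y" "Y \<subseteq> G" using B' \<open>finite B'\<close> by (auto simp: Y_def)
  have "indep_mod B Y" using indep_mod_iff_independent[OF B0 Y(3)] Y B'(3) by simp
  moreover have "G \<subseteq> cs.span (Y \<union> B)" using B'(4) span_Un_span[of Y B0] Y(1) B0(3) by simp
  ultimately show thesis using that Y(4) by blast
qed

lemma indep_mod_subset:
  assumes "indep_mod B Y" "X \<subseteq> Y" shows "indep_mod B X"
  unfolding indep_mod_def
proof (intro conjI allI impI)
  have fY: "finite Y" using assms(1) by (simp add: indep_mod_def)
  show "finite X" using fY assms(2) finite_subset by blast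
  fix c assume c: "(\<Sum>y\<in>X. c y *\<^sub>C y) \<in> B"
  define d where "d y = (if y \<in> X then c y else 0)" for y
  have "(\<Sum>y\<in>Y. d y *\<^sub>C y) = (\<Sum>y\<in>X. c y *\<^sub>C y)"
    using fY assms(2) by (intro sum.mono_neutral_cong_right) (auto simp: d_def)
  then have "\<forall>y\<in>Y. d y = 0" using assms(1) c unfolding indep_mod_def by metis
  then show "\<forall>y\<in>X. c y = 0" using assms(2) by (metis d_def subsetD)
qed

lemma indep_mod_notin:
  assumes "indep_mod B Y" "y \<in> Y" shows "y \<notin> B"
proof
  assume y: "y \<in> B"
  have "indep_mod B {y}" using indep_mod_subset[OF assms(1), of "{y}"] assms(2) by simp
  then show False
    using y by (auto simp: indep_mod_def dest: spec[of _ "\<lambda>_. 1"])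
qed

text \<open>An eigenvector is congruent to the part of any representation by eigenvectors that has the
  same eigenvalue.\<close>

lemma eigen_part_mod:
  assumes B: "cs.subspace B" "\<And>v. v \<in> B \<Longrightarrow> T \<cdot> v \<in> B"
    and G: "\<And>u. u \<in> G \<Longrightarrow> \<exists>l. T \<cdot> u = l *\<^sub>C u"
    and v: "v \<in> cs.span (G \<union> B)" "T \<cdot> v = m *\<^sub>C v"
  shows "v \<in> cs.span ({u \<in> G. T \<cdot> u = m *\<^sub>C u} \<union> B)"
proof -
  obtain x b where xb: "v = x + b" "x \<in> cs.span G" "b \<in> B"
    using v(1) B(1) unfolding cs.span_Un by (auto simp: cs.span_eq_iff[THEN iffD2])
  obtain t r where t: "finite t" "t \<subseteq> G" "x = (\<Sum>u\<in>t. r u *\<^sub>C u)"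
    using xb(2) unfolding cs.span_explicit by blast
  obtain l where l: "\<And>u. u \<in> G \<Longrightarrow> T \<cdot> u = l u *\<^sub>C u" using G by metis
  define F where "F = insert m (l ` t)"
  define w where "w k = (\<Sum>u\<in>{u \<in> t. l u = k}. r u *\<^sub>C u)" for k
  define z where "z k = w k - (if k = m then v else 0)" for k
  have finF: "finite F" using t by (simp add: F_def)
  have "(\<Sum>k\<in>F. w k) = x"
    unfolding w_def t(3) F_def using t(1) by (intro sum.group) auto
  then have "(\<Sum>k\<in>F. z k) = - b" using finF xb(1) by (simp add: z_def sum_subtractf F_def)
  then have sumB: "(\<Sum>k\<in>F. z k) \<in> B" using xb(3) B(1) cs.subspace_neg by metis
  have Tw: "T \<cdot> w k = k *\<^sub>C w k" for k
    unfolding w_def ap_sum_right cs.scale_sum_right using t(2)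
    by (intro sum.cong) (auto simp: l mult.commute)
  have "T \<cdot> z k = k *\<^sub>C z k" if "k \<in> F" for k
    using v(2) by (simp add: z_def Tw cs.scale_right_diff_distrib)
  then have "\<forall>k\<in>F. z k \<in> B" by (rule eigen_components_in[OF finF _ sumB B])
  then have "z m \<in> B" by (simp add: F_def)
  then have "- z m \<in> cs.span ({u \<in> G. T \<cdot> u = m *\<^sub>C u} \<union> B)"
    using B(1) by (intro cs.span_base) (simp add: cs.subspace_neg)
  moreover have "w m \<in> cs.span ({u \<in> G. T \<cdot> u = m *\<^sub>C u} \<union> B)"
    unfolding w_def using t(2) l by (intro cs.span_sum cs.span_scale cs.span_base) auto
  moreover have "v = - z m + w m" by (simp add: z_def)
  ultimately show ?thesis using cs.span_add by metis
qed

section \<open>Truncated power series and their derivations\<close>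

definition trunc :: "nat \<Rightarrow> nat \<Rightarrow> mps endo" where
  "trunc n N = Endo (\<lambda>f. Mps (\<lambda>m. if m \<in> monoms n N then coef f m else 0))"

lemma coef_trunc: "coef (trunc n N \<cdot> f) m = (if m \<in> monoms n N then coef f m else 0)"
  unfolding trunc_def by (subst ap_Endo) (auto simp: lin_def intro!: mps_eqI)

lemma trunc_zero_iff: "trunc n N \<cdot> f = 0 \<longleftrightarrow> f \<in> K n N"
proof
  assume "trunc n N \<cdot> f = 0"
  then have "coef (trunc n N \<cdot> f) m = 0" for m by simp
  then show "f \<in> K n N" unfolding coef_trunc K_def by (auto split: if_split_asm) metis
qed (auto intro!: mps_eqI simp: coef_trunc K_def)

lemma trunc_expand: "trunc n N \<cdot> f = (\<Sum>m\<in>monoms n N. coef f m *\<^sub>C mon m)"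
proof (rule mps_eqI)
  fix p
  have "coef (\<Sum>m\<in>monoms n N. coef f m *\<^sub>C mon m) p = (\<Sum>m\<in>monoms n N. if m = p then coef f p else 0)"
    unfolding coef_sum by (intro sum.cong) (auto simp: coef_mon)
  then show "coef (trunc n N \<cdot> f) p = coef (\<Sum>m\<in>monoms n N. coef f m *\<^sub>C mon m) p"
    by (simp add: coef_trunc finite_monoms)
qed

lemma fin_proj_trunc: "fin_proj (trunc n N)"
proof
  show "trunc n N * trunc n N = trunc n N"
    by (intro endo_eqI mps_eqI) (simp add: coef_trunc)
  have "range (ap (trunc n N)) \<subseteq> cs.span (mon ` monoms n N)"
    unfolding trunc_expand
    by (intro image_subsetI cs.span_sum cs.span_scale cs.span_base imageI)
  moreover have "finite (mon ` monoms n N)" using finite_monoms by simp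
  ultimately show "\<exists>B. finite B \<and> range (ap (trunc n N)) \<subseteq> cs.span B"
    by blast
qed

text \<open>\<open>J\<close> is the preimage of the defining ideal: it contains the \<open>N\<close>-th power of the maximal ideal and
  lies in the \<open>k\<close>-th. Truncating at degree \<open>N + 1\<close> keeps the finite dimensional quotient
  \<open>J / \<mm> J\<close> visible.\<close>

locale presentation =
  fixes n k N :: nat and J :: "mps set"
  assumes ideal_J: "mi.subspace J" and K_sub_J: "K n N \<subseteq> J" and J_sub_K: "J \<subseteq> K n k" and k2: "2 \<le> k"
begin

definition E :: "mps endo" where "E = trunc n (Suc N)"

abbreviation TK :: "mps set" where "TK \<equiv> K n (Suc N)"

sublocale fin_proj E
  unfolding E_def by (rule fin_proj_trunc)

lemma E_zero_iff: "E \<cdot> f = 0 \<longleftrightarrow> f \<in> TK"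
  by (simp add: E_def trunc_zero_iff)

lemma E_eq_iff: "E \<cdot> f = E \<cdot> h \<longleftrightarrow> f - h \<in> TK"
  by (simp flip: E_zero_iff)

lemma E_diff_TK: "f - E \<cdot> f \<in> TK" "E \<cdot> f - f \<in> TK"
  by (simp_all flip: E_eq_iff add: M_fix)

lemma E_mult_E: "E \<cdot> (E \<cdot> f * h) = E \<cdot> (f * h)" "E \<cdot> (f * E \<cdot> h) = E \<cdot> (f * h)"
proof -
  have "(E \<cdot> f - f) * h \<in> TK" "f * (E \<cdot> h - h) \<in> TK"
    using ideal_mult_left[OF ideal_K] ideal_mult_right[OF ideal_K] E_diff_TK(2) by blast+
  then show "E \<cdot> (E \<cdot> f * h) = E \<cdot> (f * h)" "E \<cdot> (f * E \<cdot> h) = E \<cdot> (f * h)"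
    by (simp_all add: E_eq_iff algebra_simps)
qed

lemma TK_sub_J: "TK \<subseteq> J"
  using K_antimono[of N "Suc N" n] K_sub_J by auto

lemma TK_sub: "i \<le> Suc N \<Longrightarrow> TK \<subseteq> K n i"
  by (rule K_antimono)

lemma E_in_ideal:
  assumes "mi.subspace A" "TK \<subseteq> A" shows "E \<cdot> f \<in> A \<longleftrightarrow> f \<in> A"
  using mi.subspace_diff[OF assms(1), of "E \<cdot> f" "E \<cdot> f - f"] mi.subspace_add[OF assms(1), of "E \<cdot> f - f" f]
    mi.subspace_diff[OF assms(1), of f "f - E \<cdot> f"] E_diff_TK assms(2)
  by (auto simp: algebra_simps)

definition derv :: "mps endo \<Rightarrow> bool" where
  "derv T \<longleftrightarrow> (\<forall>f h. T \<cdot> (f * h) = E \<cdot> (T \<cdot> f * h + f * T \<cdot> h))"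

text \<open>The derivations of the truncated ring that preserve the maximal ideal and \<open>J\<close>. Besides the
  quotient by \<open>J\<close> they act on \<open>J / \<mm> J\<close>, the space of equations.\<close>

definition g :: "mps endo set" where
  "g = {T \<in> ops. derv T \<and> (\<forall>f\<in>J. T \<cdot> f \<in> J) \<and> (\<forall>f\<in>K n 1. T \<cdot> f \<in> K n 1)}"

lemma op_TK: "T \<in> ops \<Longrightarrow> f \<in> TK \<Longrightarrow> T \<cdot> f = 0"
  by (metis E_zero_iff ap_zero_right ops_E)

lemma derv_add: "derv S \<Longrightarrow> derv T \<Longrightarrow> derv (S + T)"
  unfolding derv_def by (simp add: algebra_simps)

lemma derv_scale: "derv T \<Longrightarrow> derv (c *\<^sub>C T)"
  unfolding derv_def by (simp add: cscale_add_right)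

lemma derv_br:
  assumes "S \<in> ops" "T \<in> ops" "derv S" "derv T" shows "derv (br S T)"
proof -
  have 1: "S \<cdot> T \<cdot> (f * h) = E \<cdot> (S \<cdot> T \<cdot> f * h + T \<cdot> f * S \<cdot> h + (S \<cdot> f * T \<cdot> h + f * S \<cdot> T \<cdot> h))"
    if "S \<in> ops" "T \<in> ops" "derv S" "derv T" for S T f h
  proof -
    have "S \<cdot> T \<cdot> (f * h) = S \<cdot> (T \<cdot> f * h + f * T \<cdot> h)"
      using that(1,4) by (simp add: derv_def ops_E del: ap_add_right)
    then show ?thesis using that(3) by (simp add: derv_def)
  qed
  show ?thesis
    unfolding derv_def ap_br 1[OF assms] 1[OF assms(2,1,4,3)] by (simp add: algebra_simps)
qed

lemma ideal_K1: "mi.subspace (K n 1)"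
  by (rule ideal_K)

lemma subspace_J: "cs.subspace J"
  by (rule ideal_cs[OF ideal_J])

lemma lie_sub_g: "lie_sub g"
  unfolding lie_sub_def
proof (intro conjI ballI)
  show "cs.subspace g"
  proof (rule cs.subspaceI)
    have "derv 0" by (simp add: derv_def)
    then show "0 \<in> g"
      using cs.subspace_0[OF subspace_ops] cs.subspace_0[OF subspace_J] cs.subspace_0[OF subspace_K]
      by (simp add: g_def)
    fix S T c assume S: "S \<in> g" and T: "T \<in> g"
    show "S + T \<in> g" using S T cs.subspace_add[OF subspace_J] cs.subspace_add[OF subspace_K]
      by (simp add: g_def ops_add derv_add)
    show "c *\<^sub>C S \<in> g" using S cs.subspace_scale[OF subspace_J] cs.subspace_scale[OF subspace_K]
      by (simp add: g_def ops_scale derv_scale)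
  qed
  fix S T assume "S \<in> g" "T \<in> g"
  then show "br S T \<in> g" using cs.subspace_diff[OF subspace_J] cs.subspace_diff[OF subspace_K]
    by (simp add: g_def br_ops derv_br ap_br)
qed

text \<open>Generalized eigenvalues of a derivation add up in products: \<open>x - (l + m)\<close> applied to \<open>u v\<close> gives
  \<open>((x - l) u) v + u ((x - m) v)\<close>, and repeated application exhausts one of the two factors.\<close>

lemma genvec_prod:
  assumes x: "x \<in> ops" "derv x"
  shows "shift x l ^ i \<cdot> u = 0 \<Longrightarrow> shift x m ^ j \<cdot> v = 0 \<Longrightarrow> genvec x (l + m) (E \<cdot> (u * v))"
proof (induction "i + j" arbitrary: i j u v rule: less_induct)
  case less
  show ?case
  proof (cases "i = 0 \<or> j = 0")
    case True
    then have "u * v = 0" using less.prems by auto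
    then show ?thesis by simp
  next
    case False
    then obtain i' j' where ij: "i = Suc i'" "j = Suc j'" using not0_implies_Suc by blast
    have "genvec x (l + m) (E \<cdot> (shift x l \<cdot> u * v))"
      using less.prems ij by (intro less.hyps[of i' j]) (simp_all only: ap_power_Suc2)
    moreover have "genvec x (l + m) (E \<cdot> (u * shift x m \<cdot> v))"
      using less.prems ij by (intro less.hyps[of i j']) (simp_all only: ap_power_Suc2)
    moreover have "shift x (l + m) \<cdot> E \<cdot> (u * v) = E \<cdot> (shift x l \<cdot> u * v) + E \<cdot> (u * shift x m \<cdot> v)"
      using x by (simp add: ops_E derv_def algebra_simps cscale_add_left)
    ultimately have "genvec x (l + m) (shift x (l + m) \<cdot> E \<cdot> (u * v))" using genvec_add by metis
    then obtain r where "shift x (l + m) ^ r \<cdot> shift x (l + m) \<cdot> E \<cdot> (u * v) = 0" by (auto simp: genvec_def)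
    then have "shift x (l + m) ^ Suc r \<cdot> E \<cdot> (u * v) = 0" by (simp only: ap_power_Suc2)
    then show ?thesis unfolding genvec_def by blast
  qed
qed

text \<open>Up to truncation, an \<open>x\<close>-invariant subspace is spanned by generalized eigenvectors of \<open>x\<close>, and \<open>y\<close>
  multiplies each of these by a scalar.\<close>

lemma replica_invariant:
  assumes x: "x \<in> ops" and y: "y \<in> ops" "\<And>m v. v \<in> M \<Longrightarrow> genvec x m v \<Longrightarrow> y \<cdot> v = ps m *\<^sub>C v"
    and A: "mi.subspace A" "TK \<subseteq> A" "\<And>f. f \<in> A \<Longrightarrow> x \<cdot> f \<in> A" and f: "f \<in> A"
  shows "y \<cdot> f \<in> A"
proof -
  define U where "U = M \<inter> A"
  have subU: "cs.subspace U" unfolding U_def using subspace_M ideal_cs[OF A(1)] by (rule cs.subspace_inter)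
  have xU: "x \<cdot> u \<in> U" if "u \<in> U" for u using that A(3) ops_in_M[OF x] by (simp add: U_def)
  obtain F where F: "finite F" "M \<subseteq> cs.span F" by (rule M_finite_span)
  have "E \<cdot> f \<in> U" using E_in_ideal[OF A(1,2)] f by (simp add: U_def)
  moreover have "U \<subseteq> cs.span F" using F(2) by (auto simp: U_def)
  ultimately have "E \<cdot> f \<in> cs.span {u \<in> U. \<exists>l. genvec x l u}"
    using in_span_genvec[OF subU xU F(1)] by blast
  then have "y \<cdot> E \<cdot> f \<in> A"
  proof (induction rule: cs.span_induct_alt)
    case base
    then show ?case using mi.subspace_0[OF A(1)] by simp
  next
    case (step c u w)
    then obtain l where "genvec x l u" "u \<in> M" "u \<in> A" by (auto simp: U_def)
    then have "y \<cdot> u \<in> A" using y(2) ideal_scale[OF A(1)] by simp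
    then show ?case using step ideal_scale[OF A(1)] mi.subspace_add[OF A(1)] by simp
  qed
  then show ?thesis by (simp add: ops_E[OF y(1)])
qed

text \<open>On generalized eigenvectors with eigenvalues \<open>l\<close> and \<open>m\<close>, the Leibniz rule for \<open>y\<close> amounts to
  \<open>ps (l + m) = ps l + ps m\<close>.\<close>

lemma replica_derv:
  assumes x: "x \<in> ops" "derv x"
    and y: "y \<in> ops" "\<And>m v. v \<in> M \<Longrightarrow> genvec x m v \<Longrightarrow> y \<cdot> v = ps m *\<^sub>C v"
    and ps: "\<And>c d. ps (c + d) = ps c + ps d"
  shows "derv y"
proof -
  obtain F where F: "finite F" "M \<subseteq> cs.span F" by (rule M_finite_span)
  define G where "G = {u \<in> M. \<exists>l. genvec x l u}"
  have MG: "v \<in> cs.span G" if "v \<in> M" for v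
    using in_span_genvec[OF subspace_M ops_in_M[OF x(1)] F that] by (simp add: G_def)
  have 1: "y \<cdot> (u * v) = E \<cdot> (y \<cdot> u * v + u * y \<cdot> v)" if uv: "u \<in> G" "v \<in> G" for u v
  proof -
    obtain l m where l: "genvec x l u" "u \<in> M" and m: "genvec x m v" "v \<in> M" using uv by (auto simp: G_def)
    then have "genvec x (l + m) (E \<cdot> (u * v))" using genvec_prod[OF x] by (auto simp: genvec_def)
    then have "y \<cdot> E \<cdot> (u * v) = ps (l + m) *\<^sub>C E \<cdot> (u * v)" using y(2) by simp
    then show ?thesis using y(2)[OF l(2,1)] y(2)[OF m(2,1)] by (simp add: ops_E[OF y(1)] ps cscale_add_left)
  qed
  have 2: "y \<cdot> (u * v) = E \<cdot> (y \<cdot> u * v + u * y \<cdot> v)" if u: "u \<in> G" and v: "v \<in> cs.span G" for u v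
    using v
  proof (induction rule: cs.span_induct_alt)
    case (step c w v)
    then show ?case using 1[OF u step(1)] by (simp add: algebra_simps)
  qed simp
  have 3: "y \<cdot> (u * v) = E \<cdot> (y \<cdot> u * v + u * y \<cdot> v)" if v: "v \<in> cs.span G" and u: "u \<in> cs.span G" for u v
    using u
  proof (induction rule: cs.span_induct_alt)
    case (step c w u)
    then show ?case using 2[OF step(1) v] by (simp add: algebra_simps)
  qed simp
  show ?thesis
    unfolding derv_def
  proof (intro allI)
    fix f h
    have "y \<cdot> (f * h) = y \<cdot> E \<cdot> (E \<cdot> f * E \<cdot> h)" by (simp only: E_mult_E ops_E[OF y(1)])
    also have "\<dots> = E \<cdot> (y \<cdot> E \<cdot> f * E \<cdot> h + E \<cdot> f * y \<cdot> E \<cdot> h)"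
      using 3 MG by (simp add: ops_E[OF y(1)])
    also have "\<dots> = E \<cdot> (y \<cdot> f * h + f * y \<cdot> h)"
      by (simp add: E_mult_E ops_E[OF y(1)])
    finally show "y \<cdot> (f * h) = E \<cdot> (y \<cdot> f * h + f * y \<cdot> h)" .
  qed
qed

lemma N_pos: "0 < N"
proof (rule ccontr)
  assume "\<not> 0 < N"
  then have "1 \<in> K n k" using K_sub_J J_sub_K by auto
  then have "coef 1 {#} = 0" using k2 unfolding K_def monoms_def by simp
  then show False by (simp add: coef_one)
qed

sublocale lie_ops E g
proof
  show "g \<subseteq> ops" by (auto simp: g_def)
  show "lie_sub g" by (rule lie_sub_g)
  fix x y and ps :: "complex \<Rightarrow> complex"
  assume x: "x \<in> g" and y: "y \<in> ops" and ps: "\<And>c d. ps (c + d) = ps c + ps d"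
    and eig: "\<And>m v. v \<in> M \<Longrightarrow> genvec x m v \<Longrightarrow> y \<cdot> v = ps m *\<^sub>C v"
  have xo: "x \<in> ops" "derv x" using x by (auto simp: g_def)
  have "derv y" by (rule replica_derv[OF xo y eig ps])
  moreover have "y \<cdot> f \<in> J" if "f \<in> J" for f
    using replica_invariant[OF xo(1) y eig ideal_J TK_sub_J _ that] x by (auto simp: g_def)
  moreover have "y \<cdot> f \<in> K n 1" if "f \<in> K n 1" for f
    using replica_invariant[OF xo(1) y eig ideal_K1 TK_sub _ that] x by (auto simp: g_def)
  ultimately show "y \<in> g" using y by (simp add: g_def)
qed

end

section \<open>The number of generators is at least the dimension\<close>

definition msets :: "'a set \<Rightarrow> nat \<Rightarrow> 'a multiset set" where
  "msets A t = {m. set_mset m \<subseteq> A \<and> size m < t}"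

text \<open>Both bounds identify multisets with functions of exponents: each exponent is below \<open>t\<close>, and
  exponents below \<open>u\<close> keep the degree below \<open>card A * u\<close>.\<close>

lemma msets_upper:
  assumes "finite A" shows "finite (msets A t) \<and> card (msets A t) \<le> t ^ card A"
proof -
  define F where "F m = restrict (count m) A" for m
  have inj: "inj_on F (msets A t)"
  proof (rule inj_onI)
    fix m m' assume m: "m \<in> msets A t" "m' \<in> msets A t" "F m = F m'"
    show "m = m'"
    proof (rule multiset_eqI)
      fix x
      show "count m x = count m' x"
      proof (cases "x \<in> A")
        case True
        then show ?thesis using m(3) unfolding F_def by (metis restrict_apply')
      next
        case False
        then have "x \<notin># m" "x \<notin># m'" using m(1,2) by (auto simp: msets_def)
        then show ?thesis by (simp add: not_in_iff)
      qed
    qed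
  qed
  have sub: "F ` msets A t \<subseteq> (A \<rightarrow>\<^sub>E {..<t})"
    by (auto simp: F_def msets_def intro: le_less_trans[OF count_le_size])
  have fin: "finite (A \<rightarrow>\<^sub>E {..<t})" using assms by (intro finite_PiE) auto
  have "card (msets A t) = card (F ` msets A t)" using inj by (simp add: card_image)
  also have "\<dots> \<le> card (A \<rightarrow>\<^sub>E {..<t})" by (rule card_mono[OF fin sub])
  also have "\<dots> = t ^ card A" using assms by (simp add: card_PiE)
  finally show ?thesis using inj_on_finite[OF inj sub fin] by simp
qed

lemma msets_lower:
  assumes "finite A" "0 < card A" "0 < u" shows "u ^ card A \<le> card (msets A (card A * u))"
proof -
  define F where "F f = (\<Sum>i\<in>A. replicate_mset (f i) i)" for f :: "'a \<Rightarrow> nat"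
  have cnt: "count (F f) x = (if x \<in> A then f x else 0)" for f x
    using assms(1) by (simp add: F_def count_sum if_distrib cong: if_cong)
  have inj: "inj_on F (A \<rightarrow>\<^sub>E {..<u})"
  proof (rule inj_onI)
    fix f g assume f: "f \<in> A \<rightarrow>\<^sub>E {..<u}" "g \<in> A \<rightarrow>\<^sub>E {..<u}" "F f = F g"
    show "f = g"
    proof (rule PiE_ext[OF f(1,2)])
      fix x assume "x \<in> A"
      then show "f x = g x" using cnt[of f x] cnt[of g x] f(3) by simp
    qed
  qed
  have sub: "F ` (A \<rightarrow>\<^sub>E {..<u}) \<subseteq> msets A (card A * u)"
  proof
    fix m assume "m \<in> F ` (A \<rightarrow>\<^sub>E {..<u})"
    then obtain f where f: "f \<in> A \<rightarrow>\<^sub>E {..<u}" "m = F f" by blast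
    have "size m = (\<Sum>i\<in>A. f i)" unfolding f(2) F_def by (simp add: size_multiset_sum)
    also have "\<dots> \<le> (\<Sum>i\<in>A. u - 1)" using f(1) assms(3) by (intro sum_mono) (fastforce simp: PiE_def Pi_def)
    also have "\<dots> < card A * u" using assms by simp
    finally have "size m < card A * u" .
    moreover have "set_mset m \<subseteq> A"
    proof
      fix x assume "x \<in># m"
      then show "x \<in> A" using cnt[of f x] f(2) by (metis count_eq_zero_iff)
    qed
    ultimately show "m \<in> msets A (card A * u)" by (simp add: msets_def)
  qed
  have "u ^ card A = card (A \<rightarrow>\<^sub>E {..<u})" using assms(1) by (simp add: card_PiE)
  also have "\<dots> = card (F ` (A \<rightarrow>\<^sub>E {..<u}))" using inj by (simp add: card_image)
  also have "\<dots> \<le> card (msets A (card A * u))"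
    using msets_upper[OF assms(1)] sub by (intro card_mono) auto
  finally show ?thesis .
qed

lemma monoms_msets: "monoms n t = msets {..<n} t"
  by (simp add: monoms_def msets_def)

lemma prod_mset_in_K:
  "(\<And>q. q \<in># p \<Longrightarrow> q \<in> K n 1) \<Longrightarrow> prod_mset p \<in> K n (size p)"
proof (induction p)
  case (add q p)
  then have "prod_mset p \<in> K n (size p)" "q \<in> K n 1" by auto
  then show ?case using K_mult[of q n 1 "prod_mset p" "size p"] by simp
qed simp

lemma mi_span_Un_ideal:
  assumes "x \<in> mi.span (A \<union> L)" "mi.subspace L"
  obtains u v where "x = u + v" "u \<in> mi.span A" "v \<in> L"
  using assms unfolding mi.span_Un by (auto simp: mi.span_eq_iff[THEN iffD2])

text \<open>If \<open>Q\<close> generates the \<open>D\<close>-th power of the maximal ideal up to higher order terms, then every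
  power series is, up to order \<open>s\<close>, a linear combination of products of a monomial of degree below \<open>D\<close> and
  a monomial of degree below \<open>s\<close> in \<open>Q\<close>. There are at most \<open>O(s ^ card Q)\<close> such products, but \<open>s ^ n\<close>
  up to a constant many monomials of degree below \<open>s\<close>.\<close>

lemma generators_ge_dimension:
  assumes Q: "finite Q" "Q \<subseteq> K n 1" and D: "K n D \<subseteq> mi.span (Q \<union> K n (Suc D))"
  shows "n \<le> card Q"
proof (rule ccontr)
  assume "\<not> n \<le> card Q"
  then have less: "card Q < n" by simp
  have step: "K n (D + i) \<subseteq> mi.span (Q \<union> K n (Suc (D + i)))" for i
  proof
    fix f assume "f \<in> K n (D + i)"
    then obtain u where u: "u \<in> mi.span (mon ` {m. set_mset m \<subseteq> {..<n} \<and> size m = D + i})"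
        "f - u \<in> Zn n" by (rule K_split)
    have "mon m \<in> mi.span (Q \<union> K n (Suc (D + i)))" if m: "set_mset m \<subseteq> {..<n}" "size m = D + i" for m
    proof -
      obtain xs where xs: "mset xs = m" using ex_mset by blast
      define m1 m2 where "m1 = mset (take D xs)" and "m2 = mset (drop D xs)"
      have len: "length xs = D + i" using m(2) xs by (metis size_mset)
      have m12: "m = m1 + m2" unfolding m1_def m2_def using xs by (metis append_take_drop_id mset_append)
      have "mon m1 \<in> K n D" "mon m2 \<in> K n i" using len by (auto simp: m1_def m2_def intro!: mon_in_K)
      then obtain v w where vw: "mon m1 = v + w" "v \<in> mi.span Q" "w \<in> K n (Suc D)"
        using mi_span_Un_ideal[OF _ ideal_K] D by blast
      have "mon m = mon m2 * v + mon m2 * w" using vw(1) m12 by (simp flip: mon_mult add: algebra_simps)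
      moreover have "mon m2 * v \<in> mi.span (Q \<union> K n (Suc (D + i)))"
        using mi.span_scale[OF vw(2)] mi.span_mono[of Q "Q \<union> K n (Suc (D + i))"] by blast
      moreover have "mon m2 * w \<in> K n (Suc (D + i))"
        using K_mult[OF \<open>mon m2 \<in> K n i\<close> vw(3)] by (simp add: add.commute)
      then have "mon m2 * w \<in> mi.span (Q \<union> K n (Suc (D + i)))" by (intro mi.span_base) blast
      ultimately show ?thesis using mi.span_add by metis
    qed
    then have "mon ` {m. set_mset m \<subseteq> {..<n} \<and> size m = D + i} \<subseteq> mi.span (Q \<union> K n (Suc (D + i)))"
      by blast
    then have "u \<in> mi.span (Q \<union> K n (Suc (D + i)))"
      using mi.span_minimal[OF _ mi.subspace_span, THEN subsetD, OF _ u(1)] by blast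
    moreover have "f - u \<in> mi.span (Q \<union> K n (Suc (D + i)))"
      using u(2) Zn_subset_K by (intro mi.span_base) blast
    ultimately show "f \<in> mi.span (Q \<union> K n (Suc (D + i)))" using mi.span_add by fastforce
  qed
  \<comment> \<open>The hypothesis applied repeatedly pushes the remainder to arbitrarily high order.\<close>
  have deep: "K n D \<subseteq> mi.span (Q \<union> K n (D + i))" for i
  proof (induction i)
    case 0
    show ?case using mi.span_superset[of "Q \<union> K n D"] by auto
  next
    case (Suc i)
    have "Q \<union> K n (D + i) \<subseteq> mi.span (Q \<union> K n (D + Suc i))"
      using step[of i] mi.span_superset[of "Q \<union> K n (Suc (D + i))"] by auto
    then show ?case using Suc mi.span_minimal[OF _ mi.subspace_span] by blast
  qed
  have rep: "\<exists>a b c. r = a + b + c \<and> a \<in> cs.span (mon ` monoms n D) \<and> b \<in> mi.span Q \<and> c \<in> K n s" for r s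
  proof -
    have "r - trunc n D \<cdot> r \<in> K n D" by (simp add: K_def coef_trunc)
    then have "r - trunc n D \<cdot> r \<in> mi.span (Q \<union> K n (D + s))" using deep by blast
    then obtain b c where bc: "r - trunc n D \<cdot> r = b + c" "b \<in> mi.span Q" "c \<in> K n (D + s)"
      using mi_span_Un_ideal[OF _ ideal_K] by blast
    have "trunc n D \<cdot> r \<in> cs.span (mon ` monoms n D)"
      unfolding trunc_expand by (intro cs.span_sum cs.span_scale cs.span_base imageI)
    moreover have "c \<in> K n s" using bc(3) K_antimono[of s "D + s" n] by auto
    moreover have "r = trunc n D \<cdot> r + b + c" using bc(1) by (simp add: algebra_simps)
    ultimately show ?thesis using bc(2) by blast
  qed
  \<comment> \<open>Expanding the coefficients of \<open>Q\<close> in the same way \<open>t\<close> times leaves coefficients that are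
    combinations of low monomials, collected in \<open>P\<close>, and a remainder \<open>R\<close> in the \<open>t\<close>-th power of the ideal of \<open>Q\<close>.\<close>
  define P where "P t = (\<lambda>(m, a). mon m * prod_mset a) ` (monoms n D \<times> msets Q t)" for t
  define R where "R t = {prod_mset a * r |a r. set_mset a \<subseteq> Q \<and> size a = t}" for t
  have span: "f \<in> cs.span (P t \<union> R t \<union> K n s)" for f t s
  proof (induction t arbitrary: f)
    case 0
    have "f \<in> R 0" unfolding R_def by (auto intro!: exI[of _ "{#}"])
    then show ?case by (intro cs.span_base) blast
  next
    case (Suc t)
    let ?T = "cs.span (P (Suc t) \<union> R (Suc t) \<union> K n s)"
    have "P t \<subseteq> ?T"
    proof -
      have "P t \<subseteq> P (Suc t)" unfolding P_def msets_def by (intro image_mono) auto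
      then show ?thesis using cs.span_superset[of "P (Suc t) \<union> R (Suc t) \<union> K n s"] by blast
    qed
    moreover have "R t \<subseteq> ?T"
    proof
      fix x assume "x \<in> R t"
      then obtain a r where a: "x = prod_mset a * r" "set_mset a \<subseteq> Q" "size a = t" by (auto simp: R_def)
      obtain u b c where r: "r = u + b + c" "u \<in> cs.span (mon ` monoms n D)" "b \<in> mi.span Q" "c \<in> K n s"
        using rep by blast
      have "prod_mset a * u \<in> ?T" using r(2)
      proof (induction rule: cs.span_induct_alt)
        case base
        then show ?case by (simp add: cs.span_zero)
      next
        case (step e v w)
        then obtain m where "v = mon m" "m \<in> monoms n D" by blast
        then have "prod_mset a * v \<in> P (Suc t)" unfolding P_def using a
          by (intro image_eqI[of _ _ "(m, a)"]) (auto simp: msets_def mult.commute)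
        then have "e *\<^sub>C (prod_mset a * v) \<in> ?T" by (intro cs.span_scale cs.span_base) blast
        then show ?case using step(2) by (simp add: distrib_left cs.span_add)
      qed
      moreover have "prod_mset a * b \<in> ?T" using r(3)
      proof (induction rule: mi.span_induct_alt)
        case base
        then show ?case by (simp add: cs.span_zero)
      next
        case (step e q w)
        have "prod_mset a * (e * q) = q * prod_mset a * e" by (simp only: mult.commute mult.left_commute)
        also have "\<dots> = prod_mset (add_mset q a) * e" by simp
        also have "\<dots> \<in> R (Suc t)" unfolding R_def using a step(1)
          by (intro CollectI exI[of _ "add_mset q a"] exI[of _ e]) auto
        finally have "prod_mset a * (e * q) \<in> ?T" by (intro cs.span_base) blast
        then show ?case using step(2) by (simp add: distrib_left cs.span_add)
      qed
      moreover have "prod_mset a * c \<in> K n s" by (rule ideal_mult_left[OF ideal_K r(4)])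
      then have "prod_mset a * c \<in> ?T" by (intro cs.span_base) blast
      ultimately show "x \<in> ?T" unfolding a(1) r(1) by (simp add: distrib_left cs.span_add)
    qed
    moreover have "K n s \<subseteq> ?T" using cs.span_superset[of "P (Suc t) \<union> R (Suc t) \<union> K n s"] by blast
    ultimately have "cs.span (P t \<union> R t \<union> K n s) \<subseteq> ?T" by (intro cs.span_minimal cs.subspace_span) auto
    then show ?case using Suc by blast
  qed
  have finP: "finite (P s)" for s
    unfolding P_def using finite_monoms msets_upper[OF Q(1)] by (intro finite_imageI finite_cartesian_product) auto
  have bound: "card (monoms n s) \<le> card (monoms n D) * s ^ card Q" for s
  proof -
    have "R s \<subseteq> K n s"
    proof
      fix x assume "x \<in> R s"
      then obtain a r where a: "x = prod_mset a * r" "set_mset a \<subseteq> Q" "size a = s" by (auto simp: R_def)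
      then have "prod_mset a \<in> K n s" using prod_mset_in_K[of a n] Q(2) by blast
      then show "x \<in> K n s" unfolding a(1) by (rule ideal_mult_right[OF ideal_K])
    qed
    then have "P s \<union> R s \<union> K n s = P s \<union> K n s" by blast
    then have all: "f \<in> cs.span (P s \<union> K n s)" for f using span[of f s s] by simp
    have "trunc n s \<cdot> f \<in> cs.span (ap (trunc n s) ` P s)" for f
      using all[of f]
    proof (induction rule: cs.span_induct_alt)
      case base
      then show ?case by (simp add: cs.span_zero)
    next
      case (step c v w)
      have "trunc n s \<cdot> v \<in> cs.span (ap (trunc n s) ` P s)"
        using step(1) by (auto intro: cs.span_base cs.span_zero simp: trunc_zero_iff[THEN iffD2])
      then show ?case using step(2) by (simp add: cs.span_add cs.span_scale)
    qed
    moreover have "trunc n s \<cdot> mon m = mon m" if "m \<in> monoms n s" for m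
      using that by (intro mps_eqI) (auto simp: coef_trunc coef_mon)
    ultimately have sub: "mon ` monoms n s \<subseteq> cs.span (ap (trunc n s) ` P s)" by (metis image_subsetI)
    have inj: "inj_on mon (monoms n s)"
    proof (rule inj_onI)
      fix p q assume "mon p = mon q"
      then have "coef (mon p) p = coef (mon q) p" by simp
      then show "p = q" by (simp add: coef_mon split: if_splits)
    qed
    have "cs.independent (mon ` monoms n s)"
    proof (rule ccontr)
      assume "\<not> cs.independent (mon ` monoms n s)"
      then obtain u where u: "\<exists>v\<in>mon ` monoms n s. u v \<noteq> 0" "(\<Sum>v\<in>mon ` monoms n s. u v *\<^sub>C v) = 0"
        using cs.dependent_finite[of "mon ` monoms n s"] finite_monoms by auto
      then obtain m where m: "m \<in> monoms n s" "u (mon m) \<noteq> 0" by blast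
      have "0 = coef (\<Sum>p\<in>monoms n s. u (mon p) *\<^sub>C mon p) m"
        using u(2) inj by (simp add: sum.reindex)
      also have "\<dots> = (\<Sum>p\<in>monoms n s. if p = m then u (mon m) else 0)"
        unfolding coef_sum by (intro sum.cong) (auto simp: coef_mon)
      also have "\<dots> = u (mon m)" using m finite_monoms by simp
      finally show False using m by simp
    qed
    then have "card (mon ` monoms n s) \<le> card (ap (trunc n s) ` P s)"
      using cs.independent_span_bound[OF _ _ sub] finP by blast
    also have "\<dots> \<le> card (P s)" using finP by (rule card_image_le)
    also have "\<dots> \<le> card (monoms n D \<times> msets Q s)"
      unfolding P_def using finite_monoms msets_upper[OF Q(1)] by (intro card_image_le finite_cartesian_product) auto
    also have "\<dots> \<le> card (monoms n D) * s ^ card Q"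
      using msets_upper[OF Q(1)] by (simp add: card_cartesian_product)
    finally show ?thesis using inj by (simp add: card_image)
  qed
  \<comment> \<open>Growth of degree \<open>n\<close> exceeds growth of degree \<open>card Q\<close>; \<open>s = n u\<close> with \<open>u = C + 1\<close> is large enough.\<close>
  define C where "C = card (monoms n D) * n ^ card Q"
  define u where "u = Suc C"
  have "u ^ n \<le> card (monoms n (n * u))"
    using msets_lower[of "{..<n}" u] less by (simp add: monoms_msets u_def)
  also have "\<dots> \<le> card (monoms n D) * (n * u) ^ card Q" by (rule bound)
  also have "\<dots> = C * u ^ card Q" by (simp add: C_def power_mult_distrib)
  also have "\<dots> < u * u ^ card Q" by (simp add: u_def)
  also have "u * u ^ card Q = u ^ Suc (card Q)" by simp
  also have "\<dots> \<le> u ^ n" using less by (intro power_increasing) (auto simp: u_def)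
  finally show False by simp
qed

section \<open>Counting by weights\<close>

text \<open>For a module over \<open>sl\<^sub>2\<close>, the number of weight vectors with weight in \<open>{- i - 1, - i}\<close> is the number of
  simple summands with highest weight at least \<open>i\<close>; \<open>window\<close> adds the number for \<open>{i, i + 1}\<close>.\<close>

definition window :: "'b set \<Rightarrow> ('b \<Rightarrow> int) \<Rightarrow> nat \<Rightarrow> nat" where
  "window W w i = card {x \<in> W. - int i - 2 < w x \<and> w x \<le> - int i} + card {x \<in> W. int i \<le> w x \<and> w x < int i + 2}"

lemma card_sum_indicator: "finite W \<Longrightarrow> card {x \<in> W. P x} = (\<Sum>x\<in>W. if P x then 1 else 0)"
  by (simp add: sum.If_cases Int_def)

text \<open>A weight \<open>l \<noteq> 0\<close> is counted for \<open>i = |l|\<close> and \<open>i = |l| - 1\<close>, the weight \<open>0\<close> twice for \<open>i = 0\<close>.\<close>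

lemma window_sum:
  assumes "finite W" "\<And>x. x \<in> W \<Longrightarrow> \<bar>w x\<bar> \<le> int L"
  shows "(\<Sum>i\<le>L. window W w i) = 2 * card W"
proof -
  have one: "(\<Sum>i\<le>L. (if - int i - 2 < l \<and> l \<le> - int i then 1 else 0) + (if int i \<le> l \<and> l < int i + 2 then 1 else 0)) = (2::nat)"
    if l: "\<bar>l\<bar> \<le> int L" for l
  proof (cases "l = 0")
    case True
    have "(\<Sum>i\<le>L. (if - int i - 2 < l \<and> l \<le> - int i then 1 else 0) + (if int i \<le> l \<and> l < int i + 2 then 1 else 0)) = (\<Sum>i\<le>L. if i = 0 then 2 else (0::nat))"
      using True by (intro sum.cong) auto
    then show ?thesis by simp
  next
    case False
    define m where "m = nat \<bar>l\<bar>"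
    have m: "m \<noteq> 0" "m \<le> L" "l = int m \<or> l = - int m" using False l by (auto simp: m_def)
    have "(\<Sum>i\<le>L. (if - int i - 2 < l \<and> l \<le> - int i then 1 else 0) + (if int i \<le> l \<and> l < int i + 2 then 1 else 0))
        = (\<Sum>i\<le>L. if i \<in> {m - 1, m} then 1 else (0::nat))"
      using m by (intro sum.cong) auto
    also have "\<dots> = card ({..L} \<inter> {m - 1, m})" by (subst sum.If_cases) (auto simp: Int_def)
    also have "{..L} \<inter> {m - 1, m} = {m - 1, m}" using m by auto
    also have "card {m - 1, m} = 2" using m by simp
    finally show ?thesis .
  qed
  have "(\<Sum>i\<le>L. window W w i) = (\<Sum>i\<le>L. \<Sum>x\<in>W. (if - int i - 2 < w x \<and> w x \<le> - int i then 1 else 0)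
      + (if int i \<le> w x \<and> w x < int i + 2 then 1 else 0))"
    by (simp only: window_def card_sum_indicator[OF assms(1)] sum.distrib)
  also have "\<dots> = (\<Sum>x\<in>W. 2)" by (subst sum.swap) (intro sum.cong refl one assms(2))
  finally show ?thesis by simp
qed

text \<open>Each \<open>b j\<close> with \<open>j \<ge> 1\<close> is compared with the block of \<open>k\<close> consecutive values of \<open>a\<close> ending at \<open>k j\<close>.\<close>

lemma sum_blocks:
  fixes a b :: "nat \<Rightarrow> nat"
  assumes anti: "\<And>i. a (Suc i) \<le> a i" and ab: "\<And>j. b j \<le> a (k * j)"
  shows "b 0 + k * (\<Sum>j\<in>{1..L}. b j) \<le> (\<Sum>i\<le>k * L. a i)"
proof (induction L)
  case 0
  show ?case using ab[of 0] by simp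
next
  case (Suc L)
  have le: "a i \<le> a j" if "j \<le> i" for i j using lift_Suc_antimono_le[of a, OF anti that] .
  have "k * b (Suc L) \<le> (\<Sum>i\<in>{Suc (k * L)..k * Suc L}. a (k * Suc L))"
    using ab[of "Suc L"] by simp
  also have "\<dots> \<le> (\<Sum>i\<in>{Suc (k * L)..k * Suc L}. a i)" by (intro sum_mono le) auto
  finally have 1: "k * b (Suc L) \<le> (\<Sum>i\<in>{Suc (k * L)..k * Suc L}. a i)" .
  have "{..k * Suc L} = {..k * L} \<union> {Suc (k * L)..k * Suc L}" by auto
  then have "(\<Sum>i\<le>k * Suc L. a i) = (\<Sum>i\<le>k * L. a i) + (\<Sum>i\<in>{Suc (k * L)..k * Suc L}. a i)"
    by (simp only:) (subst sum.union_disjoint; auto)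
  then show ?case using Suc 1 by (simp add: distrib_left)
qed

text \<open>Let \<open>S\<close> be the sum of the windows of \<open>Y\<close> for \<open>j \<ge> 1\<close>. Summing up all windows,
  \<open>2 card W \<ge> window Y 0 + k S = 2 card Y + (k - 1) S\<close>, and \<open>S \<ge> 2\<close>.\<close>

lemma weight_count:
  assumes fin: "finite Y" "finite W" and k: "1 \<le> k"
    and le: "\<And>j. window Y wY j \<le> window W wW (k * j)"
    and anti: "\<And>i. window W wW (Suc i) \<le> window W wW i"
    and two: "2 \<le> (\<Sum>j\<in>{1..L0}. window Y wY j)"
  shows "card Y + k \<le> card W + 1"
proof -
  define sY sW where "sY = (\<Sum>y\<in>Y. nat \<bar>wY y\<bar>)" and "sW = (\<Sum>x\<in>W. nat \<bar>wW x\<bar>)"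
  \<comment> \<open>Large enough for all windows beyond it to be empty.\<close>
  define L where "L = L0 + sY + sW"
  have LY: "\<bar>wY y\<bar> \<le> int L" if "y \<in> Y" for y
  proof -
    have "nat \<bar>wY y\<bar> \<le> sY" unfolding sY_def using fin(1) that by (intro member_le_sum) auto
    then show ?thesis by (simp add: L_def)
  qed
  have kL: "L \<le> k * L" using k by simp
  have LW: "\<bar>wW x\<bar> \<le> int (k * L)" if "x \<in> W" for x
  proof -
    have "nat \<bar>wW x\<bar> \<le> sW" unfolding sW_def using fin(2) that by (intro member_le_sum) auto
    moreover have "sW \<le> L" by (simp add: L_def)
    ultimately have "nat \<bar>wW x\<bar> \<le> k * L" using kL by linarith
    then show ?thesis by linarith
  qed
  define S where "S = (\<Sum>j\<in>{1..L}. window Y wY j)"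
  have "{..L} = insert 0 {1..L}" by auto
  then have "2 * card Y = window Y wY 0 + S" using window_sum[OF fin(1) LY] by (simp add: S_def)
  moreover have "window Y wY 0 + k * S \<le> 2 * card W"
    using sum_blocks[of "window W wW" "window Y wY" k L, OF anti le] window_sum[OF fin(2) LW] by (simp add: S_def)
  moreover have "(\<Sum>j\<in>{1..L0}. window Y wY j) \<le> S"
    unfolding S_def by (intro sum_mono2) (auto simp: L_def)
  then have "2 \<le> S" using two by simp
  moreover have "k * S = S + (k - 1) * S" using k by (cases k) auto
  moreover have "(k - 1) * 2 \<le> (k - 1) * S" using calculation by simp
  ultimately show ?thesis by linarith
qed

section \<open>Weights of the variables and of the equations\<close>

context presentation
begin

text \<open>The ideal \<open>\<mm> J\<close>, enlarged by the series that vanish in \<open>n\<close> variables.\<close>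

definition mJ :: "mps set" where
  "mJ = mi.span ({a * b |a b. a \<in> K n 1 \<and> b \<in> J} \<union> Zn n)"

lemma ideal_mJ: "mi.subspace mJ"
  unfolding mJ_def by (rule mi.subspace_span)

lemma mJ_sub_J: "mJ \<subseteq> J"
  unfolding mJ_def
proof (rule mi.span_minimal[OF _ ideal_J])
  show "{a * b |a b. a \<in> K n 1 \<and> b \<in> J} \<union> Zn n \<subseteq> J"
    using ideal_mult_left[OF ideal_J] Zn_subset_K[of n N] K_sub_J by blast
qed

lemma mJ_mult: "a \<in> K n 1 \<Longrightarrow> b \<in> J \<Longrightarrow> a * b \<in> mJ"
  unfolding mJ_def by (intro mi.span_base) blast

text \<open>The \<open>(N + 1)\<close>-st power of \<open>\<mm>\<close> is \<open>\<mm>\<close> times the \<open>N\<close>-th, which lies in \<open>J\<close>.\<close>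

lemma TK_sub_mJ: "TK \<subseteq> mJ"
proof
  fix f assume "f \<in> TK"
  then obtain u where u: "u \<in> mi.span (mon ` {m. set_mset m \<subseteq> {..<n} \<and> size m = Suc N})" "f - u \<in> Zn n"
    by (rule K_split)
  have "mon m \<in> mJ" if m: "size m = Suc N" for m
  proof -
    obtain i m' where m': "m = add_mset i m'" "size m' = N" using m by (metis size_eq_Suc_imp_eq_union size_add_mset nat.inject)
    have "mon {#i#} * mon m' \<in> mJ"
      using m'(2) K_sub_J by (intro mJ_mult) (auto intro!: mon_in_K subsetD[OF K_sub_J])
    then show ?thesis using m'(1) by (simp add: mon_mult)
  qed
  then have "mi.span (mon ` {m. set_mset m \<subseteq> {..<n} \<and> size m = Suc N}) \<subseteq> mJ"
    by (intro mi.span_minimal ideal_mJ) auto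
  then have "u \<in> mJ" using u(1) by blast
  moreover have "f - u \<in> mJ" unfolding mJ_def using u(2) by (intro mi.span_base) blast
  ultimately show "f \<in> mJ" using mi.subspace_add[OF ideal_mJ] by fastforce
qed

lemma g_mult: "x \<in> g \<Longrightarrow> x \<cdot> (a * b) = E \<cdot> (x \<cdot> a * b + a * x \<cdot> b)"
  unfolding g_def derv_def by blast

lemma g_one: assumes "x \<in> g" shows "x \<cdot> 1 = 0"
proof -
  have "x \<cdot> 1 = E \<cdot> (x \<cdot> 1) + E \<cdot> (x \<cdot> 1)" using g_mult[OF assms, of 1 1] unfolding mult_1 mult_1_right ap_add_right .
  also have "E \<cdot> (x \<cdot> 1) = x \<cdot> 1" using assms by (intro M_fix ops_in_M) simp
  finally show ?thesis by simp
qed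

lemma g_J: "x \<in> g \<Longrightarrow> f \<in> J \<Longrightarrow> x \<cdot> f \<in> J"
  unfolding g_def by blast

lemma g_K1: "x \<in> g \<Longrightarrow> f \<in> K n 1 \<Longrightarrow> x \<cdot> f \<in> K n 1"
  unfolding g_def by blast

lemma g_mJ:
  assumes x: "x \<in> g" and f: "f \<in> mJ" shows "x \<cdot> f \<in> mJ"
  using f unfolding mJ_def
proof (induction rule: mi.span_induct_alt)
  case base
  then show ?case by (simp add: mi.span_zero)
next
  case (step c f y)
  have "x \<cdot> (c * f) \<in> mJ"
  proof (cases "f \<in> Zn n")
    case True
    then have "c * f \<in> TK" using ideal_mult_left[OF ideal_K] Zn_subset_K by blast
    then show ?thesis using op_TK[of x] x mi.subspace_0[OF ideal_mJ] by simp
  next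
    case False
    then obtain a b where ab: "f = a * b" "a \<in> K n 1" "b \<in> J" using step(1) by blast
    have ca: "c * a \<in> K n 1" using ideal_mult_left[OF ideal_K] ab(2) by blast
    have "x \<cdot> (c * a) * b + (c * a) * x \<cdot> b \<in> mJ"
      using x ab ca g_K1 g_J by (intro mi.subspace_add[OF ideal_mJ] mJ_mult) auto
    then have "E \<cdot> (x \<cdot> (c * a) * b + (c * a) * x \<cdot> b) \<in> mJ" using E_in_ideal[OF ideal_mJ TK_sub_mJ] by blast
    moreover have "c * f = (c * a) * b" by (simp only: ab(1) mult.assoc)
    ultimately show ?thesis by (simp only: g_mult[OF x])
  qed
  then show ?case using step(2) unfolding mJ_def[symmetric] by (simp add: mi.subspace_add[OF ideal_mJ])
qed

lemma TK_sub_K2: "TK \<subseteq> K n 2"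
  using N_pos by (intro K_antimono) simp

lemma g_K2:
  assumes x: "x \<in> g" and f: "f \<in> K n 2" shows "x \<cdot> f \<in> K n 2"
proof -
  obtain u where u: "u \<in> mi.span (mon ` {m. set_mset m \<subseteq> {..<n} \<and> size m = 2})" "f - u \<in> Zn n"
    by (rule K_split[OF f])
  have "x \<cdot> u \<in> K n 2" using u(1)
  proof (induction rule: mi.span_induct_alt)
    case base
    then show ?case using mi.subspace_0[OF ideal_K] by simp
  next
    case (step c v w)
    then obtain m where m: "v = mon m" "size m = Suc (Suc 0)" by auto
    then obtain i j where "m = {#i#} + {#j#}" by (metis One_nat_def add_mset_add_single size_eq_Suc_imp_eq_union size_1_singleton_mset size_add_mset add.commute nat.inject)
    then have v: "c * v = (c * mon {#i#}) * mon {#j#}" using m by (simp add: mon_mult mult.assoc)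
    have ij: "c * mon {#i#} \<in> K n 1" "mon {#j#} \<in> K n 1"
      using ideal_mult_left[OF ideal_K] mon_in_K by simp_all
    have "x \<cdot> (c * mon {#i#}) * mon {#j#} \<in> K n (1 + 1)" "(c * mon {#i#}) * x \<cdot> mon {#j#} \<in> K n (1 + 1)"
      using ij g_K1[OF x] by (intro K_mult; simp)+
    then have "x \<cdot> (c * mon {#i#}) * mon {#j#} + (c * mon {#i#}) * x \<cdot> mon {#j#} \<in> K n 2"
      using mi.subspace_add[OF ideal_K] by (simp add: numeral_2_eq_2)
    then have "x \<cdot> (c * v) \<in> K n 2" unfolding v g_mult[OF x] using E_in_ideal[OF ideal_K TK_sub_K2] by blast
    then show ?case using step(2) by (simp add: mi.subspace_add[OF ideal_K])
  qed
  moreover have "f - u \<in> TK" using u(2) Zn_subset_K by blast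
  then have "x \<cdot> (f - u) = 0" using op_TK[OF in_ops[OF x]] by blast
  ultimately show ?thesis by simp
qed

lemma stable_ideal:
  assumes "mi.subspace A" "\<And>x f. x \<in> g \<Longrightarrow> f \<in> A \<Longrightarrow> x \<cdot> f \<in> A" shows "stable g (M \<inter> A)"
  unfolding stable_def using assms cs.subspace_inter[OF subspace_M ideal_cs[OF assms(1)]] ops_in_M by simp

lemma stables: "stable g (M \<inter> J)" "stable g (M \<inter> mJ)" "stable g (M \<inter> K n 1)" "stable g (M \<inter> K n 2)"
  by (intro stable_ideal; use ideal_J ideal_mJ ideal_K g_J g_mJ g_K1 g_K2 in blast)+

lemma semisimple_genvec:
  assumes "h \<in> ops" "semisimple h" "genvec h l v" "v \<in> M" shows "h \<cdot> v = l *\<^sub>C v"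
proof -
  obtain B be where B: "basis B" "\<forall>b\<in>B. h \<cdot> b = be b *\<^sub>C b" by (rule semisimple_eigenbasis[OF assms(1,2)])
  then have "gbasis h B be" unfolding gbasis_def using genvec_eigen by blast
  then show ?thesis
    using gbasis_eigen[OF _ assms(4,3), of B be "\<lambda>c. c"] eigenbasis(1)[OF assms(1) B] by simp
qed

text \<open>A weight basis of the subquotient \<open>A / B\<close>, lifted to \<open>A\<close>.\<close>

lemma relative_eigenbasis:
  assumes h: "h \<in> g" "semisimple h" and A: "stable g A" "A \<subseteq> M" and B: "stable g B" "B \<subseteq> A"
  obtains Y where "indep_mod B Y" "Y \<subseteq> A" "A \<subseteq> cs.span (Y \<union> B)" "\<forall>y\<in>Y. \<exists>l. h \<cdot> y = l *\<^sub>C y"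
proof -
  obtain F where F: "finite F" "M \<subseteq> cs.span F" by (rule M_finite_span)
  define G where "G = {u \<in> A. \<exists>l. h \<cdot> u = l *\<^sub>C u}"
  have subB: "cs.subspace B" "B \<subseteq> cs.span F" using B A(2) F(2) by (auto simp: stable_def)
  have "G \<subseteq> cs.span F" using A(2) F(2) by (auto simp: G_def)
  then obtain Y where Y: "Y \<subseteq> G" "indep_mod B Y" "G \<subseteq> cs.span (Y \<union> B)"
    using ex_indep_mod[OF subB(1) F(1) subB(2)] by blast
  have "A \<subseteq> cs.span G"
  proof
    fix v assume v: "v \<in> A"
    have "v \<in> cs.span {u \<in> A. \<exists>l. genvec h l u}"
      using A h(1) F v by (intro in_span_genvec[of A h F]) (auto simp: stable_def)
    moreover have "{u \<in> A. \<exists>l. genvec h l u} \<subseteq> G"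
      using semisimple_genvec[OF _ h(2)] h(1) A(2) by (auto simp: G_def)
    ultimately show "v \<in> cs.span G" using cs.span_mono by blast
  qed
  also have "cs.span G \<subseteq> cs.span (Y \<union> B)" using Y(3) by (intro cs.span_minimal cs.subspace_span)
  finally show thesis using that Y by (auto simp: G_def)
qed

lemma card_variables:
  assumes Y: "indep_mod (M \<inter> K n 2) Y" "Y \<subseteq> M \<inter> K n 1" "M \<inter> K n 1 \<subseteq> cs.span (Y \<union> (M \<inter> K n 2))"
  shows "card Y = n"
proof -
  define X where "X = (\<lambda>i. mon {#i#}) ` {..<n}"
  have inj: "inj_on (\<lambda>i. mon {#i#}) {..<n}"
  proof (rule inj_onI)
    fix i j :: nat assume "mon {#i#} = mon {#j#}"
    then have "coef (mon {#i#}) {#i#} = coef (mon {#j#}) {#i#}" by simp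
    then show "i = j" by (simp add: coef_mon split: if_splits)
  qed
  then have cardX: "card X = n" by (simp add: X_def card_image)
  have lin: "v - (\<Sum>i<n. coef v {#i#} *\<^sub>C mon {#i#}) \<in> K n 2" if "v \<in> K n 1" for v
  proof -
    have "coef v m = coef (\<Sum>i<n. coef v {#i#} *\<^sub>C mon {#i#}) m" if m: "m \<in> monoms n 2" for m
    proof (cases "m = {#}")
      case True
      then show ?thesis using \<open>v \<in> K n 1\<close> by (simp add: coef_sum coef_mon K_def monoms_def)
    next
      case False
      then have "size m = Suc 0" using m by (simp add: monoms_def) (metis One_nat_def Suc_1 Suc_leI less_antisym not_gr0 size_eq_0_iff_empty less_2_cases)
      then obtain j where j: "m = {#j#}" using size_1_singleton_mset by auto
      have "coef (\<Sum>i<n. coef v {#i#} *\<^sub>C mon {#i#}) m = (\<Sum>i<n. if i = j then coef v {#j#} else 0)"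
        unfolding coef_sum j by (intro sum.cong) (auto simp: coef_mon)
      then show ?thesis using m j by (simp add: monoms_def)
    qed
    then show ?thesis by (simp add: K_def)
  qed
  have XM: "X \<subseteq> M \<inter> K n 1"
  proof -
    have "mon {#i#} \<in> M" if "i < n" for i
      using that N_pos unfolding M_def by (auto intro!: mps_eqI simp: E_def coef_trunc coef_mon monoms_def)
    then show ?thesis by (auto simp: X_def intro: mon_in_K)
  qed
  have spanX: "M \<inter> K n 1 \<subseteq> cs.span (X \<union> (M \<inter> K n 2))"
  proof
    fix v assume v: "v \<in> M \<inter> K n 1"
    define s where "s = (\<Sum>i<n. coef v {#i#} *\<^sub>C mon {#i#})"
    have "s \<in> M" unfolding s_def using XM
      by (intro cs.subspace_sum[OF subspace_M] cs.subspace_scale[OF subspace_M]) (auto simp: X_def)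
    then have "v - s \<in> M \<inter> K n 2" using lin[of v] v cs.subspace_diff[OF subspace_M] by (simp add: s_def)
    then have "v - s \<in> cs.span (X \<union> (M \<inter> K n 2))" by (intro cs.span_base) blast
    moreover have "s \<in> cs.span (X \<union> (M \<inter> K n 2))" unfolding s_def
      by (intro cs.span_sum cs.span_scale cs.span_base) (auto simp: X_def)
    ultimately show "v \<in> cs.span (X \<union> (M \<inter> K n 2))" using cs.span_add by fastforce
  qed
  have indX: "indep_mod (M \<inter> K n 2) X"
    unfolding indep_mod_def
  proof (intro conjI allI impI ballI)
    show "finite X" by (simp add: X_def)
    fix c y assume c: "(\<Sum>y\<in>X. c y *\<^sub>C y) \<in> M \<inter> K n 2" and "y \<in> X"
    then obtain j where j: "j < n" "y = mon {#j#}" by (auto simp: X_def)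
    have "0 = coef (\<Sum>y\<in>X. c y *\<^sub>C y) {#j#}" using c j by (simp add: K_def monoms_def)
    also have "\<dots> = (\<Sum>i<n. if i = j then c (mon {#j#}) else 0)"
      unfolding X_def using inj by (simp add: sum.reindex coef_sum coef_mon if_distrib cong: if_cong)
    finally show "c y = 0" using j by simp
  qed
  obtain F where F: "finite F" "M \<subseteq> cs.span F" by (rule M_finite_span)
  have B: "cs.subspace (M \<inter> K n 2)" "M \<inter> K n 2 \<subseteq> cs.span F"
    using stables(4) F(2) unfolding stable_def by blast+
  have "finite X" "finite Y" using Y(1) by (simp_all add: X_def indep_mod_def)
  have "X \<subseteq> cs.span (Y \<union> (M \<inter> K n 2))" "Y \<subseteq> cs.span (X \<union> (M \<inter> K n 2))"
    using XM spanX Y(2,3) by (meson subset_trans)+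
  then have "card X \<le> card Y" "card Y \<le> card X"
    using indep_mod_card[OF B(1) F(1) B(2)] Y(1) indX \<open>finite X\<close> \<open>finite Y\<close>
    by blast+
  then show ?thesis using cardX by simp
qed

text \<open>An \<open>sl\<^sub>2\<close>-triple up to the nilpotent ideal \<open>rad\<close>.\<close>

definition sl2 :: "mps endo \<Rightarrow> mps endo \<Rightarrow> mps endo \<Rightarrow> bool" where
  "sl2 e f h \<longleftrightarrow> e \<in> g \<and> f \<in> g \<and> h \<in> g \<and> br h e = 2 *\<^sub>C e \<and> br h f = (- 2) *\<^sub>C f \<and> br e f - h \<in> rad"

text \<open>This symmetry turns every statement on negative weights into one on positive weights.\<close>

lemma sl2_flip: assumes "sl2 e f h" shows "sl2 f e (- h)"
proof -
  have "- h \<in> g" using assms cs.subspace_neg[OF g_sub] by (simp add: sl2_def)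
  moreover have "br f e - - h = - (br e f - h)" by (simp add: br_def)
  moreover have "- (br e f - h) \<in> rad"
    using cs.subspace_neg[OF subspace_rad, of "br e f - h"] assms unfolding sl2_def by blast
  moreover have "br (- h) f = - br h f" "br (- h) e = - br h e" by (simp_all add: br_def)
  ultimately have "br f e - - h \<in> rad" by (simp only:)
  with \<open>- h \<in> g\<close> \<open>br (- h) f = - br h f\<close> \<open>br (- h) e = - br h e\<close> show ?thesis
    using assms unfolding sl2_def by simp
qed

lemma raise_weight:
  assumes "sl2 e f h" "h \<cdot> v = l *\<^sub>C v" shows "h \<cdot> e \<cdot> v = (l + 2) *\<^sub>C e \<cdot> v"
proof -
  have "h \<cdot> e \<cdot> v = e \<cdot> h \<cdot> v + br h e \<cdot> v" by (simp add: ap_br)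
  then show ?thesis using assms by (simp add: sl2_def cscale_add_left)
qed

lemma killed_weight_natural:
  assumes "sl2 e f h" "stable g A" "stable g B" "A \<subseteq> M" "B \<subseteq> A"
    "v \<in> A" "v \<notin> B" "h \<cdot> v = l *\<^sub>C v" "e \<cdot> v \<in> B"
  shows "l \<in> \<nat>"
  using assms highest_weight_natural[of e f h A B v l] by (simp add: sl2_def)

text \<open>Applying \<open>e\<close> as often as possible without landing in \<open>B\<close> raises the weight by even numbers and ends at a
  weight that is a natural number.\<close>

lemma weight_integral:
  assumes s: "sl2 e f h" and AB: "stable g A" "stable g B" "A \<subseteq> M" "B \<subseteq> A"
    and v: "v \<in> A" "v \<notin> B" "h \<cdot> v = l *\<^sub>C v"
  shows "l \<in> \<int>"
proof -
  have e: "e \<in> g" "h \<in> g" using s by (auto simp: sl2_def)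
  have hw: "h \<cdot> e ^ i \<cdot> v = (l + 2 * of_nat i) *\<^sub>C e ^ i \<cdot> v" for i
  proof (induction i)
    case (Suc i)
    then show ?case using raise_weight[OF s Suc] by (simp add: algebra_simps)
  qed (simp add: v)
  have eA: "e ^ i \<cdot> v \<in> A" for i using AB(1) e v(1) by (induction i) (auto simp: stable_def)
  have "\<exists>i. e ^ i \<cdot> v \<in> B"
  proof (rule ccontr)
    assume neg: "\<not> ?thesis"
    have "l + 2 * of_nat i \<in> spec h" for i
    proof -
      have "e ^ i \<cdot> v \<noteq> 0" using neg AB(2) cs.subspace_0 by (metis stable_def)
      then show ?thesis using hw eA AB(3) by (auto simp: spec_def)
    qed
    then have "range (\<lambda>i::nat. l + 2 * of_nat i) \<subseteq> spec h" by blast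
    moreover have "inj (\<lambda>i::nat. l + 2 * of_nat i)" by (rule injI) simp
    moreover have "finite (spec h)" using spec_genvec_finite e(2) by simp
    ultimately show False using finite_subset range_inj_infinite by blast
  qed
  then have j: "e ^ (LEAST i. e ^ i \<cdot> v \<in> B) \<cdot> v \<in> B" by (rule LeastI_ex)
  then have "(LEAST i. e ^ i \<cdot> v \<in> B) \<noteq> 0" using v(2) by (intro notI) simp
  then obtain i where i: "(LEAST i. e ^ i \<cdot> v \<in> B) = Suc i" using not0_implies_Suc by blast
  have "e ^ i \<cdot> v \<notin> B" using not_less_Least[of i "\<lambda>i. e ^ i \<cdot> v \<in> B"] i by simp
  moreover have "e \<cdot> e ^ i \<cdot> v \<in> B" using j i by simp
  ultimately have "l + 2 * of_nat i \<in> \<nat>" using killed_weight_natural[OF s AB eA _ hw] by blast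
  then have "l + 2 * of_nat i - of_int (2 * int i) \<in> \<int>" using Nats_subset_Ints by (intro Ints_diff) auto
  then show ?thesis by simp
qed

end

text \<open>\<open>Y\<close> represents a weight basis of \<open>\<mm> / \<mm>\<^sup>2\<close>, the variables, and \<open>W\<close> one of \<open>J / \<mm> J\<close>, the equations.\<close>

locale weighted = presentation +
  fixes e f h :: "mps endo" and Y W :: "mps set" and wY wW :: "mps \<Rightarrow> int"
  assumes k_le: "k \<le> Suc N"
    and sl2: "sl2 e f h"
    and Y: "indep_mod (M \<inter> K n 2) Y" "Y \<subseteq> M \<inter> K n 1" "M \<inter> K n 1 \<subseteq> cs.span (Y \<union> (M \<inter> K n 2))"
    and wY: "\<And>y. y \<in> Y \<Longrightarrow> h \<cdot> y = of_int (wY y) *\<^sub>C y"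
    and W: "indep_mod (M \<inter> mJ) W" "W \<subseteq> M \<inter> J" "M \<inter> J \<subseteq> cs.span (W \<union> (M \<inter> mJ))"
    and wW: "\<And>w. w \<in> W \<Longrightarrow> h \<cdot> w = of_int (wW w) *\<^sub>C w"
begin

lemma weighted_flip: "weighted n k N J f e (- h) Y W (\<lambda>y. - wY y) (\<lambda>w. - wW w)"
  by unfold_locales (use k_le sl2_flip[OF sl2] Y W wY wW in auto)

lemma e_g: "e \<in> g" and h_g: "h \<in> g"
  using sl2 by (auto simp: sl2_def)

lemma fin: "finite Y" "finite W"
  using Y(1) W(1) unfolding indep_mod_def by blast+

definition wt :: "mps multiset \<Rightarrow> int" where
  "wt p = (\<Sum>y\<in>#p. wY y)"

lemma h_monomial:
  "set_mset p \<subseteq> Y \<Longrightarrow> h \<cdot> prod_mset p = of_int (wt p) *\<^sub>C E \<cdot> prod_mset p"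
proof (induction p)
  case empty
  then show ?case using g_one[OF h_g] by (simp add: wt_def)
next
  case (add y p)
  have "h \<cdot> prod_mset (add_mset y p) = E \<cdot> (h \<cdot> y * prod_mset p + y * h \<cdot> prod_mset p)"
    using g_mult[OF h_g] by simp
  also have "\<dots> = of_int (wY y) *\<^sub>C E \<cdot> (y * prod_mset p) + of_int (wt p) *\<^sub>C E \<cdot> (y * E \<cdot> prod_mset p)"
    using add wY[of y] by simp
  finally show ?case by (simp add: E_mult_E wt_def cscale_add_left)
qed

text \<open>Since \<open>Y\<close> represents a basis of \<open>\<mm> / \<mm>\<^sup>2\<close>, the monomials in \<open>Y\<close> span everything up to truncation.\<close>

lemma monomials_span:
  assumes "s \<le> Suc N"
  shows "K n s \<subseteq> cs.span ({prod_mset p |p. set_mset p \<subseteq> Y \<and> s \<le> size p} \<union> TK)"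
proof -
  define P where "P s = {prod_mset p |p. set_mset p \<subseteq> Y \<and> size p = s}" for s
  have PK: "P s \<subseteq> K n s" for s
  proof
    fix x assume "x \<in> P s"
    then obtain p where p: "x = prod_mset p" "set_mset p \<subseteq> Y" "size p = s" by (auto simp: P_def)
    then have "q \<in> K n 1" if "q \<in># p" for q using that Y(2) by blast
    then show "x \<in> K n s" using prod_mset_in_K[of p n] p by simp
  qed
  have var: "mon {#i#} \<in> cs.span (Y \<union> K n 2)" if "i < n" for i
  proof -
    have "mon {#i#} \<in> M"
      using that N_pos unfolding M_def by (auto intro!: mps_eqI simp: E_def coef_trunc coef_mon monoms_def)
    then have "mon {#i#} \<in> cs.span (Y \<union> (M \<inter> K n 2))" using Y(3) mon_in_K[of 1 "{#i#}"] by auto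
    then show ?thesis using cs.span_mono[of "Y \<union> (M \<inter> K n 2)" "Y \<union> K n 2"] by blast
  qed
  have prod: "u * v \<in> cs.span (P (Suc s) \<union> K n (Suc (Suc s)))"
    if u: "u \<in> cs.span (Y \<union> K n 2)" and v: "v \<in> cs.span (P s \<union> K n (Suc s))" for u v s
    using u
  proof (induction rule: cs.span_induct_alt)
    case base
    then show ?case by (simp add: cs.span_zero)
  next
    case (step c y u)
    have "y * v \<in> cs.span (P (Suc s) \<union> K n (Suc (Suc s)))" using v
    proof (induction rule: cs.span_induct_alt)
      case base
      then show ?case by (simp add: cs.span_zero)
    next
      case (step d q w)
      have "y * q \<in> P (Suc s) \<union> K n (Suc (Suc s))"
      proof (cases "y \<in> K n 2")
        case True
        have "q \<in> K n s" using step(1) PK K_antimono[of s "Suc s" n] by auto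
        then show ?thesis using K_mult[OF True] by simp
      next
        case False
        then have y: "y \<in> Y" using \<open>y \<in> Y \<union> K n 2\<close> by blast
        show ?thesis
        proof (cases "q \<in> P s")
          case True
          then obtain p where p: "q = prod_mset p" "set_mset p \<subseteq> Y" "size p = s" by (auto simp: P_def)
          then have "y * q \<in> P (Suc s)" unfolding P_def using y
            by (intro CollectI exI[of _ "add_mset y p"]) auto
          then show ?thesis by blast
        next
          case False
          then have "q \<in> K n (Suc s)" using step(1) by blast
          moreover have "y \<in> K n 1" using y Y(2) by blast
          ultimately have "y * q \<in> K n (1 + Suc s)" by (intro K_mult)
          then show ?thesis by simp
        qed
      qed
      then have "y * q \<in> cs.span (P (Suc s) \<union> K n (Suc (Suc s)))" by (rule cs.span_base)
      then show ?case using step(2) by (simp add: distrib_left cs.span_add cs.span_scale)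
    qed
    then show ?case using step(2) by (simp add: distrib_right cs.span_add cs.span_scale)
  qed
  have mons: "mon m \<in> cs.span (P (size m) \<union> K n (Suc (size m)))" if "set_mset m \<subseteq> {..<n}" for m
    using that
  proof (induction m)
    case empty
    have "(1::mps) \<in> P 0" by (auto simp: P_def)
    then show ?case by (simp add: mon_empty cs.span_base)
  next
    case (add i m)
    then have "mon {#i#} * mon m \<in> cs.span (P (Suc (size m)) \<union> K n (Suc (Suc (size m))))"
      by (intro prod var) auto
    then show ?case by (simp add: mon_mult)
  qed
  have step: "K n s \<subseteq> cs.span (P s \<union> K n (Suc s))" for s
  proof
    fix v assume v: "v \<in> K n s"
    have "v - trunc n (Suc s) \<cdot> v \<in> K n (Suc s)" by (simp add: K_def coef_trunc)
    then have "v - trunc n (Suc s) \<cdot> v \<in> cs.span (P s \<union> K n (Suc s))" by (intro cs.span_base) blast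
    moreover have "coef v m *\<^sub>C mon m \<in> cs.span (P s \<union> K n (Suc s))" if m: "m \<in> monoms n (Suc s)" for m
    proof (cases "size m = s")
      case True
      then show ?thesis using mons[of m] m by (intro cs.span_scale) (auto simp: monoms_def)
    next
      case False
      then have "coef v m = 0" using m v by (auto simp: K_def monoms_def)
      then show ?thesis by (simp add: cs.span_zero)
    qed
    then have "trunc n (Suc s) \<cdot> v \<in> cs.span (P s \<union> K n (Suc s))"
      unfolding trunc_expand by (intro cs.span_sum)
    ultimately show "v \<in> cs.span (P s \<union> K n (Suc s))" using cs.span_add by fastforce
  qed
  show ?thesis using assms
  proof (induction rule: inc_induct)
    case base
    show ?case using cs.span_superset by blast
  next
    case (step s)
    let ?T = "cs.span ({prod_mset p |p. set_mset p \<subseteq> Y \<and> s \<le> size p} \<union> TK)"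
    have "P s \<subseteq> ?T" by (rule subset_trans[OF _ cs.span_superset]) (auto simp: P_def)
    moreover have "cs.span ({prod_mset p |p. set_mset p \<subseteq> Y \<and> Suc s \<le> size p} \<union> TK) \<subseteq> ?T"
      by (rule cs.span_mono) (use Suc_leD in blast)
    then have "K n (Suc s) \<subseteq> ?T" using step(3) by blast
    ultimately have "cs.span (P s \<union> K n (Suc s)) \<subseteq> ?T" by (intro cs.span_minimal cs.subspace_span) auto
    then show ?case using \<open>\<And>s. K n s \<subseteq> cs.span (P s \<union> K n (Suc s))\<close> by blast
  qed
qed

text \<open>A weight vector in the \<open>s\<close>-th power of the maximal ideal is a combination of monomials of its own
  weight and of degree at least \<open>s\<close>. If its weight exceeds \<open>- j s\<close>, each of these contains a variable of
  weight above \<open>- j\<close>.\<close>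

lemma weight_vector_in_ideal:
  assumes v: "v \<in> M" "v \<in> K n s" "s \<le> Suc N" "h \<cdot> v = of_int m *\<^sub>C v" and j: "- int s * j < m" "0 \<le> j"
  shows "v \<in> mi.span ({y \<in> Y. - j < wY y} \<union> TK)"
proof -
  let ?I = "mi.span ({y \<in> Y. - j < wY y} \<union> TK)"
  define G where "G = {E \<cdot> prod_mset p |p. set_mset p \<subseteq> Y \<and> s \<le> size p}"
  have "v \<in> cs.span ({prod_mset p |p. set_mset p \<subseteq> Y \<and> s \<le> size p} \<union> TK)"
    using monomials_span[OF v(3)] v(2) by blast
  then have "E \<cdot> v \<in> cs.span (G \<union> {0})"
  proof (induction rule: cs.span_induct_alt)
    case base
    then show ?case by (simp add: cs.span_zero)
  next
    case (step c u w)
    have "E \<cdot> u \<in> G \<union> {0}" using step(1) by (auto simp: G_def E_zero_iff)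
    then have "E \<cdot> u \<in> cs.span (G \<union> {0})" by (rule cs.span_base)
    then show ?case using step(2) by (simp add: cs.span_add cs.span_scale)
  qed
  then have vG: "v \<in> cs.span (G \<union> {0})" using v(1) by (simp add: M_fix)
  have hG: "h \<cdot> E \<cdot> prod_mset p = of_int (wt p) *\<^sub>C E \<cdot> prod_mset p" if "set_mset p \<subseteq> Y" for p
    using h_monomial[OF that] ops_E[of h] h_g by simp
  have z: "cs.subspace {0::mps}" by (simp add: cs.subspace_single_0)
  have vG': "v \<in> cs.span ({u \<in> G. h \<cdot> u = of_int m *\<^sub>C u} \<union> {0})"
    by (rule eigen_part_mod[OF z _ _ vG v(4)]) (use hG in \<open>auto simp: G_def\<close>)
  have "{u \<in> G. h \<cdot> u = of_int m *\<^sub>C u} \<union> {0} \<subseteq> ?I"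
  proof
    fix u assume u: "u \<in> {u \<in> G. h \<cdot> u = of_int m *\<^sub>C u} \<union> {0}"
    show "u \<in> ?I"
    proof (cases "u = 0")
      case True
      then show ?thesis by (simp add: mi.span_zero)
    next
      case False
      then obtain p where p: "u = E \<cdot> prod_mset p" "set_mset p \<subseteq> Y" "s \<le> size p"
        "h \<cdot> u = of_int m *\<^sub>C u" using u by (auto simp: G_def)
      have "(of_int (wt p) - of_int m) *\<^sub>C u = 0"
        using hG[OF p(2)] p(1,4) by (simp add: cs.scale_left_diff_distrib)
      then have wtp: "wt p = m" using False by simp
      have "\<exists>y\<in>#p. - j < wY y"
      proof (rule ccontr)
        assume "\<not> ?thesis"
        then have "wt p \<le> (\<Sum>y\<in>#p. - j)" unfolding wt_def by (intro sum_mset_mono) auto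
        also have "\<dots> = - int (size p) * j" by (simp add: sum_mset_constant)
        also have "\<dots> \<le> - int s * j" using p(3) j(2) by (intro mult_right_mono) auto
        finally show False using j(1) wtp by simp
      qed
      then obtain y where y: "y \<in># p" "- j < wY y" by blast
      then obtain p' where "p = add_mset y p'" by (metis mset_add)
      then have "prod_mset p = prod_mset p' * y" by (simp add: mult.commute)
      then have "prod_mset p \<in> ?I" using y p(2) by (auto intro: mi.span_scale mi.span_base)
      moreover have "E \<cdot> prod_mset p - prod_mset p \<in> ?I" using E_diff_TK(2) by (intro mi.span_base) blast
      ultimately show ?thesis using mi.span_add p(1) by fastforce
    qed
  qed
  then have "cs.span ({u \<in> G. h \<cdot> u = of_int m *\<^sub>C u} \<union> {0}) \<subseteq> ?I"
    by (intro cs.span_minimal ideal_cs mi.subspace_span)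
  then show ?thesis using vG' by blast
qed

lemma weight_part:
  assumes "v \<in> M \<inter> J" "h \<cdot> v = of_int m *\<^sub>C v"
  shows "v \<in> cs.span ({w \<in> W. wW w = m} \<union> (M \<inter> mJ))"
proof -
  have "{w \<in> W. h \<cdot> w = of_int m *\<^sub>C w} \<subseteq> {w \<in> W. wW w = m}"
  proof
    fix w assume w: "w \<in> {w \<in> W. h \<cdot> w = of_int m *\<^sub>C w}"
    then have "w \<noteq> 0" using indep_mod_notin[OF W(1)] stables(2) cs.subspace_0 by (auto simp: stable_def)
    moreover have "(of_int (wW w) - of_int m) *\<^sub>C w = 0"
      using w wW[of w] by (auto simp: cs.scale_left_diff_distrib)
    ultimately show "w \<in> {w \<in> W. wW w = m}" using w by auto
  qed
  moreover have "v \<in> cs.span ({w \<in> W. h \<cdot> w = of_int m *\<^sub>C w} \<union> (M \<inter> mJ))"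
  proof (rule eigen_part_mod)
    show "cs.subspace (M \<inter> mJ)" using stables(2) by (simp add: stable_def)
    show "h \<cdot> x \<in> M \<inter> mJ" if "x \<in> M \<inter> mJ" for x using stables(2) h_g that by (auto simp: stable_def)
    show "\<exists>l. h \<cdot> u = l *\<^sub>C u" if "u \<in> W" for u using wW that by blast
    show "v \<in> cs.span (W \<union> (M \<inter> mJ))" using W(3) assms(1) by blast
  qed (fact assms(2))
  moreover have "{w \<in> W. h \<cdot> w = of_int m *\<^sub>C w} \<union> (M \<inter> mJ) \<subseteq> {w \<in> W. wW w = m} \<union> (M \<inter> mJ)"
    using calculation(1) by (rule Un_mono) simp
  ultimately show ?thesis using cs.span_mono by blast
qed

text \<open>On negative weights \<open>e\<close> is injective modulo \<open>\<mm> J\<close>, because a weight vector killed by \<open>e\<close> has a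
  natural number as its weight. A linear relation among images is separated by weight first.\<close>

lemma raised_independent:
  assumes S: "S \<subseteq> W" "\<And>w. w \<in> S \<Longrightarrow> wW w < 0"
  shows "inj_on (ap e) S" "indep_mod (M \<inter> mJ) (ap e ` S)"
proof -
  have finS: "finite S" using S(1) fin(2) finite_subset by blast
  have subB: "cs.subspace (M \<inter> mJ)" using stables(2) by (simp add: stable_def)
  have main: "\<forall>w\<in>S. c w = 0" if c: "(\<Sum>w\<in>S. c w *\<^sub>C e \<cdot> w) \<in> M \<inter> mJ" for c
  proof -
    define F where "F = (\<lambda>w. of_int (wW w) + 2 :: complex) ` S"
    define v where "v l = (\<Sum>w\<in>{w \<in> S. of_int (wW w) + 2 = l}. c w *\<^sub>C w)" for l :: complex
    have finF: "finite F" using finS by (simp add: F_def)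
    have hv: "h \<cdot> v l = (l - 2) *\<^sub>C v l" for l
      unfolding v_def ap_sum_right cs.scale_sum_right using S(1) wW
      by (intro sum.cong) (auto simp: mult.commute)
    have "(\<Sum>l\<in>F. e \<cdot> v l) = (\<Sum>l\<in>F. \<Sum>w\<in>{w \<in> S. of_int (wW w) + 2 = l}. c w *\<^sub>C e \<cdot> w)"
      by (simp add: v_def ap_sum_right)
    also have "\<dots> = (\<Sum>w\<in>S. c w *\<^sub>C e \<cdot> w)"
      unfolding F_def using finS by (intro sum.group) auto
    finally have sumB: "(\<Sum>l\<in>F. e \<cdot> v l) \<in> M \<inter> mJ" using c by simp
    have he: "h \<cdot> e \<cdot> v l = l *\<^sub>C e \<cdot> v l" for l using raise_weight[OF sl2 hv, of l] by simp
    have hB: "h \<cdot> x \<in> M \<inter> mJ" if "x \<in> M \<inter> mJ" for x using stables(2) h_g that by (auto simp: stable_def)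
    have evB: "\<forall>l\<in>F. e \<cdot> v l \<in> M \<inter> mJ"
      by (rule eigen_components_in[OF finF he sumB subB hB])
    have "v l \<in> M \<inter> mJ" if l: "l \<in> F" for l
    proof (rule ccontr)
      assume n: "v l \<notin> M \<inter> mJ"
      have "v l \<in> M \<inter> J" unfolding v_def using S(1) W(2) stables(1)
        by (intro cs.subspace_sum cs.subspace_scale) (auto simp: stable_def)
      moreover have "M \<inter> mJ \<subseteq> M \<inter> J" using mJ_sub_J by blast
      ultimately have "l - 2 \<in> \<nat>"
        using killed_weight_natural[OF sl2 stables(1,2) _ _ _ n hv] evB l by blast
      moreover obtain w where "w \<in> S" "l = of_int (wW w) + 2" using l by (auto simp: F_def)
      ultimately have "of_int (wW w) \<in> (\<nat> :: complex set)" by simp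
      then obtain i where "of_int (wW w) = (of_nat i :: complex)" by (auto elim: Nats_cases)
      then have "wW w = int i" by (metis of_int_eq_iff of_int_of_nat_eq)
      then show False using S(2)[OF \<open>w \<in> S\<close>] by simp
    qed
    then have "(\<Sum>l\<in>F. v l) \<in> M \<inter> mJ" by (intro cs.subspace_sum[OF subB])
    also have "(\<Sum>l\<in>F. v l) = (\<Sum>w\<in>S. c w *\<^sub>C w)"
      unfolding v_def F_def using finS by (intro sum.group) auto
    finally show ?thesis using indep_mod_subset[OF W(1) S(1)] unfolding indep_mod_def by blast
  qed
  show inj: "inj_on (ap e) S"
  proof (rule inj_onI, rule ccontr)
    fix u w assume uw: "u \<in> S" "w \<in> S" "e \<cdot> u = e \<cdot> w" "u \<noteq> w"
    define c where "c x = (if x = u then 1 else if x = w then - 1 else 0 :: complex)" for x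
    have "(\<Sum>x\<in>S. c x *\<^sub>C e \<cdot> x) = (\<Sum>x\<in>S. (if x = u then e \<cdot> u else 0) + (if x = w then - (e \<cdot> w) else 0))"
      using uw by (intro sum.cong) (auto simp: c_def)
    also have "\<dots> = 0" using uw finS by (simp add: sum.distrib)
    finally have "\<forall>x\<in>S. c x = 0" using main cs.subspace_0[OF subB] by metis
    then show False using uw(1) by (auto simp: c_def)
  qed
  show "indep_mod (M \<inter> mJ) (ap e ` S)"
    unfolding indep_mod_def
  proof (intro conjI allI impI)
    show "finite (ap e ` S)" using finS by simp
    fix c assume "(\<Sum>y\<in>ap e ` S. c y *\<^sub>C y) \<in> M \<inter> mJ"
    then have "(\<Sum>w\<in>S. c (e \<cdot> w) *\<^sub>C e \<cdot> w) \<in> M \<inter> mJ" using inj by (simp add: sum.reindex)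
    then have "\<forall>w\<in>S. c (e \<cdot> w) = 0" using main[of "\<lambda>w. c (e \<cdot> w)"] by blast
    then show "\<forall>y\<in>ap e ` S. c y = 0" by blast
  qed
qed

text \<open>The images under \<open>e\<close> of the equations of the weights in \<open>P\<close> are independent modulo \<open>\<mm> J\<close>, so they can
  replace as many equations in a basis of the weight spaces in \<open>P'\<close>.\<close>

lemma raised_complement:
  assumes P: "\<And>l. P l \<Longrightarrow> l < 0 \<and> P' (l + 2)"
  obtains C where "C \<subseteq> {w \<in> W. P' (wW w)}"
    "card C + card {w \<in> W. P (wW w)} = card {w \<in> W. P' (wW w)}"
    "{w \<in> W. P' (wW w)} \<subseteq> cs.span (C \<union> ap e ` {w \<in> W. P (wW w)} \<union> (M \<inter> mJ))"
proof -
  define S where "S = {w \<in> W. P (wW w)}"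
  define S' where "S' = {w \<in> W. P' (wW w)}"
  have S: "S \<subseteq> W" "\<And>w. w \<in> S \<Longrightarrow> wW w < 0" using P by (auto simp: S_def)
  note ind = raised_independent[OF S]
  have img: "ap e ` S \<subseteq> cs.span (S' \<union> (M \<inter> mJ))"
  proof
    fix v assume "v \<in> ap e ` S"
    then obtain w where w: "w \<in> S" "v = e \<cdot> w" by blast
    have "w \<in> M \<inter> J" using w(1) S(1) W(2) by blast
    then have "v \<in> M \<inter> J" using stables(1) e_g w(2) unfolding stable_def by blast
    moreover have "h \<cdot> w = of_int (wW w) *\<^sub>C w" using wW w(1) S(1) by blast
    then have "h \<cdot> v = of_int (wW w + 2) *\<^sub>C v" using raise_weight[OF sl2] w(2) by simp
    ultimately have "v \<in> cs.span ({u \<in> W. wW u = wW w + 2} \<union> (M \<inter> mJ))" by (rule weight_part)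
    moreover have "{u \<in> W. wW u = wW w + 2} \<subseteq> S'" using P w(1) by (auto simp: S_def S'_def)
    ultimately show "v \<in> cs.span (S' \<union> (M \<inter> mJ))"
      using cs.span_mono[of "{u \<in> W. wW u = wW w + 2} \<union> (M \<inter> mJ)" "S' \<union> (M \<inter> mJ)"] by blast
  qed
  obtain F where F: "finite F" "M \<subseteq> cs.span F" by (rule M_finite_span)
  have B: "cs.subspace (M \<inter> mJ)" "M \<inter> mJ \<subseteq> cs.span F"
    using stables(2) F(2) by (auto simp: stable_def)
  have S'W: "S' \<subseteq> W" by (auto simp: S'_def)
  obtain C where C: "C \<subseteq> S'" "card C + card (ap e ` S) = card S'"
      "S' \<subseteq> cs.span (C \<union> ap e ` S \<union> (M \<inter> mJ))"
    using steinitz_mod[OF B(1) F(1) B(2) ind(2) img indep_mod_subset[OF W(1) S'W]] .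
  show thesis
    by (rule that[of C]) (use C ind(1) in \<open>simp_all add: S_def S'_def card_image\<close>)
qed

lemma multiplicity_mono:
  assumes "l < 0" shows "card {w \<in> W. wW w = l} \<le> card {w \<in> W. wW w = l + 2}"
  by (rule raised_complement[of "\<lambda>x. x = l" "\<lambda>x. x = l + 2"]) (use assms in auto)

text \<open>A derivation maps everything into an ideal that contains the images of the variables.\<close>

lemma e_in_ideal:
  assumes I: "mi.subspace I" "TK \<subseteq> I" "\<And>y. y \<in> Y \<Longrightarrow> e \<cdot> y \<in> I" shows "e \<cdot> v \<in> I"
proof -
  have prods: "e \<cdot> prod_mset p \<in> I" if "set_mset p \<subseteq> Y" for p
    using that
  proof (induction p)
    case empty
    then show ?case using g_one[OF e_g] mi.subspace_0[OF I(1)] by simp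
  next
    case (add y p)
    have "e \<cdot> y * prod_mset p + y * e \<cdot> prod_mset p \<in> I"
      using add I(3) ideal_mult_left[OF I(1)] ideal_mult_right[OF I(1)] mi.subspace_add[OF I(1)] by simp
    then have "E \<cdot> (e \<cdot> y * prod_mset p + y * e \<cdot> prod_mset p) \<in> I" using E_in_ideal[OF I(1,2)] by blast
    then show ?case using g_mult[OF e_g, of y "prod_mset p"] by (simp del: ap_add_right)
  qed
  have "v \<in> cs.span ({prod_mset p |p. set_mset p \<subseteq> Y \<and> 0 \<le> size p} \<union> TK)"
    using monomials_span[of 0] by auto
  then show ?thesis
  proof (induction rule: cs.span_induct_alt)
    case base
    then show ?case using mi.subspace_0[OF I(1)] by simp
  next
    case (step c u w)
    have "e \<cdot> u \<in> I" using step(1) prods op_TK[of e u] e_g mi.subspace_0[OF I(1)] by auto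
    then show ?case using step(2) ideal_scale[OF I(1)] mi.subspace_add[OF I(1)] by simp
  qed
qed

text \<open>Killing the variables of weight above \<open>- j\<close> and the images of the others under \<open>e\<close> leaves of the
  equations only those lowest weight vectors whose weight is at most \<open>- k j\<close>; as the quotient is still
  finite dimensional, there are at least as many of them as there are lowest weight vectors of weight
  at most \<open>- j\<close> among the variables.\<close>

lemma lower_window:
  "card {y \<in> Y. - int j - 2 < wY y \<and> wY y \<le> - int j}
    \<le> card {w \<in> W. - int (k * j) - 2 < wW w \<and> wW w \<le> - int (k * j)}"
proof -
  define I0 where "I0 = {y \<in> Y. - int j < wY y}"
  define I1 where "I1 = {y \<in> Y. wY y \<le> - int j - 2}"
  define S where "S = {w \<in> W. wW w \<le> - int (k * j) - 2}"
  define S' where "S' = {w \<in> W. wW w \<le> - int (k * j)}"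
  obtain C where C: "C \<subseteq> S'" "card C + card S = card S'" "S' \<subseteq> cs.span (C \<union> ap e ` S \<union> (M \<inter> mJ))"
  proof (rule raised_complement[of "\<lambda>l. l \<le> - int (k * j) - 2" "\<lambda>l. l \<le> - int (k * j)",
        folded S_def S'_def])
    fix l assume l: "l \<le> - int (k * j) - 2"
    have "0 \<le> int (k * j)" by simp
    then show "l < 0 \<and> l + 2 \<le> - int (k * j)" using l by linarith
  qed
  \<comment> \<open>\<open>J\<close> will turn out to be contained in the ideal of \<open>Q\<close>, up to high order. Since \<open>J\<close> contains a power of the
    maximal ideal, \<open>Q\<close> has at least \<open>n\<close> elements.\<close>
  define Q where "Q = I0 \<union> ap e ` I1 \<union> C"
  define I where "I = mi.span (Q \<union> TK)"
  have idI: "mi.subspace I" unfolding I_def by (rule mi.subspace_span)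
  have QI: "Q \<union> TK \<subseteq> I" unfolding I_def by (rule mi.span_superset)
  have YM: "y \<in> M" "y \<in> K n 1" if "y \<in> Y" for y using Y(2) that by auto
  have WM: "w \<in> M" "w \<in> J" if "w \<in> W" for w using W(2) that by auto
  have I0I: "mi.span ({y \<in> Y. - int j < wY y} \<union> TK) \<subseteq> I"
    unfolding I_def Q_def I0_def by (rule mi.span_mono) blast
  have eY: "e \<cdot> y \<in> I" if y: "y \<in> Y" for y
  proof (cases "y \<in> I1")
    case True
    then show ?thesis using QI by (auto simp: Q_def)
  next
    case False
    have "h \<cdot> e \<cdot> y = of_int (wY y + 2) *\<^sub>C e \<cdot> y" using raise_weight[OF sl2 wY[OF y]] by simp
    moreover have "- int 1 * int j < wY y + 2" using False y by (simp add: I1_def)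
    ultimately have "e \<cdot> y \<in> mi.span ({y \<in> Y. - int j < wY y} \<union> TK)"
      using e_g ops_in_M g_K1[OF e_g YM(2)[OF y]] by (intro weight_vector_in_ideal[of _ 1]) auto
    then show ?thesis using I0I by blast
  qed
  \<comment> \<open>Hence the equations \<open>e w\<close> lie in \<open>I\<close>, which is why only the complement \<open>C\<close> of them occurs in \<open>Q\<close>.\<close>
  have eI: "e \<cdot> v \<in> I" for v using e_in_ideal[OF idI _ eY] QI by blast
  have WI: "w \<in> mi.span (I \<union> mJ)" if w: "w \<in> W" for w
  proof (cases "w \<in> S'")
    case True
    have "C \<union> ap e ` S \<union> (M \<inter> mJ) \<subseteq> mi.span (I \<union> mJ)"
      using QI eI mi.span_superset[of "I \<union> mJ"] by (auto simp: Q_def)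
    then have "cs.span (C \<union> ap e ` S \<union> (M \<inter> mJ)) \<subseteq> mi.span (I \<union> mJ)"
      by (intro cs.span_minimal ideal_cs mi.subspace_span)
    then show ?thesis using True C(3) by blast
  next
    case False
    then have "- int k * int j < wW w" using w by (simp add: S'_def)
    then have "w \<in> mi.span ({y \<in> Y. - int j < wY y} \<union> TK)"
      using WM[OF w] J_sub_K k_le wW[OF w] by (intro weight_vector_in_ideal[of _ k]) auto
    then show ?thesis using I0I mi.span_superset[of "I \<union> mJ"] by blast
  qed
  have JI1: "J \<subseteq> mi.span (I \<union> mJ)"
  proof
    fix v assume v: "v \<in> J"
    have "W \<union> (M \<inter> mJ) \<subseteq> mi.span (I \<union> mJ)" using WI mi.span_superset[of "I \<union> mJ"] by blast
    then have "cs.span (W \<union> (M \<inter> mJ)) \<subseteq> mi.span (I \<union> mJ)"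
      by (intro cs.span_minimal ideal_cs mi.subspace_span)
    moreover have "E \<cdot> v \<in> M \<inter> J" using v E_in_ideal[OF ideal_J TK_sub_J] by simp
    ultimately have "E \<cdot> v \<in> mi.span (I \<union> mJ)" using W(3) by blast
    moreover have "v - E \<cdot> v \<in> mi.span (I \<union> mJ)" using E_diff_TK(1) QI by (intro mi.span_base) blast
    ultimately show "v \<in> mi.span (I \<union> mJ)" using mi.span_add by fastforce
  qed
  \<comment> \<open>Nakayama's lemma in the form of iterated substitution of \<open>J \<subseteq> I + \<mm> J\<close> into itself.\<close>
  have JI: "J \<subseteq> mi.span (I \<union> K n s)" for s
  proof (induction s)
    case 0
    show ?case using mi.span_superset[of "I \<union> K n 0"] by simp
  next
    case (Suc s)
    let ?T = "mi.span (I \<union> K n (Suc s))"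
    have "a * b \<in> ?T" if ab: "a \<in> K n 1" "b \<in> J" for a b
    proof -
      have "b \<in> mi.span (I \<union> K n s)" using Suc ab(2) by blast
      then obtain u v where uv: "b = u + v" "u \<in> mi.span I" "v \<in> K n s" using mi_span_Un_ideal[OF _ ideal_K] by blast
      have "a * u \<in> mi.span I" using uv(2) by (rule mi.span_scale)
      then have "a * u \<in> ?T" using mi.span_mono[of I "I \<union> K n (Suc s)"] by blast
      moreover have "a * v \<in> K n (1 + s)" by (rule K_mult[OF ab(1) uv(3)])
      then have "a * v \<in> ?T" by (intro mi.span_base) simp
      ultimately show ?thesis unfolding uv(1) distrib_left by (rule mi.span_add)
    qed
    moreover have "Zn n \<subseteq> ?T" using Zn_subset_K mi.span_superset[of "I \<union> K n (Suc s)"] by blast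
    ultimately have "mJ \<subseteq> ?T" unfolding mJ_def by (intro mi.span_minimal mi.subspace_span) auto
    then have "mi.span (I \<union> mJ) \<subseteq> ?T"
      using mi.span_superset[of "I \<union> K n (Suc s)"] by (intro mi.span_minimal mi.subspace_span) auto
    then show ?case using JI1 by blast
  qed
  have "I \<union> TK = I" using QI by blast
  then have "J \<subseteq> mi.span I" using JI[of "Suc N"] by simp
  then have "J \<subseteq> mi.span (Q \<union> TK)" unfolding I_def by (simp add: mi.span_span)
  then have "K n N \<subseteq> mi.span (Q \<union> TK)" using K_sub_J by blast
  moreover have "finite Q" using fin C(1) finite_subset[of C W] by (auto simp: Q_def I0_def I1_def S'_def)
  moreover have "Q \<subseteq> K n 1"
  proof -
    have "K n k \<subseteq> K n 1" using k2 by (intro K_antimono) simp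
    moreover have "C \<subseteq> J" using C(1) WM(2) unfolding S'_def by blast
    ultimately have "C \<subseteq> K n 1" using J_sub_K by blast
    then show ?thesis using YM(2) g_K1[OF e_g] by (auto simp: Q_def I0_def I1_def)
  qed
  ultimately have "n \<le> card Q" using generators_ge_dimension by blast
  also have "\<dots> \<le> card (I0 \<union> ap e ` I1) + card C" unfolding Q_def by (rule card_Un_le)
  also have "\<dots> \<le> card I0 + card (ap e ` I1) + card C" by (simp add: card_Un_le)
  also have "\<dots> \<le> card I0 + card I1 + card C" using fin by (simp add: I1_def card_image_le)
  finally have 1: "card Y \<le> card I0 + card I1 + card C" using card_variables[OF Y] by simp
  have "Y = I0 \<union> (I1 \<union> {y \<in> Y. - int j - 2 < wY y \<and> wY y \<le> - int j})" by (auto simp: I0_def I1_def)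
  then have "card Y = card (I0 \<union> (I1 \<union> {y \<in> Y. - int j - 2 < wY y \<and> wY y \<le> - int j}))" by simp
  also have "\<dots> = card I0 + (card I1 + card {y \<in> Y. - int j - 2 < wY y \<and> wY y \<le> - int j})"
    using fin by (subst card_Un_disjoint; (subst card_Un_disjoint)?) (auto simp: I0_def I1_def)
  finally have 2: "card {y \<in> Y. - int j - 2 < wY y \<and> wY y \<le> - int j} \<le> card C" using 1 by simp
  have "S' = S \<union> {w \<in> W. - int (k * j) - 2 < wW w \<and> wW w \<le> - int (k * j)}" by (auto simp: S_def S'_def)
  then have "card S' = card (S \<union> {w \<in> W. - int (k * j) - 2 < wW w \<and> wW w \<le> - int (k * j)})" by simp
  also have "\<dots> = card S + card {w \<in> W. - int (k * j) - 2 < wW w \<and> wW w \<le> - int (k * j)}"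
    using fin by (intro card_Un_disjoint) (auto simp: S_def)
  finally show ?thesis using 2 C(2) by simp
qed

text \<open>Without variables of weight \<open>1\<close>, \<open>e\<close> would kill \<open>y\<close> modulo \<open>\<mm>\<^sup>2\<close>, but weight vectors killed by
  \<open>e\<close> have weights in the natural numbers.\<close>

lemma opposite_variable:
  assumes "y \<in> Y" "wY y = - 1" shows "\<exists>y'\<in>Y. wY y' = 1"
proof (rule ccontr)
  assume no: "\<not> ?thesis"
  have hy: "h \<cdot> y = (- 1) *\<^sub>C y" using wY[OF assms(1)] assms(2) by simp
  have "h \<cdot> e \<cdot> y = 1 *\<^sub>C e \<cdot> y" using raise_weight[OF sl2 hy] by simp
  moreover have "y \<in> M \<inter> K n 1" using Y(2) assms(1) by blast
  then have "e \<cdot> y \<in> M \<inter> K n 1" using stables(3) e_g unfolding stable_def by blast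
  then have "e \<cdot> y \<in> cs.span (Y \<union> (M \<inter> K n 2))" using Y(3) by blast
  moreover have subB: "cs.subspace (M \<inter> K n 2)" using stables(4) unfolding stable_def by blast
  moreover have "h \<cdot> x \<in> M \<inter> K n 2" if "x \<in> M \<inter> K n 2" for x
    using stables(4) h_g that unfolding stable_def by blast
  moreover have "\<exists>l. h \<cdot> u = l *\<^sub>C u" if "u \<in> Y" for u using wY that by blast
  ultimately have "e \<cdot> y \<in> cs.span ({u \<in> Y. h \<cdot> u = 1 *\<^sub>C u} \<union> (M \<inter> K n 2))"
    by (intro eigen_part_mod)
  moreover have "{u \<in> Y. h \<cdot> u = 1 *\<^sub>C u} = {}"
  proof (rule ccontr)
    assume "{u \<in> Y. h \<cdot> u = 1 *\<^sub>C u} \<noteq> {}"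
    then obtain u where u: "u \<in> Y" "h \<cdot> u = u" by auto
    have "u \<noteq> 0" using indep_mod_notin[OF Y(1) u(1)] cs.subspace_0[OF subB] by metis
    moreover have "(of_int (wY u) - 1) *\<^sub>C u = 0" using wY[OF u(1)] u(2) by (simp add: cs.scale_left_diff_distrib)
    ultimately have "of_int (wY u) = (1::complex)" by simp
    then show False using no u(1) by (metis of_int_1 of_int_eq_iff)
  qed
  moreover have "cs.span (M \<inter> K n 2) = M \<inter> K n 2" by (rule cs.span_eq_iff[THEN iffD2, OF subB])
  ultimately have "e \<cdot> y \<in> M \<inter> K n 2" by (simp only: Un_empty_left)
  moreover have "M \<inter> K n 2 \<subseteq> M \<inter> K n 1" using K_antimono[of 1 2 n] by auto
  ultimately have "- 1 \<in> (\<nat> :: complex set)"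
    using killed_weight_natural[OF sl2 stables(3,4) _ _ \<open>y \<in> M \<inter> K n 1\<close> indep_mod_notin[OF Y(1) assms(1)] hy]
    by blast
  then obtain i where "- 1 = (of_nat i :: complex)" by (auto elim: Nats_cases)
  then have "of_int (- 1) = (of_int (int i) :: complex)" by simp
  then show False by (simp only: of_int_eq_iff)
qed

text \<open>The weight of a monomial is the sum of the weights of its variables.\<close>

lemma h_zero_if_weights_zero:
  assumes "\<And>y. y \<in> Y \<Longrightarrow> wY y = 0" shows "h = 0"
proof (rule endo_eqI)
  fix v
  have "v \<in> cs.span ({prod_mset p |p. set_mset p \<subseteq> Y \<and> 0 \<le> size p} \<union> TK)"
    using monomials_span[of 0] by auto
  then show "h \<cdot> v = 0 \<cdot> v"
  proof (induction rule: cs.span_induct_alt)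
    case (step c u w)
    have "h \<cdot> u = 0"
    proof (cases "u \<in> TK")
      case True
      then show ?thesis using op_TK[OF in_ops[OF h_g]] by blast
    next
      case False
      then obtain p where p: "u = prod_mset p" "set_mset p \<subseteq> Y" using step(1) by blast
      have "wt p = (\<Sum>y\<in>#p. 0)" unfolding wt_def using assms p(2)
        by (intro arg_cong[of _ _ sum_mset] image_mset_cong) auto
      then show ?thesis using h_monomial[OF p(2)] p(1) by simp
    qed
    then show ?case using step(2) by simp
  qed simp
qed

end

section \<open>Many equations for an algebra with non-solvable derivations\<close>

context presentation
begin

lemma integral_weights:
  assumes s: "sl2 e f h" and AB: "stable g A" "stable g B" "A \<subseteq> M" "B \<subseteq> A"
    and Y: "indep_mod B Y" "Y \<subseteq> A" "\<forall>y\<in>Y. \<exists>l. h \<cdot> y = l *\<^sub>C y"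
  obtains w where "\<And>y. y \<in> Y \<Longrightarrow> h \<cdot> y = of_int (w y) *\<^sub>C y"
proof -
  have "\<forall>y\<in>Y. \<exists>i::int. h \<cdot> y = of_int i *\<^sub>C y"
  proof
    fix y assume y: "y \<in> Y"
    then obtain l where l: "h \<cdot> y = l *\<^sub>C y" using Y(3) by blast
    have "l \<in> \<int>"
      using weight_integral[OF s AB _ indep_mod_notin[OF Y(1) y] l] y Y(2) by blast
    then show "\<exists>i::int. h \<cdot> y = of_int i *\<^sub>C y" using l by (auto elim: Ints_cases)
  qed
  then obtain w where "\<forall>y\<in>Y. h \<cdot> y = of_int (w y) *\<^sub>C y"
    using bchoice[of Y "\<lambda>y i. h \<cdot> y = of_int i *\<^sub>C y"] by blast
  then show thesis using that by blast
qed

text \<open>The windows of equations dominate those of variables by \<open>lower_window\<close> and its mirror image, they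
  decrease by \<open>multiplicity_mono\<close>, and the variables have windows beyond the first because \<open>h \<noteq> 0\<close>.\<close>

theorem many_equations:
  assumes kN: "k \<le> Suc N" and nonsolv: "\<And>i. \<not> dser g i \<subseteq> {0}"
    and Gs: "finite Gs" "\<And>f. f \<in> J \<Longrightarrow> \<exists>u\<in>cs.span Gs. f - u \<in> mJ"
  shows "n + k \<le> card Gs + 1"
proof -
  obtain e f h where efh: "e \<in> g" "f \<in> g" "h \<in> g" "semisimple h" "h \<noteq> 0"
    "br h e = 2 *\<^sub>C e" "br h f = (- 2) *\<^sub>C f" "br e f - h \<in> rad"
    using solvable_or_sl2 nonsolv by blast
  have s: "sl2 e f h" using efh by (simp add: sl2_def)
  have K21: "M \<inter> K n 2 \<subseteq> M \<inter> K n 1" using K_antimono[of 1 2 n] by auto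
  have mJJ: "M \<inter> mJ \<subseteq> M \<inter> J" using mJ_sub_J by blast
  obtain Y where Y: "indep_mod (M \<inter> K n 2) Y" "Y \<subseteq> M \<inter> K n 1" "M \<inter> K n 1 \<subseteq> cs.span (Y \<union> (M \<inter> K n 2))"
    "\<forall>y\<in>Y. \<exists>l. h \<cdot> y = l *\<^sub>C y"
    using relative_eigenbasis[OF efh(3,4) stables(3) _ stables(4) K21] by blast
  obtain W where W: "indep_mod (M \<inter> mJ) W" "W \<subseteq> M \<inter> J" "M \<inter> J \<subseteq> cs.span (W \<union> (M \<inter> mJ))"
    "\<forall>w\<in>W. \<exists>l. h \<cdot> w = l *\<^sub>C w"
    using relative_eigenbasis[OF efh(3,4) stables(1) _ stables(2) mJJ] by blast
  obtain wY where wY: "\<And>y. y \<in> Y \<Longrightarrow> h \<cdot> y = of_int (wY y) *\<^sub>C y"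
    by (rule integral_weights[OF s stables(3,4) _ K21 Y(1,2,4)]) auto
  obtain wW where wW: "\<And>w. w \<in> W \<Longrightarrow> h \<cdot> w = of_int (wW w) *\<^sub>C w"
    by (rule integral_weights[OF s stables(1,2) _ mJJ W(1,2,4)]) auto
  interpret w: weighted n k N J e f h Y W wY wW
    by unfold_locales (use kN s Y W wY wW in auto)
  interpret w': weighted n k N J f e "- h" Y W "\<lambda>y. - wY y" "\<lambda>w. - wW w"
    by (rule w.weighted_flip)
  have neg: "(- int j - 2 < - x \<and> - x \<le> - int j) = (int j \<le> x \<and> x < int j + 2)" for j x by auto
  have le: "window Y wY j \<le> window W wW (k * j)" for j
    using w.lower_window[of j] w'.lower_window[of j] unfolding neg window_def by linarith
  have anti: "window W wW (Suc i) \<le> window W wW i" for i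
  proof -
    have two: "card {w \<in> W. v w = c \<or> v w = d} = card {w \<in> W. v w = c} + card {w \<in> W. v w = d}"
      if "c \<noteq> d" for c d :: int and v
    proof -
      have "{w \<in> W. v w = c \<or> v w = d} = {w \<in> W. v w = c} \<union> {w \<in> W. v w = d}" by auto
      then show ?thesis using w.fin(2) that by (simp only:) (subst card_Un_disjoint; auto)
    qed
    have lo: "card {w \<in> W. - int i - 2 < v w \<and> v w \<le> - int i}
        = card {w \<in> W. v w = - int i} + card {w \<in> W. v w = - int i - 1}" for i and v :: "mps \<Rightarrow> int"
    proof -
      have "{w \<in> W. - int i - 2 < v w \<and> v w \<le> - int i} = {w \<in> W. v w = - int i \<or> v w = - int i - 1}" by auto
      then show ?thesis using two[of "- int i" "- int i - 1" v] by simp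
    qed
    have suc: "- int (Suc i) = - int i - 1" by simp
    have "card {w \<in> W. wW w = - int (Suc i) - 1} \<le> card {w \<in> W. wW w = - int i}"
      using w.multiplicity_mono[of "- int (Suc i) - 1"] by simp
    then have 1: "card {w \<in> W. - int (Suc i) - 2 < wW w \<and> wW w \<le> - int (Suc i)}
        \<le> card {w \<in> W. - int i - 2 < wW w \<and> wW w \<le> - int i}"
      unfolding lo unfolding suc by linarith
    have "card {w \<in> W. - wW w = - int (Suc i) - 1} \<le> card {w \<in> W. - wW w = - int i}"
      using w'.multiplicity_mono[of "- int (Suc i) - 1"] by simp
    then have 2: "card {w \<in> W. - int (Suc i) - 2 < - wW w \<and> - wW w \<le> - int (Suc i)}
        \<le> card {w \<in> W. - int i - 2 < - wW w \<and> - wW w \<le> - int i}"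
      unfolding lo[of _ "\<lambda>w. - wW w"] unfolding suc by linarith
    show ?thesis using 1 2 unfolding neg window_def by linarith
  qed
  have pos: "1 \<le> window Y wY j" if "y \<in> Y" "\<bar>wY y\<bar> = int j \<or> \<bar>wY y\<bar> = int j + 1" for y j
  proof -
    have "{y \<in> Y. - int j - 2 < wY y \<and> wY y \<le> - int j} \<noteq> {} \<or> {y \<in> Y. int j \<le> wY y \<and> wY y < int j + 2} \<noteq> {}"
    proof -
      have "(- int j - 2 < wY y \<and> wY y \<le> - int j) \<or> (int j \<le> wY y \<and> wY y < int j + 2)"
        using that(2) by linarith
      then show ?thesis using that(1) by blast
    qed
    then have "0 < card {y \<in> Y. - int j - 2 < wY y \<and> wY y \<le> - int j} \<or> 0 < card {y \<in> Y. int j \<le> wY y \<and> wY y < int j + 2}"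
      using w.fin(1) by (simp add: card_gt_0_iff)
    then show ?thesis unfolding window_def by linarith
  qed
  obtain y0 where y0: "y0 \<in> Y" "wY y0 \<noteq> 0" using w.h_zero_if_weights_zero efh(5) by blast
  define m where "m = nat \<bar>wY y0\<bar>"
  have m: "\<bar>wY y0\<bar> = int m" "m \<noteq> 0" using y0 by (auto simp: m_def)
  \<comment> \<open>A variable of weight \<open>\<plusminus>m\<close> counts for \<open>j = m\<close> and \<open>j = m - 1\<close>. If \<open>m = 1\<close>, the second of these is not in the
    range of summation, but there is also a variable of the opposite weight.\<close>
  have "2 \<le> (\<Sum>j\<in>{1..m}. window Y wY j)"
  proof (cases "m = 1")
    case True
    then consider "wY y0 = - 1" | "wY y0 = 1" using m by linarith
    then have ex: "(\<exists>y\<in>Y. wY y = 1) \<and> (\<exists>y\<in>Y. wY y = - 1)"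
    proof cases
      case 1
      then show ?thesis using w.opposite_variable[OF y0(1)] y0(1) by blast
    next
      case 2
      then have "\<exists>y\<in>Y. - wY y = 1" using w'.opposite_variable[OF y0(1)] by simp
      then show ?thesis using y0(1) 2 by force
    qed
    then obtain y z where yz: "y \<in> Y" "wY y = 1" "z \<in> Y" "wY z = - 1" by blast
    have "z \<in> {y \<in> Y. - int 1 - 2 < wY y \<and> wY y \<le> - int 1}" "y \<in> {y \<in> Y. int 1 \<le> wY y \<and> wY y < int 1 + 2}"
      using yz by simp_all
    then have "{y \<in> Y. - int 1 - 2 < wY y \<and> wY y \<le> - int 1} \<noteq> {}" "{y \<in> Y. int 1 \<le> wY y \<and> wY y < int 1 + 2} \<noteq> {}"
      by blast+
    then have "0 < card {y \<in> Y. - int 1 - 2 < wY y \<and> wY y \<le> - int 1}" "0 < card {y \<in> Y. int 1 \<le> wY y \<and> wY y < int 1 + 2}"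
      using w.fin(1) by (simp_all only: card_gt_0_iff) auto
    then have "2 \<le> window Y wY 1" unfolding window_def by linarith
    then show ?thesis using True by simp
  next
    case False
    have "2 \<le> (\<Sum>j\<in>{m - 1, m}. window Y wY j)"
      using pos[OF y0(1), of m] pos[OF y0(1), of "m - 1"] m by simp
    also have "\<dots> \<le> (\<Sum>j\<in>{1..m}. window Y wY j)" using False m(2) by (intro sum_mono2) auto
    finally show ?thesis .
  qed
  then have 1: "card Y + k \<le> card W + 1"
    using weight_count[OF w.fin _ le anti] k2 by simp
  have "card W \<le> card (ap E ` Gs)"
  proof -
    obtain F where F: "finite F" "M \<subseteq> cs.span F" by (rule M_finite_span)
    have B: "cs.subspace (M \<inter> mJ)" "M \<inter> mJ \<subseteq> cs.span F"
      using stables(2) F(2) unfolding stable_def by blast+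
    have "W \<subseteq> cs.span (ap E ` Gs \<union> (M \<inter> mJ))"
    proof
      fix x assume "x \<in> W"
      then have x: "x \<in> M" "x \<in> J" using W(2) by auto
      then obtain u where u: "u \<in> cs.span Gs" "x - u \<in> mJ" using Gs(2) by blast
      have "E \<cdot> u \<in> cs.span (ap E ` Gs)" using u(1)
      proof (induction rule: cs.span_induct_alt)
        case (step c v y)
        then show ?case by (simp add: cs.span_add cs.span_scale cs.span_base)
      qed (simp add: cs.span_zero)
      then have "E \<cdot> u \<in> cs.span (ap E ` Gs \<union> (M \<inter> mJ))" using cs.span_mono[of "ap E ` Gs"] by blast
      moreover have "E \<cdot> (x - u) \<in> M \<inter> mJ" using u(2) E_in_ideal[OF ideal_mJ TK_sub_mJ] E_in_M by blast
      then have "E \<cdot> (x - u) \<in> cs.span (ap E ` Gs \<union> (M \<inter> mJ))" by (intro cs.span_base) blast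
      moreover have "x = E \<cdot> u + E \<cdot> (x - u)" using x(1) by (simp add: M_fix)
      ultimately show "x \<in> cs.span (ap E ` Gs \<union> (M \<inter> mJ))" using cs.span_add by metis
    qed
    then show ?thesis using indep_mod_card[OF B(1) F(1) B(2) W(1)] Gs(1) by blast
  qed
  also have "\<dots> \<le> card Gs" using Gs(1) by (rule card_image_le)
  finally show ?thesis using 1 card_variables[OF Y(1-3)] by simp
qed

end

section \<open>Quotients of the power series ring\<close>

text \<open>If \<open>X - c a\<close>, \<open>Y - d b\<close> and \<open>a b\<close> belong to an ideal, so does \<open>X Y\<close>.\<close>

lemma prime_identity:
  fixes X Y a b c d :: "'r::comm_ring_1"
  shows "Y * (X - c * a) + (c * a) * (Y - d * b) + (c * d) * (a * b) = X * Y"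
  by (simp add: algebra_simps)

text \<open>A presentation of the ring \<open>T\<close> by power series. It will be used for the ring in \<open>n\<close> variables, for its
  quotient by the defining ideal and for the algebra itself.\<close>

locale mps_hom = cring T for T :: "('a, 'b) ring_scheme" (structure) +
  fixes p :: "mps \<Rightarrow> 'a"
  assumes p_closed [simp]: "p f \<in> carrier T"
    and p_surj: "a \<in> carrier T \<Longrightarrow> \<exists>f. p f = a"
    and p_add: "p (f + g) = p f \<oplus> p g"
    and p_mult: "p (f * g) = p f \<otimes> p g"
    and p_one: "p 1 = \<one>"
begin

lemma p_zero: "p 0 = \<zero>"
  using p_add[of 0 0] by (metis add.r_cancel_one p_closed add_0)

lemma p_uminus: "p (- f) = \<ominus> p f"
  using p_add[of "- f" f] by (simp add: p_zero sum_zero_eq_neg)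

lemma p_diff: "p (f - g) = p f \<ominus> p g"
  using p_add[of f "- g"] by (simp add: p_uminus a_minus_def)

lemma p_eq_iff: "p f = p g \<longleftrightarrow> p (f - g) = \<zero>"
  by (simp add: p_diff)

lemma p_power: "p (f ^ k) = p f [^] k"
  by (induction k) (simp_all add: p_one p_mult m_comm)

lemma p_sum: "finite A \<Longrightarrow> p (\<Sum>i\<in>A. f i) = (\<Oplus>i\<in>A. p (f i))"
  by (induction A rule: finite_induct) (simp_all add: p_zero p_add)

lemma ideal_image:
  assumes L: "mi.subspace L" shows "ideal (p ` L) T"
proof (rule idealI[OF ring_axioms])
  show "subgroup (p ` L) (add_monoid T)"
  proof (rule add.subgroupI)
    show "p ` L \<noteq> {}" using mi.subspace_0[OF L] by blast
    show "\<ominus> a \<in> p ` L" if "a \<in> p ` L" for a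
      using that mi.subspace_neg[OF L] by (auto simp flip: p_uminus)
    show "a \<oplus> b \<in> p ` L" if "a \<in> p ` L" "b \<in> p ` L" for a b
      using that mi.subspace_add[OF L] by (auto simp flip: p_add)
  qed auto
next
  fix a x assume a: "a \<in> p ` L" "x \<in> carrier T"
  then obtain f g where fg: "f \<in> L" "a = p f" "x = p g" using p_surj by blast
  show "x \<otimes> a \<in> p ` L" "a \<otimes> x \<in> p ` L"
    unfolding fg(2,3) using ideal_mult_left[OF L fg(1), of g] ideal_mult_right[OF L fg(1), of g]
    by (auto simp flip: p_mult)
qed

lemma ideal_preimage:
  assumes "ideal A T" shows "mi.subspace {f. p f \<in> A}"
proof -
  interpret A: ideal A T by fact
  show ?thesis by (rule mi.subspaceI) (simp_all add: p_zero p_add p_mult A.I_l_closed A.a_closed)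
qed

lemma genideal_image: "Idl (p ` A) = p ` (mi.span A)"
proof
  show "Idl (p ` A) \<subseteq> p ` (mi.span A)"
    by (intro genideal_minimal ideal_image) (auto intro: mi.span_base)
  have "ideal (Idl (p ` A)) T" by (rule genideal_ideal) auto
  then have "mi.span A \<subseteq> {f. p f \<in> Idl (p ` A)}"
    using genideal_self[of "p ` A"] by (intro mi.span_minimal ideal_preimage) (auto simp: image_subset_iff)
  then show "p ` (mi.span A) \<subseteq> Idl (p ` A)" by blast
qed

lemma image_mem_iff:
  assumes "mi.subspace L" "{f. p f = \<zero>} \<subseteq> L" shows "p f \<in> p ` L \<longleftrightarrow> f \<in> L"
proof
  assume "p f \<in> p ` L"
  then obtain g where g: "g \<in> L" "p f = p g" by blast
  then have "f - g \<in> L" using assms(2) p_eq_iff by blast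
  then show "f \<in> L" using mi.subspace_add[OF assms(1) _ g(1), of "f - g"] by simp
qed simp

lemma prime_image:
  assumes L: "mi.subspace L" "{f. p f = \<zero>} \<subseteq> L" "1 \<notin> L"
    and prime: "\<And>a b. a * b \<in> L \<Longrightarrow> a \<in> L \<or> b \<in> L"
  shows "primeideal (p ` L) T"
proof (rule primeidealI[OF ideal_image[OF L(1)] cring_axioms])
  show "carrier T \<noteq> p ` L"
    using image_mem_iff[OF L(1,2), of 1] L(3) p_closed[of 1] by blast
next
  fix a b assume ab: "a \<in> carrier T" "b \<in> carrier T" "a \<otimes> b \<in> p ` L"
  then obtain f g where fg: "a = p f" "b = p g" using p_surj by metis
  then have "f * g \<in> L" using ab(3) image_mem_iff[OF L(1,2)] by (simp flip: p_mult)
  then show "a \<in> p ` L \<or> b \<in> p ` L" using prime fg by blast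
qed

text \<open>If no power of \<open>x\<close> is in the kernel, an ideal \<open>P\<close> maximal among those containing the kernel but no power
  of \<open>x\<close> is prime. It lies strictly inside the maximal ideal, so the Krull dimension is positive.\<close>

lemma krull_dim_zero_imp_nilpotent:
  assumes dim: "krull_dim T = 0" and ker: "{f. p f = \<zero>} \<subseteq> K n 1" and x: "x \<in> K n 1"
  shows "\<exists>k. p (x ^ k) = \<zero>"
proof (rule ccontr)
  assume no: "\<not> ?thesis"
  define J where "J = {f. p f = \<zero>}"
  have J: "mi.subspace J"
    unfolding J_def by (rule mi.subspaceI) (simp_all add: p_zero p_add p_mult)
  define \<A> where "\<A> = {P. mi.subspace P \<and> J \<subseteq> P \<and> (\<forall>k. x ^ k \<notin> P)}"
  have JA: "J \<in> \<A>" using no J by (auto simp: \<A>_def J_def)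
  have "\<Union>C \<in> \<A>" if C: "C \<noteq> {}" "subset.chain \<A> C" for C
  proof -
    have CA: "C \<subseteq> \<A>" and lin: "\<And>P Q. P \<in> C \<Longrightarrow> Q \<in> C \<Longrightarrow> P \<subseteq> Q \<or> Q \<subseteq> P"
      using C(2) by (auto simp: subset_chain_def)
    have "mi.subspace (\<Union>C)"
    proof (rule mi.subspaceI)
      show "0 \<in> \<Union>C" using C(1) CA mi.subspace_0 unfolding \<A>_def by blast
      show "u + v \<in> \<Union>C" if uv: "u \<in> \<Union>C" "v \<in> \<Union>C" for u v
      proof -
        obtain P Q where PQ: "P \<in> C" "Q \<in> C" "u \<in> P" "v \<in> Q" using uv by blast
        then obtain W where W: "W \<in> C" "u \<in> W" "v \<in> W" using lin[OF PQ(1,2)] by blast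
        then have "mi.subspace W" using CA unfolding \<A>_def by blast
        then show ?thesis using W mi.subspace_add by blast
      qed
      show "c * u \<in> \<Union>C" if "u \<in> \<Union>C" for c u
        using that CA mi.subspace_scale unfolding \<A>_def by blast
    qed
    then show ?thesis using C(1) CA unfolding \<A>_def by blast
  qed
  then obtain P where P: "P \<in> \<A>" and max: "\<And>Q. Q \<in> \<A> \<Longrightarrow> P \<subseteq> Q \<Longrightarrow> Q = P"
    using subset_Zorn_nonempty[of \<A>] JA by blast
  have sP: "mi.subspace P" and JP: "J \<subseteq> P" and xP: "\<And>k. x ^ k \<notin> P" using P by (auto simp: \<A>_def)
  have 1: "1 \<notin> P" using xP[of 0] by simp
  \<comment> \<open>The ideal generated by \<open>P\<close> and \<open>a\<close> is larger than \<open>P\<close>, so it contains a power of \<open>x\<close>.\<close>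
  have grow: "\<exists>k c. x ^ k - c * a \<in> P" if "a \<notin> P" for a
  proof -
    define Q where "Q = {u. \<exists>c. u - c * a \<in> P}"
    have "mi.subspace Q"
    proof (rule mi.subspaceI)
      show "0 \<in> Q" unfolding Q_def using mi.subspace_0[OF sP] by (auto intro: exI[of _ 0])
      show "u + v \<in> Q" if uv: "u \<in> Q" "v \<in> Q" for u v
      proof -
        obtain c d where "u - c * a \<in> P" "v - d * a \<in> P" using uv unfolding Q_def by blast
        then have "(u - c * a) + (v - d * a) \<in> P" by (rule mi.subspace_add[OF sP])
        then have "(u + v) - (c + d) * a \<in> P" by (simp add: algebra_simps)
        then show ?thesis unfolding Q_def by blast
      qed
      show "b * u \<in> Q" if u: "u \<in> Q" for b u
      proof -
        obtain c where "u - c * a \<in> P" using u unfolding Q_def by blast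
        then have "b * (u - c * a) \<in> P" by (rule ideal_mult_left[OF sP])
        then have "b * u - (b * c) * a \<in> P" by (simp add: right_diff_distrib)
        then show ?thesis unfolding Q_def by blast
      qed
    qed
    moreover have PQ: "P \<subseteq> Q" unfolding Q_def by (auto intro: exI[of _ 0])
    moreover have "a \<in> Q" unfolding Q_def using mi.subspace_0[OF sP] by (auto intro: exI[of _ 1])
    ultimately have "\<exists>k. x ^ k \<in> Q" using max[of Q] JP \<open>a \<notin> P\<close> unfolding \<A>_def by blast
    then show ?thesis unfolding Q_def by blast
  qed
  have prime: "a \<in> P \<or> b \<in> P" if ab: "a * b \<in> P" for a b
  proof (rule ccontr)
    assume no: "\<not> (a \<in> P \<or> b \<in> P)"
    then obtain i c where c: "x ^ i - c * a \<in> P" using grow[of a] by auto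
    obtain j d where d: "x ^ j - d * b \<in> P" using grow[of b] no by auto
    have "x ^ j * (x ^ i - c * a) + (c * a) * (x ^ j - d * b) + (c * d) * (a * b) \<in> P"
      by (intro mi.subspace_add[OF sP] ideal_mult_left[OF sP] ab c d)
    also have "x ^ j * (x ^ i - c * a) + (c * a) * (x ^ j - d * b) + (c * d) * (a * b) = x ^ (i + j)"
      by (simp only: prime_identity power_add)
    finally show False using xP by blast
  qed
  have PK: "P \<subseteq> K n 1"
  proof
    fix f assume f: "f \<in> P"
    have "coef f {#} = 0"
    proof (rule ccontr)
      assume "coef f {#} \<noteq> 0"
      then obtain g where "f * g = 1" by (rule unit_if_constant_nonzero)
      then show False using ideal_mult_right[OF sP f, of g] 1 by simp
    qed
    then show "f \<in> K n 1" by (simp add: K_def monoms_def)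
  qed
  have primeK: "a \<in> K n 1 \<or> b \<in> K n 1" if "a * b \<in> K n 1" for a b
  proof -
    have "coef (a * b) {#} = coef a {#} * coef b {#}" by (simp add: coef_mult)
    then show ?thesis using that by (auto simp: K_def monoms_def)
  qed
  have "primeideal (p ` P) T" by (rule prime_image[OF sP _ 1 prime]) (use JP J_def in blast)
  moreover have "primeideal (p ` K n 1) T"
    by (rule prime_image[OF ideal_K ker _ primeK]) (simp add: K_def monoms_def coef_one)
  moreover have "p ` P \<subset> p ` K n 1"
    using PK x image_mem_iff[OF sP, of x] JP xP[of 1] unfolding J_def by fastforce
  ultimately have "\<exists>P'. (\<forall>i\<le>1. primeideal (P' i) T) \<and> (\<forall>i<1. P' i \<subset> P' (Suc i))"
    by (intro exI[of _ "\<lambda>i::nat. if i = 0 then p ` P else p ` K n 1"]) auto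
  then have "enat 1 \<le> krull_dim T" unfolding krull_dim_def by (intro Sup_upper) blast
  then show False using dim by (simp add: zero_enat_def)
qed

text \<open>If \<open>x\<^sub>i\<^sup>k\<close> is in the kernel for all \<open>i\<close>, so is every monomial of degree above \<open>n k\<close>, as it has an exponent
  of at least \<open>k\<close>.\<close>

lemma krull_dim_zero_imp_finite:
  assumes dim: "krull_dim T = 0" and ker: "Zn n \<subseteq> {f. p f = \<zero>}" "{f. p f = \<zero>} \<subseteq> K n 1"
  shows "\<exists>N. K n N \<subseteq> {f. p f = \<zero>}"
proof -
  define J where "J = {f. p f = \<zero>}"
  have J: "mi.subspace J"
    unfolding J_def by (rule mi.subspaceI) (simp_all add: p_zero p_add p_mult)
  have "\<exists>k. mon {#i#} ^ k \<in> J" for i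
    using krull_dim_zero_imp_nilpotent[OF dim ker(2), of "mon {#i#}"] mon_in_K[of 1 "{#i#}" n]
    by (simp add: J_def)
  then obtain e where e: "\<And>i. mon {#i#} ^ e i \<in> J" by metis
  define k where "k = Max (insert 0 (e ` {..<n}))"
  have pw: "mon {#i#} ^ k \<in> J" if "i < n" for i
  proof -
    have "e i \<le> k" unfolding k_def using that by (intro Max_ge) auto
    then show ?thesis using ideal_mult_right[OF J e[of i], of "mon {#i#} ^ (k - e i)"]
      by (simp flip: power_add)
  qed
  have rep: "mon (replicate_mset j i) = mon {#i#} ^ j" for i j
  proof (induction j)
    case (Suc j)
    then show ?case using mon_mult[of "{#i#}" "replicate_mset j i"] by simp
  qed (simp add: mon_empty)
  have mon: "mon m \<in> J" if m: "set_mset m \<subseteq> {..<n}" "size m = Suc (n * k)" for m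
  proof -
    have "\<exists>i<n. k \<le> count m i"
    proof (rule ccontr)
      assume "\<not> ?thesis"
      then have "(\<Sum>i\<in>set_mset m. count m i) \<le> (\<Sum>i\<in>set_mset m. k)"
        using m(1) by (intro sum_mono) (metis lessThan_iff linear subsetD)
      also have "\<dots> \<le> n * k" using card_mono[OF _ m(1)] by simp
      finally show False using m(2) by (simp add: size_multiset_overloaded_eq)
    qed
    then obtain i where i: "i < n" "k \<le> count m i" by blast
    then have "replicate_mset k i \<subseteq># m" by (simp add: count_le_replicate_mset_subset_eq)
    then have "mon m = mon {#i#} ^ k * mon (m - replicate_mset k i)"
      by (simp flip: rep add: mon_mult)
    then show ?thesis using ideal_mult_right[OF J pw[OF i(1)]] by simp
  qed
  have "K n (Suc (n * k)) \<subseteq> J"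
  proof
    fix f assume "f \<in> K n (Suc (n * k))"
    then obtain u where u: "u \<in> mi.span (mon ` {m. set_mset m \<subseteq> {..<n} \<and> size m = Suc (n * k)})"
      and z: "f - u \<in> Zn n" by (rule K_split)
    have "mon ` {m. set_mset m \<subseteq> {..<n} \<and> size m = Suc (n * k)} \<subseteq> J" using mon by auto
    then have "u \<in> J" using u mi.span_minimal[OF _ J] by auto
    moreover have "f - u \<in> J" using z ker(1) J_def by blast
    ultimately show "f \<in> J" using mi.subspace_add[OF J, of "f - u" u] by simp
  qed
  then show ?thesis unfolding J_def by blast
qed

end

section \<open>Restriction to finitely many variables\<close>

text \<open>Restriction of a power series to the first \<open>n\<close> variables, setting the others to zero.\<close>

definition rs :: "nat \<Rightarrow> mps \<Rightarrow> nat multiset \<Rightarrow> complex" where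
  "rs n f = (\<lambda>m. if set_mset m \<subseteq> {..<n} then coef f m else 0)"

lemma mps_hom_rs: "mps_hom (mpower_series n) (rs n)"
proof -
  interpret A: algebra "class_ring :: complex ring" "mpower_series n" by (rule mpower_series_algebra)
  show ?thesis
  proof (intro mps_hom.intro mps_hom_axioms.intro A.is_cring)
    fix f g :: mps
    show "rs n f \<in> carrier (mpower_series n)" by (simp add: rs_def mpower_series_def)
    show "rs n (f + g) = rs n f \<oplus>\<^bsub>mpower_series n\<^esub> rs n g"
      by (auto simp: rs_def mpower_series_def)
    show "rs n 1 = \<one>\<^bsub>mpower_series n\<^esub>"
      by (auto simp: rs_def mpower_series_def coef_one)
    show "rs n (f * g) = rs n f \<otimes>\<^bsub>mpower_series n\<^esub> rs n g"
    proof
      fix m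
      show "rs n (f * g) m = (rs n f \<otimes>\<^bsub>mpower_series n\<^esub> rs n g) m"
      proof (cases "set_mset m \<subseteq> {..<n}")
        case True
        then have "set_mset a \<subseteq> {..<n} \<and> set_mset (m - a) \<subseteq> {..<n}" if "a \<subseteq># m" for a
          using set_mset_mono[OF that] set_mset_mono[OF diff_subset_eq_self[of m a]] by blast
        then show ?thesis using True by (simp add: rs_def mpower_series_def coef_mult)
      next
        case False
        have "\<not> (set_mset a \<subseteq> {..<n} \<and> set_mset (m - a) \<subseteq> {..<n})" if "a \<subseteq># m" for a
          using that False by (metis Un_least set_mset_union subset_mset.add_diff_inverse)
        then show ?thesis using False by (auto simp: rs_def mpower_series_def intro!: sum.neutral)
      qed
    qed
  next
    fix a assume "a \<in> carrier (mpower_series n)"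
    then show "\<exists>f. rs n f = a"
      by (intro exI[of _ "Mps a"]) (auto simp: rs_def mpower_series_def)
  qed
qed

lemma rs_scale: "rs n (c *\<^sub>C f) = c \<odot>\<^bsub>mpower_series n\<^esub> rs n f"
  by (auto simp: rs_def mpower_series_def)

lemma rs_zero_iff: "rs n f = \<zero>\<^bsub>mpower_series n\<^esub> \<longleftrightarrow> f \<in> Zn n"
  by (auto simp: rs_def mpower_series_def Zn_def fun_eq_iff)

lemma rs_var: "i < n \<Longrightarrow> rs n (mon {#i#}) = mvar i"
  by (auto simp: rs_def mvar_def coef_mon)

lemma rs_mem_K: "Mps (rs n f) \<in> K n k \<longleftrightarrow> f \<in> K n k"
  by (auto simp: rs_def K_def monoms_def)


lemma mps_hom_comp:
  assumes p: "mps_hom T p" and \<phi>: "\<phi> \<in> Ring.ring_hom T U" "\<phi> ` carrier T = carrier U" and U: "cring U"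
  shows "mps_hom U (\<lambda>f. \<phi> (p f))"
proof -
  interpret mps_hom T p by (rule p)
  show ?thesis
  proof (intro mps_hom.intro mps_hom_axioms.intro U)
    fix a assume "a \<in> carrier U"
    then obtain b where "b \<in> carrier T" "a = \<phi> b" using \<phi>(2) by (metis imageE)
    then show "\<exists>f. \<phi> (p f) = a" using p_surj[of b] by metis
  qed (simp_all add: p_add p_mult p_one ring_hom_closed[OF \<phi>(1)] ring_hom_add[OF \<phi>(1)]
      ring_hom_mult[OF \<phi>(1)] ring_hom_one[OF \<phi>(1)])
qed

lemma ideal_power_in_K: "ideal_power (mpower_series n) (mmax_ideal n) k \<subseteq> {u. Mps u \<in> K n k}"
proof (induction k)
  case 0
  then show ?case by simp
next
  case (Suc k)
  interpret mps_hom "mpower_series n" "rs n" by (rule mps_hom_rs)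
  have max: "mmax_ideal n \<subseteq> {u. Mps u \<in> K n 1}"
  proof -
    have "mmax_ideal n = Idl\<^bsub>mpower_series n\<^esub> (rs n ` (\<lambda>i. mon {#i#}) ` {..<n})"
      unfolding mmax_ideal_def image_image by (rule arg_cong) (auto simp: rs_var)
    also have "\<dots> = rs n ` mi.span ((\<lambda>i. mon {#i#}) ` {..<n})" by (rule genideal_image)
    also have "\<dots> \<subseteq> rs n ` K n 1"
      by (intro image_mono mi.span_minimal ideal_K) (auto intro: mon_in_K)
    also have "\<dots> \<subseteq> {u. Mps u \<in> K n 1}" by (auto simp: rs_mem_K)
    finally show ?thesis .
  qed
  show ?case
  proof
    fix u assume "u \<in> ideal_power (mpower_series n) (mmax_ideal n) (Suc k)"
    then have "u \<in> ideal_prod (mpower_series n) (ideal_power (mpower_series n) (mmax_ideal n) k)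
        (mmax_ideal n)"
      by (simp add: ideal_power_def nat_pow_def ideals_set_def)
    then have "Mps u \<in> K n (Suc k)"
    proof induction
      case (prod i j)
      then have "Mps i \<in> K n k" "Mps j \<in> K n 1" using Suc max by auto
      then have "Mps i * Mps j \<in> K n (Suc k)" using K_mult by fastforce
      then show ?case by (simp add: times_mps_def mpower_series_def)
    next
      case (sum a b)
      then have "Mps a + Mps b \<in> K n (Suc k)" using mi.subspace_add[OF ideal_K] by blast
      then show ?case by (simp add: plus_mps_def mpower_series_def)
    qed
    then show "u \<in> {u. Mps u \<in> K n (Suc k)}" by blast
  qed
qed

text \<open>A presentation of the algebra \<open>S\<close>, with the ideal \<open>J\<close> recovered as the kernel.\<close>

locale alg_presentation = mps_hom S q + presentation n k N "{f. q f = \<zero>\<^bsub>S\<^esub>}"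
  for S :: "(complex, 'a) module" (structure) and q n k N +
  assumes alg: "algebra class_ring S" and q_scale: "q (c *\<^sub>C f) = c \<odot> q f"

text \<open>For \<open>n > 0\<close> the order is attained: \<open>x\<^sub>0\<^sup>N\<close> is in the ideal, so the exponents in question are at most \<open>N\<close>.
  For \<open>n = 0\<close> the order carries no information and \<open>k = 2\<close> is used.\<close>

lemma zero_dim_presentation_imp:
  assumes S: "algebra class_ring S" and pres: "zero_dim_presentation n I S"
  obtains q k N where "alg_presentation S q n k N" "k \<le> N" "n = 0 \<or> k = presentation_order n I"
proof -
  let ?R = "mpower_series n"
  interpret S: algebra "class_ring :: complex ring" S by (rule S)
  interpret R: mps_hom ?R "rs n" by (rule mps_hom_rs)
  have I: "ideal I ?R" "I \<noteq> carrier ?R" and dim: "krull_dim (?R Quot I) = 0"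
    and I2: "I \<subseteq> ideal_power ?R (mmax_ideal n) 2"
    using pres by (auto simp: zero_dim_presentation_def)
  obtain h where h: "h \<in> ring_iso (?R Quot I) S"
    and hs: "\<And>c f. f \<in> carrier ?R \<Longrightarrow> h (I +>\<^bsub>?R\<^esub> (c \<odot>\<^bsub>?R\<^esub> f)) = c \<odot>\<^bsub>S\<^esub> h (I +>\<^bsub>?R\<^esub> f)"
    using pres by (auto simp: zero_dim_presentation_def)
  interpret I: ideal I ?R by (rule I)
  have Q: "cring (?R Quot I)" by (rule I.quotient_is_cring[OF R.is_cring])
  have surjI: "(+>\<^bsub>?R\<^esub>) I ` carrier ?R = carrier (?R Quot I)"
    by (auto simp: FactRing_def A_RCOSETS_def')
  interpret Q: mps_hom "?R Quot I" "\<lambda>f. I +>\<^bsub>?R\<^esub> rs n f"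
    by (rule mps_hom_comp[OF mps_hom_rs I.rcos_ring_hom surjI Q])
  define q where "q = (\<lambda>f. h (I +>\<^bsub>?R\<^esub> rs n f))"
  have hr: "h \<in> Ring.ring_hom (?R Quot I) S" and hb: "bij_betw h (carrier (?R Quot I)) (carrier S)"
    using h by (auto simp: ring_iso_def)
  have q: "mps_hom S q" unfolding q_def
    by (rule mps_hom_comp[OF Q.mps_hom_axioms hr _ S.is_cring]) (use hb in \<open>simp add: bij_betw_def\<close>)
  interpret q: mps_hom S q by (rule q)
  have qs: "q (c *\<^sub>C f) = c \<odot>\<^bsub>S\<^esub> q f" for c f
    unfolding q_def rs_scale by (rule hs) simp
  define J where "J = {f. q f = \<zero>\<^bsub>S\<^esub>}"
  have QJ: "{f. I +>\<^bsub>?R\<^esub> rs n f = \<zero>\<^bsub>?R Quot I\<^esub>} = J"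
  proof -
    have "h (I +>\<^bsub>?R\<^esub> rs n f) = h (I +>\<^bsub>?R\<^esub> rs n 0) \<longleftrightarrow> I +>\<^bsub>?R\<^esub> rs n f = I +>\<^bsub>?R\<^esub> rs n 0" for f
      using hb Q.p_closed by (metis bij_betw_imp_inj_on inj_on_eq_iff)
    then show ?thesis
      unfolding J_def by (simp add: Q.p_zero flip: q.p_zero) (simp add: q_def Q.p_zero)
  qed
  have JI: "f \<in> J \<longleftrightarrow> rs n f \<in> I" for f
    unfolding QJ[symmetric]
    using I.a_rcos_const[of "rs n f"] R.a_coset_join1[of I "rs n f"] I.a_subgroup by (auto simp: FactRing_def)
  have J: "mi.subspace J" using R.ideal_preimage[OF I(1)] by (simp flip: JI)
  have J_K: "J \<subseteq> K n m" if "I \<subseteq> ideal_power ?R (mmax_ideal n) m" for m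
    using that ideal_power_in_K[of n m] JI rs_mem_K by blast
  have Zn_J: "Zn n \<subseteq> J" using JI rs_zero_iff by (metis I.zero_closed subsetI)
  have JK1: "J \<subseteq> K n 1" using J_K[OF I2] K_antimono[of 1 2 n] by auto
  obtain N where N: "K n N \<subseteq> J"
    using Q.krull_dim_zero_imp_finite[OF dim, of n] Zn_J JK1 unfolding QJ by blast
  have bound: "m \<le> N" if "n \<noteq> 0" "I \<subseteq> ideal_power ?R (mmax_ideal n) m" for m
  proof (rule ccontr)
    assume "\<not> m \<le> N"
    have "mon (replicate_mset N 0) \<in> K n m" using N J_K[OF that(2)] mon_in_K[of N "replicate_mset N 0" n] by auto
    moreover have "replicate_mset N 0 \<in> monoms n m" using \<open>\<not> m \<le> N\<close> that(1) by (auto simp: monoms_def)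
    ultimately show False by (auto simp: K_def coef_mon)
  qed
  define k where "k = (if n = 0 then 2 else presentation_order n I)"
  have k: "2 \<le> k \<and> I \<subseteq> ideal_power ?R (mmax_ideal n) k"
  proof (cases "n = 0")
    case False
    show ?thesis using GreatestI_nat[of "\<lambda>m. 2 \<le> m \<and> I \<subseteq> ideal_power ?R (mmax_ideal n) m" 2 N]
        bound[OF False] I2 False by (simp add: k_def presentation_order_def)
  qed (use I2 in \<open>simp add: k_def\<close>)
  have "alg_presentation S q n k (max N k)"
    unfolding alg_presentation_def alg_presentation_axioms_def presentation_def
    using q J K_antimono[of N "max N k" n] N J_K k S qs unfolding J_def by auto
  then show thesis by (rule that) (auto simp: k_def)
qed

section \<open>Lifting derivations to power series\<close>

lemma pd_one: "pd i 1 = 0"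
  using pd_mult[of i 1 1] by simp

lemma pd_power: "pd i (f ^ Suc p) = of_nat (Suc p) *\<^sub>C (f ^ p * pd i f)"
proof (induction p)
  case (Suc p)
  have "pd i (f ^ Suc (Suc p)) = f ^ Suc p * pd i f + f * (of_nat (Suc p) *\<^sub>C (f ^ p * pd i f))"
    unfolding power_Suc[of f "Suc p"] pd_mult[of i f] Suc.IH by (simp only: mult.commute[of "pd i f"])
  also have "f * (of_nat (Suc p) *\<^sub>C (f ^ p * pd i f)) = of_nat (Suc p) *\<^sub>C (f ^ Suc p * pd i f)"
    by simp
  also have "f ^ Suc p * pd i f + \<dots> = (1 + of_nat (Suc p)) *\<^sub>C (f ^ Suc p * pd i f)"
    unfolding cscale_add_left cscale_one ..
  also have "1 + of_nat (Suc p) = (of_nat (Suc (Suc p)) :: complex)" by simp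
  finally show ?case .
qed simp

context alg_presentation
begin

abbreviation J :: "mps set" where "J \<equiv> {f. q f = \<zero>}"

lemma q_eq_iff: "q f = q f' \<longleftrightarrow> f - f' \<in> J"
  by (simp add: p_eq_iff[of f f'])

lemma q_E [simp]: "q (E \<cdot> f) = q f"
  using E_diff_TK(2)[of f] TK_sub_J by (auto simp: q_eq_iff)

lemma one_notin_J: "1 \<notin> J"
proof
  assume "1 \<in> J"
  then have "1 \<in> K n k" using J_sub_K by blast
  moreover have "{#} \<in> monoms n k" using k2 by (simp add: monoms_def)
  ultimately show False by (auto simp: K_def coef_one)
qed

lemma unit_notin_J:
  assumes "f * h \<in> J" "f \<notin> K n 1" shows "h \<in> J"
proof -
  have "coef f {#} \<noteq> 0" using assms(2) by (simp add: K_def monoms_def)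
  then obtain f' where "f * f' = 1" by (rule unit_if_constant_nonzero)
  then have "h = f' * (f * h)" by (metis mult.assoc mult.commute mult_1)
  then show ?thesis using ideal_mult_left[OF ideal_J assms(1)] by metis
qed

lemma Der_props:
  assumes "D \<in> carrier (Der S)"
  shows "D (q f) \<in> carrier S" "D (q (f + f')) = D (q f) \<oplus> D (q f')"
    "D (q (c *\<^sub>C f)) = c \<odot> D (q f)"
    "D (q (f * f')) = D (q f) \<otimes> q f' \<oplus> q f \<otimes> D (q f')"
    "D (q 0) = \<zero>"
proof -
  show 1: "D (q f) \<in> carrier S" for f using assms by (auto simp: Der_def module_hom_def)
  show 2: "D (q (f + f')) = D (q f) \<oplus> D (q f')" for f f'
    using assms by (auto simp: Der_def module_hom_def p_add)
  show "D (q (c *\<^sub>C f)) = c \<odot> D (q f)"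
    using assms by (auto simp: Der_def module_hom_def q_scale class_ring_simps)
  show "D (q (f * f')) = D (q f) \<otimes> q f' \<oplus> q f \<otimes> D (q f')"
    using assms by (auto simp: Der_def p_mult)
  show "D (q 0) = \<zero>" using 2[of 0 0] 1[of 0] by (metis add.r_cancel_one add_0)
qed

definition lifts :: "mps endo \<Rightarrow> ('a \<Rightarrow> 'a) \<Rightarrow> bool" where
  "lifts T D \<longleftrightarrow> (\<forall>f. D (q f) = q (T \<cdot> f))"

text \<open>Choosing preimages \<open>r i\<close> of the images of the variables gives the derivation \<open>T0 = \<Sum> r\<^sub>i \<partial>\<^sub>i\<close> of power
  series, which agrees with \<open>D\<close> on monomials and hence, up to terms of high order, everywhere. It
  preserves the maximal ideal since \<open>r i\<close> has no constant term, for the following reason. Let \<open>p + 1\<close> be the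
  least exponent with \<open>x\<^sub>i\<^bsup>p + 1\<^esup>\<close> in \<open>J\<close>. Then \<open>(p + 1) r\<^sub>i x\<^sub>i\<^sup>p\<close> is in \<open>J\<close> too, and if \<open>r i\<close> were a unit,
  \<open>x\<^sub>i\<^sup>p\<close> would be in \<open>J\<close>.\<close>

lemma ex_lift:
  assumes D: "D \<in> carrier (Der S)"
  shows "\<exists>T\<in>g. lifts T D"
proof -
  note D_props = Der_props[OF D]
  have "\<exists>r. \<forall>i. q (r i) = D (q (mon {#i#}))" by (intro choice allI p_surj D_props(1))
  then obtain r where r: "\<And>i. q (r i) = D (q (mon {#i#}))" by blast
  define T0 where "T0 f = (\<Sum>i<n. r i * pd i f)" for f
  have T0_add: "T0 (f + f') = T0 f + T0 f'" for f f'
    by (simp add: T0_def pd_add distrib_left sum.distrib)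
  have T0_scale: "T0 (c *\<^sub>C f) = c *\<^sub>C T0 f" for c f
    by (simp add: T0_def pd_scale cs.scale_sum_right)
  have T0_mult: "T0 (f * f') = T0 f * f' + f * T0 f'" for f f'
    unfolding T0_def sum_distrib_left sum_distrib_right sum.distrib[symmetric]
    by (intro sum.cong refl) (simp only: pd_mult distrib_left mult.assoc mult.left_commute[of f])
  have T0_K: "T0 f \<in> K n j" if "f \<in> K n (Suc j)" for f j
    unfolding T0_def using that
    by (intro mi.subspace_sum[OF ideal_K] ideal_mult_left[OF ideal_K] pd_in_K) auto
  have agree: "q (T0 f) = D (q f)" for f
  proof -
    define A where "A = {f. q (T0 f) = D (q f)}"
    have A_add: "f + f' \<in> A" if "f \<in> A" "f' \<in> A" for f f'
      using that by (simp add: A_def T0_add p_add[of "T0 f"] D_props(2))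
    have A_scale: "c *\<^sub>C f \<in> A" if "f \<in> A" for c f
      using that unfolding A_def mem_Collect_eq T0_scale q_scale[of c "T0 f"] D_props(3) by simp
    have A_mult: "f * f' \<in> A" if "f \<in> A" "f' \<in> A" for f f'
      using that unfolding A_def mem_Collect_eq T0_mult D_props(4) by (simp add: p_add p_mult)
    have A0: "0 \<in> A" using T0_scale[of 0 0] unfolding A_def mem_Collect_eq D_props(5) by (simp add: p_zero)
    have A_mon: "mon m \<in> A" if "set_mset m \<subseteq> {..<n}" for m
      using that
    proof (induction m)
      case empty
      have "D (q 1) \<oplus> D (q 1) = D (q 1)"
        using D_props(4)[of 1 1] D_props(1)[of 1] by (simp add: p_one)
      then have "D (q 1) = \<zero>" using D_props(1)[of 1] by simp
      then show ?case by (simp add: A_def T0_def mon_empty pd_one p_zero)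
    next
      case (add i m)
      have "T0 (mon {#i#}) = r i"
        using add.prems by (simp add: T0_def pd_var if_distrib[of "\<lambda>x. r _ * x"] cong: if_cong)
      then have "mon {#i#} \<in> A" by (simp add: A_def r)
      then have "mon {#i#} * mon m \<in> A" using add by (intro A_mult) auto
      then show ?case by (simp add: mon_mult)
    qed
    have A_sum: "(\<Sum>m\<in>B. coef f m *\<^sub>C mon m) \<in> A" if "finite B" "\<forall>m\<in>B. set_mset m \<subseteq> {..<n}" for B
      using that by (induction B rule: finite_induct) (auto intro: A0 A_add A_scale A_mon)
    have "E \<cdot> f \<in> A"
      unfolding E_def trunc_expand by (rule A_sum) (auto simp: finite_monoms, auto simp: monoms_def)
    moreover have "f - E \<cdot> f \<in> A"
    proof -
      have 1: "q (f - E \<cdot> f) = \<zero>" using E_diff_TK(1)[of f] TK_sub_J by blast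
      have "q (T0 (f - E \<cdot> f)) = \<zero>" using T0_K[OF E_diff_TK(1)] K_sub_J by blast
      then show ?thesis using 1 D_props(5) by (simp add: A_def p_zero)
    qed
    ultimately have "f - E \<cdot> f + E \<cdot> f \<in> A" by (rule A_add[rotated])
    then show ?thesis by (simp add: A_def)
  qed
  have T0_J: "T0 f \<in> J" if "f \<in> J" for f
    using that agree[of f] D_props(5) by (simp add: p_zero)
  have r_K: "r i \<in> K n 1" if i: "i < n" for i
  proof (rule ccontr)
    assume nr: "r i \<notin> K n 1"
    let ?x = "mon {#i#}"
    have "?x ^ N \<in> J" using power_in_K[of ?x n N] mon_in_K[of 1 "{#i#}" n] K_sub_J by auto
    then have "?x ^ (LEAST p. ?x ^ p \<in> J) \<in> J" by (rule LeastI)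
    moreover have "(LEAST p. ?x ^ p \<in> J) \<noteq> 0"
      using calculation one_notin_J by (metis power_0)
    ultimately obtain p where p: "?x ^ Suc p \<in> J" and least: "(LEAST p. ?x ^ p \<in> J) = Suc p"
      by (metis not0_implies_Suc)
    have "T0 (?x ^ Suc p) = (\<Sum>j<n. if j = i then of_nat (Suc p) *\<^sub>C (r i * ?x ^ p) else 0)"
      unfolding T0_def pd_power by (intro sum.cong) (auto simp: pd_var)
    also have "\<dots> = of_nat (Suc p) *\<^sub>C (r i * ?x ^ p)" using i by simp
    finally have "of_nat (Suc p) *\<^sub>C (r i * ?x ^ p) \<in> J" using T0_J[OF p] by simp
    then have "(1 / of_nat (Suc p)) *\<^sub>C of_nat (Suc p) *\<^sub>C (r i * ?x ^ p) \<in> J"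
      by (rule ideal_scale[OF ideal_J])
    then have "r i * ?x ^ p \<in> J" by (simp del: of_nat_Suc)
    then have "?x ^ p \<in> J" by (rule unit_notin_J[OF _ nr])
    then show False using least not_less_Least[of p "\<lambda>p. ?x ^ p \<in> J"] by simp
  qed
  have T0_K': "T0 f \<in> K n (Suc j)" if "f \<in> K n (Suc j)" for f j
  proof -
    have "r i * pd i f \<in> K n (1 + j)" if "i < n" for i
      using r_K[OF that] pd_in_K[OF that \<open>f \<in> K n (Suc j)\<close>] by (rule K_mult)
    then show ?thesis unfolding T0_def by (intro mi.subspace_sum[OF ideal_K]) auto
  qed
  have lin: "lin T0" by (simp add: lin_def T0_add T0_scale)
  \<comment> \<open>Truncation is harmless because \<open>T0\<close> does not lower the order.\<close>
  define T where "T = E * Endo T0 * E"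
  have T_ap: "T \<cdot> f = E \<cdot> T0 (E \<cdot> f)" for f by (simp add: T_def ap_Endo[OF lin])
  have "T \<in> ops" by (rule ops_intro) (simp_all add: T_ap M_fix)
  moreover have "derv T"
    unfolding derv_def
  proof (intro allI)
    fix f h
    have "E \<cdot> (T \<cdot> f * h + f * T \<cdot> h) = E \<cdot> (T0 (E \<cdot> f) * E \<cdot> h + E \<cdot> f * T0 (E \<cdot> h))"
      by (simp add: T_ap E_mult_E)
    also have "\<dots> = E \<cdot> T0 (E \<cdot> f * E \<cdot> h)" by (simp add: T0_mult)
    also have "\<dots> = E \<cdot> T0 (E \<cdot> (f * h))"
    proof -
      have "E \<cdot> f * E \<cdot> h - E \<cdot> (f * h) \<in> TK"
        by (simp add: M_fix E_mult_E flip: E_zero_iff)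
      then have "T0 (E \<cdot> f * E \<cdot> h - E \<cdot> (f * h)) \<in> TK" by (rule T0_K')
      moreover have "T0 (E \<cdot> f * E \<cdot> h - E \<cdot> (f * h)) = T0 (E \<cdot> f * E \<cdot> h) - T0 (E \<cdot> (f * h))"
        using T0_add[of "E \<cdot> f * E \<cdot> h - E \<cdot> (f * h)" "E \<cdot> (f * h)"] by simp
      ultimately show ?thesis by (simp add: E_eq_iff)
    qed
    finally show "T \<cdot> (f * h) = E \<cdot> (T \<cdot> f * h + f * T \<cdot> h)" by (simp add: T_ap)
  qed
  moreover have lift: "lifts T D"
    unfolding lifts_def by (simp add: T_ap agree)
  moreover have "T \<cdot> f \<in> J" if "f \<in> J" for f
    using that lift D_props(5) by (simp add: lifts_def p_zero flip: lift[unfolded lifts_def, rule_format])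
  moreover have "T \<cdot> f \<in> K n 1" if f: "f \<in> K n 1" for f
  proof -
    have "E \<cdot> f \<in> K n 1" using f E_in_ideal[OF ideal_K TK_sub] by simp
    then have "T0 (E \<cdot> f) \<in> K n 1" using T0_K'[of "E \<cdot> f" 0] by simp
    then show ?thesis unfolding T_ap using E_in_ideal[OF ideal_K TK_sub] by simp
  qed
  ultimately have "T \<in> g" unfolding g_def by blast
  then show ?thesis using lift by blast
qed

text \<open>Lifting is compatible with brackets and linear combinations.\<close>

lemma derived_series_lifts:
  "derived_series class_ring (Der S) i \<subseteq> {D \<in> carrier (Der S). \<exists>T\<in>dser g i. lifts T D}"
proof (induction i)
  case 0
  then show ?case using ex_lift by auto
next
  case (Suc i)
  interpret A: lie_algebra class_ring "Der S" by (rule Der_lie_algebra[OF alg])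
  let ?U = "{D \<in> carrier (Der S). \<exists>T\<in>dser g (Suc i). lifts T D}"
  have rec: "\<zero>\<^bsub>Der S\<^esub> = (\<lambda>a\<in>carrier S. \<zero>)"
    "D \<oplus>\<^bsub>Der S\<^esub> D' = (\<lambda>a\<in>carrier S. D a \<oplus> D' a)"
    "c \<odot>\<^bsub>Der S\<^esub> D = (\<lambda>a\<in>carrier S. c \<odot> D a)"
    "lie_bracket (Der S) D D' = (\<lambda>a\<in>carrier S. D (D' a) \<ominus> D' (D a))" for D D' c
    by (simp_all add: Der_def)
  have sub: "cs.subspace (dser g (Suc i))" by simp
  have "LinearCombinations.submodule class_ring ?U (Der S)"
  proof (rule LinearCombinations.submodule.intro[OF A.module_axioms])
    show "\<zero>\<^bsub>Der S\<^esub> \<in> ?U"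
      using cs.subspace_0[OF sub] by (auto simp: lifts_def rec(1) p_zero intro: bexI[of _ 0])
        (simp flip: rec(1))
    show "D \<oplus>\<^bsub>Der S\<^esub> D' \<in> ?U" if D: "D \<in> ?U" "D' \<in> ?U" for D D'
    proof -
      obtain T T' where T: "T \<in> dser g (Suc i)" "lifts T D" "T' \<in> dser g (Suc i)" "lifts T' D'"
        using D by blast
      then have "lifts (T + T') (D \<oplus>\<^bsub>Der S\<^esub> D')" by (simp add: lifts_def rec(2) p_add)
      then show ?thesis using cs.subspace_add[OF sub T(1,3)] D by blast
    qed
    show "c \<odot>\<^bsub>Der S\<^esub> D \<in> ?U" if D: "D \<in> ?U" "c \<in> carrier class_ring" for D c
    proof -
      obtain T where T: "T \<in> dser g (Suc i)" "lifts T D" using D by blast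
      then have "lifts (c *\<^sub>C T) (c \<odot>\<^bsub>Der S\<^esub> D)" by (simp add: lifts_def rec(3) q_scale)
      then show ?thesis using cs.subspace_scale[OF sub T(1)] D A.smult_closed by blast
    qed
  qed blast
  moreover have "{lie_bracket (Der S) x y |x y. x \<in> derived_series class_ring (Der S) i \<and>
      y \<in> derived_series class_ring (Der S) i} \<subseteq> ?U"
  proof
    fix b assume "b \<in> {lie_bracket (Der S) x y |x y. x \<in> derived_series class_ring (Der S) i \<and>
      y \<in> derived_series class_ring (Der S) i}"
    then obtain D D' where b: "b = lie_bracket (Der S) D D'"
      and D: "D \<in> derived_series class_ring (Der S) i" "D' \<in> derived_series class_ring (Der S) i" by blast
    then obtain T T' where T: "T \<in> dser g i" "lifts T D" "T' \<in> dser g i" "lifts T' D'"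
      and c: "D \<in> carrier (Der S)" "D' \<in> carrier (Der S)" using Suc.IH by blast
    have "lifts (br T T') b" using T(2,4) by (simp add: lifts_def b rec(4) br_def p_diff)
    moreover have "br T T' \<in> dser g (Suc i)" unfolding dser.simps(2) using T(1,3) by (blast intro: cs.span_base)
    ultimately show "b \<in> ?U" using A.bracket_closed[OF c] b by blast
  qed
  ultimately show ?case
    unfolding derived_series.simps(2) by (intro A.span_is_subset)
qed

lemma solvable_if_dser_trivial:
  assumes "dser g i \<subseteq> {0}" shows "solvable_lie class_ring (Der S)"
proof -
  interpret A: lie_algebra class_ring "Der S" by (rule Der_lie_algebra[OF alg])
  have 0: "\<zero>\<^bsub>Der S\<^esub> = (\<lambda>a\<in>carrier S. \<zero>)" by (simp add: Der_def)
  have "D = \<zero>\<^bsub>Der S\<^esub>" if "D \<in> derived_series class_ring (Der S) i" for D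
  proof (rule extensionalityI)
    have D: "D \<in> carrier (Der S)" "lifts 0 D" using that derived_series_lifts[of i] assms by auto
    show "D \<in> extensional (carrier S)" using D(1) by (simp add: Der_def)
    show "\<zero>\<^bsub>Der S\<^esub> \<in> extensional (carrier S)" unfolding 0 by simp
    fix a assume "a \<in> carrier S"
    then show "D a = \<zero>\<^bsub>Der S\<^esub> a" using D(2) p_surj[of a] by (auto simp: 0 lifts_def p_zero)
  qed
  moreover have "\<zero>\<^bsub>Der S\<^esub> \<in> derived_series class_ring (Der S) i"
  proof (cases i)
    case (Suc j)
    have "derived_series class_ring (Der S) j \<subseteq> carrier (Der S)"
      using derived_series_lifts[of j] by blast
    then have "LinearCombinations.submodule class_ring (derived_series class_ring (Der S) i) (Der S)"
      unfolding Suc derived_series.simps(2) using A.bracket_closed by (intro A.span_is_submodule) blast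
    then show ?thesis by (simp add: LinearCombinations.submodule_def)
  qed simp
  ultimately show ?thesis unfolding solvable_lie_def by blast
qed

end

section \<open>Koszul homology in degree one\<close>

instantiation "fun" :: (type, cspace) cspace
begin

definition cscale_fun :: "complex \<Rightarrow> ('a \<Rightarrow> 'b) \<Rightarrow> 'a \<Rightarrow> 'b" where
  "c *\<^sub>C f = (\<lambda>x. c *\<^sub>C f x)"

instance
  by standard (simp_all add: cscale_fun_def fun_eq_iff cscale_add_right cscale_add_left)

end

lemma cscale_fun_apply [simp]: "(c *\<^sub>C f) x = c *\<^sub>C f x"
  by (simp add: cscale_fun_def)

lemma sum_fun_apply: "(\<Sum>i\<in>A. f i) x = (\<Sum>i\<in>A. f i x)"
  by (induction A rule: infinite_finite_induct) auto

context alg_presentation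
begin

lemma J_sub_max: "J \<subseteq> K n 1"
  using J_sub_K K_antimono[of 1 k n] k2 by auto

text \<open>A power series with nonzero constant term maps to a unit.\<close>

lemma carrier_if_unit:
  assumes "ideal A S" "q f \<in> A" "f \<notin> K n 1" shows "A = carrier S"
proof -
  interpret A: ideal A S by fact
  have "coef f {#} \<noteq> 0" using assms(3) by (simp add: K_def monoms_def)
  then obtain h where h: "f * h = 1" by (rule unit_if_constant_nonzero)
  have "q f \<otimes> q h \<in> A" by (rule A.I_r_closed[OF assms(2)]) simp
  then have "\<one> \<in> A" by (simp flip: p_mult p_one add: h)
  then show ?thesis by (rule A.one_imp_carrier)
qed

lemma max_proper: "q ` K n 1 \<noteq> carrier S"
proof
  assume "q ` K n 1 = carrier S"
  then have "q 1 \<in> q ` K n 1" by (simp del: p_one)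
  then have "1 \<in> K n 1" using image_mem_iff[OF ideal_K J_sub_max] by blast
  then show False by (simp add: K_def monoms_def coef_one)
qed

lemma the_maximal_ideal: "(THE M. maximalideal M S) = q ` K n 1"
proof (rule the_equality)
  show "maximalideal (q ` K n 1) S"
  proof (rule maximalidealI[OF ideal_image[OF ideal_K] max_proper[symmetric]])
    fix A assume A: "ideal A S" "q ` K n 1 \<subseteq> A" "A \<subseteq> carrier S"
    show "A = q ` K n 1 \<or> A = carrier S"
    proof (cases "A \<subseteq> q ` K n 1")
      case False
      then obtain a where a: "a \<in> A" "a \<notin> q ` K n 1" by blast
      then obtain f where f: "a = q f" using A(3) p_surj by blast
      then have "A = carrier S" using carrier_if_unit[OF A(1), of f] a by auto
      then show ?thesis ..
    qed (use A(2) in blast)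
  qed
next
  fix M assume "maximalideal M S"
  then interpret max: maximalideal M S .
  have "M \<subseteq> q ` K n 1"
  proof
    fix a assume a: "a \<in> M"
    then obtain f where f: "a = q f" using p_surj[OF max.Icarr[OF a]] by blast
    then have "f \<in> K n 1" using carrier_if_unit[OF max.is_ideal, of f] a max.I_notcarr by auto
    then show "a \<in> q ` K n 1" using f by blast
  qed
  then have "q ` K n 1 = M \<or> q ` K n 1 = carrier S"
    by (intro max.I_maximal ideal_image ideal_K) auto
  then show "M = q ` K n 1" using max_proper by blast
qed

text \<open>The classes of the variables generate the maximal ideal; a generating set of least cardinality is minimal.\<close>

lemma ex_minimal_generators: "\<exists>ys. minimal_generators S (q ` K n 1) ys"
proof -
  let ?X = "mon ` {m. set_mset m \<subseteq> {..<n} \<and> size m = 1}"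
  have "{m. set_mset m \<subseteq> {..<n} \<and> size m = 1} \<subseteq> monoms n 2" by (auto simp: monoms_def)
  then have fin: "finite (q ` ?X)" using finite_subset[OF _ finite_monoms] by blast
  have "q ` mi.span ?X = q ` K n 1"
  proof
    show "q ` mi.span ?X \<subseteq> q ` K n 1"
      by (intro image_mono mi.span_minimal ideal_K) (auto intro: mon_in_K)
    show "q ` K n 1 \<subseteq> q ` mi.span ?X"
    proof
      fix a assume "a \<in> q ` K n 1"
      then obtain f where f: "f \<in> K n 1" "a = q f" by blast
      obtain u where u: "u \<in> mi.span ?X" "f - u \<in> Zn n" using f(1) by (rule K_split)
      then have "q f = q u" using Zn_subset_K[of n N] K_sub_J by (auto simp: q_eq_iff)
      then show "a \<in> q ` mi.span ?X" using u f by blast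
    qed
  qed
  then have "Idl (q ` ?X) = q ` K n 1" by (simp add: genideal_image)
  then have ex: "finite (q ` ?X) \<and> q ` ?X \<subseteq> carrier S \<and> Idl (q ` ?X) = q ` K n 1" using fin by auto
  define P where "P Y \<longleftrightarrow> finite Y \<and> Y \<subseteq> carrier S \<and> Idl Y = q ` K n 1" for Y
  obtain Y where Y: "P Y" and least: "\<And>Y'. P Y' \<Longrightarrow> card Y \<le> card Y'"
    using ex_has_least_nat[of P "q ` ?X" card] ex unfolding P_def[of "q ` ?X"] by auto
  obtain ys where ys: "set ys = Y" "distinct ys"
    using finite_distinct_list[of Y] Y unfolding P_def by auto
  have "Idl Y' \<noteq> q ` K n 1" if "Y' \<subset> Y" for Y'
  proof
    assume "Idl Y' = q ` K n 1"
    then have "P Y'" using that Y unfolding P_def by (auto intro: finite_subset)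
    then show False using least[of Y'] psubset_card_mono[OF _ that] Y unfolding P_def by simp
  qed
  then show ?thesis unfolding minimal_generators_def using Y ys unfolding P_def by blast
qed

end

locale koszul = alg_presentation +
  fixes ys :: "'a list"
  assumes ys_carrier: "set ys \<subseteq> carrier S" and ys_gen: "Idl (set ys) = q ` K n 1"
begin

definition Y :: "nat \<Rightarrow> mps" where "Y i = (SOME f. q f = ys ! i)"

text \<open>The differential \<open>e\<^sub>i \<mapsto> y\<^sub>i\<close> of the Koszul complex, lifted to power series. A cycle lifts to a tuple \<open>s\<close> with
  \<open>dot s\<close> in \<open>J\<close>, and \<open>s \<mapsto> dot s\<close> maps the first homology onto \<open>J / \<mm> J\<close>.\<close>

definition dot :: "(nat \<Rightarrow> mps) \<Rightarrow> mps" where "dot s = (\<Sum>i<length ys. Y i * s i)"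

lemma q_Y: "i < length ys \<Longrightarrow> q (Y i) = ys ! i"
  unfolding Y_def by (rule someI_ex) (metis nth_mem p_surj subsetD ys_carrier)

lemma Y_K: "i < length ys \<Longrightarrow> Y i \<in> K n 1"
proof -
  assume i: "i < length ys"
  then have "q (Y i) \<in> Idl (set ys)" using genideal_self[OF ys_carrier] by (auto simp: q_Y)
  then show ?thesis unfolding ys_gen image_mem_iff[OF ideal_K J_sub_max] .
qed

lemma dot_add: "dot (s + t) = dot s + dot t"
  by (simp add: dot_def distrib_left sum.distrib)

lemma dot_scale: "dot (c *\<^sub>C s) = c *\<^sub>C dot s"
  by (simp add: dot_def cs.scale_sum_right)

lemma dot_mult: "dot (\<lambda>i. f * s i) = f * dot s"
  unfolding dot_def sum_distrib_left by (simp only: mult.left_commute[of f])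

lemma ideal_range_dot: "mi.subspace (range dot)"
proof (rule mi.subspaceI)
  show "0 \<in> range dot" by (rule range_eqI[of _ _ 0]) (simp add: dot_def)
  show "u + v \<in> range dot" if "u \<in> range dot" "v \<in> range dot" for u v
    using that by (auto simp flip: dot_add)
  show "c * u \<in> range dot" if "u \<in> range dot" for c u
    using that by (auto simp flip: dot_mult)
qed

lemma max_mod_J:
  assumes "f \<in> K n 1" shows "\<exists>s. f - dot s \<in> J"
proof -
  have Y_dot: "Y i \<in> range dot" if "i < length ys" for i
  proof (rule range_eqI)
    show "Y i = dot (\<lambda>j. if j = i then 1 else 0)"
      using that by (simp add: dot_def if_distrib[of "\<lambda>x. Y _ * x"] cong: if_cong)
  qed
  have "set ys = q ` Y ` {..<length ys}"
    by (auto simp: set_conv_nth image_image q_Y intro!: image_eqI)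
  then have "q ` K n 1 = q ` mi.span (Y ` {..<length ys})"
    unfolding ys_gen[symmetric] by (simp only: genideal_image)
  also have "\<dots> \<subseteq> q ` range dot"
    using Y_dot by (intro image_mono mi.span_minimal ideal_range_dot) auto
  finally obtain s where "q f = q (dot s)" using assms by blast
  then show ?thesis unfolding q_eq_iff by blast
qed

text \<open>Since \<open>J \<subseteq> \<mm>\<^sup>2\<close>, it suffices to treat a product of \<open>a\<close> and \<open>b\<close> in \<open>\<mm>\<close>. Modulo \<open>J\<close> the factor \<open>b\<close> is a
  combination of the generators, and \<open>a\<close> moves the error from \<open>J\<close> to \<open>\<mm> J\<close>.\<close>

lemma J_mod_mJ:
  assumes "f \<in> J" shows "\<exists>s. f - dot s \<in> mJ"
proof -
  define L where "L = {f. \<exists>s. f - dot s \<in> mJ}"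
  have L: "mi.subspace L"
  proof (rule mi.subspaceI)
    show "0 \<in> L" unfolding L_def using mi.subspace_0[OF ideal_mJ]
      by (auto intro!: exI[of _ 0] simp: dot_def)
    show "u + v \<in> L" if uv: "u \<in> L" "v \<in> L" for u v
    proof -
      obtain s t where "u - dot s \<in> mJ" "v - dot t \<in> mJ" using uv unfolding L_def by blast
      then have "(u - dot s) + (v - dot t) \<in> mJ" by (rule mi.subspace_add[OF ideal_mJ])
      then have "(u + v) - dot (s + t) \<in> mJ" by (simp add: dot_add algebra_simps)
      then show ?thesis unfolding L_def by blast
    qed
    show "c * u \<in> L" if u: "u \<in> L" for c u
    proof -
      obtain s where "u - dot s \<in> mJ" using u unfolding L_def by blast
      then have "c * (u - dot s) \<in> mJ" by (rule ideal_mult_left[OF ideal_mJ])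
      then have "c * u - dot (\<lambda>i. c * s i) \<in> mJ" by (simp add: dot_mult right_diff_distrib)
      then show ?thesis unfolding L_def by blast
    qed
  qed
  have prod: "a * b \<in> L" if ab: "a \<in> K n 1" "b \<in> K n 1" for a b
  proof -
    obtain s where s: "b - dot s \<in> J" using max_mod_J[OF ab(2)] by blast
    then have "a * (b - dot s) \<in> mJ" by (rule mJ_mult[OF ab(1)])
    then have "a * b - dot (\<lambda>i. a * s i) \<in> mJ" by (simp add: dot_mult right_diff_distrib)
    then show ?thesis unfolding L_def by blast
  qed
  have mon2: "mon m \<in> L" if m: "set_mset m \<subseteq> {..<n}" "size m = 2" for m
  proof -
    obtain i m' where i: "m = add_mset i m'" "size m' = 1"
      using m(2) by (metis One_nat_def Suc_1 size_eq_Suc_imp_eq_union size_add_mset nat.inject)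
    have "mon m = mon {#i#} * mon m'" by (simp add: mon_mult i)
    then show ?thesis using prod[of "mon {#i#}" "mon m'"] i(2) by (simp add: mon_in_K)
  qed
  have "f \<in> K n 2" using assms J_sub_K K_antimono[OF k2, of n] by blast
  then obtain u where u: "u \<in> mi.span (mon ` {m. set_mset m \<subseteq> {..<n} \<and> size m = 2})" "f - u \<in> Zn n"
    by (rule K_split)
  have "u \<in> L" using u(1) mi.span_minimal[OF _ L, of "mon ` {m. set_mset m \<subseteq> {..<n} \<and> size m = 2}"] mon2
    by auto
  moreover have "f - u \<in> L"
  proof -
    have "f - u \<in> mJ" unfolding mJ_def by (rule mi.span_base) (use u(2) in blast)
    then show ?thesis unfolding L_def by (auto intro!: exI[of _ 0] simp: dot_def)
  qed
  ultimately have "f - u + u \<in> L" using mi.subspace_add[OF L] by blast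
  then show ?thesis unfolding L_def by simp
qed

abbreviation faces :: "nat \<Rightarrow> nat set set" where
  "faces p \<equiv> {A. A \<subseteq> {..<length ys} \<and> card A = p}"

text \<open>Chains of degree one are families indexed by singletons; \<open>chain s\<close> is the class of the tuple \<open>s\<close>.\<close>

definition chain :: "(nat \<Rightarrow> mps) \<Rightarrow> nat set \<Rightarrow> 'a" where
  "chain s = (\<lambda>A\<in>faces 1. q (s (the_elem A)))"

lemma chain_eq_iff: "chain s = chain t \<longleftrightarrow> (\<forall>i<length ys. s i - t i \<in> J)"
proof
  assume "chain s = chain t"
  then have "chain s {i} = chain t {i}" for i by simp
  then have "q (s i) = q (t i)" if "i < length ys" for i
    using that by (simp add: chain_def) (metis the_elem_eq)
  then show "\<forall>i<length ys. s i - t i \<in> J" unfolding q_eq_iff by blast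
next
  assume "\<forall>i<length ys. s i - t i \<in> J"
  then have "q (s i) = q (t i)" if "i < length ys" for i using that by (simp add: q_eq_iff)
  then show "chain s = chain t"
    unfolding chain_def by (intro restrict_ext) (auto simp: card_1_singleton_iff)
qed

lemma ex_chain:
  assumes "v \<in> faces 1 \<rightarrow>\<^sub>E carrier S" shows "\<exists>s. v = chain s"
proof -
  have "\<exists>f. i < length ys \<longrightarrow> q f = v {i}" for i
    using assms p_surj[of "v {i}"] by (auto simp: PiE_iff)
  then obtain s where s: "\<And>i. i < length ys \<Longrightarrow> q (s i) = v {i}" by metis
  have "v = chain s"
  proof (rule extensionalityI[of v "faces 1"])
    show "v \<in> extensional (faces 1)" using assms by (simp add: PiE_iff)
    show "chain s \<in> extensional (faces 1)" by (simp add: chain_def)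
    show "v A = chain s A" if "A \<in> faces 1" for A
      using that s by (auto simp: chain_def card_1_singleton_iff)
  qed
  then show ?thesis by blast
qed

lemma chain_PiE: "chain s \<in> faces 1 \<rightarrow>\<^sub>E carrier S"
  by (auto simp: chain_def)

lemma chain_add: "chain s \<oplus>\<^bsub>koszul_chains S ys 1\<^esub> chain t = chain (s + t)"
  by (auto simp: koszul_chains_def Let_def chain_def p_add intro!: restrict_ext)

lemma chain_scale: "c \<odot>\<^bsub>koszul_chains S ys 1\<^esub> chain s = chain (c *\<^sub>C s)"
  by (auto simp: koszul_chains_def Let_def chain_def q_scale intro!: restrict_ext)

lemma diff_chain: "koszul_diff S ys 1 (chain s) {} = q (dot s)"
proof -
  have "koszul_diff S ys 1 (chain s) {} = (\<Oplus>i\<in>{..<length ys}. ys ! i \<otimes> q (s i))"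
    unfolding koszul_diff_def using ys_carrier
    by (auto simp: chain_def subset_iff intro!: finsum_cong')
  also have "\<dots> = (\<Oplus>i\<in>{..<length ys}. q (Y i * s i))"
    by (intro finsum_cong') (auto simp: p_mult simp flip: q_Y)
  finally show ?thesis by (simp add: dot_def p_sum)
qed

lemma cycles_eq: "koszul_cycles S ys 1 = chain ` {s. dot s \<in> J}"
proof -
  have B: "B \<subseteq> {..<length ys} \<and> Suc (card B) = 1 \<longleftrightarrow> B = {}" for B :: "nat set"
    using finite_subset[of B "{..<length ys}"] by auto
  have "carrier (koszul_chains S ys 1) = faces 1 \<rightarrow>\<^sub>E carrier S"
    by (simp add: koszul_chains_def Let_def)
  also have "\<dots> = range chain"
  proof (intro equalityI subsetI)
    fix v assume "v \<in> faces 1 \<rightarrow>\<^sub>E carrier S"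
    then obtain s where "v = chain s" using ex_chain by blast
    then show "v \<in> range chain" by blast
  qed (use chain_PiE in blast)
  finally have "carrier (koszul_chains S ys 1) = range chain" .
  then show ?thesis unfolding koszul_cycles_def B using diff_chain by auto
qed

text \<open>The differential in degree two, lifted to power series.\<close>

definition bd :: "(nat set \<Rightarrow> mps) \<Rightarrow> nat \<Rightarrow> mps" where
  "bd w j = (\<Sum>i\<in>{..<length ys} - {j}. (- 1) ^ card {j' \<in> {j}. j' < i} * (Y i * w (insert i {j})))"

lemma bd_add: "bd (v + w) = bd v + bd w"
  by (rule ext) (simp add: bd_def distrib_left sum.distrib)

lemma bd_scale: "bd (c *\<^sub>C w) = c *\<^sub>C bd w"
  by (rule ext) (simp add: bd_def cs.scale_sum_right)

text \<open>The terms for \<open>(i, j)\<close> and \<open>(j, i)\<close> cancel, also before passing to the quotient.\<close>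

lemma dot_bd: "dot (bd w) = 0"
proof -
  let ?l = "length ys"
  define F where "F i j = Y j * ((if j < i then - 1 else 1) * (Y i * w (insert i {j})))" for i j
  have sgn: "(- 1) ^ card {j' \<in> {j}. j' < i} = (if j < i then - 1 else 1 :: mps)" for i j :: nat
  proof -
    have "{j' \<in> {j}. j' < i} = (if j < i then {j} else {})" by auto
    then show ?thesis by simp
  qed
  have anti: "F i j = - F j i" if "i \<noteq> j" for i j
    using that by (cases i j rule: linorder_cases)
      (simp_all add: F_def insert_commute[of i j "{}"] mult.commute[of "Y i" "Y j"])
  have "dot (bd w) = (\<Sum>j<?l. \<Sum>i\<in>{i\<in>{..<?l}. i \<noteq> j}. F i j)"
    unfolding dot_def bd_def F_def sgn sum_distrib_left by (intro sum.cong) auto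
  also have "\<dots> = (\<Sum>j<?l. \<Sum>i\<in>{i\<in>{..<?l}. i \<noteq> j}. - F j i)"
    by (intro sum.cong) (auto intro: anti)
  also have "\<dots> = - (\<Sum>j<?l. \<Sum>i\<in>{i\<in>{..<?l}. i \<noteq> j}. F j i)" by (simp add: sum_negf)
  also have "(\<Sum>j<?l. \<Sum>i\<in>{i\<in>{..<?l}. i \<noteq> j}. F j i) = (\<Sum>i<?l. \<Sum>j\<in>{j\<in>{..<?l}. i \<noteq> j}. F j i)"
    by (rule sum.swap_restrict) auto
  also have "\<dots> = (\<Sum>i<?l. \<Sum>j\<in>{j\<in>{..<?l}. j \<noteq> i}. F j i)" by (simp only: eq_commute)
  also have "\<dots> = dot (bd w)"
    unfolding dot_def bd_def F_def sgn sum_distrib_left by (intro sum.cong) auto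
  finally have "dot (bd w) = - dot (bd w)" .
  then have "coef (dot (bd w)) m = - coef (dot (bd w)) m" for m by (metis coef_uminus)
  then show ?thesis by (intro mps_eqI) simp
qed

lemma diff_two:
  assumes "\<And>A. A \<in> faces 2 \<Longrightarrow> v A = q (w A)"
  shows "koszul_diff S ys 2 v = chain (bd w)"
proof -
  have eq: "(\<Oplus>i\<in>{..<length ys} - {j}. (\<ominus> \<one>) [^] card {j' \<in> {j}. j' < i} \<otimes> (ys ! i \<otimes> v (insert i {j})))
      = q (bd w j)" if j: "j < length ys" for j
  proof -
    have "(\<ominus> \<one>) [^] card {j' \<in> {j}. j' < i} \<otimes> (ys ! i \<otimes> v (insert i {j}))
        = q ((- 1) ^ card {j' \<in> {j}. j' < i} * (Y i * w (insert i {j})))"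
      if "i \<in> {..<length ys} - {j}" for i
    proof -
      have "v (insert i {j}) = q (w (insert i {j}))" using that j by (intro assms) auto
      then show ?thesis using that unfolding p_mult p_power p_uminus p_one by (simp add: q_Y)
    qed
    then show ?thesis unfolding bd_def by (subst p_sum) (auto intro!: finsum_cong')
  qed
  have faces: "{B. B \<subseteq> {..<length ys} \<and> Suc (card B) = 2} = faces 1" by auto
  show ?thesis
    unfolding koszul_diff_def chain_def faces
  proof (rule restrict_ext)
    fix A assume "A \<in> faces 1"
    then obtain j where "A = {j}" "j < length ys" by (auto simp: card_1_singleton_iff)
    then show "(\<Oplus>i\<in>{..<length ys} - A. (\<ominus> \<one>) [^] card {j \<in> A. j < i} \<otimes> (ys ! i \<otimes> v (insert i A)))
      = q (bd w (the_elem A))" using eq[of j] by simp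
  qed
qed

lemma boundaries_eq: "koszul_boundaries S ys 1 = range (\<lambda>w. chain (bd w))"
proof -
  have "koszul_boundaries S ys 1 = koszul_diff S ys 2 ` (faces 2 \<rightarrow>\<^sub>E carrier S)"
    by (simp add: koszul_boundaries_def koszul_chains_def Let_def numeral_2_eq_2)
  also have "\<dots> = range (\<lambda>w. chain (bd w))"
  proof (intro equalityI subsetI)
    fix x assume "x \<in> koszul_diff S ys 2 ` (faces 2 \<rightarrow>\<^sub>E carrier S)"
    then obtain v where v: "v \<in> faces 2 \<rightarrow>\<^sub>E carrier S" "x = koszul_diff S ys 2 v" by blast
    have "\<exists>f. A \<in> faces 2 \<longrightarrow> v A = q f" for A
    proof (cases "A \<in> faces 2")
      case True
      then have "v A \<in> carrier S" using v(1) by (rule PiE_mem[rotated])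
      then show ?thesis using p_surj[of "v A"] by metis
    qed blast
    then obtain w where "\<And>A. A \<in> faces 2 \<Longrightarrow> v A = q (w A)" by metis
    then show "x \<in> range (\<lambda>w. chain (bd w))" using diff_two v(2) by blast
  next
    fix x assume "x \<in> range (\<lambda>w. chain (bd w))"
    then obtain w where "x = chain (bd w)" by blast
    then have "x = koszul_diff S ys 2 (\<lambda>A\<in>faces 2. q (w A))" using diff_two[of "\<lambda>A\<in>faces 2. q (w A)" w] by simp
    then show "x \<in> koszul_diff S ys 2 ` (faces 2 \<rightarrow>\<^sub>E carrier S)" by (auto intro!: imageI)
  qed
  finally show ?thesis .
qed

end

section \<open>Equations from homology classes\<close>

context koszul
begin

abbreviation H :: "(complex, (nat set \<Rightarrow> 'a) set) module" where
  "H \<equiv> koszul_homology S ys 1"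

text \<open>The homology class of the cycle \<open>chain s\<close>, as a coset of the boundaries.\<close>

definition cls :: "(nat \<Rightarrow> mps) \<Rightarrow> (nat set \<Rightarrow> 'a) set" where
  "cls s = range (\<lambda>w. chain (bd w + s))"

lemma coset_chain:
  "koszul_boundaries S ys 1 +>\<^bsub>(koszul_chains S ys 1)\<lparr>carrier := koszul_cycles S ys 1\<rparr>\<^esub> chain s = cls s"
  unfolding a_r_coset_def' boundaries_eq cls_def using chain_add by auto

lemma homology_carrier: "carrier H = cls ` {s. dot s \<in> J}"
proof -
  have "carrier H = (\<lambda>v. koszul_boundaries S ys 1
      +>\<^bsub>(koszul_chains S ys 1)\<lparr>carrier := koszul_cycles S ys 1\<rparr>\<^esub> v) ` koszul_cycles S ys 1"
    by (auto simp: koszul_homology_def quotient_module_def A_RCOSETS_def')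
  also have "\<dots> = cls ` {s. dot s \<in> J}"
    by (subst (2) cycles_eq) (simp only: image_image coset_chain)
  finally show ?thesis .
qed

lemma cls_zero: "cls 0 = \<zero>\<^bsub>H\<^esub>"
  by (simp add: koszul_homology_def quotient_module_def boundaries_eq cls_def flip: One_nat_def)

lemma bd_zero: "bd 0 = 0"
  using bd_scale[of 0 0] by simp

lemma cls_add: "cls s \<oplus>\<^bsub>H\<^esub> cls t = cls (s + t)"
proof -
  have "cls s \<oplus>\<^bsub>H\<^esub> cls t = {chain (bd v + s + (bd w + t)) | v w. True}"
    by (auto simp: koszul_homology_def quotient_module_def set_add_def' cls_def simp flip: chain_add One_nat_def)
  also have "\<dots> = {chain (bd (v + w) + (s + t)) | v w. True}" by (simp add: bd_add algebra_simps)
  also have "\<dots> = cls (s + t)"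
    unfolding cls_def by (auto, metis add.right_neutral)
  finally show ?thesis .
qed

lemma cls_scale: "c \<odot>\<^bsub>H\<^esub> cls s = cls (c *\<^sub>C s)"
proof -
  have "c \<odot>\<^bsub>H\<^esub> cls s = (\<Union>x\<in>cls s. koszul_boundaries S ys 1
      +>\<^bsub>(koszul_chains S ys 1)\<lparr>carrier := koszul_cycles S ys 1\<rparr>\<^esub> (c \<odot>\<^bsub>koszul_chains S ys 1\<^esub> x))"
    by (simp add: koszul_homology_def quotient_module_def flip: One_nat_def)
  also have "\<dots> = (\<Union>v. cls (c *\<^sub>C (bd v + s)))"
    unfolding cls_def[of s] by (simp only: chain_scale coset_chain image_image UN_simps)
  also have "\<dots> = {chain (bd w + c *\<^sub>C (bd v + s)) | v w. True}"
    by (auto simp: cls_def)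
  also have "\<dots> = {chain (bd (w + c *\<^sub>C v) + c *\<^sub>C s) | v w. True}"
    by (simp add: bd_add bd_scale cscale_add_right add.assoc)
  also have "\<dots> = cls (c *\<^sub>C s)"
    unfolding cls_def by (auto, metis add.right_neutral cs.scale_zero_right)
  finally show ?thesis .
qed

lemma homologyE:
  assumes "X \<in> carrier H" obtains s where "X = cls s" "dot s \<in> J"
  using assms unfolding homology_carrier by blast

lemma cls_carrier: "dot s \<in> J \<Longrightarrow> cls s \<in> carrier H"
  unfolding homology_carrier by blast

lemma cyc_add: "dot s \<in> J \<Longrightarrow> dot t \<in> J \<Longrightarrow> dot (s + t) \<in> J"
  unfolding dot_add by (rule mi.subspace_add[OF ideal_J])

lemma cyc_scale: "dot s \<in> J \<Longrightarrow> dot (c *\<^sub>C s) \<in> J"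
  unfolding dot_scale by (rule ideal_scale[OF ideal_J])

lemma cyc_zero: "dot 0 \<in> J"
  using mi.subspace_0[OF ideal_J] by (simp add: dot_def)

lemma homology_vectorspace: "vectorspace class_ring H"
proof -
  have grp: "abelian_group H"
  proof (rule abelian_groupI)
    show "\<zero>\<^bsub>H\<^esub> \<in> carrier H" using cls_carrier[OF cyc_zero] by (simp add: cls_zero)
    fix X Z assume "X \<in> carrier H" "Z \<in> carrier H"
    then obtain s t where st: "X = cls s" "dot s \<in> J" "Z = cls t" "dot t \<in> J" by (elim homologyE)
    show "X \<oplus>\<^bsub>H\<^esub> Z \<in> carrier H" unfolding st cls_add by (intro cls_carrier cyc_add st)
    show "X \<oplus>\<^bsub>H\<^esub> Z = Z \<oplus>\<^bsub>H\<^esub> X" unfolding st cls_add by (simp only: add.commute)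
    show "\<zero>\<^bsub>H\<^esub> \<oplus>\<^bsub>H\<^esub> X = X" unfolding st cls_zero[symmetric] cls_add by simp
    show "\<exists>Z\<in>carrier H. Z \<oplus>\<^bsub>H\<^esub> X = \<zero>\<^bsub>H\<^esub>"
    proof (rule bexI)
      have "- 1 *\<^sub>C s + s = (- 1 + 1) *\<^sub>C s" unfolding cscale_add_left cscale_one ..
      then show "cls (- 1 *\<^sub>C s) \<oplus>\<^bsub>H\<^esub> X = \<zero>\<^bsub>H\<^esub>" unfolding st cls_add by (simp add: cls_zero)
      show "cls (- 1 *\<^sub>C s) \<in> carrier H" by (intro cls_carrier cyc_scale st)
    qed
    fix U assume "U \<in> carrier H"
    then obtain u where u: "U = cls u" by (elim homologyE)
    show "X \<oplus>\<^bsub>H\<^esub> Z \<oplus>\<^bsub>H\<^esub> U = X \<oplus>\<^bsub>H\<^esub> (Z \<oplus>\<^bsub>H\<^esub> U)"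
      unfolding st u cls_add by (simp only: add.assoc)
  qed
  interpret A: algebra "class_ring :: complex ring" S by (rule alg)
  have "Module.module class_ring H"
  proof (rule moduleI[OF A.R_cring grp])
    fix c d :: complex and X Z assume "X \<in> carrier H" "Z \<in> carrier H"
    then obtain s t where st: "X = cls s" "dot s \<in> J" "Z = cls t" "dot t \<in> J" by (elim homologyE)
    show "c \<odot>\<^bsub>H\<^esub> (X \<oplus>\<^bsub>H\<^esub> Z) = c \<odot>\<^bsub>H\<^esub> X \<oplus>\<^bsub>H\<^esub> c \<odot>\<^bsub>H\<^esub> Z"
      unfolding st cls_add cls_scale by (simp only: cscale_add_right)
  next
    fix c d :: complex and X assume "X \<in> carrier H"
    then obtain s where s: "X = cls s" "dot s \<in> J" by (elim homologyE)
    show "c \<odot>\<^bsub>H\<^esub> X \<in> carrier H" unfolding s cls_scale by (intro cls_carrier cyc_scale s)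
    show "(c \<oplus>\<^bsub>class_ring\<^esub> d) \<odot>\<^bsub>H\<^esub> X = c \<odot>\<^bsub>H\<^esub> X \<oplus>\<^bsub>H\<^esub> d \<odot>\<^bsub>H\<^esub> X"
      unfolding s cls_add cls_scale by (simp add: cscale_add_left class_ring_simps)
    show "(c \<otimes>\<^bsub>class_ring\<^esub> d) \<odot>\<^bsub>H\<^esub> X = c \<odot>\<^bsub>H\<^esub> (d \<odot>\<^bsub>H\<^esub> X)"
      unfolding s cls_scale by (simp add: class_ring_simps)
    show "\<one>\<^bsub>class_ring\<^esub> \<odot>\<^bsub>H\<^esub> X = X" unfolding s cls_scale by (simp add: class_ring_simps)
  qed
  then show ?thesis unfolding vectorspace_def using class_field by blast
qed

text \<open>The dimension of the homology is defined as a least cardinality of finite spanning sets, so it has to be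
  shown that there are any. A cycle only matters modulo \<open>J\<close>; its entries may be truncated, and the tuples of
  truncated series form a finite dimensional space.\<close>

lemma homology_spanned:
  "\<exists>A. finite A \<and> A \<subseteq> carrier H \<and> LinearCombinations.module.span class_ring H A = carrier H"
proof -
  interpret H: vectorspace class_ring H by (rule homology_vectorspace)
  let ?l = "length ys"
  define e where "e j m = (\<lambda>i. if i = j then mon m else 0)" for j :: nat and m
  define T where "T = (\<lambda>(j, m). e j m) ` ({..<?l} \<times> monoms n (Suc N))"
  have finT: "finite T" unfolding T_def by (intro finite_imageI finite_cartesian_product) (auto simp: finite_monoms)
  define Cyc where "Cyc = {s. dot s \<in> J} \<inter> cs.span T"
  have sub: "cs.subspace Cyc"
    unfolding Cyc_def
  proof (rule cs.subspace_inter)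
    show "cs.subspace {s. dot s \<in> J}"
      unfolding cs.subspace_def using cyc_zero cyc_add cyc_scale by blast
  qed simp
  obtain B where B: "B \<subseteq> Cyc" "cs.independent B" "Cyc \<subseteq> cs.span B"
    by (rule cs.basis_exists[of Cyc])
  have finB: "finite B"
    using cs.independent_span_bound[OF finT B(2)] B(1) unfolding Cyc_def by blast
  have truncate: "\<exists>t\<in>Cyc. cls t = cls s" if s: "dot s \<in> J" for s
  proof
    define t where "t i = (if i < ?l then E \<cdot> s i else 0)" for i
    have st: "t i - s i \<in> J" if "i < ?l" for i
      using that E_diff_TK(2)[of "s i"] TK_sub_J by (auto simp: t_def)
    have "chain (bd w + t) = chain (bd w + s)" for w
      using st by (simp add: chain_eq_iff)
    then show "cls t = cls s" by (simp add: cls_def)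
    have "dot t - dot s = (\<Sum>i<?l. Y i * (t i - s i))"
      by (simp add: dot_def sum_subtractf right_diff_distrib)
    also have "\<dots> \<in> J"
      using st by (intro mi.subspace_sum[OF ideal_J] ideal_mult_left[OF ideal_J]) auto
    finally have "dot t - dot s + dot s \<in> J" using s mi.subspace_add[OF ideal_J] by blast
    then have "dot t \<in> J" by simp
    moreover have "t = (\<Sum>j<?l. \<Sum>m\<in>monoms n (Suc N). coef (s j) m *\<^sub>C e j m)"
    proof
      fix i
      have "(\<Sum>j<?l. \<Sum>m\<in>monoms n (Suc N). coef (s j) m *\<^sub>C e j m) i =
          (\<Sum>j<?l. if j = i then E \<cdot> s i else 0)"
        unfolding sum_fun_apply
        by (intro sum.cong) (auto simp: e_def E_def trunc_expand)
      then show "t i = (\<Sum>j<?l. \<Sum>m\<in>monoms n (Suc N). coef (s j) m *\<^sub>C e j m) i" by (simp add: t_def)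
    qed
    moreover have "(\<Sum>j<?l. \<Sum>m\<in>monoms n (Suc N). coef (s j) m *\<^sub>C e j m) \<in> cs.span T"
    proof -
      have "e j m \<in> T" if "j < ?l" "m \<in> monoms n (Suc N)" for j m
        unfolding T_def using that by (intro image_eqI[of _ _ "(j, m)"]) auto
      then show ?thesis by (intro cs.span_sum cs.span_scale cs.span_base) auto
    qed
    ultimately show "t \<in> Cyc" unfolding Cyc_def by simp
  qed
  have A: "cls ` B \<subseteq> carrier H" using B(1) cls_carrier unfolding Cyc_def by blast
  let ?S = "LinearCombinations.module.span class_ring H (cls ` B)"
  have span: "LinearCombinations.submodule class_ring ?S H" by (rule H.span_is_submodule[OF A])
  define C where "C = {s. cls s \<in> ?S}"
  have "cs.subspace C"
    unfolding cs.subspace_def C_def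
    using span by (auto simp: LinearCombinations.submodule_def cls_zero class_ring_simps
        simp flip: cls_add cls_scale)
  moreover have "B \<subseteq> C" unfolding C_def using H.in_own_span[OF A] by blast
  ultimately have "cs.span B \<subseteq> C" by (rule cs.span_minimal[rotated])
  then have "cls s \<in> ?S" if "dot s \<in> J" for s
    using truncate[OF that] B(3) unfolding C_def by auto
  then have "carrier H \<subseteq> ?S" unfolding homology_carrier by blast
  then have "?S = carrier H" using H.span_is_subset2[OF A] by blast
  then show ?thesis using A finB by blast
qed

text \<open>Lifted boundaries are contracted to zero, and changing the entries of a lift by elements of \<open>J\<close> changes the
  contraction by an element of \<open>\<mm> J\<close>, since the generators lie in \<open>\<mm>\<close>.\<close>

lemma cls_eq_imp:
  assumes "cls s = cls t" shows "dot s - dot t \<in> mJ"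
proof -
  have "chain (bd 0 + s) \<in> cls s" unfolding cls_def by (rule rangeI)
  then have "chain s \<in> cls t" unfolding assms by (simp add: bd_zero)
  then obtain w where "chain s = chain (bd w + t)" unfolding cls_def by blast
  then have J: "s i - (bd w + t) i \<in> J" if "i < length ys" for i using that unfolding chain_eq_iff by blast
  have "dot s - dot t = dot s - dot (bd w + t)" by (simp add: dot_add dot_bd)
  also have "\<dots> = (\<Sum>i<length ys. Y i * (s i - (bd w + t) i))"
    unfolding dot_def sum_subtractf[symmetric] right_diff_distrib ..
  also have "\<dots> \<in> mJ" by (intro mi.subspace_sum[OF ideal_mJ] mJ_mult Y_K J) auto
  finally show ?thesis .
qed

text \<open>Contracting a spanning set of the homology with the generators gives elements of \<open>J\<close> that span it modulo
  \<open>\<mm> J\<close>, because \<^const>\<open>dot\<close> is onto modulo \<open>\<mm> J\<close> and respects homology classes.\<close>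

lemma generators_from_homology:
  obtains Gs where "finite Gs" "card Gs \<le> vectorspace.dim class_ring H"
    "\<forall>f\<in>J. \<exists>u\<in>cs.span Gs. f - u \<in> mJ"
proof -
  interpret H: vectorspace class_ring H by (rule homology_vectorspace)
  have "\<exists>d A. finite A \<and> card A = d \<and> A \<subseteq> carrier H \<and> H.span A = carrier H"
    using homology_spanned by blast
  then have "\<exists>A. finite A \<and> card A = H.dim \<and> A \<subseteq> carrier H \<and> H.span A = carrier H"
    unfolding H.dim_def by (rule LeastI_ex)
  then obtain A where A: "finite A" "card A = H.dim" "A \<subseteq> carrier H" "H.span A = carrier H" by blast
  have "\<forall>X\<in>A. \<exists>s. X = cls s \<and> dot s \<in> J" using A(3) homologyE by blast
  then obtain s where s: "\<And>X. X \<in> A \<Longrightarrow> X = cls (s X) \<and> dot (s X) \<in> J" by metis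
  define Gs where "Gs = (\<lambda>X. dot (s X)) ` A"
  define U where "U = cls ` {t. dot t \<in> J \<and> (\<exists>u\<in>cs.span Gs. dot t - u \<in> mJ)}"
  have "LinearCombinations.submodule class_ring U H"
  proof (rule LinearCombinations.submodule.intro[OF H.module_axioms])
    show "U \<subseteq> carrier H" unfolding U_def homology_carrier by blast
    have "dot 0 - 0 \<in> mJ" using mi.subspace_0[OF ideal_mJ] by (simp add: dot_def)
    then show "\<zero>\<^bsub>H\<^esub> \<in> U" unfolding U_def cls_zero[symmetric] using cyc_zero cs.span_zero by blast
    show "X \<oplus>\<^bsub>H\<^esub> Z \<in> U" if XZ: "X \<in> U" "Z \<in> U" for X Z
    proof -
      obtain t u t' u' where t: "X = cls t" "dot t \<in> J" "u \<in> cs.span Gs" "dot t - u \<in> mJ"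
        "Z = cls t'" "dot t' \<in> J" "u' \<in> cs.span Gs" "dot t' - u' \<in> mJ" using XZ unfolding U_def by blast
      have "(dot t - u) + (dot t' - u') \<in> mJ" using mi.subspace_add[OF ideal_mJ] t by blast
      then have "dot (t + t') - (u + u') \<in> mJ" by (simp add: dot_add algebra_simps)
      then show ?thesis unfolding U_def t(1,5) cls_add
        using cyc_add[OF t(2,6)] cs.span_add[OF t(3,7)] by blast
    qed
    show "c \<odot>\<^bsub>H\<^esub> X \<in> U" if X: "X \<in> U" for c X
    proof -
      obtain t u where t: "X = cls t" "dot t \<in> J" "u \<in> cs.span Gs" "dot t - u \<in> mJ"
        using X unfolding U_def by blast
      have "c *\<^sub>C (dot t - u) \<in> mJ" using ideal_scale[OF ideal_mJ] t by blast
      then have "dot (c *\<^sub>C t) - c *\<^sub>C u \<in> mJ" by (simp add: dot_scale cs.scale_right_diff_distrib)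
      then show ?thesis unfolding U_def t(1) cls_scale
        using cyc_scale[OF t(2)] cs.span_scale[OF t(3)] by blast
    qed
  qed
  moreover have "A \<subseteq> U"
  proof
    fix X assume X: "X \<in> A"
    have "dot (s X) \<in> cs.span Gs" unfolding Gs_def using X by (blast intro: cs.span_base)
    moreover have "dot (s X) - dot (s X) \<in> mJ" using mi.subspace_0[OF ideal_mJ] by simp
    ultimately have "cls (s X) \<in> U" unfolding U_def using s[OF X] by blast
    then show "X \<in> U" using s[OF X] by simp
  qed
  ultimately have "H.span A \<subseteq> U" by (intro H.span_is_subset)
  then have HU: "carrier H \<subseteq> U" using A(4) by simp
  show thesis
  proof (rule that)
    show "finite Gs" using A(1) by (simp add: Gs_def)
    show "card Gs \<le> H.dim" unfolding A(2)[symmetric] Gs_def by (rule card_image_le[OF A(1)])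
    show "\<forall>f\<in>J. \<exists>u\<in>cs.span Gs. f - u \<in> mJ"
    proof
      fix f assume f: "f \<in> J"
      obtain t where t: "f - dot t \<in> mJ" using J_mod_mJ[OF f] by blast
      have "f - (f - dot t) \<in> J" using mi.subspace_diff[OF ideal_J f] t mJ_sub_J by blast
      then have "dot t \<in> J" by simp
      then have "cls t \<in> U" using HU cls_carrier by blast
      then obtain t' u where u: "cls t = cls t'" "u \<in> cs.span Gs" "dot t' - u \<in> mJ"
        unfolding U_def by blast
      have "(f - dot t) + (dot t - dot t') + (dot t' - u) \<in> mJ"
        using mi.subspace_add[OF ideal_mJ] t cls_eq_imp[OF u(1)] u(3) by blast
      then show "\<exists>u\<in>cs.span Gs. f - u \<in> mJ" using u(2) by (auto simp: algebra_simps)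
    qed
  qed
qed

end

section \<open>The solvability criterion\<close>

text \<open>For \<open>n = 0\<close> the kernel equals \<open>mJ\<close>, so no generators are needed at all, contrary to \<open>many_equations\<close>.\<close>

lemma (in alg_presentation) solvable_if_few_generators:
  assumes "k \<le> N" "n = 0 \<or> first_deviation S + 1 < n + k"
  shows "solvable_lie class_ring (Der S)"
proof (rule ccontr)
  assume "\<not> ?thesis"
  then have no: "\<not> dser g i \<subseteq> {0}" for i using solvable_if_dser_trivial by blast
  have k: "k \<le> Suc N" using assms(1) by simp
  show False
  proof (cases "n = 0")
    case True
    have "f \<in> mJ" if "f \<in> J" for f
    proof -
      have "f \<in> K 0 1" using that J_sub_max True by blast
      then have "f \<in> Zn n" using True by (simp add: K_def monoms_def Zn_def)
      then show ?thesis unfolding mJ_def by (blast intro: mi.span_base)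
    qed
    then have "n + k \<le> card ({} :: mps set) + 1" by (intro many_equations[OF k no]) auto
    then show False using k2 by simp
  next
    case False
    define ys where "ys = (SOME ys. minimal_generators S (q ` K n 1) ys)"
    have "minimal_generators S (q ` K n 1) ys" unfolding ys_def by (rule someI_ex[OF ex_minimal_generators])
    then interpret koszul S q n k N ys by unfold_locales (auto simp: minimal_generators_def)
    have dim: "first_deviation S = vectorspace.dim class_ring H"
      by (simp add: first_deviation_def Let_def the_maximal_ideal ys_def)
    obtain Gs where Gs: "finite Gs" "card Gs \<le> vectorspace.dim class_ring H"
      "\<forall>f\<in>J. \<exists>u\<in>cs.span Gs. f - u \<in> mJ" by (rule generators_from_homology)
    have "n + k \<le> card Gs + 1" by (rule many_equations[OF k no Gs(1)]) (use Gs(3) in blast)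
    then show False using Gs(2) assms(2) False dim by simp
  qed
qed

theorem theorem1:
  fixes S :: "(complex, 'a) module"
    and n :: nat
    and I :: "(nat multiset \<Rightarrow> complex) set"
  assumes "algebra class_ring S"
    and "zero_dim_presentation n I S"
    and "first_deviation S + 1 < n + presentation_order n I"
  shows "solvable_lie class_ring (Der S)"
proof -
  obtain q k N where pres: "alg_presentation S q n k N" and k: "k \<le> N" "n = 0 \<or> k = presentation_order n I"
    using zero_dim_presentation_imp[OF assms(1,2)] by blast
  interpret alg_presentation S q n k N by (rule pres)
  show ?thesis using solvable_if_few_generators[OF k(1)] k(2) assms(3) by blast
qed

end
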